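(* Let $N\ge1$, $D\ge0$, $M\ge0$ and $\sigma>0$. There is a constant $T_0>0$, depending only on $N$, $D$, $M$, $\sigma$ (and the fixed $f,r,H,R$), such that the following holds: whenever $u_0\in V$ with $\|u_0\|_V\le M$, $0<t_1<\dots<t_N<T_0$, and $z_1,\dots,z_N\in\mathbb R^q$ with $|z_i|\le D$ for all $i$, the cost functional $$J(u)=\frac12\sum_{i=1}^N\big|R^{-1/2}\big(Hy(t_i)-z_i\big)\big|^2+\frac1{2\sigma^2}\|u-u_0\|_V^2$$ has a unique global minimizer in $V$.
   Context: $\|\cdot\|$ and $\langle\cdot,\cdot\rangle$ denote the norm and inner product of $L^2(0,1)$; $V=H^1_0(0,1)$ with norm $\|u\|_V=\|u_x\|$. Standing assumptions: $f,r\in C^2(\mathbb R)$ and $\int_{-\infty}^0\frac{dy}{|r(y)|+1}=\int_0^\infty\frac{dy}{|r(y)|+1}=\infty$ (which guarantees global solutions). For $u\in V$, $y=y(x,t)$ denotes the solution of $y_t+f(y)_x=y_{xx}+r(y)$ on $[0,1]\times(0,\infty)$ with $y(0,t)=y(1,t)=0$ and $y(\cdot,0)=u$. $H:L^2(0,1)\to\mathbb R^q$ is a fixed bounded linear operator, $R$ a fixed symmetric positive definite $q\times q$ matrix, $|\cdot|$ the Euclidean norm. *)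

theory Defs
  imports "HOL-Analysis.Analysis"
begin

text \<open>Functions on (0,1) are represented as real \<Rightarrow> real. Elements of V are
  normalised to vanish outside [0,1], so that equality in V is equality of functions.\<close>

definition C2 :: "(real \<Rightarrow> real) \<Rightarrow> bool" where
  "C2 g \<longleftrightarrow> (\<exists>g1 g2. (\<forall>x. (g has_real_derivative g1 x) (at x)) \<and>
                       (\<forall>x. (g1 has_real_derivative g2 x) (at x)) \<and> continuous_on UNIV g2)"

definition L2 :: "(real \<Rightarrow> real) set" where
  "L2 = {v. set_borel_measurable lborel {0..1} v \<and>
            set_integrable lborel {0..1} (\<lambda>x. (v x)\<^sup>2)}"

definition L2norm :: "(real \<Rightarrow> real) \<Rightarrow> real" where
  "L2norm v = sqrt (LINT x:{0..1}|lborel. (v x)\<^sup>2)"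

text \<open>V = H^1_0(0,1): u(x) = int_0^x g with g in L2(0,1), u(0) = u(1) = 0,
  u vanishing outside [0,1].\<close>
definition V :: "(real \<Rightarrow> real) set" where
  "V = {u. (\<exists>g. g \<in> L2 \<and> (\<forall>x\<in>{0..1}. u x = (LINT s:{0..x}|lborel. g s)))
           \<and> u 0 = 0 \<and> u 1 = 0 \<and> (\<forall>x. x \<notin> {0..1} \<longrightarrow> u x = 0)}"

text \<open>||u||_V = ||u_x||, with u_x the (a.e. defined) derivative.\<close>
definition Vnorm :: "(real \<Rightarrow> real) \<Rightarrow> real" where
  "Vnorm u = sqrt (LINT x:{0..1}|lborel. (deriv u x)\<^sup>2)"

definition slice :: "(real \<Rightarrow> real \<Rightarrow> real) \<Rightarrow> real \<Rightarrow> real \<Rightarrow> real" where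
  "slice y t = (\<lambda>x. if x \<in> {0..1} then y x t else 0)"

definition is_sol :: "(real \<Rightarrow> real) \<Rightarrow> (real \<Rightarrow> real) \<Rightarrow> (real \<Rightarrow> real)
                       \<Rightarrow> (real \<Rightarrow> real \<Rightarrow> real) \<Rightarrow> bool" where
  "is_sol f r u y \<longleftrightarrow>
     (\<forall>x t. (x \<notin> {0..1} \<or> t < 0) \<longrightarrow> y x t = 0) \<and>
     (\<forall>x\<in>{0..1}. y x 0 = u x) \<and>
     (\<forall>t\<ge>0. y 0 t = 0 \<and> y 1 t = 0) \<and>
     (\<forall>t\<ge>0. slice y t \<in> V) \<and>
     (\<forall>t\<ge>0. ((\<lambda>s. Vnorm (\<lambda>x. slice y s x - slice y t x)) \<longlongrightarrow> 0) (at t within {0..})) \<and>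
     (\<forall>x\<in>{0<..<1}. \<forall>t>0. \<exists>yt yx yxx fx.
        ((\<lambda>s. y x s) has_real_derivative yt) (at t) \<and>
        (\<forall>\<^sub>F \<xi> in nhds x. ((\<lambda>\<eta>. y \<eta> t) has_real_derivative yx \<xi>) (at \<xi>)) \<and>
        (yx has_real_derivative yxx) (at x) \<and>
        ((\<lambda>\<xi>. f (y \<xi> t)) has_real_derivative fx) (at x) \<and>
        yt + fx = yxx + r (y x t))"

definition sol :: "(real \<Rightarrow> real) \<Rightarrow> (real \<Rightarrow> real) \<Rightarrow> (real \<Rightarrow> real) \<Rightarrow> (real \<Rightarrow> real \<Rightarrow> real)" where
  "sol f r u = (THE y. is_sol f r u y)"

definition sym_posdef :: "real^'q^'q \<Rightarrow> bool" where
  "sym_posdef A \<longleftrightarrow> transpose A = A \<and> (\<forall>x. x \<noteq> 0 \<longrightarrow> x \<bullet> (A *v x) > 0)"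

definition inv_sqrt :: "real^'q^'q \<Rightarrow> real^'q^'q" where
  "inv_sqrt A = (THE S. sym_posdef S \<and> S ** S = matrix_inv A)"

definition costJ :: "(real \<Rightarrow> real) \<Rightarrow> (real \<Rightarrow> real) \<Rightarrow> ((real \<Rightarrow> real) \<Rightarrow> real^'q)
    \<Rightarrow> real^'q^'q \<Rightarrow> nat \<Rightarrow> (nat \<Rightarrow> real) \<Rightarrow> (nat \<Rightarrow> real^'q) \<Rightarrow> real \<Rightarrow> (real \<Rightarrow> real)
    \<Rightarrow> (real \<Rightarrow> real) \<Rightarrow> real" where
  "costJ f r H R N t z \<sigma> u0 u =
     (1/2) * (\<Sum>i=1..N. (norm (inv_sqrt R *v (H (slice (sol f r u) (t i)) - z i)))\<^sup>2)
     + 1 / (2 * \<sigma>\<^sup>2) * (Vnorm (\<lambda>x. u x - u0 x))\<^sup>2"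

end

theory Submission
  imports Defs
begin

text \<open>The equation is solved for short times as a mild solution in sine coefficients; the integral conditions on \<open>r\<close> bound the solution in
  the maximum norm, so the nonlinearity can be truncated and the solution is global, classical for positive times, and (maximum principle) unique.
  On a ball of \<open>V\<close> the solution map is Lipschitz in the maximum norm. The defect \<open>q = (y(u) + y(v)) / 2 - y((u + v) / 2)\<close> starts at zero
  and is driven by terms of size \<open>O(\<parallel>u - v\<parallel>\<^sub>V\<^sup>2)\<close>, so an energy estimate gives \<open>\<parallel>q(t)\<parallel> = o(1) \<parallel>u - v\<parallel>\<^sub>V\<^sup>2\<close> as \<open>t\<close> tends to 0. Hence for small
  observation times the convexity of the regularisation term dominates and \<open>J\<close> is uniformly midpoint convex on a ball that contains
  \<open>{u. J u \<le> J u\<^sub>0}\<close>: minimising sequences are Cauchy and the minimiser is unique. The ball depends only on \<open>N\<close>, \<open>D\<close>, \<open>M\<close>, \<open>\<sigma>\<close>,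
  because \<open>J u\<^sub>0\<close> contains no regularisation term.\<close>

section \<open>Sine and cosine coefficients\<close>

text \<open>Two of the definitions shape the work. \<open>sol\<close> is a definite description over
  \<open>is_sol\<close>, which asks for derivatives pointwise, with no continuity or bound on them:
  uniqueness has to hold in that wide class, while existence has to deliver two genuine space
  derivatives for arbitrary data in \<open>V\<close>. And \<open>Vnorm\<close> integrates
  \<open>deriv u\<close>, so a differentiation theorem and the measurability of \<open>deriv\<close>
  come before the Hilbert space structure of \<open>V\<close>. The convection term costs one space
  derivative: a maximum norm bound controls the coefficients of the differentiated flux only up to a
  factor of the frequency. The heat factor repays this with an integrable power of time, and an
  exponential weight in time lets the contraction close on any prescribed interval. The defect
  \<open>q\<close> must be of second order in \<open>u - v\<close>, because the convexity gain it is
  compared with is quadratic; Lipschitz continuity of the derivatives of \<open>f\<close> and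
  \<open>r\<close> on bounded sets provides this order. For \<open>T0\<close> to be uniform, every
  constant is fixed before the datum, the prior, the times and the observations.\<close>

definition freq :: "nat \<Rightarrow> real" where "freq n = pi * real (Suc n)"

text \<open>The factor 2 offsets the mean 1/2 of the squared sine and cosine, so that
  \<open>h\<close> is formally the sum of \<open>fsin n h * sin (freq n * x)\<close>. Indexing
  starts at frequency \<open>pi\<close>; the cosine family therefore lacks the constant function,
  and \<open>fcos\<close> does not see the mean of \<open>h\<close>.\<close>

definition fsin :: "nat \<Rightarrow> (real \<Rightarrow> real) \<Rightarrow> real" where
  "fsin n h = 2 * integral {0..1} (\<lambda>x. h x * sin (freq n * x))"

definition fcos :: "nat \<Rightarrow> (real \<Rightarrow> real) \<Rightarrow> real" where
  "fcos n h = 2 * integral {0..1} (\<lambda>x. h x * cos (freq n * x))"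

lemma freq_pos: "freq n > 0" and freq_ge1: "freq n \<ge> 1" and freq_ge: "freq n \<ge> real (Suc n)"
proof -
  have "pi \<ge> 1" using pi_ge_two by linarith
  then have "1 * real (Suc n) \<le> pi * real (Suc n)" by (intro mult_right_mono) auto
  then show "freq n \<ge> real (Suc n)" by (simp add: freq_def)
  then show "freq n \<ge> 1" "freq n > 0" by auto
qed

lemma freq_simps [simp]: "sin (freq n) = 0" "freq n \<noteq> 0" "0 < freq n" "0 \<le> freq n"
  using freq_pos[of n] by (auto simp: freq_def mult.commute[of pi] sin_npi simp del: of_nat_Suc)

lemma abs_sin_freq_diff_le: "\<bar>sin (freq n * x) - sin (freq n * y)\<bar> \<le> freq n * \<bar>x - y\<bar>"
proof -
  have "\<bar>sin (freq n * x) - sin (freq n * y)\<bar> \<le> \<bar>freq n * x - freq n * y\<bar>"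
  proof -
    have *: "(sin has_field_derivative cos z) (at z within UNIV)" for z :: real
      by (auto intro!: derivative_eq_intros)
    show ?thesis
      using field_differentiable_bound[of UNIV sin cos 1 "freq n * x" "freq n * y", OF _ *]
      by (simp add: dist_norm)
  qed
  also have "\<dots> = freq n * \<bar>x - y\<bar>" by (simp add: abs_mult flip: right_diff_distrib)
  finally show ?thesis .
qed

section \<open>Orthogonality and Bessel's inequality\<close>

lemma has_integral_cos_pi:
  "((\<lambda>x. cos (pi * of_int k * x)) has_integral (if k = 0 then 1 else 0)) {0..1::real}"
proof (cases "k = 0")
  case True then show ?thesis using has_integral_const_real[of "1::real" 0 1] by simp
next
  case False
  have "((\<lambda>x. cos (pi * of_int k * x)) has_integral
      (sin (pi * of_int k * 1) / (pi * of_int k) - sin (pi * of_int k * 0) / (pi * of_int k))) {0..1::real}"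
    using False by (intro fundamental_theorem_of_calculus)
      (auto simp flip: has_real_derivative_iff_has_vector_derivative intro!: derivative_eq_intros)
  then show ?thesis using False sin_integer_2pi[of "of_int k / 2"]
    by (simp add: sin_zero_iff_int2 mult.commute)
qed

text \<open>The product formula produces the integer frequencies \<open>n - m\<close> and
  \<open>n + m + 2\<close>. Only the first can vanish, and it does so exactly for equal
  indices.\<close>

lemma has_integral_sin_sin:
  "((\<lambda>x. sin (freq n * x) * sin (freq m * x)) has_integral (if n = m then 1/2 else 0)) {0..1}"
proof -
  have *: "sin (freq n * x) * sin (freq m * x) = 1/2 * (cos (pi * of_int (int n - int m) * x) -
     cos (pi * of_int (int n + int m + 2) * x))" for x
  proof -
    have 1: "pi * of_int (int n - int m) * x = freq n * x - freq m * x"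
      "pi * of_int (int n + int m + 2) * x = freq n * x + freq m * x"
      by (simp_all add: freq_def algebra_simps)
    show ?thesis unfolding 1 by (simp add: sin_times_sin)
  qed
  show ?thesis unfolding *
    using has_integral_mult_right[OF has_integral_diff[OF has_integral_cos_pi[of "int n - int m"]
     has_integral_cos_pi[of "int n + int m + 2"]], of "1/2"]
    by (auto split: if_splits)
qed

lemma has_integral_cos_cos:
  "((\<lambda>x. cos (freq n * x) * cos (freq m * x)) has_integral (if n = m then 1/2 else 0)) {0..1}"
proof -
  have *: "cos (freq n * x) * cos (freq m * x) = 1/2 * (cos (pi * of_int (int n - int m) * x) +
     cos (pi * of_int (int n + int m + 2) * x))" for x
  proof -
    have 1: "pi * of_int (int n - int m) * x = freq n * x - freq m * x"
      "pi * of_int (int n + int m + 2) * x = freq n * x + freq m * x"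
      by (simp_all add: freq_def algebra_simps)
    show ?thesis unfolding 1 by (simp add: cos_times_cos)
  qed
  show ?thesis unfolding *
    using has_integral_mult_right[OF has_integral_add[OF has_integral_cos_pi[of "int n - int m"]
     has_integral_cos_pi[of "int n + int m + 2"]], of "1/2"]
    by (auto split: if_splits)
qed

lemma has_integral_orthogonal_sum_square:
  fixes e :: "nat \<Rightarrow> real \<Rightarrow> real"
  assumes "\<And>n m. ((\<lambda>x. e n x * e m x) has_integral (if n = m then 1/2 else 0)) {0..1}"
  shows "((\<lambda>x. (\<Sum>n\<in>A. b n * e n x)\<^sup>2) has_integral (1/2 * (\<Sum>n\<in>A. (b n)\<^sup>2))) {0..1}"
proof (cases "finite A")
  case True
  have *: "(\<Sum>n\<in>A. b n * e n x)\<^sup>2 = (\<Sum>n\<in>A. \<Sum>m\<in>A. b n * b m * (e n x * e m x))" for x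
    by (simp add: power2_eq_square sum_product algebra_simps)
  have "((\<lambda>x. (\<Sum>n\<in>A. b n * e n x)\<^sup>2) has_integral
      (\<Sum>n\<in>A. \<Sum>m\<in>A. b n * b m * (if n = m then 1/2 else 0))) {0..1}"
    unfolding * by (intro has_integral_sum has_integral_mult_right assms True)
  also have "(\<Sum>n\<in>A. \<Sum>m\<in>A. b n * b m * (if n = m then 1/2 else 0)) = 1/2 * (\<Sum>n\<in>A. (b n)\<^sup>2)"
    using True by (simp add: sum.delta power2_eq_square sum_distrib_left mult.commute if_distrib cong: if_cong)
  finally show ?thesis .
qed auto

text \<open>Expansion of the nonnegative integral of the squared remainder after \<open>m\<close>
  terms. Only integrability of the square of \<open>h\<close> and of the products is asked, so that
  the inequality also applies to the weak derivative of an element of \<open>V\<close>.\<close>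

lemma bessel_inequality:
  fixes e :: "nat \<Rightarrow> real \<Rightarrow> real"
  assumes orth: "\<And>n m. ((\<lambda>x. e n x * e m x) has_integral (if n = m then 1/2 else 0)) {0..1}"
    and sq: "(\<lambda>x. (h x)\<^sup>2) integrable_on {0..1}"
    and he: "\<And>n. (\<lambda>x. h x * e n x) integrable_on {0..1}"
  shows "(\<Sum>n<m. (2 * integral {0..1} (\<lambda>x. h x * e n x))\<^sup>2) \<le> 2 * integral {0..1} (\<lambda>x. (h x)\<^sup>2)"
proof -
  define b where "b n = 2 * integral {0..1} (\<lambda>x. h x * e n x)" for n
  have *: "(h x - (\<Sum>n<m. b n * e n x))\<^sup>2 = (h x)\<^sup>2 - 2 * (\<Sum>n<m. b n * (h x * e n x)) + (\<Sum>n<m. b n * e n x)\<^sup>2" for x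
    by (simp add: power2_eq_square algebra_simps sum_distrib_left)
  have "((\<lambda>x. (h x - (\<Sum>n<m. b n * e n x))\<^sup>2) has_integral
     (integral {0..1} (\<lambda>x. (h x)\<^sup>2) - 2 * (\<Sum>n<m. b n * integral {0..1} (\<lambda>x. h x * e n x)) + 1/2 * (\<Sum>n<m. (b n)\<^sup>2))) {0..1}"
    unfolding * by (intro has_integral_add has_integral_diff has_integral_mult_right has_integral_sum
      has_integral_orthogonal_sum_square orth integrable_integral sq he) auto
  then have "0 \<le> integral {0..1} (\<lambda>x. (h x)\<^sup>2) - 2 * (\<Sum>n<m. b n * integral {0..1} (\<lambda>x. h x * e n x)) + 1/2 * (\<Sum>n<m. (b n)\<^sup>2)"
    by (rule has_integral_nonneg) simp
  also have "(\<Sum>n<m. b n * integral {0..1} (\<lambda>x. h x * e n x)) = 1/2 * (\<Sum>n<m. (b n)\<^sup>2)"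
    by (simp add: b_def power2_eq_square sum_distrib_left algebra_simps)
  finally show ?thesis unfolding b_def by simp
qed

lemma bessel_fsin:
  assumes "continuous_on {0..1} h"
  shows "(\<Sum>n<m. (fsin n h)\<^sup>2) \<le> 2 * integral {0..1} (\<lambda>x. (h x)\<^sup>2)"
  unfolding fsin_def
  by (rule bessel_inequality[of "\<lambda>n x. sin (freq n * x)", OF has_integral_sin_sin])
    (intro integrable_continuous_interval continuous_intros assms)+

lemma bessel_fcos:
  assumes "continuous_on {0..1} h"
  shows "(\<Sum>n<m. (fcos n h)\<^sup>2) \<le> 2 * integral {0..1} (\<lambda>x. (h x)\<^sup>2)"
  unfolding fcos_def
  by (rule bessel_inequality[of "\<lambda>n x. cos (freq n * x)", OF has_integral_cos_cos])
    (intro integrable_continuous_interval continuous_intros assms)+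

lemma integral_unit_square_le:
  fixes h :: "real \<Rightarrow> real"
  assumes "continuous_on {0..1} h" "\<And>x. x \<in> {0..1} \<Longrightarrow> \<bar>h x\<bar> \<le> B"
  shows "integral {0..1} (\<lambda>x. (h x)\<^sup>2) \<le> B\<^sup>2"
proof -
  have "integral {0..1} (\<lambda>x. (h x)\<^sup>2) \<le> integral {0..1} (\<lambda>x::real. B\<^sup>2)"
  proof (rule integral_le)
    show "(h x)\<^sup>2 \<le> B\<^sup>2" if "x \<in> {0..1}" for x using power_mono[OF assms(2)[OF that], of 2] by simp
  qed (intro integrable_continuous_interval continuous_intros assms(1))+
  then show ?thesis by simp
qed

section \<open>Coefficients of derivatives and completeness of the sine system\<close>

lemma integral_parts_unit:
  fixes h k :: "real \<Rightarrow> real"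
  assumes "\<And>x. x \<in> {0..1} \<Longrightarrow> (h has_real_derivative h' x) (at x within {0..1})"
    and "\<And>x. x \<in> {0..1} \<Longrightarrow> (k has_real_derivative k' x) (at x within {0..1})"
    and "continuous_on {0..1} h'" "continuous_on {0..1} k'"
  shows "integral {0..1} (\<lambda>x. h x * k' x) = h 1 * k 1 - h 0 * k 0 - integral {0..1} (\<lambda>x. h' x * k x)"
proof -
  have c: "continuous_on {0..1} h" "continuous_on {0..1} k"
    using assms(1,2) DERIV_continuous_on by blast+
  have "((\<lambda>x. h x * k' x + h' x * k x) has_integral (h 1 * k 1 - h 0 * k 0)) {0..1}"
    by (rule fundamental_theorem_of_calculus)
      (auto simp flip: has_real_derivative_iff_has_vector_derivative intro!: DERIV_cong[OF DERIV_mult] assms)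
  then have "integral {0..1} (\<lambda>x. h x * k' x + h' x * k x) = h 1 * k 1 - h 0 * k 0" by (rule integral_unique)
  moreover have "integral {0..1} (\<lambda>x. h x * k' x + h' x * k x) = integral {0..1} (\<lambda>x. h x * k' x) + integral {0..1} (\<lambda>x. h' x * k x)"
    by (intro integral_add integrable_continuous_interval continuous_intros c assms)
  ultimately show ?thesis by simp
qed

text \<open>The boundary term carries a sine, which vanishes at 0 and 1, so \<open>h\<close> may
  have any boundary values. This admits compositions \<open>f (h x)\<close> with \<open>f 0\<close>
  nonzero. In the dual formula \<open>fsin_eq_fcos_deriv\<close> the vanishing of \<open>h\<close>
  takes over this task.\<close>

lemma fcos_eq_fsin_deriv:
  assumes "\<And>x. x \<in> {0..1} \<Longrightarrow> (h has_real_derivative h' x) (at x within {0..1})"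
    and "continuous_on {0..1} h'"
  shows "freq n * fcos n h = - fsin n h'"
proof -
  have "integral {0..1} (\<lambda>x. h x * (cos (freq n * x) * freq n)) =
     h 1 * sin (freq n * 1) - h 0 * sin (freq n * 0) - integral {0..1} (\<lambda>x. h' x * sin (freq n * x))"
  proof (rule integral_parts_unit[where k = "\<lambda>x. sin (freq n * x)", OF assms(1) _ assms(2)])
    show "continuous_on {0..1} (\<lambda>x. cos (freq n * x) * freq n)" by (intro continuous_intros)
  qed (auto intro!: derivative_eq_intros)
  also have "(\<lambda>x. h x * (cos (freq n * x) * freq n)) = (\<lambda>x. freq n * (h x * cos (freq n * x)))"
    by (intro ext) (simp only: mult_ac)
  also have "integral {0..1} \<dots> = freq n * integral {0..1} (\<lambda>x. h x * cos (freq n * x))"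
    by (rule integral_mult_right)
  finally have "freq n * integral {0..1} (\<lambda>x. h x * cos (freq n * x)) = - integral {0..1} (\<lambda>x. h' x * sin (freq n * x))"
    by simp
  then show ?thesis unfolding fcos_def fsin_def by linarith
qed

lemma fsin_eq_fcos_deriv:
  assumes "\<And>x. x \<in> {0..1} \<Longrightarrow> (h has_real_derivative h' x) (at x within {0..1})"
    and "continuous_on {0..1} h'" "h 0 = 0" "h 1 = 0"
  shows "freq n * fsin n h = fcos n h'"
proof -
  have "integral {0..1} (\<lambda>x. h x * (sin (freq n * x) * freq n)) =
     h 1 * - cos (freq n * 1) - h 0 * - cos (freq n * 0) - integral {0..1} (\<lambda>x. h' x * - cos (freq n * x))"
  proof (rule integral_parts_unit[where k = "\<lambda>x. - cos (freq n * x)", OF assms(1) _ assms(2)])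
    show "continuous_on {0..1} (\<lambda>x. sin (freq n * x) * freq n)" by (intro continuous_intros)
  qed (auto intro!: derivative_eq_intros)
  also have "(\<lambda>x. h x * (sin (freq n * x) * freq n)) = (\<lambda>x. freq n * (h x * sin (freq n * x)))"
    by (intro ext) (simp only: mult_ac)
  also have "integral {0..1} \<dots> = freq n * integral {0..1} (\<lambda>x. h x * sin (freq n * x))"
    by (rule integral_mult_right)
  finally show ?thesis unfolding fcos_def fsin_def by (simp add: assms)
qed

lemma sin_freq_cos:
  "sin (freq n * x) * cos (pi * x) = 1/2 * (sin (freq (Suc n) * x) + (if n = 0 then 0 else sin (freq (n - 1) * x)))"
proof -
  have *: "freq n * x + pi * x = freq (Suc n) * x" by (simp add: freq_def algebra_simps)
  have **: "freq n * x - pi * x = (if n = 0 then 0 else freq (n - 1) * x)"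
    by (cases n) (simp_all add: freq_def algebra_simps)
  show ?thesis unfolding sin_times_cos * ** by auto
qed

text \<open>Since sin (n \<pi> x) cos(\<pi> x)^k lies in the span of the sines, \<open>h\<close> is orthogonal to sin (\<pi> x) p(cos (\<pi> x))
  for every polynomial \<open>p\<close>; Weierstrass approximation of \<open>h\<close> as a function of cos (\<pi> x) gives \<open>h = 0\<close>.\<close>

lemma fsin_complete:
  assumes cont: "continuous_on {0..1} h" and zero: "\<And>n. fsin n h = 0" and x: "x \<in> {0..1}"
  shows "h x = 0"
proof -
  note ic = integrable_continuous_interval
  have 1: "integral {0..1} (\<lambda>x. h x * sin (freq n * x) * cos (pi * x) ^ k) = 0" for n k
  proof (induction k arbitrary: n)
    case 0 then show ?case using zero[of n] by (simp add: fsin_def)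
  next
    case (Suc k)
    have e: "h x * sin (freq n * x) * cos (pi * x) ^ Suc k = 1/2 * (h x * sin (freq (Suc n) * x) * cos (pi * x) ^ k) +
            1/2 * (if n = 0 then 0 else h x * sin (freq (n-1) * x) * cos (pi * x) ^ k)" for x
    proof -
      have "h x * sin (freq n * x) * cos (pi * x) ^ Suc k = h x * (sin (freq n * x) * cos (pi * x)) * cos (pi * x) ^ k"
        by (simp add: mult_ac)
      then show ?thesis unfolding sin_freq_cos by (simp add: algebra_simps)
    qed
    have ii: "((\<lambda>x. h x * sin (freq m * x) * cos (pi * x) ^ k) has_integral 0) {0..1}" for m
    proof -
      have "(\<lambda>x. h x * sin (freq m * x) * cos (pi * x) ^ k) integrable_on {0..1}"
        by (intro ic continuous_intros cont)
      from integrable_integral[OF this] show ?thesis by (simp add: Suc)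
    qed
    have "((\<lambda>x. 1/2 * (h x * sin (freq (Suc n) * x) * cos (pi * x) ^ k) +
            1/2 * (if n = 0 then 0 else h x * sin (freq (n-1) * x) * cos (pi * x) ^ k)) has_integral (1/2 * 0 + 1/2 * 0)) {0..1}"
      using ii[of "n - 1"] by (intro has_integral_add has_integral_mult_right ii) (cases "n = 0"; simp)
    then show ?case unfolding e by (simp add: integral_unique)
  qed
  have 2: "integral {0..1} (\<lambda>x. h x * sin (pi * x) * p (cos (pi * x))) = 0" if p: "real_polynomial_function p" for p
  proof -
    obtain a N where p: "p = (\<lambda>x. \<Sum>i\<le>(N::nat). a i * x ^ i)"
      using p real_polynomial_function_iff_sum by metis
    have e: "h x * sin (pi * x) * p (cos (pi * x)) = (\<Sum>i\<le>N. a i * (h x * sin (freq 0 * x) * cos (pi * x) ^ i))" for x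
      by (auto simp: p sum_distrib_left freq_def algebra_simps)
    have "integral {0..1} (\<lambda>x. \<Sum>i\<le>N. a i * (h x * sin (freq 0 * x) * cos (pi * x) ^ i)) = (\<Sum>i\<le>N. a i * integral {0..1} (\<lambda>x. h x * sin (freq 0 * x) * cos (pi * x) ^ i))"
      by (subst integral_sum, simp, intro ic continuous_intros cont, simp)
    then show ?thesis unfolding e using 1 by simp
  qed
  have ch: "h (arccos (cos (pi * x)) / pi) = h x" if "x \<in> {0..1}" for x
  proof -
    have "0 \<le> pi * x" "pi * x \<le> pi" using that by (auto simp: mult_le_cancel_left1)
    then show ?thesis by (simp add: arccos_cos)
  qed
  have pc: "continuous_on {-1..1} (\<lambda>c. h (arccos c / pi))"
    by (rule continuous_on_compose2[OF cont]) (auto intro!: continuous_intros simp: divide_le_eq arccos_lbound arccos_ubound)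
  obtain M where M: "\<And>x. x \<in> {0..1} \<Longrightarrow> \<bar>h x\<bar> \<le> M"
    using continuous_on_compact_bound[OF compact_Icc cont] by (auto simp del: atLeastAtMost_iff)
  have "integral {0..1} (\<lambda>x. (h x)\<^sup>2 * sin (pi * x)) \<le> e * M" if e: "e > 0" for e
  proof -
    obtain p where p: "real_polynomial_function p" "\<And>c. c \<in> {-1..1} \<Longrightarrow> \<bar>h (arccos c / pi) - p c\<bar> < e"
      using Stone_Weierstrass_real_polynomial_function[OF compact_Icc pc e] by blast
    have cp: "continuous_on {0..1} (\<lambda>x. p (cos (pi * x)))"
      by (rule continuous_on_compose2[of UNIV p])
        (auto intro!: continuous_intros simp: continuous_on_polymonial_function[OF p(1)[unfolded real_polynomial_function_eq]])
    have "integral {0..1} (\<lambda>x. (h x)\<^sup>2 * sin (pi * x)) = integral {0..1} (\<lambda>x. (h x)\<^sup>2 * sin (pi * x)) - integral {0..1} (\<lambda>x. h x * sin (pi * x) * p (cos (pi * x)))"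
      using 2[OF p(1)] by simp
    also have "\<dots> = integral {0..1} (\<lambda>x. (h x)\<^sup>2 * sin (pi * x) - h x * sin (pi * x) * p (cos (pi * x)))"
      by (rule integral_diff[symmetric]) (intro ic continuous_intros cont cp)+
    also have "\<dots> \<le> integral {0..1} (\<lambda>x::real. e * M)"
    proof (rule integral_le)
      fix x :: real assume x: "x \<in> {0..1}"
      have d: "\<bar>h x - p (cos (pi * x))\<bar> \<le> e" using p(2)[of "cos (pi * x)"] ch[OF x] by simp
      have "(h x)\<^sup>2 * sin (pi * x) - h x * sin (pi * x) * p (cos (pi * x)) = (h x - p (cos (pi * x))) * (h x * sin (pi * x))"
        by (simp add: power2_eq_square algebra_simps)
      also have "\<dots> \<le> \<bar>h x - p (cos (pi * x))\<bar> * \<bar>h x * sin (pi * x)\<bar>" by (metis abs_ge_self abs_mult)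
      also have "\<dots> \<le> e * M"
      proof (intro mult_mono d)
        have "\<bar>h x\<bar> * \<bar>sin (pi * x)\<bar> \<le> M * 1" by (intro mult_mono M x) (use M[OF x] in auto)
        then show "\<bar>h x * sin (pi * x)\<bar> \<le> M" by (simp add: abs_mult)
      qed (use e in auto)
      finally show "(h x)\<^sup>2 * sin (pi * x) - h x * sin (pi * x) * p (cos (pi * x)) \<le> e * M" .
    qed (intro ic continuous_intros cont cp)+
    finally show ?thesis by simp
  qed
  note small = this
  have Mn: "0 \<le> M" using M[of 0] by auto
  have s0: "0 \<le> sin (pi * x)" if "x \<in> {0..1}" for x
    using that by (intro sin_ge_zero) (auto simp: mult_le_cancel_left1)
  have "integral {0..1} (\<lambda>x. (h x)\<^sup>2 * sin (pi * x)) \<le> 0"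
  proof (rule field_le_epsilon)
    fix e :: real assume e: "e > 0"
    have "integral {0..1} (\<lambda>x. (h x)\<^sup>2 * sin (pi * x)) \<le> e / (M + 1) * M"
      by (rule small) (use e Mn in auto)
    also have "\<dots> \<le> e" using e Mn by (simp add: divide_simps mult_left_mono)
    finally show "integral {0..1} (\<lambda>x. (h x)\<^sup>2 * sin (pi * x)) \<le> 0 + e" by simp
  qed
  moreover have "integral {0..1} (\<lambda>x. (h x)\<^sup>2 * sin (pi * x)) \<ge> 0"
    using s0 by (intro integral_nonneg ic continuous_intros cont) auto
  ultimately have "\<forall>x\<in>{0..1}. (h x)\<^sup>2 * sin (pi * x) = 0"
    using s0 by (subst integral_eq_0_iff[symmetric]) (auto intro!: continuous_intros cont)
  then have h0: "h x = 0" if "x \<in> {0<..<1}" for x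
  proof -
    have "sin (pi * x) > 0" using that by (intro sin_gt_zero) auto
    then show ?thesis using that \<open>\<forall>x\<in>{0..1}. _\<close> by force
  qed
  \<comment> \<open>The weight \<open>sin (pi * x)\<close> is zero at the end points, so positivity
    settles the open interval only; continuity does the rest.\<close>
  show ?thesis
    by (rule continuous_constant_on_closure[of "{0<..<1}" h 0 x]) (use cont h0 x in auto)
qed

section \<open>Linearity, bounds and limits of the coefficients\<close>

lemma fsin_add:
  assumes "continuous_on {0..1} h" "continuous_on {0..1} k"
  shows "fsin n (\<lambda>x. h x + k x) = fsin n h + fsin n k"
proof -
  have "integral {0..1} (\<lambda>x. (h x + k x) * sin (freq n * x)) = integral {0..1} (\<lambda>x. h x * sin (freq n * x)) + integral {0..1} (\<lambda>x. k x * sin (freq n * x))"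
    unfolding distrib_right by (intro integral_add integrable_continuous_interval continuous_intros assms)
  then show ?thesis by (simp add: fsin_def)
qed

lemma fcos_add:
  assumes "continuous_on {0..1} h" "continuous_on {0..1} k"
  shows "fcos n (\<lambda>x. h x + k x) = fcos n h + fcos n k"
proof -
  have "integral {0..1} (\<lambda>x. (h x + k x) * cos (freq n * x)) = integral {0..1} (\<lambda>x. h x * cos (freq n * x)) + integral {0..1} (\<lambda>x. k x * cos (freq n * x))"
    unfolding distrib_right by (intro integral_add integrable_continuous_interval continuous_intros assms)
  then show ?thesis by (simp add: fcos_def)
qed

lemma fsin_cmult: "fsin n (\<lambda>x. c * h x) = c * fsin n h"
  by (simp add: fsin_def mult.assoc)

lemma fcos_cmult: "fcos n (\<lambda>x. c * h x) = c * fcos n h"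
  by (simp add: fcos_def mult.assoc)

lemma fsin_diff:
  assumes "continuous_on {0..1} h" "continuous_on {0..1} k"
  shows "fsin n (\<lambda>x. h x - k x) = fsin n h - fsin n k"
  using fsin_add[of h "\<lambda>x. -1 * k x" n] fsin_cmult[of n "-1" k] assms by (simp add: continuous_on_minus)

lemma fcos_diff:
  assumes "continuous_on {0..1} h" "continuous_on {0..1} k"
  shows "fcos n (\<lambda>x. h x - k x) = fcos n h - fcos n k"
  using fcos_add[of h "\<lambda>x. -1 * k x" n] fcos_cmult[of n "-1" k] assms by (simp add: continuous_on_minus)

lemma fsin_cong: "(\<And>x. x \<in> {0..1} \<Longrightarrow> h x = k x) \<Longrightarrow> fsin n h = fsin n k"
  unfolding fsin_def by (intro arg_cong[where f = "\<lambda>z. 2 * z"] integral_cong) simp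

lemma fsin_sin: "fsin n (\<lambda>x. sin (freq k * x)) = (if k = n then 1 else 0)"
  unfolding fsin_def using integral_unique[OF has_integral_sin_sin[of k n]] by simp

lemma fsin_sum_sin: "fsin n (\<lambda>x. \<Sum>k<m. a k * sin (freq k * x)) = (if n < m then a n else 0)"
proof (induction m)
  case 0 then show ?case by (simp add: fsin_def)
next
  case (Suc m)
  have "fsin n (\<lambda>x. \<Sum>k<Suc m. a k * sin (freq k * x)) = fsin n (\<lambda>x. \<Sum>k<m. a k * sin (freq k * x)) + a m * fsin n (\<lambda>x. sin (freq m * x))"
    by (simp add: fsin_cmult[symmetric], rule fsin_add; intro continuous_intros)
  then show ?case using Suc by (auto simp: fsin_sin less_Suc_eq)
qed

lemma abs_fsin_le:
  assumes "continuous_on {0..1} h" "\<And>x. x \<in> {0..1} \<Longrightarrow> \<bar>h x\<bar> \<le> B"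
  shows "\<bar>fsin n h\<bar> \<le> 2 * B"
proof -
  have "norm (integral {0..1} (\<lambda>x. h x * sin (freq n * x))) \<le> B * (1 - 0)"
  proof (rule integral_bound)
    fix t :: real assume t: "t \<in> {0..1}"
    have "\<bar>h t\<bar> * \<bar>sin (freq n * t)\<bar> \<le> B * 1"
      using assms(2)[OF t] by (intro mult_mono) auto
    then show "norm (h t * sin (freq n * t)) \<le> B" by (simp add: abs_mult)
  qed (auto intro!: continuous_intros assms)
  then show ?thesis by (simp add: fsin_def)
qed

lemma abs_fcos_le:
  assumes "continuous_on {0..1} h" "\<And>x. x \<in> {0..1} \<Longrightarrow> \<bar>h x\<bar> \<le> B"
  shows "\<bar>fcos n h\<bar> \<le> 2 * B"
proof -
  have "norm (integral {0..1} (\<lambda>x. h x * cos (freq n * x))) \<le> B * (1 - 0)"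
  proof (rule integral_bound)
    fix t :: real assume t: "t \<in> {0..1}"
    have "\<bar>h t\<bar> * \<bar>cos (freq n * t)\<bar> \<le> B * 1"
      using assms(2)[OF t] by (intro mult_mono) auto
    then show "norm (h t * cos (freq n * t)) \<le> B" by (simp add: abs_mult)
  qed (auto intro!: continuous_intros assms)
  then show ?thesis by (simp add: fcos_def)
qed

lemma tendsto_fsin:
  assumes lim: "uniform_limit {0..1} g h F" and g: "\<forall>\<^sub>F k in F. continuous_on {0..1} (g k)"
    and h: "continuous_on {0..1} h"
  shows "((\<lambda>k. fsin n (g k)) \<longlongrightarrow> fsin n h) F"
proof (rule tendstoI)
  fix e :: real assume e: "e > 0"
  have "\<forall>\<^sub>F k in F. \<forall>x\<in>{0..1}. dist (g k x) (h x) < e / 4"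
    using uniform_limitD[OF lim, of "e / 4"] e by simp
  with g show "\<forall>\<^sub>F k in F. dist (fsin n (g k)) (fsin n h) < e"
  proof eventually_elim
    case (elim k)
    have "\<bar>fsin n (\<lambda>x. g k x - h x)\<bar> \<le> 2 * (e / 4)"
      using elim h by (intro abs_fsin_le continuous_intros) (auto simp: dist_real_def intro: less_imp_le)
    then show ?case using e elim h by (simp add: dist_real_def fsin_diff)
  qed
qed

lemma tendsto_fcos:
  assumes lim: "uniform_limit {0..1} g h F" and g: "\<forall>\<^sub>F k in F. continuous_on {0..1} (g k)"
    and h: "continuous_on {0..1} h"
  shows "((\<lambda>k. fcos n (g k)) \<longlongrightarrow> fcos n h) F"
proof (rule tendstoI)
  fix e :: real assume e: "e > 0"
  have "\<forall>\<^sub>F k in F. \<forall>x\<in>{0..1}. dist (g k x) (h x) < e / 4"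
    using uniform_limitD[OF lim, of "e / 4"] e by simp
  with g show "\<forall>\<^sub>F k in F. dist (fcos n (g k)) (fcos n h) < e"
  proof eventually_elim
    case (elim k)
    have "\<bar>fcos n (\<lambda>x. g k x - h x)\<bar> \<le> 2 * (e / 4)"
      using elim h by (intro abs_fcos_le continuous_intros) (auto simp: dist_real_def intro: less_imp_le)
    then show ?case using e elim h by (simp add: dist_real_def fcos_diff)
  qed
qed

text \<open>The square root of zeta(3/2). It is the Cauchy-Schwarz constant for weights of order
  \<open>(n + 1) powr (-3/4)\<close>, whose squares are summable.\<close>

definition weight_sum :: real where "weight_sum = sqrt (\<Sum>n. real (Suc n) powr (-3/2))"

lemma summable_Suc_powr: "summable (\<lambda>n. real (Suc n) powr (-3/2))"
  using summable_real_powr_iff[of "-3/2"] summable_Suc_iff[of "\<lambda>n. real n powr (-3/2)"] by simp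

lemma weight_sum_nonneg: "weight_sum \<ge> 0"
  unfolding weight_sum_def by (intro real_sqrt_ge_zero suminf_nonneg summable_Suc_powr) auto

lemma sum_weighted_le:
  assumes d: "\<And>n. 0 \<le> d n" "\<And>n. d n \<le> real (Suc n) powr (-3/4)"
  shows "(\<Sum>n<m. d n * \<bar>c n\<bar>) \<le> weight_sum * sqrt (\<Sum>n<m. (c n)\<^sup>2)"
proof -
  have "(\<Sum>n<m. d n * \<bar>c n\<bar>) \<le> (\<Sum>n<m. real (Suc n) powr (-3/4) * \<bar>c n\<bar>)"
    by (intro sum_mono mult_right_mono d) auto
  also have "\<dots> \<le> sqrt ((\<Sum>n<m. (real (Suc n) powr (-3/4))\<^sup>2) * (\<Sum>n<m. \<bar>c n\<bar>\<^sup>2))"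
    by (intro real_le_rsqrt Cauchy_Schwarz_ineq_sum)
  also have "(\<Sum>n<m. (real (Suc n) powr (-3/4))\<^sup>2) = (\<Sum>n<m. real (Suc n) powr (-3/2))"
    by (simp add: power2_eq_square del: of_nat_Suc flip: powr_add)
  also have "sqrt ((\<Sum>n<m. real (Suc n) powr (-3/2)) * (\<Sum>n<m. \<bar>c n\<bar>\<^sup>2)) \<le> weight_sum * sqrt (\<Sum>n<m. (c n)\<^sup>2)"
    unfolding weight_sum_def real_sqrt_mult
    by (intro mult_mono real_sqrt_le_mono sum_le_suminf summable_Suc_powr) (use summable_Suc_powr in \<open>auto intro!: real_sqrt_ge_zero suminf_nonneg sum_nonneg simp del: of_nat_Suc\<close>)
  finally show ?thesis .
qed

lemma inverse_freq_le: "1 / freq n \<le> real (Suc n) powr (-3/4)"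
proof -
  have "1 / freq n \<le> 1 / real (Suc n)" using freq_ge[of n] by (intro divide_left_mono) auto
  also have "\<dots> = real (Suc n) powr (-1)" by (simp add: powr_minus_divide del: of_nat_Suc)
  also have "\<dots> \<le> real (Suc n) powr (-3/4)" by (intro powr_mono) auto
  finally show ?thesis .
qed

text \<open>The sums of squares of \<open>freq n * a n\<close> are, up to a factor, the squared L2
  norm of the derivative, and \<open>1 / freq n\<close> is square summable: the Sobolev embedding of
  H^1 into bounded functions, in coefficients.\<close>

lemma summable_abs_of_energy:
  assumes "\<And>m. (\<Sum>n<m. (freq n * a n)\<^sup>2) \<le> E"
  shows "summable (\<lambda>n. \<bar>a n\<bar>)" "(\<Sum>n<m. \<bar>a n\<bar>) \<le> weight_sum * sqrt E"
proof -
  have *: "(\<Sum>n<m. \<bar>a n\<bar>) \<le> weight_sum * sqrt E" for m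
  proof -
    have "(\<Sum>n<m. \<bar>a n\<bar>) = (\<Sum>n<m. 1 / freq n * \<bar>freq n * a n\<bar>)"
      by (simp add: abs_mult)
    also have "\<dots> \<le> weight_sum * sqrt (\<Sum>n<m. (freq n * a n)\<^sup>2)"
      by (intro sum_weighted_le inverse_freq_le) simp
    also have "\<dots> \<le> weight_sum * sqrt E"
      by (intro mult_left_mono real_sqrt_le_mono assms weight_sum_nonneg)
    finally show ?thesis .
  qed
  show "summable (\<lambda>n. \<bar>a n\<bar>)"
    by (rule bounded_imp_summable[of _ "weight_sum * sqrt E"]) (use *[of "Suc n" for n] in \<open>simp_all add: lessThan_Suc_atMost\<close>)
  show "(\<Sum>n<m. \<bar>a n\<bar>) \<le> weight_sum * sqrt E" by (rule *)
qed

section \<open>Absolutely convergent sine series\<close>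

lemma uniform_limit_sine_series:
  assumes M: "summable M" "\<And>n t. t \<in> S \<Longrightarrow> \<bar>a n t\<bar> \<le> M n"
  shows "uniform_limit (S \<times> UNIV) (\<lambda>m (t,x). \<Sum>n<m. a n t * sin (freq n * x)) (\<lambda>(t,x). \<Sum>n. a n t * sin (freq n * x)) sequentially"
proof -
  have "uniform_limit (S \<times> UNIV) (\<lambda>m p. \<Sum>n<m. a n (fst p) * sin (freq n * snd p)) (\<lambda>p. \<Sum>n. a n (fst p) * sin (freq n * snd p)) sequentially"
  proof (rule Weierstrass_m_test[OF _ M(1)])
    fix n p assume p: "p \<in> S \<times> (UNIV :: real set)"
    have "\<bar>a n (fst p)\<bar> * \<bar>sin (freq n * snd p)\<bar> \<le> M n * 1"
      using p M(2)[of "fst p" n] by (intro mult_mono) auto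
    then show "norm (a n (fst p) * sin (freq n * snd p)) \<le> M n" by (simp add: abs_mult)
  qed
  then show ?thesis by (simp add: case_prod_beta')
qed

lemma continuous_on_sine_series:
  assumes M: "summable M" "\<And>n t. t \<in> S \<Longrightarrow> \<bar>a n t\<bar> \<le> M n"
    and a: "\<And>n. continuous_on S (a n)"
  shows "continuous_on (S \<times> UNIV) (\<lambda>(t,x). \<Sum>n. a n t * sin (freq n * x))"
proof (rule uniform_limit_theorem[OF _ uniform_limit_sine_series[OF M]])
  have [continuous_intros]: "continuous_on (S \<times> UNIV) (\<lambda>p. a n (fst p))" for n
    by (rule continuous_on_compose2[OF a]) (auto intro!: continuous_intros)
  have [continuous_intros]: "continuous_on (S \<times> UNIV) (\<lambda>p. sin (freq n * snd p))" for n
    by (rule continuous_on_compose2[of UNIV sin]) (auto intro!: continuous_intros)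
  show "\<forall>\<^sub>F m in sequentially. continuous_on (S \<times> UNIV) (\<lambda>(t, x). \<Sum>n<m. a n t * sin (freq n * x))"
    unfolding case_prod_beta'
    by (intro always_eventually allI continuous_intros)
qed auto

lemma fsin_sine_series:
  assumes "summable (\<lambda>n. \<bar>a n\<bar>)"
  shows "continuous_on UNIV (\<lambda>x. \<Sum>n. a n * sin (freq n * x))" (is ?th1)
    and "fsin n (\<lambda>x. \<Sum>n. a n * sin (freq n * x)) = a n" (is ?th2)
    and "uniform_limit UNIV (\<lambda>m x. \<Sum>n<m. a n * sin (freq n * x)) (\<lambda>x. \<Sum>n. a n * sin (freq n * x)) sequentially" (is ?th3)
proof -
  show u: ?th3
    using uniform_limit_compose'[OF uniform_limit_sine_series[OF assms, of "{()}" "\<lambda>n _. a n"], of "\<lambda>x. ((), x)" UNIV]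
    by simp
  show c: ?th1
    by (rule uniform_limit_theorem[OF _ u]) (auto intro!: always_eventually continuous_intros)
  have "(\<lambda>m. fsin n (\<lambda>x. \<Sum>n<m. a n * sin (freq n * x))) \<longlonglongrightarrow> fsin n (\<lambda>x. \<Sum>n. a n * sin (freq n * x))"
    by (rule tendsto_fsin[OF uniform_limit_on_subset[OF u]])
      (auto intro!: always_eventually continuous_intros continuous_on_subset[OF c])
  moreover have "(\<lambda>m. fsin n (\<lambda>x. \<Sum>n<m. a n * sin (freq n * x))) \<longlonglongrightarrow> a n"
    by (rule tendsto_eventually, rule eventually_mono[OF eventually_gt_at_top[of n]]) (simp add: fsin_sum_sin)
  ultimately show ?th2 using LIMSEQ_unique by blast
qed

text \<open>\<open>h\<close> and the sum of its series share all coefficients, and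
  \<open>fsin_complete\<close> leaves no room for a difference. In particular summability of the
  coefficients forces \<open>h\<close> to vanish at 0 and 1; this is how solutions obtain their
  boundary values.\<close>

lemma sine_series_expansion:
  assumes h: "continuous_on {0..1} h" and s: "summable (\<lambda>n. \<bar>fsin n h\<bar>)" and x: "x \<in> {0..1}"
  shows "h x = (\<Sum>n. fsin n h * sin (freq n * x))"
proof -
  note S = fsin_sine_series[OF s]
  have "h x - (\<Sum>n. fsin n h * sin (freq n * x)) = 0"
  proof (rule fsin_complete[OF _ _ x])
    show "continuous_on {0..1} (\<lambda>x. h x - (\<Sum>n. fsin n h * sin (freq n * x)))"
      by (intro continuous_intros h continuous_on_subset[OF S(1)]) auto
    show "fsin n (\<lambda>x. h x - (\<Sum>n. fsin n h * sin (freq n * x))) = 0" for n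
      by (subst fsin_diff) (auto simp: S(2) intro: h continuous_on_subset[OF S(1)])
  qed
  then show ?thesis by simp
qed

lemma uniform_limit_sine_expansion:
  assumes h: "continuous_on {0..1} h" and s: "summable (\<lambda>n. \<bar>fsin n h\<bar>)"
  shows "uniform_limit {0..1} (\<lambda>m x. \<Sum>n<m. fsin n h * sin (freq n * x)) h sequentially"
  by (rule uniform_limit_cong'[THEN iffD1, OF _ _ uniform_limit_on_subset[OF fsin_sine_series(3)[OF s]]])
    (auto simp: sine_series_expansion[OF h s])

text \<open>By the chain rule, composition with \<open>f\<close> multiplies the H^1 energy by at
  most the square of \<open>L\<close>. Since \<open>h\<close> need not be differentiable, the
  computation is done on its sine partial sums, where Bessel's inequality applies to
  \<open>f' (P k x) * P' k x\<close>, and each finite sum passes to the uniform limit.\<close>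

lemma fcos_compose_energy:
  assumes h: "continuous_on {0..1} h" and E: "\<And>m. (\<Sum>n<m. (freq n * fsin n h)\<^sup>2) \<le> E"
    and f: "\<And>x. (f has_real_derivative f' x) (at x)" and f'c: "continuous_on UNIV f'"
    and L: "\<And>x. \<bar>f' x\<bar> \<le> L"
  shows "(\<Sum>n<m. (freq n * fcos n (\<lambda>x. f (h x)))\<^sup>2) \<le> L\<^sup>2 * E"
proof -
  define P where "P k x = (\<Sum>n<k. fsin n h * sin (freq n * x))" for k x
  define P' where "P' k x = (\<Sum>n<k. (freq n * fsin n h) * cos (freq n * x))" for k x
  have P: "(P k has_real_derivative P' k x) (at x)" for k x
    unfolding P_def P'_def by (auto intro!: derivative_eq_intros sum.cong)
  have cP: "continuous_on S (P k)" "continuous_on S (P' k)" for S k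
    unfolding P_def P'_def by (intro continuous_intros)+
  have fc: "continuous_on S f" for S
    using f by (meson DERIV_continuous_on has_field_derivative_at_within)
  have L0: "L \<ge> 0" using L[of 0] by auto
  have 1: "(\<Sum>n<m. (freq n * fcos n (\<lambda>x. f (P k x)))\<^sup>2) \<le> L\<^sup>2 * E" for k
  proof -
    have c: "continuous_on {0..1} (\<lambda>x. f' (P k x) * P' k x)"
      by (intro continuous_intros cP continuous_on_compose2[OF f'c cP(1)]) auto
    have "(\<Sum>n<m. (freq n * fcos n (\<lambda>x. f (P k x)))\<^sup>2) = (\<Sum>n<m. (fsin n (\<lambda>x. f' (P k x) * P' k x))\<^sup>2)"
    proof -
      have "freq n * fcos n (\<lambda>x. f (P k x)) = - fsin n (\<lambda>x. f' (P k x) * P' k x)" for n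
        by (rule fcos_eq_fsin_deriv[OF has_field_derivative_at_within c]) (rule DERIV_chain2[OF f P])
      then show ?thesis by simp
    qed
    also have "\<dots> \<le> 2 * integral {0..1} (\<lambda>x. (f' (P k x) * P' k x)\<^sup>2)"
      by (rule bessel_fsin[OF c])
    also have "\<dots> \<le> 2 * integral {0..1} (\<lambda>x. L\<^sup>2 * (P' k x)\<^sup>2)"
    proof (intro mult_left_mono integral_le)
      show "(f' (P k x) * P' k x)\<^sup>2 \<le> L\<^sup>2 * (P' k x)\<^sup>2" for x
        using power_mono[OF L[of "P k x"], of 2] by (simp add: power_mult_distrib mult_right_mono)
    qed (auto intro!: integrable_continuous_interval continuous_intros c cP)
    also have "\<dots> = L\<^sup>2 * (2 * integral {0..1} (\<lambda>x. (P' k x)\<^sup>2))" by simp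
    also have "integral {0..1} (\<lambda>x. (P' k x)\<^sup>2) = 1/2 * (\<Sum>n<k. (freq n * fsin n h)\<^sup>2)"
      unfolding P'_def by (intro integral_unique has_integral_orthogonal_sum_square has_integral_cos_cos)
    also have "L\<^sup>2 * (2 * \<dots>) \<le> L\<^sup>2 * E" using E[of k] by (intro mult_left_mono) auto
    finally show ?thesis .
  qed
  have u: "uniform_limit {0..1} P h sequentially"
    using uniform_limit_sine_expansion[OF h summable_abs_of_energy(1)[OF E]] unfolding P_def .
  have lip: "\<bar>f a - f b\<bar> \<le> L * \<bar>a - b\<bar>" for a b
  proof -
    have "norm (f a - f b) \<le> L * norm (a - b)"
      by (rule field_differentiable_bound[of UNIV f f']) (auto intro: has_field_derivative_at_within f L)
    then show ?thesis by simp
  qed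
  have uf: "uniform_limit {0..1} (\<lambda>k x. f (P k x)) (\<lambda>x. f (h x)) sequentially"
  proof (rule uniform_limitI)
    fix e :: real assume e: "e > 0"
    then have "e / (L + 1) > 0" using L0 by simp
    then have "\<forall>\<^sub>F k in sequentially. \<forall>x\<in>{0..1}. dist (P k x) (h x) < e / (L + 1)"
      by (rule uniform_limitD[OF u])
    then show "\<forall>\<^sub>F k in sequentially. \<forall>x\<in>{0..1}. dist (f (P k x)) (f (h x)) < e"
    proof eventually_elim
      case (elim k)
      show ?case
      proof
        fix x :: real assume x: "x \<in> {0..1}"
        have "dist (f (P k x)) (f (h x)) \<le> L * dist (P k x) (h x)" using lip by (simp add: dist_real_def)
        also have "\<dots> \<le> L * (e / (L + 1))" using elim x L0 by (intro mult_left_mono) (auto intro: less_imp_le)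
        also have "\<dots> < e" using e L0 by (simp add: divide_simps)
        finally show "dist (f (P k x)) (f (h x)) < e" .
      qed
    qed
  qed
  have "(\<lambda>k. \<Sum>n<m. (freq n * fcos n (\<lambda>x. f (P k x)))\<^sup>2) \<longlonglongrightarrow> (\<Sum>n<m. (freq n * fcos n (\<lambda>x. f (h x)))\<^sup>2)"
    by (intro tendsto_intros tendsto_fcos uf always_eventually allI continuous_on_compose2[OF fc[of UNIV]] cP h) auto
  then show ?thesis by (rule LIMSEQ_le_const2) (use 1 in auto)
qed

lemma integral_Cauchy_Schwarz:
  fixes f g :: "real \<Rightarrow> real"
  assumes f: "continuous_on {a..b} f" and g: "continuous_on {a..b} g"
  shows "(integral {a..b} (\<lambda>x. f x * g x))\<^sup>2 \<le> integral {a..b} (\<lambda>x. (f x)\<^sup>2) * integral {a..b} (\<lambda>x. (g x)\<^sup>2)"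
proof -
  note ic = integrable_continuous_interval
  define P Q R where "P = integral {a..b} (\<lambda>x. (f x)\<^sup>2)" and "Q = integral {a..b} (\<lambda>x. (g x)\<^sup>2)" and "R = integral {a..b} (\<lambda>x. f x * g x)"
  have q: "0 \<le> P - 2 * c * R + c\<^sup>2 * Q" for c
  proof -
    have "((\<lambda>x. (f x)\<^sup>2 - 2 * c * (f x * g x) + c\<^sup>2 * (g x)\<^sup>2) has_integral (P - 2 * c * R + c\<^sup>2 * Q)) {a..b}"
      unfolding P_def Q_def R_def
      by (intro has_integral_add has_integral_diff has_integral_mult_right integrable_integral ic continuous_intros f g)
    then show ?thesis
    proof (rule has_integral_nonneg)
      fix x show "0 \<le> (f x)\<^sup>2 - 2 * c * (f x * g x) + c\<^sup>2 * (g x)\<^sup>2"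
        using zero_le_power2[of "f x - c * g x"] by (simp add: power2_eq_square algebra_simps)
    qed
  qed
  have Q0: "Q \<ge> 0" unfolding Q_def by (intro integral_nonneg ic continuous_intros g) auto
  have "R\<^sup>2 \<le> P * Q"
  proof (cases "Q = 0")
    case True
    have "R = 0"
    proof (rule ccontr)
      assume "R \<noteq> 0"
      \<comment> \<open>With \<open>Q = 0\<close> the quadratic is affine in \<open>c\<close>, and
        at this \<open>c\<close> it equals -1.\<close>
      then show False using q[of "(P + 1) / (2 * R)"] q[of 0] True by simp
    qed
    then show ?thesis using True by simp
  next
    case False
    then have "P - 2 * (R / Q) * R + (R / Q)\<^sup>2 * Q = P - R\<^sup>2 / Q" by (simp add: power2_eq_square)
    then have "R\<^sup>2 / Q \<le> P" using q[of "R / Q"] by simp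
    then show ?thesis using False Q0 by (simp add: pos_divide_le_eq)
  qed
  then show ?thesis unfolding P_def Q_def R_def .
qed

section \<open>Mild solutions for globally Lipschitz nonlinearities\<close>

lemma exp_neg_le_powr:
  fixes x b :: real
  assumes "x > 0" "0 \<le> b" "b \<le> 1"
  shows "exp (- x) \<le> x powr (- b)"
proof -
  have "x powr b \<le> 1 + x"
  proof (cases "x \<le> 1")
    case True
    then have "x powr b \<le> 1" using assms by (simp add: powr_le1)
    then show ?thesis using assms by simp
  next
    case False
    then have "x powr b \<le> x powr 1" using assms by (intro powr_mono) auto
    then show ?thesis using assms by simp
  qed
  also have "\<dots> \<le> exp x" by (rule exp_ge_add_one_self)
  finally have "inverse (exp x) \<le> inverse (x powr b)"
    using assms by (intro le_imp_inverse_le) auto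
  then show ?thesis by (simp add: exp_minus powr_minus)
qed

text \<open>The exponent is twice the -7/8 of \<open>exp_freq_le\<close>: the heat factor at index
  \<open>n\<close> and time \<tau> is at most of order -7/8 in the product of the squared frequency
  and \<tau>. The value 7/8 lies strictly between 3/4 and 1. Below 1 the singularity in time is
  integrable; above 3/4 the weight remains square summable after multiplication by one
  frequency.\<close>

definition mode_weight :: "nat \<Rightarrow> real" where "mode_weight n = real (Suc n) powr (-7/4)"

lemma mode_weight_nonneg [simp]: "mode_weight n \<ge> 0" by (simp add: mode_weight_def)

lemma mode_weight_le: "mode_weight n \<le> real (Suc n) powr (-3/4)"
  unfolding mode_weight_def by (intro powr_mono) auto

lemma freq_mode_weight: "freq n * mode_weight n = pi * real (Suc n) powr (-3/4)"
proof -
  have "real (Suc n) powr (-3/4) = real (Suc n) powr (1 + (-7/4))" by simp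
  also have "\<dots> = real (Suc n) * real (Suc n) powr (-7/4)" by (subst powr_add) simp
  finally show ?thesis by (simp add: freq_def mode_weight_def)
qed

text \<open>The rate \<alpha> = 1 serves the heat kernel itself, and \<alpha> = 1/4 its scaling
  quotients, which have given up part of the decay to absorb polynomial factors.\<close>

lemma exp_freq_le:
  assumes "\<tau> > 0" "0 < \<alpha>"
  shows "exp (- (\<alpha> * (freq n)\<^sup>2 * \<tau>)) \<le> \<alpha> powr (-7/8) * mode_weight n * \<tau> powr (-7/8)"
proof -
  have "(real (Suc n))\<^sup>2 \<le> (freq n)\<^sup>2" using freq_ge[of n] by (intro power_mono) auto
  then have "exp (- (\<alpha> * (freq n)\<^sup>2 * \<tau>)) \<le> exp (- (\<alpha> * (real (Suc n))\<^sup>2 * \<tau>))"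
    using assms by (simp add: mult_left_mono mult_right_mono del: of_nat_Suc)
  also have "\<dots> \<le> (\<alpha> * (real (Suc n))\<^sup>2 * \<tau>) powr (- (7/8))"
    using assms by (intro exp_neg_le_powr) auto
  also have "\<dots> = \<alpha> powr (-7/8) * ((real (Suc n))\<^sup>2 powr (-7/8)) * \<tau> powr (-7/8)"
    using assms by (simp add: powr_mult del: of_nat_Suc)
  also have "(real (Suc n))\<^sup>2 powr (-7/8) = mode_weight n"
    by (simp add: mode_weight_def powr_powr del: of_nat_Suc flip: powr_numeral)
  finally show ?thesis .
qed

lemma has_integral_powr_reflect:
  fixes t a :: real
  assumes "t \<ge> 0" "a > 0"
  shows "((\<lambda>s. (t - s) powr (a - 1)) has_integral (t powr a / a)) {0..t}"
proof -
  have "((\<lambda>s. (t - s) powr (a - 1)) has_integral (- ((t - t) powr a / a) - - ((t - 0) powr a / a))) {0..t}"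
  \<comment> \<open>For \<open>a < 1\<close> the integrand is unbounded near \<open>s = t\<close>;
    the interior version of the theorem asks for the derivative on the open interval only.\<close>
  proof (rule fundamental_theorem_of_calculus_interior)
    show "continuous_on {0..t} (\<lambda>s. - ((t - s) powr a / a))"
      using assms by (intro continuous_intros continuous_on_powr') auto
    fix s assume "s \<in> {0<..<t}"
    then show "((\<lambda>s. - ((t - s) powr a / a)) has_vector_derivative (t - s) powr (a - 1)) (at s)"
      unfolding has_real_derivative_iff_has_vector_derivative[symmetric] using assms
      by (auto intro!: derivative_eq_intros simp: powr_diff field_simps)
  qed (use assms in auto)
  then show ?thesis using assms by simp
qed

text \<open>The factor \<open>\<kappa> powr (-1/16)\<close> makes the heat operator a contraction in the norm weighted by \<open>exp (\<kappa> t)\<close>.\<close>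

lemma duhamel_sum_le:
  fixes k g :: "nat \<Rightarrow> real \<Rightarrow> real"
  assumes t: "0 \<le> t" "t \<le> T" and \<kappa>: "\<kappa> > 0" and Kc: "Kc \<ge> 0" and \<Gamma>: "\<Gamma> \<ge> 0"
    and kc: "\<And>n. continuous_on {0..t} (k n)"
    and kb: "\<And>n \<tau>. 0 < \<tau> \<Longrightarrow> \<tau> \<le> t \<Longrightarrow> \<bar>k n \<tau>\<bar> \<le> Kc * mode_weight n * \<tau> powr (-7/8)"
    and gc: "\<And>n. continuous_on {0..t} (g n)"
    and gb: "\<And>m s. s \<in> {0..t} \<Longrightarrow> (\<Sum>n<m. mode_weight n * \<bar>g n s\<bar>) \<le> \<Gamma> * exp (\<kappa> * s)"
  shows "(\<Sum>n<m. \<bar>integral {0..t} (\<lambda>s. k n (t - s) * g n s)\<bar>) \<le> Kc * \<Gamma> * exp (\<kappa> * t) * (16 * T powr (1/16) * \<kappa> powr (-1/16))"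
proof -
  note ic = integrable_continuous_interval
  have kc': "continuous_on {0..t} (\<lambda>s. k n (t - s))" for n
    by (rule continuous_on_compose2[OF kc]) (auto intro!: continuous_intros)
  define h where "h s = (\<Sum>n<m. \<bar>k n (t - s) * g n s\<bar>)" for s
  define b where "b s = (Kc * \<Gamma> * exp (\<kappa> * t) * \<kappa> powr (-1/16)) * (t - s) powr (1/16 - 1)" for s
  \<comment> \<open>At \<open>s = t\<close> the power \<open>0 powr (-15/16)\<close> is 0, so
    \<open>b\<close> need not dominate \<open>h\<close> there. Changing one point leaves the
    integral alone.\<close>
  define b' where "b' s = (if s = t then h t else b s)" for s
  have hc: "continuous_on {0..t} h" unfolding h_def by (intro continuous_intros kc' gc)
  have "(\<Sum>n<m. \<bar>integral {0..t} (\<lambda>s. k n (t - s) * g n s)\<bar>) \<le> (\<Sum>n<m. integral {0..t} (\<lambda>s. \<bar>k n (t - s) * g n s\<bar>))"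
  proof (intro sum_mono)
    fix n
    have "norm (integral {0..t} (\<lambda>s. k n (t - s) * g n s)) \<le> integral {0..t} (\<lambda>s. \<bar>k n (t - s) * g n s\<bar>)"
      by (intro integral_norm_bound_integral ic continuous_intros kc' gc) auto
    then show "\<bar>integral {0..t} (\<lambda>s. k n (t - s) * g n s)\<bar> \<le> integral {0..t} (\<lambda>s. \<bar>k n (t - s) * g n s\<bar>)" by simp
  qed
  also have "\<dots> = integral {0..t} h"
    unfolding h_def by (rule integral_sum[symmetric]) (auto intro!: ic continuous_intros kc' gc)
  finally have 1: "(\<Sum>n<m. \<bar>integral {0..t} (\<lambda>s. k n (t - s) * g n s)\<bar>) \<le> integral {0..t} h" .
  have bi: "(b has_integral (Kc * \<Gamma> * exp (\<kappa> * t) * \<kappa> powr (-1/16)) * (t powr (1/16) / (1/16))) {0..t}"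
    unfolding b_def by (intro has_integral_mult_right has_integral_powr_reflect) (use t in auto)
  have b'i: "(b' has_integral (Kc * \<Gamma> * exp (\<kappa> * t) * \<kappa> powr (-1/16)) * (t powr (1/16) / (1/16))) {0..t}"
    by (rule has_integral_spike_finite[OF _ _ bi, of "{t}"]) (auto simp: b'_def)
  have hb: "h s \<le> b' s" if s: "s \<in> {0..t}" for s
  proof (cases "s = t")
    case False
    define \<tau> where "\<tau> = t - s"
    have \<tau>: "0 < \<tau>" "\<tau> \<le> t" using s False by (auto simp: \<tau>_def)
    have "h s \<le> (\<Sum>n<m. (Kc * mode_weight n * \<tau> powr (-7/8)) * \<bar>g n s\<bar>)"
      unfolding h_def abs_mult \<tau>_def[symmetric] by (intro sum_mono mult_right_mono kb \<tau>) auto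
    also have "\<dots> = Kc * \<tau> powr (-7/8) * (\<Sum>n<m. mode_weight n * \<bar>g n s\<bar>)"
      by (simp add: sum_distrib_left sum_distrib_right mult_ac)
    also have "\<dots> \<le> Kc * \<tau> powr (-7/8) * (\<Gamma> * exp (\<kappa> * s))"
      using Kc by (intro mult_left_mono gb s) auto
    also have "exp (\<kappa> * s) = exp (\<kappa> * t) * exp (- (\<kappa> * \<tau>))"
      by (simp add: \<tau>_def algebra_simps flip: exp_add)
    \<comment> \<open>The exponential left over from moving the weight to time \<open>t\<close> is
      traded for \<open>(\<kappa> * \<tau>) powr (-1/16)\<close>. The total power of \<tau> becomes
      -7/8 - 1/16 = -15/16, still integrable, and \<open>\<kappa> powr (-1/16)\<close> is
      gained.\<close>
    also have "Kc * \<tau> powr (-7/8) * (\<Gamma> * (exp (\<kappa> * t) * exp (- (\<kappa> * \<tau>)))) \<le> Kc * \<tau> powr (-7/8) * (\<Gamma> * (exp (\<kappa> * t) * (\<kappa> * \<tau>) powr (-(1/16))))"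
      using Kc \<Gamma> \<kappa> \<tau> by (intro mult_left_mono exp_neg_le_powr) auto
    also have "\<dots> = (Kc * \<Gamma> * exp (\<kappa> * t) * \<kappa> powr (-1/16)) * (\<tau> powr (-7/8) * \<tau> powr (-1/16))"
      using \<kappa> \<tau> by (simp add: powr_mult)
    also have "\<tau> powr (-7/8) * \<tau> powr (-1/16) = \<tau> powr (1/16 - 1)"
      by (simp flip: powr_add)
    finally show ?thesis using False by (simp add: b'_def b_def \<tau>_def)
  qed (simp add: b'_def)
  have "integral {0..t} h \<le> (Kc * \<Gamma> * exp (\<kappa> * t) * \<kappa> powr (-1/16)) * (t powr (1/16) / (1/16))"
    by (rule has_integral_le[OF integrable_integral[OF ic[OF hc]] b'i hb])
  also have "\<dots> \<le> (Kc * \<Gamma> * exp (\<kappa> * t) * \<kappa> powr (-1/16)) * (T powr (1/16) / (1/16))"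
    using Kc \<Gamma> \<kappa> t by (intro mult_left_mono divide_right_mono powr_mono2) auto
  finally show ?thesis using 1 by (simp add: mult_ac)
qed

lemma eventually_weight_small:
  assumes "e > 0"
  shows "\<forall>\<^sub>F \<kappa> in at_top. C * (16 * T powr (1/16) * \<kappa> powr (-1/16)) < (e::real)"
proof -
  have "((\<lambda>\<kappa>::real. \<kappa> powr (-1/16)) \<longlongrightarrow> 0) at_top"
    by (rule tendsto_neg_powr) (auto intro: filterlim_ident)
  then have "((\<lambda>\<kappa>. C * (16 * T powr (1/16) * \<kappa> powr (-1/16))) \<longlongrightarrow> C * (16 * T powr (1/16) * 0)) at_top"
    by (intro tendsto_intros)
  then show ?thesis using assms by (intro order_tendstoD(2)) auto
qed

text \<open>Cauchy-Schwarz in time: the squared kernel has integral at most one half of the inverse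
  squared frequency, which exactly pays for the factor \<open>freq n\<close>. Summed over the modes,
  the Duhamel term gains one space derivative over a source that is square integrable in space and
  time.\<close>

lemma duhamel_mode_le:
  assumes t: "0 \<le> t" and g: "continuous_on {0..t} g"
  shows "(freq n * integral {0..t} (\<lambda>s. exp (- ((freq n)\<^sup>2 * (t - s))) * g s))\<^sup>2 \<le> 1/2 * integral {0..t} (\<lambda>s. (g s)\<^sup>2)"
proof -
  define l where "l = (freq n)\<^sup>2"
  have l: "l > 0" by (simp add: l_def)
  have "((\<lambda>s. (exp (- (l * (t - s))))\<^sup>2) has_integral (exp (- 2 * l * (t - t)) / (2 * l) - exp (- 2 * l * (t - 0)) / (2 * l))) {0..t}"
    using l t by (intro fundamental_theorem_of_calculus)
      (auto simp: power2_eq_square simp flip: has_real_derivative_iff_has_vector_derivative exp_add intro!: derivative_eq_intros)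
  then have 1: "integral {0..t} (\<lambda>s. (exp (- (l * (t - s))))\<^sup>2) \<le> 1 / (2 * l)"
    using l by (simp add: integral_unique)
  have "(integral {0..t} (\<lambda>s. exp (- (l * (t - s))) * g s))\<^sup>2 \<le> integral {0..t} (\<lambda>s. (exp (- (l * (t - s))))\<^sup>2) * integral {0..t} (\<lambda>s. (g s)\<^sup>2)"
    by (intro integral_Cauchy_Schwarz continuous_intros g)
  also have "\<dots> \<le> 1 / (2 * l) * integral {0..t} (\<lambda>s. (g s)\<^sup>2)"
    by (intro mult_right_mono 1 integral_nonneg integrable_continuous_interval continuous_intros g) auto
  finally have "l * (integral {0..t} (\<lambda>s. exp (- (l * (t - s))) * g s))\<^sup>2 \<le> l * (1 / (2 * l) * integral {0..t} (\<lambda>s. (g s)\<^sup>2))"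
    using l by (intro mult_left_mono) auto
  then show ?thesis using l by (simp add: power_mult_distrib l_def)
qed

lemma continuous_on_duhamel:
  fixes g :: "real \<Rightarrow> real"
  assumes g: "continuous_on {0..T} g"
  shows "continuous_on {0..T} (\<lambda>t. integral {0..t} (\<lambda>s. exp (- (l * (t - s))) * g s))"
proof -
  have "integral {0..t} (\<lambda>s. exp (- (l * (t - s))) * g s) = exp (- l * t) * integral {0..t} (\<lambda>s. exp (l * s) * g s)" for t
  proof -
    have "(\<lambda>s. exp (- (l * (t - s))) * g s) = (\<lambda>s. exp (- l * t) * (exp (l * s) * g s))"
      by (rule ext) (simp add: algebra_simps exp_diff exp_minus divide_inverse)
    then show ?thesis by simp
  qed
  moreover have "continuous_on {0..T} (\<lambda>t. exp (- l * t) * integral {0..t} (\<lambda>s. exp (l * s) * g s))"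
    by (intro continuous_intros indefinite_integral_continuous_1 integrable_continuous_interval g)
  ultimately show ?thesis by simp
qed

section \<open>Globally Lipschitz nonlinearities and their source coefficients\<close>

lemma abs_diff_le_of_deriv_bound:
  fixes f :: "real \<Rightarrow> real"
  assumes "\<And>x. (f has_real_derivative f' x) (at x)" "\<And>x. \<bar>f' x\<bar> \<le> L"
  shows "\<bar>f a - f b\<bar> \<le> L * \<bar>a - b\<bar>"
proof -
  have "norm (f a - f b) \<le> L * norm (a - b)"
    by (rule field_differentiable_bound[of UNIV f f']) (auto intro: has_field_derivative_at_within assms)
  then show ?thesis by simp
qed

text \<open>Tailored to the truncated nonlinearities: truncation makes the derivatives bounded and
  Lipschitz but may destroy second derivatives, so Lipschitz conditions on \<open>f'\<close> and
  \<open>r'\<close> stand in for \<open>C2\<close>. One constant \<open>L\<close> serves all four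
  bounds.\<close>

locale smooth_nonlinearity =
  fixes f f' r r' :: "real \<Rightarrow> real" and L :: real
  assumes f_deriv: "\<And>x. (f has_real_derivative f' x) (at x)"
    and r_deriv: "\<And>x. (r has_real_derivative r' x) (at x)"
    and f'_le: "\<And>x. \<bar>f' x\<bar> \<le> L" and r'_le: "\<And>x. \<bar>r' x\<bar> \<le> L"
    and f'_lip: "\<And>x y. \<bar>f' x - f' y\<bar> \<le> L * \<bar>x - y\<bar>"
    and r'_lip: "\<And>x y. \<bar>r' x - r' y\<bar> \<le> L * \<bar>x - y\<bar>"
begin

lemma L_nonneg: "L \<ge> 0" using f'_le[of 0] by linarith

lemma f_lip: "\<bar>f x - f y\<bar> \<le> L * \<bar>x - y\<bar>"
  by (rule abs_diff_le_of_deriv_bound[OF f_deriv f'_le])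

lemma r_lip: "\<bar>r x - r y\<bar> \<le> L * \<bar>x - y\<bar>"
  by (rule abs_diff_le_of_deriv_bound[OF r_deriv r'_le])

lemma f_cont: "continuous_on S f" and r_cont: "continuous_on S r"
  using f_deriv r_deriv by (meson DERIV_continuous_on has_field_derivative_at_within)+

lemma f'_cont: "continuous_on S f'" and r'_cont: "continuous_on S r'"
proof -
  have "L-lipschitz_on UNIV f'" "L-lipschitz_on UNIV r'"
    using f'_lip r'_lip L_nonneg by (auto intro!: lipschitz_onI simp: dist_real_def)
  then show "continuous_on S f'" "continuous_on S r'"
    using lipschitz_on_continuous_on continuous_on_subset by blast+
qed

lemma continuous_on_f_compose: "continuous_on S h \<Longrightarrow> continuous_on S (\<lambda>x. f (h x))"
  and continuous_on_r_compose: "continuous_on S h \<Longrightarrow> continuous_on S (\<lambda>x. r (h x))"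
  and continuous_on_f'_compose: "continuous_on S h \<Longrightarrow> continuous_on S (\<lambda>x. f' (h x))"
  and continuous_on_r'_compose: "continuous_on S h \<Longrightarrow> continuous_on S (\<lambda>x. r' (h x))"
  using continuous_on_compose2[OF f_cont[of UNIV]] continuous_on_compose2[OF r_cont[of UNIV]]
    continuous_on_compose2[OF f'_cont[of UNIV]] continuous_on_compose2[OF r'_cont[of UNIV]] by auto

lemmas cont_compose = continuous_on_f_compose continuous_on_r_compose continuous_on_f'_compose continuous_on_r'_compose

text \<open>The sine coefficient of \<open>- f(h)\<^sub>x + r(h)\<close>, integrated by parts so that \<open>h\<close> need not be differentiable.\<close>

definition source_coef :: "nat \<Rightarrow> (real \<Rightarrow> real) \<Rightarrow> real" where
  "source_coef n h = freq n * fcos n (\<lambda>x. f (h x)) + fsin n (\<lambda>x. r (h x))"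

definition source_const :: real where "source_const = (pi + 1) * (weight_sum * sqrt 2)"

lemma source_const_nonneg: "source_const \<ge> 0" by (simp add: source_const_def weight_sum_nonneg)

end

text \<open>\<open>freq n * mode_weight n\<close> is of order \<open>(n + 1) powr (-3/4)\<close>, so
  the frequency in front of \<open>fcos n F\<close> is affordable: Bessel bounds the coefficients in
  square sum by the maximum norm, and Cauchy-Schwarz closes the estimate. A maximum norm bound on
  the flux is thus enough to feed \<open>duhamel_sum_le\<close>.\<close>

lemma weighted_source_le:
  fixes F R :: "real \<Rightarrow> real"
  assumes F: "continuous_on {0..1} F" "\<And>x. x \<in> {0..1} \<Longrightarrow> \<bar>F x\<bar> \<le> \<delta>"
    and R: "continuous_on {0..1} R" "\<And>x. x \<in> {0..1} \<Longrightarrow> \<bar>R x\<bar> \<le> \<delta>"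
  shows "(\<Sum>n<m. mode_weight n * \<bar>freq n * fcos n F + fsin n R\<bar>) \<le> (pi + 1) * (weight_sum * sqrt 2) * \<delta>"
proof -
  have \<delta>: "\<delta> \<ge> 0" using F(2)[of 0] by auto
  have sq: "sqrt (\<Sum>n<m. (c n)\<^sup>2) \<le> sqrt 2 * \<delta>" if "(\<Sum>n<m. (c n)\<^sup>2) \<le> 2 * integral {0..1} (\<lambda>x. (h x)\<^sup>2)"
    "continuous_on {0..1} h" "\<And>x. x \<in> {0..1} \<Longrightarrow> \<bar>h x\<bar> \<le> \<delta>" for c and h :: "real \<Rightarrow> real"
  proof -
    have "(\<Sum>n<m. (c n)\<^sup>2) \<le> 2 * \<delta>\<^sup>2" using that(1) integral_unit_square_le[OF that(2,3)] by auto
    then have "sqrt (\<Sum>n<m. (c n)\<^sup>2) \<le> sqrt (2 * \<delta>\<^sup>2)" by (rule real_sqrt_le_mono)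
    then show ?thesis using \<delta> by (simp add: real_sqrt_mult)
  qed
  have "(\<Sum>n<m. mode_weight n * \<bar>freq n * fcos n F + fsin n R\<bar>) \<le> (\<Sum>n<m. pi * (real (Suc n) powr (-3/4) * \<bar>fcos n F\<bar>) + real (Suc n) powr (-3/4) * \<bar>fsin n R\<bar>)"
  proof (intro sum_mono)
    fix n
    have "mode_weight n * \<bar>freq n * fcos n F + fsin n R\<bar> \<le> mode_weight n * (freq n * \<bar>fcos n F\<bar> + \<bar>fsin n R\<bar>)"
      by (intro mult_left_mono order_trans[OF abs_triangle_ineq]) (auto simp: abs_mult)
    also have "\<dots> = (freq n * mode_weight n) * \<bar>fcos n F\<bar> + mode_weight n * \<bar>fsin n R\<bar>" by (simp add: algebra_simps)
    also have "\<dots> \<le> pi * (real (Suc n) powr (-3/4) * \<bar>fcos n F\<bar>) + real (Suc n) powr (-3/4) * \<bar>fsin n R\<bar>"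
      unfolding freq_mode_weight using mult_right_mono[OF mode_weight_le[of n], of "\<bar>fsin n R\<bar>"] by simp
    finally show "mode_weight n * \<bar>freq n * fcos n F + fsin n R\<bar> \<le> pi * (real (Suc n) powr (-3/4) * \<bar>fcos n F\<bar>) + real (Suc n) powr (-3/4) * \<bar>fsin n R\<bar>" .
  qed
  also have "\<dots> = pi * (\<Sum>n<m. real (Suc n) powr (-3/4) * \<bar>fcos n F\<bar>) + (\<Sum>n<m. real (Suc n) powr (-3/4) * \<bar>fsin n R\<bar>)"
    by (simp add: sum.distrib sum_distrib_left)
  also have "\<dots> \<le> pi * (weight_sum * (sqrt 2 * \<delta>)) + weight_sum * (sqrt 2 * \<delta>)"
  proof (intro add_mono mult_left_mono)
    show "(\<Sum>n<m. real (Suc n) powr (-3/4) * \<bar>fcos n F\<bar>) \<le> weight_sum * (sqrt 2 * \<delta>)"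
      by (rule order_trans[OF sum_weighted_le mult_left_mono[OF sq[OF bessel_fcos]]]) (use F weight_sum_nonneg in auto)
    show "(\<Sum>n<m. real (Suc n) powr (-3/4) * \<bar>fsin n R\<bar>) \<le> weight_sum * (sqrt 2 * \<delta>)"
      by (rule order_trans[OF sum_weighted_le mult_left_mono[OF sq[OF bessel_fsin]]]) (use R weight_sum_nonneg in auto)
  qed auto
  also have "\<dots> = (pi + 1) * (weight_sum * sqrt 2) * \<delta>" by (simp add: algebra_simps)
  finally show ?thesis .
qed

context smooth_nonlinearity begin

lemma source_coef_diff:
  assumes "continuous_on {0..1} h" "continuous_on {0..1} k"
  shows "source_coef n h - source_coef n k = freq n * fcos n (\<lambda>x. f (h x) - f (k x)) + fsin n (\<lambda>x. r (h x) - r (k x))"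
  unfolding source_coef_def by (subst fcos_diff fsin_diff; (intro cont_compose assms)?)+ (simp add: algebra_simps)

lemma source_coef_diff_weighted:
  assumes h: "continuous_on {0..1} h" and k: "continuous_on {0..1} k"
    and \<delta>: "\<And>x. x \<in> {0..1} \<Longrightarrow> \<bar>h x - k x\<bar> \<le> \<delta>"
  shows "(\<Sum>n<m. mode_weight n * \<bar>source_coef n h - source_coef n k\<bar>) \<le> source_const * (L * \<delta>)"
  unfolding source_coef_diff[OF h k] source_const_def
proof (rule weighted_source_le)
  fix x :: real assume x: "x \<in> {0..1}"
  have "L * \<bar>h x - k x\<bar> \<le> L * \<delta>" using \<delta>[OF x] L_nonneg by (rule mult_left_mono)
  then show "\<bar>f (h x) - f (k x)\<bar> \<le> L * \<delta>" "\<bar>r (h x) - r (k x)\<bar> \<le> L * \<delta>"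
    using f_lip[of "h x" "k x"] r_lip[of "h x" "k x"] by linarith+
qed (intro continuous_intros cont_compose h k)+

definition energy_const :: real where "energy_const = 2 * L\<^sup>2 + 8 * (r 0)\<^sup>2 + 8 * L\<^sup>2 * weight_sum\<^sup>2"

lemma energy_const_nonneg: "energy_const \<ge> 0" by (simp add: energy_const_def)

text \<open>The flux part is square summable by \<open>fcos_compose_energy\<close>, the reaction
  part by the Sobolev bound on \<open>h\<close> and the linear growth of \<open>r\<close>. The bound
  is affine in \<open>E\<close>, and affine growth is what an exponential weight can absorb on any
  time interval.\<close>

lemma source_coef_energy:
  assumes h: "continuous_on {0..1} h" and E: "\<And>m. (\<Sum>n<m. (freq n * fsin n h)\<^sup>2) \<le> E"
  shows "(\<Sum>n<m. (source_coef n h)\<^sup>2) \<le> energy_const * (1 + E)"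
proof -
  have E0: "E \<ge> 0" using E[of 0] by simp
  have hb: "\<bar>h x\<bar> \<le> weight_sum * sqrt E" if x: "x \<in> {0..1}" for x
  proof -
    note s = summable_abs_of_energy[OF E]
    have "\<bar>h x\<bar> = \<bar>\<Sum>n. fsin n h * sin (freq n * x)\<bar>" using sine_series_expansion[OF h s(1) x] by simp
    also have "\<dots> \<le> (\<Sum>n. \<bar>fsin n h\<bar>)"
    proof -
      have "norm (fsin n h * sin (freq n * x)) \<le> \<bar>fsin n h\<bar>" for n
        using mult_left_mono[OF abs_sin_le_one[of "freq n * x"], of "\<bar>fsin n h\<bar>"] by (simp add: abs_mult)
      from norm_suminf_le[OF this s(1)] show ?thesis by simp
    qed
    also have "\<dots> \<le> weight_sum * sqrt E" by (rule suminf_le_const[OF s(1) s(2)])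
    finally show ?thesis .
  qed
  have rb: "\<bar>r (h x)\<bar> \<le> \<bar>r 0\<bar> + L * (weight_sum * sqrt E)" if x: "x \<in> {0..1}" for x
    using r_lip[of "h x" 0] mult_left_mono[OF hb[OF x] L_nonneg] by simp
  have "(\<Sum>n<m. (source_coef n h)\<^sup>2) \<le> (\<Sum>n<m. 2 * (freq n * fcos n (\<lambda>x. f (h x)))\<^sup>2 + 2 * (fsin n (\<lambda>x. r (h x)))\<^sup>2)"
  proof (intro sum_mono)
    fix n
    show "(source_coef n h)\<^sup>2 \<le> 2 * (freq n * fcos n (\<lambda>x. f (h x)))\<^sup>2 + 2 * (fsin n (\<lambda>x. r (h x)))\<^sup>2"
      unfolding source_coef_def power2_sum
      using sum_squares_bound[of "freq n * fcos n (\<lambda>x. f (h x))" "fsin n (\<lambda>x. r (h x))"] by linarith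
  qed
  also have "\<dots> = 2 * (\<Sum>n<m. (freq n * fcos n (\<lambda>x. f (h x)))\<^sup>2) + 2 * (\<Sum>n<m. (fsin n (\<lambda>x. r (h x)))\<^sup>2)"
    by (simp add: sum.distrib sum_distrib_left)
  also have "\<dots> \<le> 2 * (L\<^sup>2 * E) + 2 * (2 * (\<bar>r 0\<bar> + L * (weight_sum * sqrt E))\<^sup>2)"
  proof (intro add_mono mult_left_mono)
    show "(\<Sum>n<m. (freq n * fcos n (\<lambda>x. f (h x)))\<^sup>2) \<le> L\<^sup>2 * E"
      by (rule fcos_compose_energy[OF h E f_deriv f'_cont f'_le])
    have "(\<Sum>n<m. (fsin n (\<lambda>x. r (h x)))\<^sup>2) \<le> 2 * integral {0..1} (\<lambda>x. (r (h x))\<^sup>2)"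
      by (rule bessel_fsin[OF continuous_on_r_compose[OF h]])
    also have "\<dots> \<le> 2 * (\<bar>r 0\<bar> + L * (weight_sum * sqrt E))\<^sup>2"
      by (intro mult_left_mono integral_unit_square_le rb continuous_on_r_compose h) auto
    finally show "(\<Sum>n<m. (fsin n (\<lambda>x. r (h x)))\<^sup>2) \<le> 2 * (\<bar>r 0\<bar> + L * (weight_sum * sqrt E))\<^sup>2" .
  qed auto
  also have "(\<bar>r 0\<bar> + L * (weight_sum * sqrt E))\<^sup>2 \<le> 2 * (r 0)\<^sup>2 + 2 * (L\<^sup>2 * weight_sum\<^sup>2 * E)"
  proof -
    have "(\<bar>r 0\<bar> + L * (weight_sum * sqrt E))\<^sup>2 \<le> 2 * \<bar>r 0\<bar>\<^sup>2 + 2 * (L * (weight_sum * sqrt E))\<^sup>2"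
      using sum_squares_bound[of "\<bar>r 0\<bar>" "L * (weight_sum * sqrt E)"] by (simp add: power2_sum)
    then show ?thesis using E0 by (simp add: power_mult_distrib mult_ac)
  qed
  also have "2 * (L\<^sup>2 * E) + 2 * (2 * (2 * (r 0)\<^sup>2 + 2 * (L\<^sup>2 * weight_sum\<^sup>2 * E))) \<le> energy_const * (1 + E)"
    using E0 by (simp add: energy_const_def algebra_simps)
  finally show ?thesis by simp
qed

section \<open>The fixed point iteration for the mild formulation\<close>

definition jointly_cont :: "real \<Rightarrow> (real \<Rightarrow> real \<Rightarrow> real) \<Rightarrow> bool" where
  "jointly_cont T Y \<longleftrightarrow> continuous_on ({0..T} \<times> {0..1}) (\<lambda>p. Y (fst p) (snd p))"

lemma jointly_cont_slice: "jointly_cont T Y \<Longrightarrow> t \<in> {0..T} \<Longrightarrow> continuous_on {0..1} (Y t)"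
  unfolding jointly_cont_def by (drule continuous_on_compose2[of _ _ "{0..1}" "\<lambda>x. (t, x)"]) (auto intro!: continuous_intros)

end

lemma continuous_on_fourier_param:
  fixes F :: "real \<Rightarrow> real \<Rightarrow> real"
  assumes "continuous_on (S \<times> {0..1}) (\<lambda>p. F (fst p) (snd p))"
  shows "continuous_on S (\<lambda>s. fsin n (F s))" "continuous_on S (\<lambda>s. fcos n (F s))"
proof -
  have c: "continuous_on (S \<times> {0..1}) (\<lambda>p. g (freq n * snd p))" if "continuous_on UNIV g" for g :: "real \<Rightarrow> real"
    by (rule continuous_on_compose2[OF that]) (auto intro!: continuous_intros)
  have "continuous_on S (\<lambda>s. integral (cbox 0 1) (\<lambda>x. F s x * sin (freq n * x)))"
    "continuous_on S (\<lambda>s. integral (cbox 0 1) (\<lambda>x. F s x * cos (freq n * x)))"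
    by (rule integral_continuous_on_param; simp add: case_prod_beta';
      intro continuous_on_mult assms c continuous_intros)+
  then show "continuous_on S (\<lambda>s. fsin n (F s))" "continuous_on S (\<lambda>s. fcos n (F s))"
    unfolding fsin_def fcos_def by (auto intro!: continuous_intros)
qed

context smooth_nonlinearity begin

lemma continuous_on_source_coef:
  assumes "jointly_cont T Y"
  shows "continuous_on {0..T} (\<lambda>s. source_coef n (Y s))"
  unfolding source_coef_def using assms[unfolded jointly_cont_def]
  by (intro continuous_intros continuous_on_fourier_param cont_compose)

text \<open>Variation of constants for one mode, in which the equation is a linear ordinary
  differential equation with decay rate the squared frequency and inhomogeneity
  \<open>source_coef n (Y t)\<close>.\<close>

definition mild_coef :: "(real \<Rightarrow> real) \<Rightarrow> (real \<Rightarrow> real \<Rightarrow> real) \<Rightarrow> nat \<Rightarrow> real \<Rightarrow> real" where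
  "mild_coef u Y n t = exp (- ((freq n)\<^sup>2 * t)) * fsin n u +
     integral {0..t} (\<lambda>s. exp (- ((freq n)\<^sup>2 * (t - s))) * source_coef n (Y s))"

lemma continuous_on_mild_coef:
  assumes "jointly_cont T Y" shows "continuous_on {0..T} (mild_coef u Y n)"
  unfolding mild_coef_def by (intro continuous_intros continuous_on_duhamel continuous_on_source_coef[OF assms])

lemma jointly_cont_subset: "jointly_cont T Y \<Longrightarrow> t \<le> T \<Longrightarrow> jointly_cont t Y"
  unfolding jointly_cont_def by (erule continuous_on_subset) auto

lemma mild_coef_square_le:
  assumes Y: "jointly_cont T Y" and t: "t \<in> {0..T}"
  shows "(freq n * mild_coef u Y n t)\<^sup>2 \<le> 2 * (freq n * fsin n u)\<^sup>2 + integral {0..t} (\<lambda>s. (source_coef n (Y s))\<^sup>2)"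
proof -
  define A where "A = freq n * (exp (- ((freq n)\<^sup>2 * t)) * fsin n u)"
  define B where "B = freq n * integral {0..t} (\<lambda>s. exp (- ((freq n)\<^sup>2 * (t - s))) * source_coef n (Y s))"
  have sc: "continuous_on {0..t} (\<lambda>s. source_coef n (Y s))"
    by (rule continuous_on_subset[OF continuous_on_source_coef[OF Y]]) (use t in auto)
  have "(freq n * mild_coef u Y n t)\<^sup>2 = (A + B)\<^sup>2" by (simp add: A_def B_def mild_coef_def algebra_simps)
  also have "\<dots> \<le> 2 * A\<^sup>2 + 2 * B\<^sup>2" using sum_squares_bound[of A B] by (simp add: power2_sum)
  also have "A\<^sup>2 \<le> (freq n * fsin n u)\<^sup>2"
  proof -
    have "exp (- ((freq n)\<^sup>2 * t)) \<le> 1" using t by simp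
    then have "\<bar>A\<bar> \<le> \<bar>freq n * fsin n u\<bar>"
      by (simp add: A_def abs_mult mult_left_le_one_le)
    then show ?thesis by (simp add: abs_le_square_iff)
  qed
  also have "B\<^sup>2 \<le> 1/2 * integral {0..t} (\<lambda>s. (source_coef n (Y s))\<^sup>2)"
    unfolding B_def using t by (intro duhamel_mode_le sc) auto
  finally show ?thesis by simp
qed

text \<open>The invariant set of the iteration. Energy is prescribed through finite partial sums,
  each of which is continuous under uniform convergence; so the set is closed in the maximum norm,
  the norm in which the map contracts.\<close>

definition admissible :: "real \<Rightarrow> real \<Rightarrow> real \<Rightarrow> (real \<Rightarrow> real \<Rightarrow> real) \<Rightarrow> bool" where
  "admissible T K \<kappa> Y \<longleftrightarrow> jointly_cont T Y \<and> (\<forall>t\<in>{0..T}. \<forall>m. (\<Sum>n<m. (freq n * fsin n (Y t))\<^sup>2) \<le> K * exp (\<kappa> * t))"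

lemma source_coef_square_integral_le:
  assumes Y: "admissible T K \<kappa> Y" and t: "t \<in> {0..T}" and \<kappa>: "\<kappa> > 0" and K: "K \<ge> 0"
  shows "(\<Sum>n<m. integral {0..t} (\<lambda>s. (source_coef n (Y s))\<^sup>2)) \<le> energy_const * (1 + K) * exp (\<kappa> * t) / \<kappa>"
proof -
  note ic = integrable_continuous_interval
  have Yc: "jointly_cont T Y" using Y by (simp add: admissible_def)
  have sc: "continuous_on {0..t} (\<lambda>s. source_coef n (Y s))" for n
    by (rule continuous_on_subset[OF continuous_on_source_coef[OF Yc]]) (use t in auto)
  have "(\<Sum>n<m. integral {0..t} (\<lambda>s. (source_coef n (Y s))\<^sup>2)) = integral {0..t} (\<lambda>s. \<Sum>n<m. (source_coef n (Y s))\<^sup>2)"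
    by (rule integral_sum[symmetric]) (auto intro!: ic continuous_intros sc)
  also have "\<dots> \<le> integral {0..t} (\<lambda>s. energy_const * (1 + K) * exp (\<kappa> * s))"
  proof (rule integral_le)
    fix s assume s: "s \<in> {0..t}"
    have "(\<Sum>n<m. (source_coef n (Y s))\<^sup>2) \<le> energy_const * (1 + K * exp (\<kappa> * s))"
      by (rule source_coef_energy) (use s t Y jointly_cont_slice[OF Yc, of s] in \<open>auto simp: admissible_def\<close>)
    also have "\<dots> \<le> energy_const * (1 * exp (\<kappa> * s) + K * exp (\<kappa> * s))"
      using s \<kappa> energy_const_nonneg by (intro mult_left_mono add_right_mono) auto
    finally show "(\<Sum>n<m. (source_coef n (Y s))\<^sup>2) \<le> energy_const * (1 + K) * exp (\<kappa> * s)" by (simp add: algebra_simps)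
  qed (intro ic continuous_intros sc)+
  also have "\<dots> = energy_const * (1 + K) * ((exp (\<kappa> * t) - 1) / \<kappa>)"
  proof -
    have "((\<lambda>s. exp (\<kappa> * s)) has_integral (exp (\<kappa> * t) / \<kappa> - exp (\<kappa> * 0) / \<kappa>)) {0..t}"
      using \<kappa> t by (intro fundamental_theorem_of_calculus)
        (auto simp flip: has_real_derivative_iff_has_vector_derivative intro!: derivative_eq_intros)
    then show ?thesis using \<kappa> by (simp add: integral_unique diff_divide_distrib)
  qed
  also have "\<dots> \<le> energy_const * (1 + K) * (exp (\<kappa> * t) / \<kappa>)"
    using \<kappa> K energy_const_nonneg by (intro mult_left_mono divide_right_mono) auto
  finally show ?thesis by simp
qed

lemma mild_coef_energy:
  assumes Y: "admissible T K \<kappa> Y" and t: "t \<in> {0..T}" and u: "\<And>m. (\<Sum>n<m. (freq n * fsin n u)\<^sup>2) \<le> E0"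
    and K: "K = 4 * E0 + 1" and \<kappa>: "\<kappa> > 0" "\<kappa> \<ge> 4 * energy_const"
  shows "(\<Sum>n<m. (freq n * mild_coef u Y n t)\<^sup>2) \<le> K * exp (\<kappa> * t)"
proof -
  have Yc: "jointly_cont T Y" using Y by (simp add: admissible_def)
  have E0: "E0 \<ge> 0" using u[of 0] by simp
  have e1: "exp (\<kappa> * t) \<ge> 1" using \<kappa> t by simp
  have "(\<Sum>n<m. (freq n * mild_coef u Y n t)\<^sup>2) \<le> (\<Sum>n<m. 2 * (freq n * fsin n u)\<^sup>2 + integral {0..t} (\<lambda>s. (source_coef n (Y s))\<^sup>2))"
    by (intro sum_mono mild_coef_square_le[OF Yc t])
  also have "\<dots> = 2 * (\<Sum>n<m. (freq n * fsin n u)\<^sup>2) + (\<Sum>n<m. integral {0..t} (\<lambda>s. (source_coef n (Y s))\<^sup>2))"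
    by (simp add: sum.distrib sum_distrib_left)
  also have "\<dots> \<le> 2 * E0 + energy_const * (1 + K) * exp (\<kappa> * t) / \<kappa>"
    using K E0 by (intro add_mono mult_left_mono u source_coef_square_integral_le[OF Y t \<kappa>(1)]) auto
  also have "2 * E0 \<le> 2 * E0 * exp (\<kappa> * t)" using mult_left_mono[OF e1, of "2 * E0"] E0 by simp
  also have "energy_const * (1 + K) * exp (\<kappa> * t) / \<kappa> \<le> (1 + K) / 4 * exp (\<kappa> * t)"
    using \<kappa> K E0 mult_right_mono[OF \<kappa>(2), of "(1 + K) * exp (\<kappa> * t)"] by (simp add: divide_simps mult_ac)
  finally have "(\<Sum>n<m. (freq n * mild_coef u Y n t)\<^sup>2) \<le> (2 * E0 + (1 + K) / 4) * exp (\<kappa> * t)" by (simp add: algebra_simps)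
  \<comment> \<open>With \<open>K = 4 * E0 + 1\<close> the factor on the left is
    \<open>3 * E0 + 1/2\<close>.\<close>
  also have "\<dots> \<le> K * exp (\<kappa> * t)" using K E0 by (intro mult_right_mono) auto
  finally show ?thesis .
qed

definition mild_map :: "(real \<Rightarrow> real) \<Rightarrow> (real \<Rightarrow> real \<Rightarrow> real) \<Rightarrow> real \<Rightarrow> real \<Rightarrow> real" where
  "mild_map u Y t x = (\<Sum>n. mild_coef u Y n t * sin (freq n * x))"

text \<open>The majorant is made independent of \<open>t\<close> by enlarging the energy integral of
  the source from \<open>{0..t}\<close> to \<open>{0..T}\<close>. Its square summability with the
  factor \<open>freq n\<close> later yields continuity in time with values in \<open>V\<close>, down
  to time zero.\<close>

lemma mild_coef_majorant:
  assumes Y: "admissible T K \<kappa> Y" and u: "\<And>m. (\<Sum>n<m. (freq n * fsin n u)\<^sup>2) \<le> E0"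
    and K: "K \<ge> 0" and \<kappa>: "\<kappa> > 0" and T: "T \<ge> 0"
  obtains M where "summable (\<lambda>n. (freq n * M n)\<^sup>2)" "summable M" "\<And>n t. t \<in> {0..T} \<Longrightarrow> \<bar>mild_coef u Y n t\<bar> \<le> M n"
proof -
  have Yc: "jointly_cont T Y" using Y by (simp add: admissible_def)
  define Q where "Q n = 2 * (freq n * fsin n u)\<^sup>2 + integral {0..T} (\<lambda>s. (source_coef n (Y s))\<^sup>2)" for n
  define M where "M n = sqrt (Q n) / freq n" for n
  have sc: "(\<lambda>s. (source_coef n (Y s))\<^sup>2) integrable_on {0..T}" for n
    by (intro integrable_continuous_interval continuous_intros continuous_on_source_coef[OF Yc])
  have Q0: "Q n \<ge> 0" for n unfolding Q_def by (intro add_nonneg_nonneg integral_nonneg sc) auto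
  have fM: "(freq n * M n)\<^sup>2 = Q n" for n by (simp add: M_def Q0)
  have "(\<Sum>n<m. (freq n * M n)\<^sup>2) \<le> 2 * E0 + energy_const * (1 + K) * exp (\<kappa> * T) / \<kappa>" for m
  proof -
    have "(\<Sum>n<m. (freq n * M n)\<^sup>2) = 2 * (\<Sum>n<m. (freq n * fsin n u)\<^sup>2) + (\<Sum>n<m. integral {0..T} (\<lambda>s. (source_coef n (Y s))\<^sup>2))"
      by (simp add: fM Q_def sum.distrib sum_distrib_left)
    also have "\<dots> \<le> 2 * E0 + energy_const * (1 + K) * exp (\<kappa> * T) / \<kappa>"
      using T by (intro add_mono mult_left_mono u source_coef_square_integral_le[OF Y _ \<kappa> K]) auto
    finally show ?thesis .
  qed
  note E = this
  show ?thesis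
  proof
    show "summable (\<lambda>n. (freq n * M n)\<^sup>2)"
      by (rule bounded_imp_summable[of _ "2 * E0 + energy_const * (1 + K) * exp (\<kappa> * T) / \<kappa>"]) (use E[of "Suc n" for n] in \<open>simp_all add: lessThan_Suc_atMost\<close>)
    show "summable M" using summable_abs_of_energy(1)[OF E] by (rule summable_rabs_cancel)
    fix n t assume t: "t \<in> {0..T}"
    have "(freq n * mild_coef u Y n t)\<^sup>2 \<le> Q n"
    proof -
      have "integral {0..t} (\<lambda>s. (source_coef n (Y s))\<^sup>2) \<le> integral {0..T} (\<lambda>s. (source_coef n (Y s))\<^sup>2)"
        by (rule integral_subset_le) (use t sc integrable_on_subinterval[OF sc[of n], of 0 t] in auto)
      then show ?thesis using mild_coef_square_le[OF Yc t, of n u] unfolding Q_def by linarith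
    qed
    then have "\<bar>freq n * mild_coef u Y n t\<bar> \<le> sqrt (Q n)" by (rule real_le_rsqrt[of "\<bar>freq n * mild_coef u Y n t\<bar>", simplified])
    then show "\<bar>mild_coef u Y n t\<bar> \<le> M n" using freq_pos[of n] by (simp add: M_def abs_mult field_simps)
  qed
qed

lemma mild_map_props:
  assumes Y: "admissible T K \<kappa> Y" and u: "\<And>m. (\<Sum>n<m. (freq n * fsin n u)\<^sup>2) \<le> E0"
    and K: "K = 4 * E0 + 1" and \<kappa>: "\<kappa> > 0" "\<kappa> \<ge> 4 * energy_const" and T: "T \<ge> 0"
  shows "admissible T K \<kappa> (mild_map u Y)" and "\<And>t n. t \<in> {0..T} \<Longrightarrow> fsin n (mild_map u Y t) = mild_coef u Y n t"
    and "\<And>t. t \<in> {0..T} \<Longrightarrow> summable (\<lambda>n. \<bar>mild_coef u Y n t\<bar>)"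
proof -
  have Yc: "jointly_cont T Y" using Y by (simp add: admissible_def)
  have E0: "E0 \<ge> 0" using u[of 0] by simp
  obtain M where M: "summable M" "\<And>n t. t \<in> {0..T} \<Longrightarrow> \<bar>mild_coef u Y n t\<bar> \<le> M n"
    using mild_coef_majorant[OF Y u _ \<kappa>(1) T] K E0 by (metis add_nonneg_nonneg mult_nonneg_nonneg zero_le_numeral zero_le_one)
  show s: "summable (\<lambda>n. \<bar>mild_coef u Y n t\<bar>)" if "t \<in> {0..T}" for t
    by (rule summable_comparison_test[OF _ M(1)]) (use M(2)[OF that] in auto)
  show fs: "fsin n (mild_map u Y t) = mild_coef u Y n t" if "t \<in> {0..T}" for t n
    unfolding mild_map_def by (rule fsin_sine_series(2)[OF s[OF that]])
  have "continuous_on ({0..T} \<times> UNIV) (\<lambda>(t,x). mild_map u Y t x)"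
    unfolding mild_map_def by (rule continuous_on_sine_series[OF M]) (auto intro: continuous_on_mild_coef[OF Yc])
  then have "jointly_cont T (mild_map u Y)" unfolding jointly_cont_def case_prod_beta' by (rule continuous_on_subset) auto
  then show "admissible T K \<kappa> (mild_map u Y)" unfolding admissible_def using mild_coef_energy[OF Y _ u K \<kappa>] fs by simp
qed

text \<open>The datum cancels in the difference, and \<open>duhamel_sum_le\<close> bounds the
  absolute sum of the remaining coefficients, hence the maximum norm. The factor 1/2 is bought with
  a large \<kappa>, for any \<open>T\<close>.\<close>

lemma mild_map_contraction:
  assumes Y: "admissible T K \<kappa> Y" and Z: "admissible T K \<kappa> Z" and u: "\<And>m. (\<Sum>n<m. (freq n * fsin n u)\<^sup>2) \<le> E0"
    and K: "K = 4 * E0 + 1" and \<kappa>: "\<kappa> > 0" "\<kappa> \<ge> 4 * energy_const" and T: "T \<ge> 0"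
    and small: "source_const * L * (16 * T powr (1/16) * \<kappa> powr (-1/16)) \<le> 1/2"
    and \<delta>: "\<delta> \<ge> 0" "\<And>t x. t \<in> {0..T} \<Longrightarrow> x \<in> {0..1} \<Longrightarrow> \<bar>Y t x - Z t x\<bar> \<le> \<delta> * exp (\<kappa> * t)"
    and t: "t \<in> {0..T}" and x: "x \<in> {0..1}"
  shows "\<bar>mild_map u Y t x - mild_map u Z t x\<bar> \<le> \<delta> / 2 * exp (\<kappa> * t)"
proof -
  have Yc: "jointly_cont T Y" and Zc: "jointly_cont T Z" using Y Z by (auto simp: admissible_def)
  have s: "continuous_on {0..t} (\<lambda>s. source_coef n (Y s))" "continuous_on {0..t} (\<lambda>s. source_coef n (Z s))" for n
    by (rule continuous_on_subset[OF continuous_on_source_coef[OF Yc]], use t in force)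
      (rule continuous_on_subset[OF continuous_on_source_coef[OF Zc]], use t in force)
  define g where "g n s = source_coef n (Y s) - source_coef n (Z s)" for n s
  have d: "mild_coef u Y n t - mild_coef u Z n t = integral {0..t} (\<lambda>s. exp (- (1 * (freq n)\<^sup>2 * (t - s))) * g n s)" for n
    unfolding mild_coef_def g_def right_diff_distrib
    by (subst integral_diff) (auto intro!: integrable_continuous_interval continuous_intros s)
  have sum: "(\<Sum>n<m. \<bar>mild_coef u Y n t - mild_coef u Z n t\<bar>) \<le> \<delta> / 2 * exp (\<kappa> * t)" for m
  proof -
    have "(\<Sum>n<m. \<bar>mild_coef u Y n t - mild_coef u Z n t\<bar>) \<le> 1 * (source_const * L * \<delta>) * exp (\<kappa> * t) * (16 * T powr (1/16) * \<kappa> powr (-1/16))"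
      unfolding d
    proof (rule duhamel_sum_le)
      show "\<bar>exp (- (1 * (freq n)\<^sup>2 * \<tau>))\<bar> \<le> 1 * mode_weight n * \<tau> powr (-7/8)" if "0 < \<tau>" for n \<tau>
        using exp_freq_le[OF that, of 1 n] by simp
      fix m s assume s: "s \<in> {0..t}"
      have "(\<Sum>n<m. mode_weight n * \<bar>g n s\<bar>) \<le> source_const * (L * (\<delta> * exp (\<kappa> * s)))"
        unfolding g_def by (rule source_coef_diff_weighted) (use s t \<delta>(2) jointly_cont_slice[OF Yc] jointly_cont_slice[OF Zc] in auto)
      then show "(\<Sum>n<m. mode_weight n * \<bar>g n s\<bar>) \<le> source_const * L * \<delta> * exp (\<kappa> * s)" by (simp add: mult_ac)
    qed (use t \<kappa> \<delta> source_const_nonneg L_nonneg in \<open>auto intro!: continuous_intros s simp: g_def\<close>)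
    also have "\<dots> = (source_const * L * (16 * T powr (1/16) * \<kappa> powr (-1/16))) * (\<delta> * exp (\<kappa> * t))" by simp
    also have "\<dots> \<le> 1/2 * (\<delta> * exp (\<kappa> * t))" using small \<delta>(1) by (intro mult_right_mono) auto
    finally show ?thesis by simp
  qed
  note pY = mild_map_props(3)[OF Y u K \<kappa> T t] and pZ = mild_map_props(3)[OF Z u K \<kappa> T t]
  have b: "\<bar>a * sin (freq n * x)\<bar> \<le> \<bar>a\<bar>" for a n
    using mult_left_mono[OF abs_sin_le_one[of "freq n * x"], of "\<bar>a\<bar>"] by (simp add: abs_mult)
  have smY: "summable (\<lambda>n. mild_coef u Y n t * sin (freq n * x))" and smZ: "summable (\<lambda>n. mild_coef u Z n t * sin (freq n * x))"
    by (rule summable_comparison_test[OF _ pY], use b in auto) (rule summable_comparison_test[OF _ pZ], use b in auto)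
  have sd: "summable (\<lambda>n. \<bar>mild_coef u Y n t - mild_coef u Z n t\<bar>)"
    by (rule bounded_imp_summable[of _ "\<delta> / 2 * exp (\<kappa> * t)"]) (use sum[of "Suc n" for n] in \<open>simp_all add: lessThan_Suc_atMost\<close>)
  have "mild_map u Y t x - mild_map u Z t x = (\<Sum>n. (mild_coef u Y n t - mild_coef u Z n t) * sin (freq n * x))"
    unfolding mild_map_def by (subst suminf_diff[OF smY smZ]) (simp add: algebra_simps)
  then have "\<bar>mild_map u Y t x - mild_map u Z t x\<bar> \<le> (\<Sum>n. \<bar>mild_coef u Y n t - mild_coef u Z n t\<bar>)"
    using norm_suminf_le[OF _ sd, of "\<lambda>n. (mild_coef u Y n t - mild_coef u Z n t) * sin (freq n * x)"] b by simp
  also have "\<dots> \<le> \<delta> / 2 * exp (\<kappa> * t)" by (rule suminf_le_const[OF sd sum])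
  finally show ?thesis .
qed

lemma mild_map_zero_bound:
  assumes "admissible T K \<kappa> Y" "t \<in> {0..T}" "x \<in> {0..1}"
  shows "\<bar>Y t x\<bar> \<le> weight_sum * sqrt (K * exp (\<kappa> * t))"
proof -
  have E: "(\<Sum>n<m. (freq n * fsin n (Y t))\<^sup>2) \<le> K * exp (\<kappa> * t)" for m
    using assms by (auto simp: admissible_def)
  note s = summable_abs_of_energy[OF E]
  have c: "continuous_on {0..1} (Y t)" using assms jointly_cont_slice by (auto simp: admissible_def)
  have b: "\<bar>a * sin (freq n * x)\<bar> \<le> \<bar>a\<bar>" for a n
    using mult_left_mono[OF abs_sin_le_one[of "freq n * x"], of "\<bar>a\<bar>"] by (simp add: abs_mult)
  have "\<bar>Y t x\<bar> = \<bar>\<Sum>n. fsin n (Y t) * sin (freq n * x)\<bar>" using sine_series_expansion[OF c s(1) assms(3)] by simp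
  also have "\<dots> \<le> (\<Sum>n. \<bar>fsin n (Y t)\<bar>)"
    using norm_suminf_le[OF _ s(1), of "\<lambda>n. fsin n (Y t) * sin (freq n * x)"] b by simp
  also have "\<dots> \<le> weight_sum * sqrt (K * exp (\<kappa> * t))" by (rule suminf_le_const[OF s])
  finally show ?thesis .
qed

text \<open>Picard iteration from zero, converging geometrically in the weighted maximum norm.
  \<kappa> is chosen before \<open>u\<close>, so every constant derived later from the solution is
  uniform over a ball of data.\<close>

theorem mild_solution_exists:
  assumes T: "T \<ge> 0" and E0: "E0 \<ge> 0"
  obtains \<kappa> where "\<kappa> > 0" "\<And>u. (\<And>m. (\<Sum>n<m. (freq n * fsin n u)\<^sup>2) \<le> E0) \<Longrightarrow>
     \<exists>Y. admissible T (4 * E0 + 1) \<kappa> Y \<and> (\<forall>t\<in>{0..T}. \<forall>n. fsin n (Y t) = mild_coef u Y n t)"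
proof -
  define K where "K = 4 * E0 + 1"
  have K1: "K \<ge> 0" using E0 by (simp add: K_def)
  have "\<forall>\<^sub>F \<kappa> in at_top. source_const * L * (16 * T powr (1/16) * \<kappa> powr (-1/16)) < 1/2 \<and> \<kappa> \<ge> 4 * energy_const \<and> \<kappa> > (0::real)"
    by (intro eventually_conj eventually_weight_small eventually_ge_at_top eventually_gt_at_top) simp
  then obtain \<kappa> where \<kappa>: "source_const * L * (16 * T powr (1/16) * \<kappa> powr (-1/16)) \<le> 1/2" "\<kappa> \<ge> 4 * energy_const" "\<kappa> > (0::real)"
    using eventually_happens'[OF trivial_limit_at_top_linorder] by (metis (no_types, lifting) less_imp_le)
  show ?thesis
  proof (rule that[OF \<kappa>(3)])
    fix u :: "real \<Rightarrow> real" assume u: "\<And>m. (\<Sum>n<m. (freq n * fsin n u)\<^sup>2) \<le> E0"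
    define y where "y k = (mild_map u ^^ k) (\<lambda>t x. 0)" for k
    have ySuc: "y (Suc k) = mild_map u (y k)" and y0: "y 0 = (\<lambda>t x. 0)" for k by (simp_all add: y_def)
    have adm0: "admissible T K \<kappa> (y 0)"
      using K1 by (auto simp: y0 admissible_def jointly_cont_def fsin_def)
    have admissible: "admissible T K \<kappa> (y k)" for k
      by (induction k) (auto simp: ySuc intro: adm0 mild_map_props(1)[OF _ u K_def \<kappa>(3,2) T])
    define d where "d = weight_sum * sqrt (K * exp (\<kappa> * T))"
    have d0: "d \<ge> 0" using K1 by (auto simp: d_def weight_sum_nonneg intro!: mult_nonneg_nonneg)
    have step: "\<bar>y (Suc k) t x - y k t x\<bar> \<le> d / 2 ^ k * exp (\<kappa> * t)" if "t \<in> {0..T}" "x \<in> {0..1}" for k t x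
      using that
    proof (induction k arbitrary: t x)
      case 0
      have "\<bar>y (Suc 0) t x - y 0 t x\<bar> \<le> weight_sum * sqrt (K * exp (\<kappa> * t))" using mild_map_zero_bound[OF admissible[of "Suc 0"] 0] by (simp add: y0)
      also have "\<dots> \<le> d" unfolding d_def using 0 K1 \<kappa>(3) by (intro mult_left_mono real_sqrt_le_mono weight_sum_nonneg) auto
      also have "\<dots> \<le> d * exp (\<kappa> * t)" using d0 0 \<kappa>(3) by (simp add: mult_le_cancel_left1)
      finally show ?case by simp
    next
      case (Suc k)
      have "\<bar>mild_map u (y (Suc k)) t x - mild_map u (y k) t x\<bar> \<le> d / 2 ^ k / 2 * exp (\<kappa> * t)"
        by (rule mild_map_contraction[OF admissible admissible u K_def \<kappa>(3,2) T \<kappa>(1) _ _ Suc.prems]) (use d0 Suc.IH in auto)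
      then show ?case by (simp add: ySuc mult.commute)
    qed
    define Y where "Y t x = (\<Sum>k. y (Suc k) t x - y k t x)" for t x
    have ul: "uniform_limit ({0..T} \<times> {0..1}) (\<lambda>k p. y k (fst p) (snd p)) (\<lambda>p. Y (fst p) (snd p)) sequentially"
    proof -
      have "uniform_limit ({0..T} \<times> {0..1}) (\<lambda>m p. \<Sum>k<m. y (Suc k) (fst p) (snd p) - y k (fst p) (snd p))
         (\<lambda>p. \<Sum>k. y (Suc k) (fst p) (snd p) - y k (fst p) (snd p)) sequentially"
      proof (rule Weierstrass_m_test)
        fix k p assume p: "p \<in> {0..T} \<times> {0..1::real}"
        have "\<bar>y (Suc k) (fst p) (snd p) - y k (fst p) (snd p)\<bar> \<le> d / 2 ^ k * exp (\<kappa> * fst p)" using step p by auto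
        also have "\<dots> \<le> d / 2 ^ k * exp (\<kappa> * T)" using p \<kappa>(3) d0 by (intro mult_left_mono) auto
        finally show "norm (y (Suc k) (fst p) (snd p) - y k (fst p) (snd p)) \<le> (d * exp (\<kappa> * T)) * (1/2) ^ k"
          by (simp add: power_divide mult_ac)
      next
        show "summable (\<lambda>k. (d * exp (\<kappa> * T)) * (1/2) ^ k)" by (intro summable_mult summable_geometric) simp
      qed
      moreover have "(\<Sum>k<m. y (Suc k) t x - y k t x) = y m t x" for m t x
        using sum_lessThan_telescope[of "\<lambda>k. y k t x" m] by (simp add: y0)
      ultimately show ?thesis by (simp add: Y_def)
    qed
    have cy: "jointly_cont T (y k)" for k using admissible by (simp add: admissible_def)
    have cY: "jointly_cont T Y" unfolding jointly_cont_def
      by (rule uniform_limit_theorem[OF _ ul]) (use cy in \<open>auto simp: jointly_cont_def\<close>)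
    have fl: "(\<lambda>k. fsin n (y k t)) \<longlonglongrightarrow> fsin n (Y t)" if t: "t \<in> {0..T}" for n t
    proof (rule tendsto_fsin)
      show "uniform_limit {0..1} (\<lambda>k. y k t) (Y t) sequentially"
        using uniform_limit_compose'[OF ul, of "\<lambda>x. (t, x)" "{0..1}"] t by auto
    qed (use jointly_cont_slice[OF cy t] jointly_cont_slice[OF cY t] in auto)
    have admY: "admissible T K \<kappa> Y" unfolding admissible_def
    proof (intro conjI cY ballI allI)
      fix t m assume t: "t \<in> {0..T}"
      have "(\<lambda>k. \<Sum>n<m. (freq n * fsin n (y k t))\<^sup>2) \<longlonglongrightarrow> (\<Sum>n<m. (freq n * fsin n (Y t))\<^sup>2)"
        by (intro tendsto_intros fl t)
      then show "(\<Sum>n<m. (freq n * fsin n (Y t))\<^sup>2) \<le> K * exp (\<kappa> * t)"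
        by (rule LIMSEQ_le_const2) (use admissible t in \<open>auto simp: admissible_def\<close>)
    qed
    have fix_pt: "Y t x = mild_map u Y t x" if t: "t \<in> {0..T}" and x: "x \<in> {0..1}" for t x
    proof -
      have "\<bar>Y t x - mild_map u Y t x\<bar> \<le> 0 + e" if e: "e > 0" for e
      proof -
        define \<eta> where "\<eta> = e / (1 + exp (\<kappa> * T))"
        have ep: "1 + exp (\<kappa> * T) > 0" by (simp add: add_pos_pos)
        have \<eta>: "\<eta> > 0" using e ep by (simp add: \<eta>_def)
        have "\<forall>\<^sub>F k in sequentially. \<forall>p\<in>{0..T} \<times> {0..1}. dist (y k (fst p) (snd p)) (Y (fst p) (snd p)) < \<eta>"
          by (rule uniform_limitD[OF ul \<eta>])
        then obtain N where N: "\<And>k p. k \<ge> N \<Longrightarrow> p \<in> {0..T} \<times> {0..1} \<Longrightarrow> dist (y k (fst p) (snd p)) (Y (fst p) (snd p)) < \<eta>"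
          unfolding eventually_sequentially by blast
        have N': "\<bar>y k t x - Y t x\<bar> \<le> \<eta>" if "k \<ge> N" "t \<in> {0..T}" "x \<in> {0..1}" for k t x
          using N[of k "(t, x)"] that by (simp add: dist_real_def)
        have "\<bar>mild_map u (y N) t x - mild_map u Y t x\<bar> \<le> \<eta> / 2 * exp (\<kappa> * t)"
        proof (rule mild_map_contraction[OF admissible admY u K_def \<kappa>(3,2) T \<kappa>(1) _ _ t x])
          fix t x assume tx: "t \<in> {0..T}" "x \<in> {0..1::real}"
          have "\<bar>y N t x - Y t x\<bar> \<le> \<eta> * 1" using N' tx by simp
          also have "\<dots> \<le> \<eta> * exp (\<kappa> * t)" using \<eta> tx \<kappa>(3) by (intro mult_left_mono) auto
          finally show "\<bar>y N t x - Y t x\<bar> \<le> \<eta> * exp (\<kappa> * t)" .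
        qed (use \<eta> in auto)
        also have "\<dots> \<le> \<eta> * exp (\<kappa> * T)" using \<eta> t \<kappa>(3) by (intro mult_mono) auto
        finally have "\<bar>y (Suc N) t x - mild_map u Y t x\<bar> \<le> \<eta> * exp (\<kappa> * T)" by (simp add: ySuc)
        moreover have "\<bar>y (Suc N) t x - Y t x\<bar> \<le> \<eta>" using N' t x by simp
        ultimately have "\<bar>Y t x - mild_map u Y t x\<bar> \<le> \<eta> * (1 + exp (\<kappa> * T))" by (simp add: algebra_simps)
        then show ?thesis using ep by (simp add: \<eta>_def)
      qed
      then have "\<bar>Y t x - mild_map u Y t x\<bar> \<le> 0" by (rule field_le_epsilon)
      then show ?thesis by simp
    qed
    have "fsin n (Y t) = mild_coef u Y n t" if t: "t \<in> {0..T}" for t n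
      using fsin_cong[of "Y t" "mild_map u Y t" n] fix_pt[OF t] mild_map_props(2)[OF admY u K_def \<kappa>(3,2) T t] by simp
    then show "\<exists>Y. admissible T (4 * E0 + 1) \<kappa> Y \<and> (\<forall>t\<in>{0..T}. \<forall>n. fsin n (Y t) = mild_coef u Y n t)"
      using admY K_def by blast
  qed
qed

end

section \<open>Regularity of mild solutions\<close>

text \<open>The time derivative is found by scaling: \<open>t * Y\<^sub>t\<close> is the derivative of \<open>Y (c * t)\<close> with respect to \<open>c\<close> at 1. After the substitution
  \<open>s = c * s'\<close> the Duhamel integral runs over a domain independent of \<open>c\<close>, and all \<open>c\<close>-derivatives of its kernel are controlled by
  the heat kernel itself, so no singularity at \<open>s = t\<close> appears.\<close>

lemma halving_bound:
  fixes \<phi> w :: "'a \<Rightarrow> real"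
  assumes w: "\<And>p. p \<in> S \<Longrightarrow> w p \<ge> 0" and Mb: "\<And>p. p \<in> S \<Longrightarrow> \<phi> p \<le> Mb * w p" "Mb \<ge> 0" and a: "a \<ge> 0"
    and step: "\<And>\<delta>. \<delta> \<ge> 0 \<Longrightarrow> (\<And>p. p \<in> S \<Longrightarrow> \<phi> p \<le> \<delta> * w p) \<Longrightarrow> (\<And>p. p \<in> S \<Longrightarrow> \<phi> p \<le> (a + \<delta> / 2) * w p)"
    and p: "p \<in> S"
  shows "\<phi> p \<le> 2 * a * w p"
proof -
  \<comment> \<open>Each application of \<open>step\<close> halves the excess over its fixed value
    \<open>2 * a\<close>. Since \<open>Mb\<close> only starts the induction and leaves no trace in
    the conclusion, it may depend on parameters in which the result has to be uniform.\<close>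
  have "\<phi> p \<le> (2 * a + Mb / 2 ^ k) * w p" if "p \<in> S" for k p
    using that
  proof (induction k arbitrary: p)
    case 0 show ?case using Mb(1)[OF 0] mult_nonneg_nonneg[OF a w[OF 0]] by (simp add: algebra_simps)
  next
    case (Suc k)
    have "\<phi> p \<le> (a + (2 * a + Mb / 2 ^ k) / 2) * w p"
      by (rule step[OF _ Suc.IH Suc.prems]) (use a Mb in auto)
    also have "a + (2 * a + Mb / 2 ^ k) / 2 = 2 * a + Mb / 2 ^ Suc k" by simp
    finally show ?case .
  qed
  from this[OF p] have 1: "\<phi> p \<le> (2 * a + Mb * (1/2) ^ k) * w p" for k by (simp add: power_divide)
  have "(\<lambda>k. (2 * a + Mb * (1/2) ^ k) * w p) \<longlonglongrightarrow> (2 * a + Mb * 0) * w p"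
    by (intro tendsto_intros LIMSEQ_realpow_zero) auto
  from LIMSEQ_le_const[OF this] 1 show ?thesis by auto
qed

section \<open>Scaling quotients of the heat factors\<close>

definition diff_quot :: "(real \<Rightarrow> real) \<Rightarrow> real \<Rightarrow> real" where "diff_quot p c = (p c - p 1) / (c - 1)"

lemma diff_quot_bounds:
  assumes c: "c \<in> {1/2..3/2}" "c \<noteq> 1"
    and p: "\<And>x. (p has_real_derivative p' x) (at x)" "\<And>x. (p' has_real_derivative p'' x) (at x)"
    and M: "\<And>x. x \<in> {1/2..3/2} \<Longrightarrow> \<bar>p' x\<bar> \<le> M" "\<And>x. x \<in> {1/2..3/2} \<Longrightarrow> \<bar>p'' x\<bar> \<le> M"
  shows "\<bar>diff_quot p c\<bar> \<le> M" "\<bar>diff_quot p c - p' 1\<bar> \<le> M * \<bar>c - 1\<bar>"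
proof -
  have 1: "norm (p c - p 1) \<le> M * norm (c - 1)"
    by (rule field_differentiable_bound[of "{1/2..3/2}" p p']) (use c M p in \<open>auto intro: has_field_derivative_at_within\<close>)
  then show "\<bar>diff_quot p c\<bar> \<le> M" using c by (simp add: diff_quot_def divide_le_eq)
  have Mb: "M \<ge> 0" using M(1)[of 1] by auto
  have s: "closed_segment 1 c \<subseteq> {1/2..3/2}" by (rule closed_segment_subset) (use c in auto)
  have "norm ((p c - p' 1 * c) - (p 1 - p' 1 * 1)) \<le> (M * \<bar>c - 1\<bar>) * norm (c - 1)"
  proof (rule field_differentiable_bound[of "closed_segment 1 c" "\<lambda>x. p x - p' 1 * x" "\<lambda>x. p' x - p' 1"])
    fix x assume x: "x \<in> closed_segment 1 c"
    show "((\<lambda>x. p x - p' 1 * x) has_field_derivative p' x - p' 1) (at x within closed_segment 1 c)"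
      by (auto intro!: derivative_eq_intros has_field_derivative_at_within[OF p(1)])
    have "norm (p' x - p' 1) \<le> M * norm (x - 1)"
      by (rule field_differentiable_bound[of "{1/2..3/2}" p' p'']) (use x s M p in \<open>auto intro: has_field_derivative_at_within\<close>)
    also have "\<dots> \<le> M * \<bar>c - 1\<bar>" using x Mb by (intro mult_left_mono) (auto simp: closed_segment_eq_real_ivl split: if_splits)
    finally show "norm (p' x - p' 1) \<le> M * \<bar>c - 1\<bar>" .
  qed auto
  then have "\<bar>p c - p 1 - p' 1 * (c - 1)\<bar> \<le> (M * \<bar>c - 1\<bar>) * \<bar>c - 1\<bar>" by (simp add: algebra_simps)
  moreover have "diff_quot p c - p' 1 = (p c - p 1 - p' 1 * (c - 1)) / (c - 1)" using c by (simp add: diff_quot_def field_simps)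
  ultimately show "\<bar>diff_quot p c - p' 1\<bar> \<le> M * \<bar>c - 1\<bar>" using c by (simp add: divide_le_eq)
qed

text \<open>Since \<open>c\<close> is at least 1/2, the exponential contains two factors
  \<open>exp (- (X/4))\<close>: one absorbs the polynomial, the other is kept as decay in the
  frequency.\<close>

lemma poly_exp_bounds:
  fixes X :: real
  assumes X: "X \<ge> 0" and c: "c \<in> {1/2..3/2}"
  shows "(1 + 2 * X) * exp (- (c * X)) \<le> 9 * exp (- (X/4))" "X\<^sup>2 * exp (- (c * X)) \<le> 64 * exp (- (X/4))"
proof -
  have e: "exp (- (c * X)) \<le> exp (- (X/4)) * exp (- (X/4))"
    using mult_right_mono[of "1/2" c X] c X by (simp flip: exp_add)
  have 1: "1 + 2 * X \<le> 9 * exp (X/4)" using exp_ge_add_one_self[of "X/4"] X by linarith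
  have "X / 8 \<le> exp (X/8)" using exp_ge_add_one_self[of "X/8"] X by linarith
  then have "(X / 8)\<^sup>2 \<le> (exp (X/8))\<^sup>2" using X by (intro power_mono) auto
  then have 2: "X\<^sup>2 \<le> 64 * exp (X/4)" by (simp add: power2_eq_square flip: exp_add)
  have e1: "exp (X/4) * exp (- (X/4)) = 1" by (simp flip: exp_add)
  have *: "q * exp (- (c * X)) \<le> C * exp (- (X/4))" if "0 \<le> q" "q \<le> C * exp (X/4)" for q C
  proof -
    have "q * exp (- (c * X)) \<le> q * (exp (- (X/4)) * exp (- (X/4)))" using that e by (intro mult_left_mono) auto
    also have "\<dots> \<le> (C * exp (X/4)) * (exp (- (X/4)) * exp (- (X/4)))" using that by (intro mult_right_mono) auto
    also have "\<dots> = C * (exp (X/4) * exp (- (X/4))) * exp (- (X/4))" by (simp only: mult_ac)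
    finally show ?thesis unfolding e1 by simp
  qed
  show "(1 + 2 * X) * exp (- (c * X)) \<le> 9 * exp (- (X/4))" by (rule *[OF _ 1]) (use X in auto)
  show "X\<^sup>2 * exp (- (c * X)) \<le> 64 * exp (- (X/4))" by (rule *[OF _ 2]) auto
qed

definition heat_factor :: "real \<Rightarrow> real \<Rightarrow> real" where "heat_factor X c = exp (- (c * X))"
text \<open>The kernel of the Duhamel integral after the substitution \<open>s = c * s'\<close>, to
  be taken at \<open>X\<close> equal to the squared frequency times \<open>t - s'\<close>. The
  leading \<open>c\<close> is the Jacobian.\<close>

definition scaled_heat_factor :: "real \<Rightarrow> real \<Rightarrow> real" where "scaled_heat_factor X c = c * exp (- (c * X))"

lemma diff_quot_heat_factor:
  assumes X: "X \<ge> 0" and c: "c \<in> {1/2..3/2}" "c \<noteq> 1"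
  shows "\<bar>diff_quot (heat_factor X) c\<bar> \<le> 104" "\<bar>diff_quot (heat_factor X) c - (- X * exp (- X))\<bar> \<le> 104 * \<bar>c - 1\<bar>"
proof -
  have d: "(heat_factor X has_real_derivative - X * exp (- (x * X))) (at x)" for x
    unfolding heat_factor_def by (auto intro!: derivative_eq_intros)
  have d2: "((\<lambda>x. - X * exp (- (x * X))) has_real_derivative X\<^sup>2 * exp (- (x * X))) (at x)" for x
    by (auto intro!: derivative_eq_intros simp: power2_eq_square)
  have e4: "exp (- (X/4)) \<le> 1" using X by simp
  have b: "\<bar>- X * exp (- (x * X))\<bar> \<le> 104" "\<bar>X\<^sup>2 * exp (- (x * X))\<bar> \<le> 104" if "x \<in> {1/2..3/2}" for x
  proof -
    have "X * exp (- (x * X)) \<le> (1 + 2 * X) * exp (- (x * X))" using X by (intro mult_right_mono) auto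
    then show "\<bar>- X * exp (- (x * X))\<bar> \<le> 104" using poly_exp_bounds(1)[OF X that] e4 X unfolding abs_mult abs_minus_cancel abs_exp_cancel abs_of_nonneg[OF X] by linarith
    show "\<bar>X\<^sup>2 * exp (- (x * X))\<bar> \<le> 104" using poly_exp_bounds(2)[OF X that] e4 unfolding abs_mult abs_exp_cancel abs_power2 by linarith
  qed
  show "\<bar>diff_quot (heat_factor X) c\<bar> \<le> 104" "\<bar>diff_quot (heat_factor X) c - (- X * exp (- X))\<bar> \<le> 104 * \<bar>c - 1\<bar>"
    using diff_quot_bounds[OF c d d2 b] by simp_all
qed

lemma diff_quot_scaled_heat_factor:
  assumes X: "X \<ge> 0" and c: "c \<in> {1/2..3/2}" "c \<noteq> 1"
  shows "\<bar>diff_quot (scaled_heat_factor X) c\<bar> \<le> 114 * exp (- (X/4))"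
    "\<bar>diff_quot (scaled_heat_factor X) c - (1 - X) * exp (- X)\<bar> \<le> 114 * exp (- (X/4)) * \<bar>c - 1\<bar>"
proof -
  have d: "(scaled_heat_factor X has_real_derivative (1 - x * X) * exp (- (x * X))) (at x)" for x
    unfolding scaled_heat_factor_def by (auto intro!: derivative_eq_intros simp: algebra_simps)
  have d2: "((\<lambda>x. (1 - x * X) * exp (- (x * X))) has_real_derivative (x * X\<^sup>2 - 2 * X) * exp (- (x * X))) (at x)" for x
    by (auto intro!: derivative_eq_intros simp: power2_eq_square algebra_simps)
  have b: "\<bar>(1 - x * X) * exp (- (x * X))\<bar> \<le> 114 * exp (- (X/4))" "\<bar>(x * X\<^sup>2 - 2 * X) * exp (- (x * X))\<bar> \<le> 114 * exp (- (X/4))" if x: "x \<in> {1/2..3/2}" for x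
  proof -
    note p = poly_exp_bounds[OF X x]
    have e0: "exp (- (X/4)) \<ge> 0" by simp
    have xX: "0 \<le> x * X" "x * X \<le> 2 * X" using x X by (auto intro: mult_right_mono)
    have "\<bar>1 - x * X\<bar> * exp (- (x * X)) \<le> (1 + 2 * X) * exp (- (x * X))"
      using xX by (intro mult_right_mono) auto
    then show "\<bar>(1 - x * X) * exp (- (x * X))\<bar> \<le> 114 * exp (- (X/4))"
      using p(1) e0 unfolding abs_mult abs_exp_cancel by linarith
    have "0 \<le> x * X\<^sup>2" "x * X\<^sup>2 \<le> 3/2 * X\<^sup>2" using x mult_right_mono[of x "3/2" "X\<^sup>2"] by auto
    then have "\<bar>x * X\<^sup>2 - 2 * X\<bar> \<le> 3/2 * X\<^sup>2 + (1 + 2 * X)" using X by linarith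
    then have "\<bar>x * X\<^sup>2 - 2 * X\<bar> * exp (- (x * X)) \<le> (3/2 * X\<^sup>2 + (1 + 2 * X)) * exp (- (x * X))"
      by (intro mult_right_mono) auto
    also have "\<dots> = 3/2 * (X\<^sup>2 * exp (- (x * X))) + (1 + 2 * X) * exp (- (x * X))" by (simp add: algebra_simps)
    \<comment> \<open>The two bounds add up to 3/2 * 64 + 9 = 105, which 114 covers.\<close>
    also have "\<dots> \<le> 114 * exp (- (X/4))" using p e0 by linarith
    finally show "\<bar>(x * X\<^sup>2 - 2 * X) * exp (- (x * X))\<bar> \<le> 114 * exp (- (X/4))" by (simp add: abs_mult)
  qed
  show "\<bar>diff_quot (scaled_heat_factor X) c\<bar> \<le> 114 * exp (- (X/4))"
    "\<bar>diff_quot (scaled_heat_factor X) c - (1 - X) * exp (- X)\<bar> \<le> 114 * exp (- (X/4)) * \<bar>c - 1\<bar>"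
    using diff_quot_bounds[OF c d d2 b] by simp_all
qed

section \<open>Difference quotients of the solution under scaling of time\<close>

lemma abs_le_fsin_sum:
  assumes W: "continuous_on {0..1} W" and b: "\<And>m. (\<Sum>n<m. \<bar>fsin n W\<bar>) \<le> b" and x: "x \<in> {0..1}"
  shows "\<bar>W x\<bar> \<le> b"
proof -
  have s: "summable (\<lambda>n. \<bar>fsin n W\<bar>)"
    by (rule bounded_imp_summable[of _ b]) (use b[of "Suc n" for n] in \<open>simp_all add: lessThan_Suc_atMost\<close>)
  have "norm (fsin n W * sin (freq n * x)) \<le> \<bar>fsin n W\<bar>" for n
    using mult_left_mono[OF abs_sin_le_one[of "freq n * x"], of "\<bar>fsin n W\<bar>"] by (simp add: abs_mult)
  from norm_suminf_le[OF this s] have "\<bar>W x\<bar> \<le> (\<Sum>n. \<bar>fsin n W\<bar>)"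
    using sine_series_expansion[OF W s x] by simp
  also have "\<dots> \<le> b" by (rule suminf_le_const[OF s b])
  finally show ?thesis .
qed

text \<open>The solution lives on twice the interval on which conclusions are drawn: the surplus
  accommodates the scaled times \<open>c * t\<close> with \<open>c\<close> up to 3/2.\<close>

locale mild_solution = smooth_nonlinearity +
  fixes u :: "real \<Rightarrow> real" and Y :: "real \<Rightarrow> real \<Rightarrow> real" and T K \<kappa> E0 :: real
  assumes T: "T > 0" and admissible: "admissible (2 * T) K \<kappa> Y" and \<kappa>: "\<kappa> > 0" and K: "K \<ge> 0"
    and u_energy: "\<And>m. (\<Sum>n<m. (freq n * fsin n u)\<^sup>2) \<le> E0"
    and mild: "\<And>t n. t \<in> {0..2*T} \<Longrightarrow> fsin n (Y t) = mild_coef u Y n t"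
begin

lemma Y_jointly_cont: "jointly_cont (2 * T) Y" using admissible by (simp add: admissible_def)

lemma Y_slice: "t \<in> {0..2*T} \<Longrightarrow> continuous_on {0..1} (Y t)" by (rule jointly_cont_slice[OF Y_jointly_cont])

lemma scaled_in: "c \<in> {1/2..3/2} \<Longrightarrow> t \<in> {0..T} \<Longrightarrow> c * t \<in> {0..2*T}"
  using mult_mono[of c "2" t T] by auto

lemma jointly_cont_scaled: "c \<in> {1/2..3/2} \<Longrightarrow> jointly_cont T (\<lambda>t. Y (c * t))"
  unfolding jointly_cont_def using scaled_in
  by (intro continuous_on_compose2[OF Y_jointly_cont[unfolded jointly_cont_def], of _ "\<lambda>p. (c * fst p, snd p)", simplified]) (auto intro!: continuous_intros)

lemma jointly_cont_T: "jointly_cont T Y" by (rule jointly_cont_subset[OF Y_jointly_cont]) (use T in auto)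

lemma continuous_on_source_coef_scaled:
  assumes "c \<in> {1/2..3/2}" "t \<in> {0..T}" shows "continuous_on {0..t} (\<lambda>s. source_coef n (Y (c * s)))"
  by (rule continuous_on_subset[OF continuous_on_source_coef[OF jointly_cont_scaled[OF assms(1)]]]) (use assms in auto)

lemma mild_coef_scaled:
  assumes c: "c \<in> {1/2..3/2}" and t: "t \<in> {0..T}"
  shows "mild_coef u Y n (c * t) = heat_factor ((freq n)\<^sup>2 * t) c * fsin n u +
    integral {0..t} (\<lambda>s. scaled_heat_factor ((freq n)\<^sup>2 * (t - s)) c * source_coef n (Y (c * s)))"
proof -
  have "((\<lambda>s. c *\<^sub>R (exp (- ((freq n)\<^sup>2 * (c * t - c * s))) * source_coef n (Y (c * s)))) has_integral
     integral {c * 0..c * t} (\<lambda>s. exp (- ((freq n)\<^sup>2 * (c * t - s))) * source_coef n (Y s))) {0..t}"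
  proof (rule has_integral_substitution)
    show "(*) c ` {0..t} \<subseteq> {0..2*T}" using scaled_in[OF c] t by auto
    show "continuous_on {0..2*T} (\<lambda>s. exp (- ((freq n)\<^sup>2 * (c * t - s))) * source_coef n (Y s))"
      by (intro continuous_intros continuous_on_source_coef Y_jointly_cont)
    show "((*) c has_real_derivative c) (at x within {0..t})" for x
      by (auto intro!: derivative_eq_intros)
  qed (use c t in \<open>auto intro: mult_left_mono\<close>)
  then have "integral {0..c * t} (\<lambda>s. exp (- ((freq n)\<^sup>2 * (c * t - s))) * source_coef n (Y s)) =
    integral {0..t} (\<lambda>s. c *\<^sub>R (exp (- ((freq n)\<^sup>2 * (c * t - c * s))) * source_coef n (Y (c * s))))"
    unfolding mult_zero_right by (rule integral_unique[symmetric])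
  also have "\<dots> = integral {0..t} (\<lambda>s. scaled_heat_factor ((freq n)\<^sup>2 * (t - s)) c * source_coef n (Y (c * s)))"
    by (simp add: scaled_heat_factor_def algebra_simps)
  finally show ?thesis by (simp add: mild_coef_def heat_factor_def algebra_simps)
qed

text \<open>The secant of the curve \<open>Y (c * t)\<close> between \<open>c\<close> and 1. As
  \<open>c\<close> tends to 1 it converges to \<open>t\<close> times the time derivative, and it
  does so uniformly down to \<open>t = 0\<close>.\<close>

definition D :: "real \<Rightarrow> real \<Rightarrow> real \<Rightarrow> real" where "D c t x = (Y (c * t) x - Y t x) / (c - 1)"

lemma D_jointly_cont: "c \<in> {1/2..3/2} \<Longrightarrow> jointly_cont T (D c)"
  using jointly_cont_scaled[of c] jointly_cont_T unfolding jointly_cont_def D_def divide_inverse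
  by (intro continuous_intros)

definition \<gamma> :: "real \<Rightarrow> nat \<Rightarrow> real \<Rightarrow> real" where
  "\<gamma> c n s = (source_coef n (Y (c * s)) - source_coef n (Y s)) / (c - 1)"

text \<open>A discrete product rule with three terms, according to whether the difference falls on
  the factor of the datum, on the kernel or on the source. Only the last contains the unknown,
  through \<open>\<gamma>\<close>.\<close>

lemma D_coef:
  assumes c: "c \<in> {1/2..3/2}" "c \<noteq> 1" and t: "t \<in> {0..T}"
  shows "fsin n (D c t) = diff_quot (heat_factor ((freq n)\<^sup>2 * t)) c * fsin n u +
    integral {0..t} (\<lambda>s. diff_quot (scaled_heat_factor ((freq n)\<^sup>2 * (t - s))) c * source_coef n (Y (c * s))) +
    integral {0..t} (\<lambda>s. exp (- (1 * (freq n)\<^sup>2 * (t - s))) * \<gamma> c n s)"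
proof -
  note ic = integrable_continuous_interval
  have t2: "t \<in> {0..2*T}" using t by auto
  have s1: "continuous_on {0..t} (\<lambda>s. source_coef n (Y (c * s)))" by (rule continuous_on_source_coef_scaled[OF c(1) t])
  have s2: "continuous_on {0..t} (\<lambda>s. source_coef n (Y s))" using continuous_on_source_coef_scaled[of 1, OF _ t] by simp
  have kc: "continuous_on {0..t} (\<lambda>s. scaled_heat_factor ((freq n)\<^sup>2 * (t - s)) d)" for d
    unfolding scaled_heat_factor_def by (intro continuous_intros)
  have "fsin n (D c t) = (mild_coef u Y n (c * t) - mild_coef u Y n (1 * t)) / (c - 1)"
  proof -
    have "D c t = (\<lambda>x. (1 / (c - 1)) * (Y (c * t) x - Y t x))" by (auto simp: D_def)
    then show ?thesis
      using fsin_diff[OF Y_slice Y_slice, of "c * t" t n] mild scaled_in[OF c(1) t] t2 by (simp only: fsin_cmult) simp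
  qed
  also have "\<dots> = diff_quot (heat_factor ((freq n)\<^sup>2 * t)) c * fsin n u +
     (integral {0..t} (\<lambda>s. scaled_heat_factor ((freq n)\<^sup>2 * (t - s)) c * source_coef n (Y (c * s))) - integral {0..t} (\<lambda>s. scaled_heat_factor ((freq n)\<^sup>2 * (t - s)) 1 * source_coef n (Y s))) / (c - 1)"
  proof -
    have "mild_coef u Y n (1 * t) = heat_factor ((freq n)\<^sup>2 * t) 1 * fsin n u + integral {0..t} (\<lambda>s. scaled_heat_factor ((freq n)\<^sup>2 * (t - s)) 1 * source_coef n (Y s))"
      using mild_coef_scaled[of 1 t n] t by simp
    then show ?thesis unfolding mild_coef_scaled[OF c(1) t]
      by (simp only: diff_quot_def times_divide_eq_left left_diff_distrib flip: add_divide_distrib) (simp add: algebra_simps)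
  qed
  also have "integral {0..t} (\<lambda>s. scaled_heat_factor ((freq n)\<^sup>2 * (t - s)) c * source_coef n (Y (c * s))) - integral {0..t} (\<lambda>s. scaled_heat_factor ((freq n)\<^sup>2 * (t - s)) 1 * source_coef n (Y s))
     = integral {0..t} (\<lambda>s. (c - 1) * (diff_quot (scaled_heat_factor ((freq n)\<^sup>2 * (t - s))) c * source_coef n (Y (c * s))) + (c - 1) * (exp (- (1 * (freq n)\<^sup>2 * (t - s))) * \<gamma> c n s))"
  proof -
    have e: "scaled_heat_factor ((freq n)\<^sup>2 * (t - s)) c * source_coef n (Y (c * s)) - scaled_heat_factor ((freq n)\<^sup>2 * (t - s)) 1 * source_coef n (Y s) =
      (c - 1) * (diff_quot (scaled_heat_factor ((freq n)\<^sup>2 * (t - s))) c * source_coef n (Y (c * s))) + (c - 1) * (exp (- (1 * (freq n)\<^sup>2 * (t - s))) * \<gamma> c n s)" for s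
    proof -
      have 1: "(c - 1) * diff_quot p c = p c - p 1" for p using c by (simp add: diff_quot_def)
      have 2: "(c - 1) * \<gamma> c n s = source_coef n (Y (c * s)) - source_coef n (Y s)" using c by (simp add: \<gamma>_def)
      have 3: "exp (- (1 * (freq n)\<^sup>2 * (t - s))) = scaled_heat_factor ((freq n)\<^sup>2 * (t - s)) 1" by (simp add: scaled_heat_factor_def)
      show ?thesis unfolding 3 mult.assoc[symmetric] 1
        unfolding mult.assoc mult.left_commute[of "c - 1"] 2 by (simp add: algebra_simps)
    qed
    show ?thesis unfolding e[symmetric]
      by (rule integral_diff[symmetric]) (intro ic continuous_intros kc s1 s2)+
  qed
  also have "\<dots> = (c - 1) * integral {0..t} (\<lambda>s. diff_quot (scaled_heat_factor ((freq n)\<^sup>2 * (t - s))) c * source_coef n (Y (c * s))) +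
      (c - 1) * integral {0..t} (\<lambda>s. exp (- (1 * (freq n)\<^sup>2 * (t - s))) * \<gamma> c n s)"
    unfolding diff_quot_def \<gamma>_def by (subst integral_add) (intro ic continuous_intros kc s1 s2 ballI, use c in simp, intro ic continuous_intros kc s1 s2 ballI, use c in simp, simp)
  finally show ?thesis using c(2) by (simp add: add_divide_distrib)
qed

lemma exp_quarter_le:
  assumes "\<tau> > 0"
  shows "exp (- ((freq n)\<^sup>2 * \<tau> / 4)) \<le> 4 * mode_weight n * \<tau> powr (-7/8)"
proof -
  have "((1/4)::real) powr (-7/8) = 4 powr (7/8)" by (simp add: powr_minus powr_divide inverse_eq_divide)
  also have "\<dots> \<le> 4 powr 1" by (intro powr_mono) auto
  finally have 1: "((1/4)::real) powr (-7/8) \<le> 4" by simp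
  have "exp (- ((freq n)\<^sup>2 * \<tau> / 4)) = exp (- (1/4 * (freq n)\<^sup>2 * \<tau>))" by simp
  also have "\<dots> \<le> (1/4) powr (-7/8) * mode_weight n * \<tau> powr (-7/8)"
    by (rule exp_freq_le) (use assms in auto)
  also have "\<dots> \<le> 4 * mode_weight n * \<tau> powr (-7/8)" by (intro mult_right_mono 1) auto
  finally show ?thesis .
qed

lemma source_coef_weighted_bound:
  obtains \<Gamma> where "\<Gamma> \<ge> 0" "\<And>s m. s \<in> {0..2*T} \<Longrightarrow> (\<Sum>n<m. mode_weight n * \<bar>source_coef n (Y s)\<bar>) \<le> \<Gamma>"
proof -
  define B where "B = weight_sum * sqrt (K * exp (\<kappa> * (2 * T)))"
  have YB: "\<bar>Y s x\<bar> \<le> B" if "s \<in> {0..2*T}" "x \<in> {0..1}" for s x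
  proof -
    have "\<bar>Y s x\<bar> \<le> weight_sum * sqrt (K * exp (\<kappa> * s))" by (rule mild_map_zero_bound[OF admissible that])
    also have "\<dots> \<le> B" unfolding B_def using that \<kappa> K
      by (intro mult_left_mono real_sqrt_le_mono weight_sum_nonneg) auto
    finally show ?thesis .
  qed
  have B0: "B \<ge> 0" using YB[of 0 0] T by auto
  define \<delta> where "\<delta> = \<bar>f 0\<bar> + \<bar>r 0\<bar> + L * B"
  have d0: "\<delta> \<ge> 0" using L_nonneg B0 by (simp add: \<delta>_def)
  show ?thesis
  proof
    show "source_const * \<delta> \<ge> 0" using d0 source_const_nonneg by simp
    fix s m assume s: "s \<in> {0..2*T}"
    show "(\<Sum>n<m. mode_weight n * \<bar>source_coef n (Y s)\<bar>) \<le> source_const * \<delta>"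
      unfolding source_coef_def source_const_def
    proof (rule weighted_source_le)
      fix x :: real assume x: "x \<in> {0..1}"
      have "L * \<bar>Y s x\<bar> \<le> L * B" by (intro mult_left_mono YB s x L_nonneg)
      then show "\<bar>f (Y s x)\<bar> \<le> \<delta>" "\<bar>r (Y s x)\<bar> \<le> \<delta>"
        using f_lip[of "Y s x" 0] r_lip[of "Y s x" 0] unfolding \<delta>_def diff_zero by linarith+
    qed (intro cont_compose Y_slice s)+
  qed
qed

lemma sum_abs_u_le: "(\<Sum>n<m. \<bar>fsin n u\<bar>) \<le> weight_sum * sqrt E0"
  by (rule summable_abs_of_energy(2)[OF u_energy])

lemma weight_obtain:
  obtains \<kappa>' where "\<kappa>' \<ge> 1" "16 * T powr (1/16) * \<kappa>' powr (-1/16) \<le> 1"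
    "source_const * L * (16 * T powr (1/16) * \<kappa>' powr (-1/16)) \<le> 1/2"
proof -
  have "\<forall>\<^sub>F \<kappa> in at_top. source_const * L * (16 * T powr (1/16) * \<kappa> powr (-1/16)) < 1/2 \<and> 1 * (16 * T powr (1/16) * \<kappa> powr (-1/16)) < 1 \<and> \<kappa> \<ge> (1::real)"
    by (intro eventually_conj eventually_weight_small eventually_ge_at_top) simp_all
  then show ?thesis
    using that eventually_happens'[OF trivial_limit_at_top_linorder] by (metis (no_types, lifting) less_imp_le mult_1)
qed

lemma \<gamma>_eq:
  assumes c: "c \<in> {1/2..3/2}" and s: "s \<in> {0..T}"
  shows "\<gamma> c n s = freq n * fcos n (\<lambda>x. (f (Y (c * s) x) - f (Y s x)) / (c - 1)) + fsin n (\<lambda>x. (r (Y (c * s) x) - r (Y s x)) / (c - 1))"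
proof -
  have Y: "continuous_on {0..1} (Y (c * s))" "continuous_on {0..1} (Y s)"
    using scaled_in[OF c s] s by (auto intro: Y_slice)
  show ?thesis unfolding \<gamma>_def source_coef_diff[OF Y]
    using fcos_cmult[of n "1 / (c - 1)" "\<lambda>x. f (Y (c * s) x) - f (Y s x)"]
      fsin_cmult[of n "1 / (c - 1)" "\<lambda>x. r (Y (c * s) x) - r (Y s x)"]
    by (simp add: add_divide_distrib)
qed

lemma continuous_on_\<gamma>: "c \<in> {1/2..3/2} \<Longrightarrow> t \<in> {0..T} \<Longrightarrow> continuous_on {0..t} (\<gamma> c n)"
  unfolding \<gamma>_def divide_inverse using continuous_on_source_coef_scaled[of 1 t] by (intro continuous_intros continuous_on_source_coef_scaled) auto

lemma D_slice: "c \<in> {1/2..3/2} \<Longrightarrow> t \<in> {0..T} \<Longrightarrow> continuous_on {0..1} (D c t)"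
  using jointly_cont_slice[OF D_jointly_cont] by blast

text \<open>The terms of \<open>D_coef\<close> without \<open>\<gamma>\<close> are bounded uniformly
  in \<open>c\<close>; the \<open>\<gamma>\<close> term returns at most half of a bound for
  \<open>D\<close>, by the choice of \<open>\<kappa>'\<close>. So \<open>halving_bound\<close>
  applies, started from a bound that degenerates as \<open>c\<close> tends to 1. The number 456 is 4
  * 114, with the 4 from \<open>exp_quarter_le\<close>.\<close>

lemma D_bounded:
  obtains A where "A \<ge> 0" "\<And>c t x. c \<in> {1/2..3/2} \<Longrightarrow> c \<noteq> 1 \<Longrightarrow> t \<in> {0..T} \<Longrightarrow> x \<in> {0..1} \<Longrightarrow> \<bar>D c t x\<bar> \<le> A"
proof -
  obtain \<Gamma> where \<Gamma>: "\<Gamma> \<ge> 0" "\<And>s m. s \<in> {0..2*T} \<Longrightarrow> (\<Sum>n<m. mode_weight n * \<bar>source_coef n (Y s)\<bar>) \<le> \<Gamma>"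
    using source_coef_weighted_bound by blast
  obtain \<kappa>' where \<kappa>': "\<kappa>' \<ge> 1" "16 * T powr (1/16) * \<kappa>' powr (-1/16) \<le> 1"
    "source_const * L * (16 * T powr (1/16) * \<kappa>' powr (-1/16)) \<le> 1/2" using weight_obtain by blast
  define S where "S = 16 * T powr (1/16) * \<kappa>' powr (-1/16)"
  define a where "a = 104 * (weight_sum * sqrt E0) + 456 * \<Gamma>"
  have E00: "E0 \<ge> 0" using u_energy[of 0] by simp
  have S: "0 \<le> S" "S \<le> 1" "source_const * L * S \<le> 1/2" using \<kappa>' by (auto simp: S_def)
  have a: "a \<ge> 0" using \<Gamma> weight_sum_nonneg E00 by (simp add: a_def)
  have e1: "1 \<le> exp (\<kappa>' * t)" if "t \<ge> 0" for t using that \<kappa>' by simp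
  obtain B where B: "\<And>p. p \<in> {0..2*T} \<times> {0..1} \<Longrightarrow> norm (Y (fst p) (snd p)) \<le> B"
    using continuous_on_compact_bound[OF compact_Times[OF compact_Icc compact_Icc] Y_jointly_cont[unfolded jointly_cont_def]] by blast
  have main: "\<bar>D c (fst p) (snd p)\<bar> \<le> 2 * a * exp (\<kappa>' * fst p)"
    if c: "c \<in> {1/2..3/2}" "c \<noteq> 1" and p: "p \<in> {0..T} \<times> {0..1}" for c p
  proof (rule halving_bound[where Mb = "2 * \<bar>B\<bar> / \<bar>c - 1\<bar>", OF _ _ _ a _ p])
    fix p assume p: "p \<in> {0..T} \<times> {0..1::real}"
    have "\<bar>Y (c * fst p) (snd p) - Y (fst p) (snd p)\<bar> \<le> 2 * \<bar>B\<bar>"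
      using B[of "(c * fst p, snd p)"] B[of p] scaled_in[OF c(1), of "fst p"] p by auto
    then have "\<bar>D c (fst p) (snd p)\<bar> \<le> 2 * \<bar>B\<bar> / \<bar>c - 1\<bar>" unfolding D_def abs_divide by (intro divide_right_mono) auto
    also have "\<dots> \<le> 2 * \<bar>B\<bar> / \<bar>c - 1\<bar> * exp (\<kappa>' * fst p)" using e1[of "fst p"] p mult_left_mono[of 1 "exp (\<kappa>' * fst p)" "2 * \<bar>B\<bar> / \<bar>c - 1\<bar>"] by auto
    finally show "\<bar>D c (fst p) (snd p)\<bar> \<le> 2 * \<bar>B\<bar> / \<bar>c - 1\<bar> * exp (\<kappa>' * fst p)" .
  next
    fix \<delta> p assume \<delta>: "\<delta> \<ge> 0" "\<And>p. p \<in> {0..T} \<times> {0..1} \<Longrightarrow> \<bar>D c (fst p) (snd p)\<bar> \<le> \<delta> * exp (\<kappa>' * fst p)"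
      and p: "p \<in> {0..T} \<times> {0..1::real}"
    define t where "t = fst p"
    have t: "t \<in> {0..T}" using p by (auto simp: t_def)
    show "\<bar>D c (fst p) (snd p)\<bar> \<le> (a + \<delta> / 2) * exp (\<kappa>' * fst p)"
      unfolding t_def[symmetric]
    proof (rule abs_le_fsin_sum[OF D_slice[OF c(1) t]])
      fix m
      have s1: "(\<Sum>n<m. \<bar>diff_quot (heat_factor ((freq n)\<^sup>2 * t)) c * fsin n u\<bar>) \<le> 104 * (weight_sum * sqrt E0)"
      proof -
        have "(\<Sum>n<m. \<bar>diff_quot (heat_factor ((freq n)\<^sup>2 * t)) c * fsin n u\<bar>) \<le> (\<Sum>n<m. 104 * \<bar>fsin n u\<bar>)"
          unfolding abs_mult by (intro sum_mono mult_right_mono diff_quot_heat_factor c) (use t in auto)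
        also have "\<dots> = 104 * (\<Sum>n<m. \<bar>fsin n u\<bar>)" by (simp add: sum_distrib_left)
        finally show ?thesis using sum_abs_u_le[of m] by simp
      qed
      have s2: "(\<Sum>n<m. \<bar>integral {0..t} (\<lambda>s. diff_quot (scaled_heat_factor ((freq n)\<^sup>2 * (t - s))) c * source_coef n (Y (c * s)))\<bar>)
         \<le> 456 * \<Gamma> * exp (\<kappa>' * t) * S" unfolding S_def
      proof (rule duhamel_sum_le[where k = "\<lambda>n \<tau>. diff_quot (scaled_heat_factor ((freq n)\<^sup>2 * \<tau>)) c" and g = "\<lambda>n s. source_coef n (Y (c * s))"])
        show "continuous_on {0..t} (\<lambda>\<tau>. diff_quot (scaled_heat_factor ((freq n)\<^sup>2 * \<tau>)) c)" for n
          unfolding diff_quot_def scaled_heat_factor_def divide_inverse by (intro continuous_intros)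
        show "\<bar>diff_quot (scaled_heat_factor ((freq n)\<^sup>2 * \<tau>)) c\<bar> \<le> 456 * mode_weight n * \<tau> powr (-7/8)" if "0 < \<tau>" for n \<tau>
          using diff_quot_scaled_heat_factor(1)[of "(freq n)\<^sup>2 * \<tau>", OF _ c] exp_quarter_le[OF that, of n] that by simp
        fix m s assume s: "s \<in> {0..t}"
        have "(\<Sum>n<m. mode_weight n * \<bar>source_coef n (Y (c * s))\<bar>) \<le> \<Gamma> * 1" using \<Gamma>(2)[OF scaled_in[OF c(1)], of s m] s t by auto
        also have "\<dots> \<le> \<Gamma> * exp (\<kappa>' * s)" using \<Gamma>(1) e1[of s] s by (intro mult_left_mono) auto
        finally show "(\<Sum>n<m. mode_weight n * \<bar>source_coef n (Y (c * s))\<bar>) \<le> \<Gamma> * exp (\<kappa>' * s)" .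
      qed (use t \<kappa>' \<Gamma> c in \<open>auto intro!: continuous_on_source_coef_scaled\<close>)
      have s3: "(\<Sum>n<m. \<bar>integral {0..t} (\<lambda>s. exp (- (1 * (freq n)\<^sup>2 * (t - s))) * \<gamma> c n s)\<bar>) \<le> 1 * (source_const * (L * \<delta>)) * exp (\<kappa>' * t) * S"
        unfolding S_def
      proof (rule duhamel_sum_le[where k = "\<lambda>n \<tau>. exp (- (1 * (freq n)\<^sup>2 * \<tau>))" and g = "\<gamma> c"])
        show "\<bar>exp (- (1 * (freq n)\<^sup>2 * \<tau>))\<bar> \<le> 1 * mode_weight n * \<tau> powr (-7/8)" if "0 < \<tau>" for n \<tau>
          using exp_freq_le[OF that, of 1 n] by simp
        fix m s assume s: "s \<in> {0..t}"
        then have sT: "s \<in> {0..T}" using t by auto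
        have Ys: "continuous_on {0..1} (Y (c * s))" "continuous_on {0..1} (Y s)"
          using scaled_in[OF c(1) sT] sT by (auto intro: Y_slice)
        have "(\<Sum>n<m. mode_weight n * \<bar>\<gamma> c n s\<bar>) \<le> source_const * (L * (\<delta> * exp (\<kappa>' * s)))"
          unfolding \<gamma>_eq[OF c(1) sT] source_const_def
        proof (rule weighted_source_le)
          fix x :: real assume x: "x \<in> {0..1}"
          have *: "L * \<bar>D c s x\<bar> \<le> L * (\<delta> * exp (\<kappa>' * s))" using \<delta>(2)[of "(s,x)"] sT x L_nonneg by (intro mult_left_mono) auto
          have "\<bar>g (Y (c * s) x) - g (Y s x)\<bar> \<le> L * \<bar>Y (c * s) x - Y s x\<bar> \<Longrightarrow> \<bar>(g (Y (c * s) x) - g (Y s x)) / (c - 1)\<bar> \<le> L * \<bar>D c s x\<bar>" for g :: "real \<Rightarrow> real"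
            unfolding D_def abs_divide times_divide_eq_right by (rule divide_right_mono) auto
          then show "\<bar>(f (Y (c * s) x) - f (Y s x)) / (c - 1)\<bar> \<le> L * (\<delta> * exp (\<kappa>' * s))"
            "\<bar>(r (Y (c * s) x) - r (Y s x)) / (c - 1)\<bar> \<le> L * (\<delta> * exp (\<kappa>' * s))"
            using * f_lip r_lip by (meson order_trans)+
        qed (unfold divide_inverse, (intro continuous_intros cont_compose Ys)+)
        then show "(\<Sum>n<m. mode_weight n * \<bar>\<gamma> c n s\<bar>) \<le> source_const * (L * \<delta>) * exp (\<kappa>' * s)" by (simp add: mult_ac)
      qed (use t \<kappa>' \<delta> source_const_nonneg L_nonneg c continuous_on_\<gamma> in \<open>auto intro!: continuous_intros\<close>)
      have "(\<Sum>n<m. \<bar>fsin n (D c t)\<bar>) \<le> (\<Sum>n<m. \<bar>diff_quot (heat_factor ((freq n)\<^sup>2 * t)) c * fsin n u\<bar>) +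
         (\<Sum>n<m. \<bar>integral {0..t} (\<lambda>s. diff_quot (scaled_heat_factor ((freq n)\<^sup>2 * (t - s))) c * source_coef n (Y (c * s)))\<bar>) +
         (\<Sum>n<m. \<bar>integral {0..t} (\<lambda>s. exp (- (1 * (freq n)\<^sup>2 * (t - s))) * \<gamma> c n s)\<bar>)"
        unfolding D_coef[OF c t] sum.distrib[symmetric] by (intro sum_mono) linarith
      also have "\<dots> \<le> 104 * (weight_sum * sqrt E0) + 456 * \<Gamma> * exp (\<kappa>' * t) * S + 1 * (source_const * (L * \<delta>)) * exp (\<kappa>' * t) * S"
        by (intro add_mono s1 s2 s3)
      also have "\<dots> = 104 * (weight_sum * sqrt E0) * 1 + 456 * \<Gamma> * S * exp (\<kappa>' * t) + (source_const * L * S) * \<delta> * exp (\<kappa>' * t)"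
        by (simp add: mult_ac)
      also have "\<dots> \<le> 104 * (weight_sum * sqrt E0) * exp (\<kappa>' * t) + 456 * \<Gamma> * 1 * exp (\<kappa>' * t) + 1/2 * \<delta> * exp (\<kappa>' * t)"
        using S \<delta>(1) \<Gamma>(1) e1[of t] t weight_sum_nonneg E00 by (intro add_mono mult_left_mono mult_right_mono) auto
      also have "\<dots> = (a + \<delta> / 2) * exp (\<kappa>' * t)" by (simp add: a_def algebra_simps)
      finally show "(\<Sum>n<m. \<bar>fsin n (D c t)\<bar>) \<le> (a + \<delta> / 2) * exp (\<kappa>' * t)" .
    qed (use p in auto)
  qed auto
  show ?thesis
  proof (rule that[of "2 * a * exp (\<kappa>' * T)"])
    fix c t x :: real assume *: "c \<in> {1/2..3/2}" "c \<noteq> 1" "t \<in> {0..T}" "x \<in> {0..1::real}"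
    have "\<bar>D c t x\<bar> \<le> 2 * a * exp (\<kappa>' * t)" using main[of c "(t,x)"] * by simp
    also have "\<dots> \<le> 2 * a * exp (\<kappa>' * T)" using a * \<kappa>' by (intro mult_left_mono) auto
    finally show "\<bar>D c t x\<bar> \<le> 2 * a * exp (\<kappa>' * T)" .
  qed (use a in simp)
qed

lemma f_taylor: "\<bar>f (a + h) - f a - f' a * h\<bar> \<le> L * h\<^sup>2" and r_taylor: "\<bar>r (a + h) - r a - r' a * h\<bar> \<le> L * h\<^sup>2"
proof -
  have *: "\<bar>g (a + h) - g a - g' a * h\<bar> \<le> L * h\<^sup>2"
    if g: "\<And>x. (g has_real_derivative g' x) (at x)" "\<And>x y. \<bar>g' x - g' y\<bar> \<le> L * \<bar>x - y\<bar>" for g g' :: "real \<Rightarrow> real"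
  proof -
    have "norm ((g (a + h) - g' a * (a + h)) - (g a - g' a * a)) \<le> (L * \<bar>h\<bar>) * norm ((a + h) - a)"
    proof (rule field_differentiable_bound[of "closed_segment a (a + h)" "\<lambda>x. g x - g' a * x" "\<lambda>x. g' x - g' a"])
      fix x assume x: "x \<in> closed_segment a (a + h)"
      show "((\<lambda>x. g x - g' a * x) has_field_derivative g' x - g' a) (at x within closed_segment a (a + h))"
        by (auto intro!: derivative_eq_intros has_field_derivative_at_within[OF g(1)])
      have "\<bar>x - a\<bar> \<le> \<bar>h\<bar>" using x by (auto simp: closed_segment_eq_real_ivl split: if_splits)
      then show "norm (g' x - g' a) \<le> L * \<bar>h\<bar>" using g(2)[of x a] mult_left_mono[OF _ L_nonneg] by (smt (verit) real_norm_def)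
    qed auto
    then show ?thesis by (simp add: algebra_simps power2_eq_square abs_mult_self_eq flip: abs_mult)
  qed
  show "\<bar>f (a + h) - f a - f' a * h\<bar> \<le> L * h\<^sup>2" by (rule *[OF f_deriv f'_lip])
  show "\<bar>r (a + h) - r a - r' a * h\<bar> \<le> L * h\<^sup>2" by (rule *[OF r_deriv r'_lip])
qed

text \<open>Both quotients linearise to \<open>g' v\<close> times the respective secant, so the
  linear parts differ by \<open>g' v * (P - Q)\<close>; the Taylor remainders are of first order in
  the increments \<open>p\<close> and \<open>q\<close>.\<close>

lemma quotient_diff_le:
  assumes g: "\<And>a h. \<bar>g (a + h) - g a - g' a * h\<bar> \<le> L * h\<^sup>2" "\<And>a. \<bar>g' a\<bar> \<le> L"
    and v: "vc = v + p * P" "vd = v + q * Q" "p \<noteq> 0" "q \<noteq> (0::real)" and PQ: "\<bar>P\<bar> \<le> A" "\<bar>Q\<bar> \<le> A"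
  shows "\<bar>(g vc - g v) / p - (g vd - g v) / q\<bar> \<le> L * \<bar>P - Q\<bar> + L * A\<^sup>2 * (\<bar>p\<bar> + \<bar>q\<bar>)"
proof -
  have *: "\<bar>(g (v + p * P) - g v) / p - g' v * P\<bar> \<le> L * A\<^sup>2 * \<bar>p\<bar>" if "p \<noteq> 0" "\<bar>P\<bar> \<le> A" for p P
  proof -
    have "\<bar>(g (v + p * P) - g v) / p - g' v * P\<bar> = \<bar>g (v + p * P) - g v - g' v * (p * P)\<bar> / \<bar>p\<bar>"
      using that by (simp add: field_simps flip: abs_divide)
    also have "\<dots> \<le> L * (p * P)\<^sup>2 / \<bar>p\<bar>" by (intro divide_right_mono g) auto
    also have "\<dots> = L * P\<^sup>2 * \<bar>p\<bar>" using that by (simp add: power_mult_distrib) (simp add: power2_eq_square abs_if)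
    also have "\<dots> \<le> L * A\<^sup>2 * \<bar>p\<bar>"
      using that by (intro mult_right_mono mult_left_mono L_nonneg) (auto simp: abs_le_square_iff[symmetric])
    finally show ?thesis .
  qed
  have "\<bar>g' v * (P - Q)\<bar> \<le> L * \<bar>P - Q\<bar>" unfolding abs_mult by (intro mult_right_mono g) auto
  moreover have "\<bar>(g vc - g v) / p - g' v * P\<bar> \<le> L * A\<^sup>2 * \<bar>p\<bar>" "\<bar>(g vd - g v) / q - g' v * Q\<bar> \<le> L * A\<^sup>2 * \<bar>q\<bar>"
    using *[OF v(3) PQ(1)] *[OF v(4) PQ(2)] by (simp_all only: v)
  ultimately show ?thesis unfolding right_diff_distrib distrib_left by linarith
qed

text \<open>The argument of \<open>D_bounded\<close> one order higher. Datum and kernel now enter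
  through differences of divided differences, of size \<open>\<epsilon>\<close>, and the
  \<open>\<gamma>\<close> terms through \<open>quotient_diff_le\<close>, which returns the unknown
  difference with factor \<open>L\<close> plus a quadratic remainder. \<open>D_bounded\<close>
  controls that remainder.\<close>

lemma D_cauchy:
  obtains A where "A \<ge> 0" "\<And>c d t x. c \<in> {1/2..3/2} \<Longrightarrow> c \<noteq> 1 \<Longrightarrow> d \<in> {1/2..3/2} \<Longrightarrow> d \<noteq> 1 \<Longrightarrow> t \<in> {0..T} \<Longrightarrow> x \<in> {0..1} \<Longrightarrow>
    \<bar>D c t x - D d t x\<bar> \<le> A * (\<bar>c - 1\<bar> + \<bar>d - 1\<bar>)"
proof -
  obtain \<Gamma> where \<Gamma>: "\<Gamma> \<ge> 0" "\<And>s m. s \<in> {0..2*T} \<Longrightarrow> (\<Sum>n<m. mode_weight n * \<bar>source_coef n (Y s)\<bar>) \<le> \<Gamma>"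
    using source_coef_weighted_bound by blast
  obtain \<kappa>' where \<kappa>': "\<kappa>' \<ge> 1" "16 * T powr (1/16) * \<kappa>' powr (-1/16) \<le> 1"
    "source_const * L * (16 * T powr (1/16) * \<kappa>' powr (-1/16)) \<le> 1/2" using weight_obtain by blast
  obtain B where B: "B \<ge> 0" "\<And>c t x. c \<in> {1/2..3/2} \<Longrightarrow> c \<noteq> 1 \<Longrightarrow> t \<in> {0..T} \<Longrightarrow> x \<in> {0..1} \<Longrightarrow> \<bar>D c t x\<bar> \<le> B"
    using D_bounded by blast
  define S where "S = 16 * T powr (1/16) * \<kappa>' powr (-1/16)"
  have E00: "E0 \<ge> 0" using u_energy[of 0] by simp
  have S: "0 \<le> S" "S \<le> 1" "source_const * L * S \<le> 1/2" using \<kappa>' by (auto simp: S_def)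
  define a where "a = 104 * (weight_sum * sqrt E0) + 456 * \<Gamma> + 456 * (source_const * (L * B)) + source_const * (L * B\<^sup>2)"
  have a: "a \<ge> 0" using \<Gamma> weight_sum_nonneg E00 source_const_nonneg L_nonneg B by (simp add: a_def)
  have e1: "1 \<le> exp (\<kappa>' * t)" if "t \<ge> 0" for t using that \<kappa>' by simp
  have main: "\<bar>D c (fst p) (snd p) - D d (fst p) (snd p)\<bar> \<le> 2 * (a * (\<bar>c - 1\<bar> + \<bar>d - 1\<bar>)) * exp (\<kappa>' * fst p)"
    if c: "c \<in> {1/2..3/2}" "c \<noteq> 1" and d: "d \<in> {1/2..3/2}" "d \<noteq> 1" and p: "p \<in> {0..T} \<times> {0..1}" for c d p
  proof -
    define \<epsilon> where "\<epsilon> = \<bar>c - 1\<bar> + \<bar>d - 1\<bar>"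
    have \<epsilon>: "\<epsilon> \<ge> 0" by (simp add: \<epsilon>_def)
    have a\<epsilon>: "a * \<epsilon> \<ge> 0" using a \<epsilon> by simp
    show ?thesis unfolding \<epsilon>_def[symmetric]
    proof (rule halving_bound[where Mb = "2 * B", OF _ _ _ a\<epsilon> _ p])
      fix p assume p: "p \<in> {0..T} \<times> {0..1::real}"
      have "\<bar>D c (fst p) (snd p) - D d (fst p) (snd p)\<bar> \<le> 2 * B"
        using B(2)[OF c, of "fst p" "snd p"] B(2)[OF d, of "fst p" "snd p"] p by auto
      also have "\<dots> \<le> 2 * B * exp (\<kappa>' * fst p)" using e1[of "fst p"] p mult_left_mono[of 1 "exp (\<kappa>' * fst p)" "2 * B"] B by auto
      finally show "\<bar>D c (fst p) (snd p) - D d (fst p) (snd p)\<bar> \<le> 2 * B * exp (\<kappa>' * fst p)" .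
    next
      fix \<delta> p assume \<delta>: "\<delta> \<ge> 0" "\<And>p. p \<in> {0..T} \<times> {0..1} \<Longrightarrow> \<bar>D c (fst p) (snd p) - D d (fst p) (snd p)\<bar> \<le> \<delta> * exp (\<kappa>' * fst p)"
        and p: "p \<in> {0..T} \<times> {0..1::real}"
      define t where "t = fst p"
      have t: "t \<in> {0..T}" using p by (auto simp: t_def)
      have cD: "continuous_on {0..1} (\<lambda>x. D c t x - D d t x)" by (intro continuous_intros D_slice c d t)
      show "\<bar>D c (fst p) (snd p) - D d (fst p) (snd p)\<bar> \<le> (a * \<epsilon> + \<delta> / 2) * exp (\<kappa>' * fst p)"
        unfolding t_def[symmetric]
      proof (rule abs_le_fsin_sum[OF cD])
        fix m
        have s1: "(\<Sum>n<m. \<bar>(diff_quot (heat_factor ((freq n)\<^sup>2 * t)) c - diff_quot (heat_factor ((freq n)\<^sup>2 * t)) d) * fsin n u\<bar>) \<le> 104 * \<epsilon> * (weight_sum * sqrt E0)"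
        proof -
          have "(\<Sum>n<m. \<bar>(diff_quot (heat_factor ((freq n)\<^sup>2 * t)) c - diff_quot (heat_factor ((freq n)\<^sup>2 * t)) d) * fsin n u\<bar>) \<le> (\<Sum>n<m. (104 * \<epsilon>) * \<bar>fsin n u\<bar>)"
            unfolding abs_mult
          proof (intro sum_mono mult_right_mono)
            fix n
            have X: "(freq n)\<^sup>2 * t \<ge> 0" using t by auto
            show "\<bar>diff_quot (heat_factor ((freq n)\<^sup>2 * t)) c - diff_quot (heat_factor ((freq n)\<^sup>2 * t)) d\<bar> \<le> 104 * \<epsilon>"
              using diff_quot_heat_factor(2)[OF X c] diff_quot_heat_factor(2)[OF X d] unfolding \<epsilon>_def distrib_left by linarith
          qed auto
          also have "\<dots> = 104 * \<epsilon> * (\<Sum>n<m. \<bar>fsin n u\<bar>)" by (simp add: sum_distrib_left)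
          also have "\<dots> \<le> 104 * \<epsilon> * (weight_sum * sqrt E0)" using \<epsilon> by (intro mult_left_mono sum_abs_u_le) auto
          finally show ?thesis .
        qed
        have s2: "(\<Sum>n<m. \<bar>integral {0..t} (\<lambda>s. (diff_quot (scaled_heat_factor ((freq n)\<^sup>2 * (t - s))) c - diff_quot (scaled_heat_factor ((freq n)\<^sup>2 * (t - s))) d) * source_coef n (Y (c * s)))\<bar>)
           \<le> (456 * \<epsilon>) * \<Gamma> * exp (\<kappa>' * t) * S" unfolding S_def
        proof (rule duhamel_sum_le[where k = "\<lambda>n \<tau>. diff_quot (scaled_heat_factor ((freq n)\<^sup>2 * \<tau>)) c - diff_quot (scaled_heat_factor ((freq n)\<^sup>2 * \<tau>)) d" and g = "\<lambda>n s. source_coef n (Y (c * s))"])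
          show "continuous_on {0..t} (\<lambda>\<tau>. diff_quot (scaled_heat_factor ((freq n)\<^sup>2 * \<tau>)) c - diff_quot (scaled_heat_factor ((freq n)\<^sup>2 * \<tau>)) d)" for n
            unfolding diff_quot_def scaled_heat_factor_def divide_inverse by (intro continuous_intros)
          show "\<bar>diff_quot (scaled_heat_factor ((freq n)\<^sup>2 * \<tau>)) c - diff_quot (scaled_heat_factor ((freq n)\<^sup>2 * \<tau>)) d\<bar> \<le> (456 * \<epsilon>) * mode_weight n * \<tau> powr (-7/8)" if "0 < \<tau>" for n \<tau>
          proof -
            have X: "(freq n)\<^sup>2 * \<tau> \<ge> 0" using that by auto
            have "\<bar>diff_quot (scaled_heat_factor ((freq n)\<^sup>2 * \<tau>)) c - diff_quot (scaled_heat_factor ((freq n)\<^sup>2 * \<tau>)) d\<bar> \<le> 114 * exp (- ((freq n)\<^sup>2 * \<tau> / 4)) * \<epsilon>"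
              using diff_quot_scaled_heat_factor(2)[OF X c] diff_quot_scaled_heat_factor(2)[OF X d] unfolding \<epsilon>_def distrib_left by linarith
            also have "\<dots> \<le> 114 * (4 * mode_weight n * \<tau> powr (-7/8)) * \<epsilon>"
              by (intro mult_right_mono mult_left_mono exp_quarter_le that \<epsilon>) auto
            finally show ?thesis by (simp add: mult_ac)
          qed
          fix m s assume s: "s \<in> {0..t}"
          have "(\<Sum>n<m. mode_weight n * \<bar>source_coef n (Y (c * s))\<bar>) \<le> \<Gamma> * 1" using \<Gamma>(2)[OF scaled_in[OF c(1)], of s m] s t by auto
          also have "\<dots> \<le> \<Gamma> * exp (\<kappa>' * s)" using \<Gamma>(1) e1[of s] s by (intro mult_left_mono) auto
          finally show "(\<Sum>n<m. mode_weight n * \<bar>source_coef n (Y (c * s))\<bar>) \<le> \<Gamma> * exp (\<kappa>' * s)" .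
        qed (use t \<kappa>' \<Gamma> c \<epsilon> in \<open>auto intro!: continuous_on_source_coef_scaled\<close>)
        have s3: "(\<Sum>n<m. \<bar>integral {0..t} (\<lambda>s. diff_quot (scaled_heat_factor ((freq n)\<^sup>2 * (t - s))) d * (source_coef n (Y (c * s)) - source_coef n (Y (d * s))))\<bar>)
           \<le> 456 * (source_const * (L * (B * \<epsilon>))) * exp (\<kappa>' * t) * S" unfolding S_def
        proof (rule duhamel_sum_le[where k = "\<lambda>n \<tau>. diff_quot (scaled_heat_factor ((freq n)\<^sup>2 * \<tau>)) d" and g = "\<lambda>n s. source_coef n (Y (c * s)) - source_coef n (Y (d * s))"])
          show "continuous_on {0..t} (\<lambda>\<tau>. diff_quot (scaled_heat_factor ((freq n)\<^sup>2 * \<tau>)) d)" for n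
            unfolding diff_quot_def scaled_heat_factor_def divide_inverse by (intro continuous_intros)
          show "\<bar>diff_quot (scaled_heat_factor ((freq n)\<^sup>2 * \<tau>)) d\<bar> \<le> 456 * mode_weight n * \<tau> powr (-7/8)" if "0 < \<tau>" for n \<tau>
            using diff_quot_scaled_heat_factor(1)[of "(freq n)\<^sup>2 * \<tau>", OF _ d] exp_quarter_le[OF that, of n] that by simp
          fix m s assume s: "s \<in> {0..t}"
          then have sT: "s \<in> {0..T}" using t by auto
          have "(\<Sum>n<m. mode_weight n * \<bar>source_coef n (Y (c * s)) - source_coef n (Y (d * s))\<bar>) \<le> source_const * (L * (B * \<epsilon>))"
          proof (rule source_coef_diff_weighted)
            fix x :: real assume x: "x \<in> {0..1}"
            have "Y (c * s) x - Y (d * s) x = (c - 1) * D c s x - (d - 1) * D d s x"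
              using c d by (simp add: D_def)
            also have "\<bar>\<dots>\<bar> \<le> \<bar>c - 1\<bar> * \<bar>D c s x\<bar> + \<bar>d - 1\<bar> * \<bar>D d s x\<bar>" by (simp flip: abs_mult)
            also have "\<dots> \<le> \<bar>c - 1\<bar> * B + \<bar>d - 1\<bar> * B" by (intro add_mono mult_left_mono B(2) c d sT x) auto
            finally show "\<bar>Y (c * s) x - Y (d * s) x\<bar> \<le> B * \<epsilon>" by (simp add: \<epsilon>_def algebra_simps)
          qed (use scaled_in[OF c(1) sT] scaled_in[OF d(1) sT] in \<open>auto intro: Y_slice\<close>)
          also have "\<dots> \<le> source_const * (L * (B * \<epsilon>)) * exp (\<kappa>' * s)"
            using e1[of s] s source_const_nonneg L_nonneg B(1) \<epsilon> mult_left_mono[of 1 "exp (\<kappa>' * s)" "source_const * (L * (B * \<epsilon>))"] by auto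
          finally show "(\<Sum>n<m. mode_weight n * \<bar>source_coef n (Y (c * s)) - source_coef n (Y (d * s))\<bar>) \<le> source_const * (L * (B * \<epsilon>)) * exp (\<kappa>' * s)" .
        qed (use t \<kappa>' source_const_nonneg L_nonneg B(1) c d \<epsilon> in \<open>auto intro!: continuous_on_source_coef_scaled continuous_on_diff\<close>)
        have s4: "(\<Sum>n<m. \<bar>integral {0..t} (\<lambda>s. exp (- (1 * (freq n)\<^sup>2 * (t - s))) * (\<gamma> c n s - \<gamma> d n s))\<bar>) \<le> 1 * (source_const * (L * \<delta> + L * B\<^sup>2 * \<epsilon>)) * exp (\<kappa>' * t) * S"
          unfolding S_def
        proof (rule duhamel_sum_le[where k = "\<lambda>n \<tau>. exp (- (1 * (freq n)\<^sup>2 * \<tau>))" and g = "\<lambda>n s. \<gamma> c n s - \<gamma> d n s"])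
          show "\<bar>exp (- (1 * (freq n)\<^sup>2 * \<tau>))\<bar> \<le> 1 * mode_weight n * \<tau> powr (-7/8)" if "0 < \<tau>" for n \<tau>
            using exp_freq_le[OF that, of 1 n] by simp
          fix m s assume s: "s \<in> {0..t}"
          then have sT: "s \<in> {0..T}" using t by auto
          have Ys: "continuous_on {0..1} (Y (c * s))" "continuous_on {0..1} (Y (d * s))" "continuous_on {0..1} (Y s)"
            using scaled_in[OF c(1) sT] scaled_in[OF d(1) sT] sT by (auto intro: Y_slice)
          define F where "F g x = (g (Y (c * s) x) - g (Y s x)) / (c - 1) - (g (Y (d * s) x) - g (Y s x)) / (d - 1)" for g :: "real \<Rightarrow> real" and x
          have \<gamma>: "\<gamma> c n s - \<gamma> d n s = freq n * fcos n (F f) + fsin n (F r)" for n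
          proof -
            have ca: "continuous_on {0..1} (\<lambda>x. (f (Y (c * s) x) - f (Y s x)) / (c - 1))" "continuous_on {0..1} (\<lambda>x. (f (Y (d * s) x) - f (Y s x)) / (d - 1))"
              "continuous_on {0..1} (\<lambda>x. (r (Y (c * s) x) - r (Y s x)) / (c - 1))" "continuous_on {0..1} (\<lambda>x. (r (Y (d * s) x) - r (Y s x)) / (d - 1))"
              unfolding divide_inverse by (intro continuous_intros cont_compose Ys)+
            show ?thesis unfolding \<gamma>_eq[OF c(1) sT] \<gamma>_eq[OF d(1) sT] F_def fcos_diff[OF ca(1,2)] fsin_diff[OF ca(3,4)]
              by (simp add: algebra_simps)
          qed
          have "(\<Sum>n<m. mode_weight n * \<bar>\<gamma> c n s - \<gamma> d n s\<bar>) \<le> source_const * (L * (\<delta> * exp (\<kappa>' * s)) + L * B\<^sup>2 * \<epsilon>)"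
            unfolding \<gamma> source_const_def
          proof (rule weighted_source_le)
            show "continuous_on {0..1} (F f)" "continuous_on {0..1} (F r)"
              unfolding F_def divide_inverse by (intro continuous_intros cont_compose Ys)+
            fix x :: real assume x: "x \<in> {0..1}"
            have v: "Y (c * s) x = Y s x + (c - 1) * D c s x" "Y (d * s) x = Y s x + (d - 1) * D d s x" "c - 1 \<noteq> 0" "d - 1 \<noteq> 0"
              using c d by (simp_all add: D_def)
            have *: "L * \<bar>D c s x - D d s x\<bar> \<le> L * (\<delta> * exp (\<kappa>' * s))" using \<delta>(2)[of "(s,x)"] sT x L_nonneg by (intro mult_left_mono) auto
            show "\<bar>F f x\<bar> \<le> L * (\<delta> * exp (\<kappa>' * s)) + L * B\<^sup>2 * \<epsilon>"
              using * quotient_diff_le[OF f_taylor f'_le v B(2)[OF c sT x] B(2)[OF d sT x]] unfolding F_def \<epsilon>_def by linarith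
            show "\<bar>F r x\<bar> \<le> L * (\<delta> * exp (\<kappa>' * s)) + L * B\<^sup>2 * \<epsilon>"
              using * quotient_diff_le[OF r_taylor r'_le v B(2)[OF c sT x] B(2)[OF d sT x]] unfolding F_def \<epsilon>_def by linarith
          qed
          also have "\<dots> \<le> source_const * (L * (\<delta> * exp (\<kappa>' * s)) + L * B\<^sup>2 * \<epsilon> * exp (\<kappa>' * s))"
            using e1[of s] s source_const_nonneg L_nonneg \<epsilon> mult_left_mono[of 1 "exp (\<kappa>' * s)" "L * B\<^sup>2 * \<epsilon>"] by (intro mult_left_mono add_left_mono) auto
          finally show "(\<Sum>n<m. mode_weight n * \<bar>\<gamma> c n s - \<gamma> d n s\<bar>) \<le> source_const * (L * \<delta> + L * B\<^sup>2 * \<epsilon>) * exp (\<kappa>' * s)" by (simp add: algebra_simps)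
        qed (use t \<kappa>' \<delta> \<epsilon> source_const_nonneg L_nonneg c d continuous_on_\<gamma> in \<open>auto intro!: continuous_intros\<close>)
        \<comment> \<open>The product of kernel and source is split so that the kernel difference
          meets the source at \<open>c * s\<close>, and the kernel for \<open>d\<close> meets the
          difference of the sources.\<close>
        have dec: "fsin n (\<lambda>x. D c t x - D d t x) = (diff_quot (heat_factor ((freq n)\<^sup>2 * t)) c - diff_quot (heat_factor ((freq n)\<^sup>2 * t)) d) * fsin n u +
            integral {0..t} (\<lambda>s. (diff_quot (scaled_heat_factor ((freq n)\<^sup>2 * (t - s))) c - diff_quot (scaled_heat_factor ((freq n)\<^sup>2 * (t - s))) d) * source_coef n (Y (c * s))) +
            integral {0..t} (\<lambda>s. diff_quot (scaled_heat_factor ((freq n)\<^sup>2 * (t - s))) d * (source_coef n (Y (c * s)) - source_coef n (Y (d * s)))) +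
            integral {0..t} (\<lambda>s. exp (- (1 * (freq n)\<^sup>2 * (t - s))) * (\<gamma> c n s - \<gamma> d n s))" for n
        proof -
          note ic = integrable_continuous_interval
          have k: "continuous_on {0..t} (\<lambda>s. diff_quot (scaled_heat_factor ((freq n)\<^sup>2 * (t - s))) e)" for e
            unfolding diff_quot_def scaled_heat_factor_def divide_inverse by (intro continuous_intros)
          have cs: "continuous_on {0..t} (\<lambda>s. source_coef n (Y (c * s)))" "continuous_on {0..t} (\<lambda>s. source_coef n (Y (d * s)))"
            by (rule continuous_on_source_coef_scaled[OF _ t], rule c, rule continuous_on_source_coef_scaled[OF _ t], rule d)
          note cg = continuous_on_\<gamma>[OF c(1) t] continuous_on_\<gamma>[OF d(1) t]
          have 1: "integral {0..t} (\<lambda>s. (diff_quot (scaled_heat_factor ((freq n)\<^sup>2 * (t - s))) c - diff_quot (scaled_heat_factor ((freq n)\<^sup>2 * (t - s))) d) * source_coef n (Y (c * s))) =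
             integral {0..t} (\<lambda>s. diff_quot (scaled_heat_factor ((freq n)\<^sup>2 * (t - s))) c * source_coef n (Y (c * s))) - integral {0..t} (\<lambda>s. diff_quot (scaled_heat_factor ((freq n)\<^sup>2 * (t - s))) d * source_coef n (Y (c * s)))"
            unfolding left_diff_distrib by (rule integral_diff) (intro ic continuous_intros k cs)+
          have 2: "integral {0..t} (\<lambda>s. diff_quot (scaled_heat_factor ((freq n)\<^sup>2 * (t - s))) d * (source_coef n (Y (c * s)) - source_coef n (Y (d * s)))) =
             integral {0..t} (\<lambda>s. diff_quot (scaled_heat_factor ((freq n)\<^sup>2 * (t - s))) d * source_coef n (Y (c * s))) - integral {0..t} (\<lambda>s. diff_quot (scaled_heat_factor ((freq n)\<^sup>2 * (t - s))) d * source_coef n (Y (d * s)))"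
            unfolding right_diff_distrib[of "diff_quot _ _"] by (rule integral_diff) (intro ic continuous_intros k cs)+
          have 3: "integral {0..t} (\<lambda>s. exp (- (1 * (freq n)\<^sup>2 * (t - s))) * (\<gamma> c n s - \<gamma> d n s)) =
             integral {0..t} (\<lambda>s. exp (- (1 * (freq n)\<^sup>2 * (t - s))) * \<gamma> c n s) - integral {0..t} (\<lambda>s. exp (- (1 * (freq n)\<^sup>2 * (t - s))) * \<gamma> d n s)"
            unfolding right_diff_distrib[of "exp _"] by (rule integral_diff) (intro ic continuous_intros cg)+
          show ?thesis unfolding fsin_diff[OF D_slice[OF c(1) t] D_slice[OF d(1) t]] D_coef[OF c t] D_coef[OF d t] 1 2 3
            by (simp add: algebra_simps)
        qed
        have "(\<Sum>n<m. \<bar>fsin n (\<lambda>x. D c t x - D d t x)\<bar>) \<le>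
           (\<Sum>n<m. \<bar>(diff_quot (heat_factor ((freq n)\<^sup>2 * t)) c - diff_quot (heat_factor ((freq n)\<^sup>2 * t)) d) * fsin n u\<bar>) +
           (\<Sum>n<m. \<bar>integral {0..t} (\<lambda>s. (diff_quot (scaled_heat_factor ((freq n)\<^sup>2 * (t - s))) c - diff_quot (scaled_heat_factor ((freq n)\<^sup>2 * (t - s))) d) * source_coef n (Y (c * s)))\<bar>) +
           (\<Sum>n<m. \<bar>integral {0..t} (\<lambda>s. diff_quot (scaled_heat_factor ((freq n)\<^sup>2 * (t - s))) d * (source_coef n (Y (c * s)) - source_coef n (Y (d * s))))\<bar>) +
           (\<Sum>n<m. \<bar>integral {0..t} (\<lambda>s. exp (- (1 * (freq n)\<^sup>2 * (t - s))) * (\<gamma> c n s - \<gamma> d n s))\<bar>)"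
          unfolding dec sum.distrib[symmetric] by (intro sum_mono) linarith
        also have "\<dots> \<le> 104 * \<epsilon> * (weight_sum * sqrt E0) + (456 * \<epsilon>) * \<Gamma> * exp (\<kappa>' * t) * S + 456 * (source_const * (L * (B * \<epsilon>))) * exp (\<kappa>' * t) * S
            + 1 * (source_const * (L * \<delta> + L * B\<^sup>2 * \<epsilon>)) * exp (\<kappa>' * t) * S"
          by (intro add_mono s1 s2 s3 s4)
        also have "\<dots> = 104 * \<epsilon> * (weight_sum * sqrt E0) * 1 + ((456 * \<epsilon>) * \<Gamma> + 456 * (source_const * (L * (B * \<epsilon>))) + source_const * (L * B\<^sup>2 * \<epsilon>)) * exp (\<kappa>' * t) * S
            + (source_const * L * S) * (\<delta> * exp (\<kappa>' * t))"
          by (simp add: algebra_simps)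
        also have "\<dots> \<le> 104 * \<epsilon> * (weight_sum * sqrt E0) * exp (\<kappa>' * t) + ((456 * \<epsilon>) * \<Gamma> + 456 * (source_const * (L * (B * \<epsilon>))) + source_const * (L * B\<^sup>2 * \<epsilon>)) * exp (\<kappa>' * t) * 1
            + 1/2 * (\<delta> * exp (\<kappa>' * t))"
          using S \<delta>(1) \<Gamma>(1) e1[of t] t weight_sum_nonneg E00 \<epsilon> source_const_nonneg L_nonneg B(1)
          by (intro add_mono mult_left_mono mult_right_mono S) (auto intro!: mult_nonneg_nonneg add_nonneg_nonneg)
        also have "\<dots> = (a * \<epsilon> + \<delta> / 2) * exp (\<kappa>' * t)" by (simp add: a_def algebra_simps)
        finally show "(\<Sum>n<m. \<bar>fsin n (\<lambda>x. D c t x - D d t x)\<bar>) \<le> (a * \<epsilon> + \<delta> / 2) * exp (\<kappa>' * t)" .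
      qed (use p in auto)
    qed (use B(1) in auto)
  qed
  show ?thesis
  proof (rule that[of "2 * a * exp (\<kappa>' * T)"])
    fix c d t x :: real assume *: "c \<in> {1/2..3/2}" "c \<noteq> 1" "d \<in> {1/2..3/2}" "d \<noteq> 1" "t \<in> {0..T}" "x \<in> {0..1::real}"
    have "\<bar>D c t x - D d t x\<bar> \<le> 2 * (a * (\<bar>c - 1\<bar> + \<bar>d - 1\<bar>)) * exp (\<kappa>' * t)" using main[of c d "(t,x)"] * by simp
    also have "\<dots> \<le> 2 * (a * (\<bar>c - 1\<bar> + \<bar>d - 1\<bar>)) * exp (\<kappa>' * T)" using a * \<kappa>' by (intro mult_left_mono) auto
    finally show "\<bar>D c t x - D d t x\<bar> \<le> 2 * a * exp (\<kappa>' * T) * (\<bar>c - 1\<bar> + \<bar>d - 1\<bar>)" by (simp add: algebra_simps)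
  qed (use a in simp)
qed

lemma scaling_derivative_exists:
  obtains Z A where "jointly_cont T Z" "A \<ge> 0" "\<And>c t x. c \<in> {1/2..3/2} \<Longrightarrow> c \<noteq> 1 \<Longrightarrow> t \<in> {0..T} \<Longrightarrow> x \<in> {0..1} \<Longrightarrow>
    \<bar>D c t x - Z t x\<bar> \<le> A * \<bar>c - 1\<bar>"
proof -
  obtain A where A: "A \<ge> 0" "\<And>c d t x. c \<in> {1/2..3/2} \<Longrightarrow> c \<noteq> 1 \<Longrightarrow> d \<in> {1/2..3/2} \<Longrightarrow> d \<noteq> 1 \<Longrightarrow> t \<in> {0..T} \<Longrightarrow> x \<in> {0..1} \<Longrightarrow>
    \<bar>D c t x - D d t x\<bar> \<le> A * (\<bar>c - 1\<bar> + \<bar>d - 1\<bar>)" using D_cauchy by blast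
  define e where "e k = 1 / (real k + 2)" for k
  have e: "1 + e k \<in> {1/2..3/2}" "1 + e k \<noteq> 1" "e k > 0" for k by (auto simp: e_def field_simps)
  have e0: "e \<longlonglongrightarrow> 0"
  proof -
    have "(\<lambda>k. 1 / real (k + 2)) \<longlonglongrightarrow> 0" by (rule LIMSEQ_ignore_initial_segment[OF lim_1_over_n])
    then show ?thesis unfolding e_def by (simp only: of_nat_add of_nat_numeral)
  qed
  define Z where "Z t x = lim (\<lambda>k. D (1 + e k) t x)" for t x
  have lim: "(\<lambda>k. D (1 + e k) t x) \<longlonglongrightarrow> Z t x" if tx: "t \<in> {0..T}" "x \<in> {0..1}" for t x
  proof -
    have "Cauchy (\<lambda>k. D (1 + e k) t x)"
    proof (rule metric_CauchyI)
      fix \<epsilon> :: real assume \<epsilon>: "\<epsilon> > 0"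
      have "(\<lambda>k. A * (2 * e k)) \<longlonglongrightarrow> A * (2 * 0)" by (intro tendsto_intros e0)
      then have "\<forall>\<^sub>F k in sequentially. A * (2 * e k) < \<epsilon>" using \<epsilon> by (intro order_tendstoD(2)) auto
      then obtain N where N: "A * (2 * e k) < \<epsilon>" if "k \<ge> N" for k unfolding eventually_sequentially by blast
      have mono: "e k \<le> e N" if "k \<ge> N" for k using that by (auto simp: e_def intro!: divide_left_mono)
      show "\<exists>M. \<forall>m\<ge>M. \<forall>n\<ge>M. dist (D (1 + e m) t x) (D (1 + e n) t x) < \<epsilon>"
      proof (intro exI[of _ N] allI impI)
        fix m n assume mn: "N \<le> m" "N \<le> n"
        have "\<bar>D (1 + e m) t x - D (1 + e n) t x\<bar> \<le> A * (\<bar>1 + e m - 1\<bar> + \<bar>1 + e n - 1\<bar>)"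
          by (rule A(2)[OF e(1,2) e(1,2) tx])
        also have "\<dots> \<le> A * (2 * e N)" using mono[OF mn(1)] mono[OF mn(2)] e(3)[of m] e(3)[of n] by (intro mult_left_mono A(1)) auto
        finally show "dist (D (1 + e m) t x) (D (1 + e n) t x) < \<epsilon>" using N[of N] by (simp add: dist_real_def)
      qed
    qed
    then show ?thesis unfolding Z_def by (simp add: Cauchy_convergent_iff convergent_LIMSEQ_iff)
  qed
  have bound: "\<bar>D c t x - Z t x\<bar> \<le> A * \<bar>c - 1\<bar>" if c: "c \<in> {1/2..3/2}" "c \<noteq> 1" and tx: "t \<in> {0..T}" "x \<in> {0..1}" for c t x
  proof (rule LIMSEQ_le)
    show "(\<lambda>k. \<bar>D c t x - D (1 + e k) t x\<bar>) \<longlonglongrightarrow> \<bar>D c t x - Z t x\<bar>" by (intro tendsto_intros lim tx)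
    have "(\<lambda>k. A * (\<bar>c - 1\<bar> + \<bar>e k\<bar>)) \<longlonglongrightarrow> A * (\<bar>c - 1\<bar> + \<bar>0\<bar>)" by (intro tendsto_intros e0)
    then show "(\<lambda>k. A * (\<bar>c - 1\<bar> + \<bar>e k\<bar>)) \<longlonglongrightarrow> A * \<bar>c - 1\<bar>" by simp
    show "\<exists>N. \<forall>n\<ge>N. \<bar>D c t x - D (1 + e n) t x\<bar> \<le> A * (\<bar>c - 1\<bar> + \<bar>e n\<bar>)"
      using A(2)[OF c e(1,2) tx] by simp
  qed
  have "jointly_cont T Z" unfolding jointly_cont_def
  proof (rule uniform_limit_theorem[where f = "\<lambda>k p. D (1 + e k) (fst p) (snd p)" and F = sequentially])
    show "\<forall>\<^sub>F k in sequentially. continuous_on ({0..T} \<times> {0..1}) (\<lambda>p. D (1 + e k) (fst p) (snd p))"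
      using D_jointly_cont[OF e(1)] by (simp add: jointly_cont_def)
    show "uniform_limit ({0..T} \<times> {0..1}) (\<lambda>k p. D (1 + e k) (fst p) (snd p)) (\<lambda>p. Z (fst p) (snd p)) sequentially"
    proof (rule uniform_limitI)
      fix \<epsilon> :: real assume \<epsilon>: "\<epsilon> > 0"
      have "(\<lambda>k. A * e k) \<longlonglongrightarrow> A * 0" by (intro tendsto_intros e0)
      then have "\<forall>\<^sub>F k in sequentially. A * e k < \<epsilon>" using \<epsilon> by (intro order_tendstoD(2)) auto
      then show "\<forall>\<^sub>F k in sequentially. \<forall>p\<in>{0..T} \<times> {0..1}. dist (D (1 + e k) (fst p) (snd p)) (Z (fst p) (snd p)) < \<epsilon>"
      proof eventually_elim
        case (elim k)
        show ?case
        proof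
          fix p assume "p \<in> {0..T} \<times> {0..1::real}"
          then have "\<bar>D (1 + e k) (fst p) (snd p) - Z (fst p) (snd p)\<bar> \<le> A * \<bar>1 + e k - 1\<bar>"
            by (intro bound e) auto
          then show "dist (D (1 + e k) (fst p) (snd p)) (Z (fst p) (snd p)) < \<epsilon>" using elim e(3)[of k] by (simp add: dist_real_def)
        qed
      qed
    qed
  qed simp
  from that[OF this A(1) bound] show ?thesis by blast
qed

section \<open>Classical derivatives of the mild solution\<close>

lemma scaling_to_derivative:
  fixes g :: "real \<Rightarrow> real"
  assumes t: "t > 0" and A: "A \<ge> 0" and g: "\<And>c. c \<in> {1/2..3/2} \<Longrightarrow> c \<noteq> 1 \<Longrightarrow> \<bar>(g (c * t) - g t) / (c - 1) - z\<bar> \<le> A * \<bar>c - 1\<bar>"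
  shows "(g has_real_derivative z / t) (at t)"
  unfolding has_field_derivative_iff
proof (rule tendstoI)
  fix \<epsilon> :: real assume \<epsilon>: "\<epsilon> > 0"
  define d where "d = min (t / 2) (\<epsilon> * t\<^sup>2 / (A + 1))"
  have d: "d > 0" using t \<epsilon> A by (simp add: d_def)
  show "\<forall>\<^sub>F s in at t. dist ((g s - g t) / (s - t)) (z / t) < \<epsilon>"
    unfolding eventually_at
  proof (intro exI[of _ d] conjI ballI impI d)
    fix s assume s: "s \<noteq> t \<and> dist s t < d"
    define c where "c = s / t"
    have sc: "s = c * t" using t by (simp add: c_def)
    have c1: "\<bar>c - 1\<bar> = dist s t / t"
    proof -
      have "c - 1 = (s - t) / t" using t by (simp add: c_def field_simps)
      then show ?thesis using t by (simp add: dist_real_def abs_divide)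
    qed
    have c: "c \<in> {1/2..3/2}" "c \<noteq> 1"
    proof -
      have "\<bar>c - 1\<bar> \<le> (t / 2) / t" unfolding c1 using s t by (intro divide_right_mono) (auto simp: d_def)
      then have "\<bar>c - 1\<bar> \<le> 1/2" using t by simp
      then show "c \<in> {1/2..3/2}" unfolding abs_le_iff by auto
      show "c \<noteq> 1" using s t by (auto simp: c_def)
    qed
    have "(g s - g t) / (s - t) - z / t = ((g (c * t) - g t) / (c - 1) - z) / t"
      using t c by (simp add: sc field_simps)
    then have "dist ((g s - g t) / (s - t)) (z / t) = \<bar>(g (c * t) - g t) / (c - 1) - z\<bar> / t"
      using t by (simp add: dist_real_def)
    also have "\<dots> \<le> A * \<bar>c - 1\<bar> / t" using t by (intro divide_right_mono g c) auto
    also have "\<dots> \<le> (A + 1) * \<bar>c - 1\<bar> / t" using t by (intro divide_right_mono mult_right_mono) auto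
    also have "\<dots> = (A + 1) * (dist s t / t\<^sup>2)" unfolding c1 by (simp add: power2_eq_square)
    also have "\<dots> < (A + 1) * (\<epsilon> * t\<^sup>2 / (A + 1) / t\<^sup>2)"
      using s t A by (intro mult_strict_left_mono divide_strict_right_mono) (auto simp: d_def)
    also have "\<dots> = \<epsilon>" using t A by simp
    finally show "dist ((g s - g t) / (s - t)) (z / t) < \<epsilon>" .
  qed
qed

lemma mild_coef_derivative:
  assumes t: "t \<in> {0<..<2*T}"
  shows "(mild_coef u Y n has_real_derivative (source_coef n (Y t) - (freq n)\<^sup>2 * mild_coef u Y n t)) (at t)"
proof -
  define l where "l = (freq n)\<^sup>2"
  define I where "I t = integral {0..t} (\<lambda>s. exp (l * s) * source_coef n (Y s))" for t
  have m: "mild_coef u Y n t = exp (- (l * t)) * (fsin n u + I t)" for t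
  proof -
    have "integral {0..t} (\<lambda>s. exp (- ((freq n)\<^sup>2 * (t - s))) * source_coef n (Y s)) = exp (- (l * t)) * I t"
    proof -
      have "(\<lambda>s. exp (- ((freq n)\<^sup>2 * (t - s))) * source_coef n (Y s)) = (\<lambda>s. exp (- (l * t)) * (exp (l * s) * source_coef n (Y s)))"
        by (rule ext) (simp add: l_def algebra_simps exp_diff exp_minus divide_inverse)
      then show ?thesis by (simp add: I_def)
    qed
    then show ?thesis by (simp add: mild_coef_def l_def algebra_simps)
  qed
  have "(I has_real_derivative exp (l * t) * source_coef n (Y t)) (at t within {0..2*T})"
    unfolding I_def by (rule integral_has_real_derivative) (use t in \<open>auto intro!: continuous_intros continuous_on_source_coef Y_jointly_cont\<close>)
  then have I: "(I has_real_derivative exp (l * t) * source_coef n (Y t)) (at t)"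
    using t by (simp add: at_within_Icc_at)
  have "((\<lambda>t. exp (- (l * t)) * (fsin n u + I t)) has_real_derivative
      (source_coef n (Y t) - l * (exp (- (l * t)) * (fsin n u + I t)))) (at t)"
    by (auto intro!: derivative_eq_intros I) (simp add: algebra_simps flip: exp_add)
  then show ?thesis unfolding m[abs_def] l_def[symmetric] by simp
qed

end

lemma deriv_le_of_lipschitz:
  fixes h :: "real \<Rightarrow> real"
  assumes x: "x \<in> {0..1}" and d: "(h has_real_derivative d) (at x within {0..1})"
    and lip: "\<And>y. y \<in> {0..1} \<Longrightarrow> \<bar>h y - h x\<bar> \<le> C * \<bar>y - x\<bar>"
  shows "\<bar>d\<bar> \<le> C"
proof (rule tendsto_upperbound)
  show "((\<lambda>y. \<bar>(h y - h x) / (y - x)\<bar>) \<longlongrightarrow> \<bar>d\<bar>) (at x within {0..1})"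
    using d unfolding has_field_derivative_iff by (rule tendsto_rabs)
  show "\<forall>\<^sub>F y in at x within {0..1}. \<bar>(h y - h x) / (y - x)\<bar> \<le> C"
    unfolding eventually_at_filter
    by (rule always_eventually) (auto simp: abs_divide divide_le_eq lip)
  show "at x within {0..1} \<noteq> bot"
    using x by (simp add: trivial_limit_within islimpt_Icc)
qed

text \<open>Time is the first argument. The majorant of the sine coefficients in the last clause gives continuity in time with values in \<open>V\<close>.\<close>

definition classical_sol :: "(real \<Rightarrow> real) \<Rightarrow> (real \<Rightarrow> real) \<Rightarrow> (real \<Rightarrow> real) \<Rightarrow> real \<Rightarrow> real \<Rightarrow> (real \<Rightarrow> real) \<Rightarrow>
    (real \<Rightarrow> real \<Rightarrow> real) \<Rightarrow> (real \<Rightarrow> real \<Rightarrow> real) \<Rightarrow> (real \<Rightarrow> real \<Rightarrow> real) \<Rightarrow> bool" where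
  "classical_sol f f' r T k u Y yt yx \<longleftrightarrow>
     continuous_on ({0..T} \<times> {0..1}) (\<lambda>p. Y (fst p) (snd p)) \<and>
     (\<forall>x\<in>{0..1}. Y 0 x = u x) \<and> (\<forall>t\<in>{0..T}. Y t 0 = 0 \<and> Y t 1 = 0) \<and>
     continuous_on ({0<..T} \<times> {0..1}) (\<lambda>p. yt (fst p) (snd p)) \<and>
     (\<forall>t\<in>{0<..T}. \<forall>x\<in>{0..1}.
        ((\<lambda>s. Y s x) has_real_derivative yt t x) (at t within {0..T}) \<and>
        (Y t has_real_derivative yx t x) (at x within {0..1}) \<and>
        (yx t has_real_derivative yt t x + f' (Y t x) * yx t x - r (Y t x)) (at x within {0..1}) \<and>
        \<bar>yx t x\<bar> \<le> k * (t powr (-7/8) + 1)) \<and>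
     (\<exists>M. summable (\<lambda>n. (freq n * M n)\<^sup>2) \<and> (\<forall>t\<in>{0..T}. \<forall>n. \<bar>fsin n (Y t)\<bar> \<le> M n))"

context mild_solution begin

text \<open>Absolute sums of \<open>freq n\<close> times the coefficients bound the gradient in the
  maximum norm. The datum costs \<open>t powr (-7/8)\<close>, an integrable singularity and
  therefore affordable in the comparison argument; the Duhamel part stays bounded because the source
  is square summable by \<open>source_coef_energy\<close>.\<close>

lemma freq_mild_coef_sum_le:
  assumes t: "t \<in> {0<..T}"
  shows "(\<Sum>n<m. freq n * \<bar>mild_coef u Y n t\<bar>) \<le> weight_sum * sqrt E0 * t powr (-7/8) +
    (pi * (weight_sum * sqrt (energy_const * (1 + K)))) * exp (\<kappa> * T) * (16 * T powr (1/16) * \<kappa> powr (-1/16))"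
proof -
  have t0: "0 \<le> t" "t \<le> T" "0 < t" using t by auto
  have E00: "E0 \<ge> 0" using u_energy[of 0] by simp
  have 1: "(\<Sum>n<m. freq n * \<bar>exp (- ((freq n)\<^sup>2 * t)) * fsin n u\<bar>) \<le> weight_sum * sqrt E0 * t powr (-7/8)"
  proof -
    have "(\<Sum>n<m. freq n * \<bar>exp (- ((freq n)\<^sup>2 * t)) * fsin n u\<bar>) \<le> (\<Sum>n<m. t powr (-7/8) * (real (Suc n) powr (-3/4) * \<bar>freq n * fsin n u\<bar>))"
    proof (intro sum_mono)
      fix n
      have "exp (- ((freq n)\<^sup>2 * t)) \<le> mode_weight n * t powr (-7/8)" using exp_freq_le[OF t0(3), of 1 n] by simp
      also have "\<dots> \<le> real (Suc n) powr (-3/4) * t powr (-7/8)" by (intro mult_right_mono mode_weight_le) auto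
      finally have "exp (- ((freq n)\<^sup>2 * t)) * \<bar>freq n * fsin n u\<bar> \<le> real (Suc n) powr (-3/4) * t powr (-7/8) * \<bar>freq n * fsin n u\<bar>"
        by (rule mult_right_mono) auto
      then show "freq n * \<bar>exp (- ((freq n)\<^sup>2 * t)) * fsin n u\<bar> \<le> t powr (-7/8) * (real (Suc n) powr (-3/4) * \<bar>freq n * fsin n u\<bar>)"
        by (simp add: abs_mult mult_ac)
    qed
    also have "\<dots> = t powr (-7/8) * (\<Sum>n<m. real (Suc n) powr (-3/4) * \<bar>freq n * fsin n u\<bar>)" by (simp add: sum_distrib_left)
    also have "\<dots> \<le> t powr (-7/8) * (weight_sum * sqrt (\<Sum>n<m. (freq n * fsin n u)\<^sup>2))" by (intro mult_left_mono sum_weighted_le) auto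
    also have "\<dots> \<le> t powr (-7/8) * (weight_sum * sqrt E0)" by (intro mult_left_mono real_sqrt_le_mono u_energy weight_sum_nonneg) auto
    finally show ?thesis by (simp add: mult_ac)
  qed
  have sc: "continuous_on {0..t} (\<lambda>s. source_coef n (Y s))" for n
    by (rule continuous_on_subset[OF continuous_on_source_coef[OF Y_jointly_cont]]) (use t0 in auto)
  have 2: "(\<Sum>n<m. \<bar>integral {0..t} (\<lambda>s. exp (- (1 * (freq n)\<^sup>2 * (t - s))) * (freq n * source_coef n (Y s)))\<bar>)
     \<le> 1 * (pi * (weight_sum * sqrt (energy_const * (1 + K)))) * exp (\<kappa> * t) * (16 * T powr (1/16) * \<kappa> powr (-1/16))"
  proof (rule duhamel_sum_le[where k = "\<lambda>n \<tau>. exp (- (1 * (freq n)\<^sup>2 * \<tau>))" and g = "\<lambda>n s. freq n * source_coef n (Y s)"])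
    show "\<bar>exp (- (1 * (freq n)\<^sup>2 * \<tau>))\<bar> \<le> 1 * mode_weight n * \<tau> powr (-7/8)" if "0 < \<tau>" for n \<tau>
      using exp_freq_le[OF that, of 1 n] by simp
    fix m s assume s: "s \<in> {0..t}"
    then have s2: "s \<in> {0..2*T}" using t0 by auto
    have es: "1 \<le> exp (\<kappa> * s)" using s \<kappa> by simp
    have "(\<Sum>n<m. mode_weight n * \<bar>freq n * source_coef n (Y s)\<bar>) = pi * (\<Sum>n<m. real (Suc n) powr (-3/4) * \<bar>source_coef n (Y s)\<bar>)"
      unfolding sum_distrib_left abs_mult mult.assoc[symmetric] by (simp add: mult.commute[of "mode_weight _"] freq_mode_weight del: of_nat_Suc)
    also have "\<dots> \<le> pi * (weight_sum * sqrt (\<Sum>n<m. (source_coef n (Y s))\<^sup>2))" by (intro mult_left_mono sum_weighted_le) auto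
    also have "\<dots> \<le> pi * (weight_sum * (sqrt (energy_const * (1 + K)) * exp (\<kappa> * s)))"
    proof -
      have "(\<Sum>n<m. (source_coef n (Y s))\<^sup>2) \<le> energy_const * (1 + K * exp (\<kappa> * s))"
        by (rule source_coef_energy) (use s2 admissible Y_slice in \<open>auto simp: admissible_def\<close>)
      also have "energy_const * (1 + K * exp (\<kappa> * s)) \<le> energy_const * (1 + K) * (exp (\<kappa> * s))\<^sup>2"
      proof -
        have e2: "exp (\<kappa> * s) \<le> (exp (\<kappa> * s))\<^sup>2" using es mult_left_mono[OF es, of "exp (\<kappa> * s)"] by (simp add: power2_eq_square)
        then have "1 + K * exp (\<kappa> * s) \<le> 1 * (exp (\<kappa> * s))\<^sup>2 + K * (exp (\<kappa> * s))\<^sup>2" using es K by (intro add_mono mult_left_mono) auto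
        then have "energy_const * (1 + K * exp (\<kappa> * s)) \<le> energy_const * (1 * (exp (\<kappa> * s))\<^sup>2 + K * (exp (\<kappa> * s))\<^sup>2)" by (intro mult_left_mono energy_const_nonneg)
        then show ?thesis by (simp add: algebra_simps)
      qed
      finally have "sqrt (\<Sum>n<m. (source_coef n (Y s))\<^sup>2) \<le> sqrt (energy_const * (1 + K) * (exp (\<kappa> * s))\<^sup>2)" by (rule real_sqrt_le_mono)
      also have "\<dots> = sqrt (energy_const * (1 + K)) * exp (\<kappa> * s)" by (simp add: real_sqrt_mult)
      finally show ?thesis by (intro mult_left_mono weight_sum_nonneg) auto
    qed
    finally show "(\<Sum>n<m. mode_weight n * \<bar>freq n * source_coef n (Y s)\<bar>) \<le> pi * (weight_sum * sqrt (energy_const * (1 + K))) * exp (\<kappa> * s)"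
      by (simp add: mult_ac)
  qed (use t0 \<kappa> K weight_sum_nonneg energy_const_nonneg in \<open>auto intro!: continuous_intros sc\<close>)
  have "(\<Sum>n<m. freq n * \<bar>mild_coef u Y n t\<bar>) \<le> (\<Sum>n<m. freq n * \<bar>exp (- ((freq n)\<^sup>2 * t)) * fsin n u\<bar>) +
    (\<Sum>n<m. \<bar>integral {0..t} (\<lambda>s. exp (- (1 * (freq n)\<^sup>2 * (t - s))) * (freq n * source_coef n (Y s)))\<bar>)"
    unfolding sum.distrib[symmetric]
  proof (intro sum_mono)
    fix n
    have i: "integral {0..t} (\<lambda>s. exp (- (1 * (freq n)\<^sup>2 * (t - s))) * (freq n * source_coef n (Y s))) = freq n * integral {0..t} (\<lambda>s. exp (- ((freq n)\<^sup>2 * (t - s))) * source_coef n (Y s))"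
      by (simp add: mult.left_commute)
    have "freq n * \<bar>a + b\<bar> \<le> freq n * \<bar>a\<bar> + \<bar>freq n * b\<bar>" for a b
      unfolding abs_mult using mult_left_mono[OF abs_triangle_ineq[of a b], of "freq n"] by (simp add: algebra_simps)
    then show "freq n * \<bar>mild_coef u Y n t\<bar> \<le> freq n * \<bar>exp (- ((freq n)\<^sup>2 * t)) * fsin n u\<bar> + \<bar>integral {0..t} (\<lambda>s. exp (- (1 * (freq n)\<^sup>2 * (t - s))) * (freq n * source_coef n (Y s)))\<bar>"
      unfolding i mild_coef_def .
  qed
  also have "\<dots> \<le> weight_sum * sqrt E0 * t powr (-7/8) + 1 * (pi * (weight_sum * sqrt (energy_const * (1 + K)))) * exp (\<kappa> * t) * (16 * T powr (1/16) * \<kappa> powr (-1/16))"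
    by (intro add_mono 1 2)
  also have "exp (\<kappa> * t) \<le> exp (\<kappa> * T)" using t0 \<kappa> by simp
  finally show ?thesis using weight_sum_nonneg energy_const_nonneg K by (simp add: mult_left_mono mult_right_mono)
qed

text \<open>A Lipschitz constant read off the series termwise. It becomes a bound on the space
  derivative once \<open>space_regularity\<close> has shown that the derivative exists.\<close>

lemma Y_lipschitz:
  assumes t: "t \<in> {0..2*T}" and b: "\<And>m. (\<Sum>n<m. freq n * \<bar>mild_coef u Y n t\<bar>) \<le> C" and x: "x \<in> {0..1}" "y \<in> {0..1}"
  shows "\<bar>Y t y - Y t x\<bar> \<le> C * \<bar>y - x\<bar>"
proof -
  have E: "(\<Sum>n<m. (freq n * fsin n (Y t))\<^sup>2) \<le> K * exp (\<kappa> * t)" for m using admissible t by (auto simp: admissible_def)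
  note s = summable_abs_of_energy(1)[OF E]
  have e: "Y t x = (\<Sum>n. fsin n (Y t) * sin (freq n * x))" if "x \<in> {0..1}" for x
    by (rule sine_series_expansion[OF Y_slice[OF t] s that])
  have sm: "summable (\<lambda>n. fsin n (Y t) * sin (freq n * x))" for x
  proof (rule summable_comparison_test[OF _ s])
    show "\<exists>N. \<forall>n\<ge>N. norm (fsin n (Y t) * sin (freq n * x)) \<le> \<bar>fsin n (Y t)\<bar>"
      using mult_left_mono[OF abs_sin_le_one, of "\<bar>fsin _ (Y t)\<bar>"] by (simp add: abs_mult)
  qed
  have sC: "summable (\<lambda>n. freq n * \<bar>fsin n (Y t)\<bar>)"
    by (rule bounded_imp_summable[of _ C]) (use b[of "Suc n" for n] mild[OF t] in \<open>simp_all add: lessThan_Suc_atMost\<close>)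
  have "Y t y - Y t x = (\<Sum>n. fsin n (Y t) * (sin (freq n * y) - sin (freq n * x)))"
    unfolding e[OF x(1)] e[OF x(2)] suminf_diff[OF sm sm] by (simp add: right_diff_distrib)
  also have "\<bar>\<dots>\<bar> \<le> (\<Sum>n. (freq n * \<bar>fsin n (Y t)\<bar>) * \<bar>y - x\<bar>)"
  proof -
    have "norm (fsin n (Y t) * (sin (freq n * y) - sin (freq n * x))) \<le> (freq n * \<bar>fsin n (Y t)\<bar>) * \<bar>y - x\<bar>" for n
      using mult_left_mono[OF abs_sin_freq_diff_le[of n y x], of "\<bar>fsin n (Y t)\<bar>"] by (simp add: abs_mult mult_ac)
    from norm_suminf_le[OF this summable_mult2[OF sC]] show ?thesis by simp
  qed
  also have "\<dots> = (\<Sum>n. freq n * \<bar>fsin n (Y t)\<bar>) * \<bar>y - x\<bar>" by (rule suminf_mult2[OF sC, symmetric])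
  also have "\<dots> \<le> C * \<bar>y - x\<bar>" by (intro mult_right_mono suminf_le_const sC) (use b mild[OF t] in auto)
  finally show ?thesis .
qed

text \<open>The weak equation for the sine coefficients determines \<open>Y t\<close> as the solution of an ordinary boundary value problem, which gives two space derivatives.\<close>

lemma space_regularity:
  assumes t: "t \<in> {0..2*T}" and z: "continuous_on {0..1} z"
    and eq: "\<And>n. fsin n z = source_coef n (Y t) - (freq n)\<^sup>2 * fsin n (Y t)"
  obtains yx where "\<And>x. x \<in> {0..1} \<Longrightarrow> (Y t has_real_derivative yx x) (at x within {0..1})"
    "\<And>x. x \<in> {0..1} \<Longrightarrow> (yx has_real_derivative z x + f' (Y t x) * yx x - r (Y t x)) (at x within {0..1})"
    "Y t 0 = 0" "Y t 1 = 0"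
proof -
  define q where "q x = z x - r (Y t x)" for x
  define Q where "Q x = integral {0..x} q" for x
  define F where "F x = f (Y t x)" for x
  define P where "P x = integral {0..x} (\<lambda>s. F s + Q s)" for x
  \<comment> \<open>The free constant of the first integration, which makes \<open>W\<close> vanish
    at 1 as it does at 0.\<close>
  define c where "c = - P 1"
  have qc: "continuous_on {0..1} q" unfolding q_def by (intro continuous_intros z cont_compose Y_slice t)
  have Fc: "continuous_on {0..1} F" unfolding F_def by (intro cont_compose Y_slice t)
  have Q': "(Q has_real_derivative q x) (at x within {0..1})" if "x \<in> {0..1}" for x
    unfolding Q_def by (rule integral_has_real_derivative[OF qc that])
  have Qc: "continuous_on {0..1} Q" using Q' by (rule DERIV_continuous_on)
  have P': "(P has_real_derivative F x + Q x) (at x within {0..1})" if "x \<in> {0..1}" for x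
    unfolding P_def by (rule integral_has_real_derivative) (use that Fc Qc in \<open>auto intro!: continuous_intros\<close>)
  define W where "W x = P x + c * x" for x
  have W': "(W has_real_derivative F x + Q x + c) (at x within {0..1})" if "x \<in> {0..1}" for x
    unfolding W_def using that by (auto intro!: derivative_eq_intros P')
  have W01: "W 0 = 0" "W 1 = 0" by (simp_all add: W_def P_def c_def)
  have Wc: "continuous_on {0..1} W" using W' by (rule DERIV_continuous_on)
  have fW: "fsin n W = fsin n (Y t)" for n
  proof -
    have c0: "fcos n (\<lambda>x. c) = 0"
      using fcos_eq_fsin_deriv[of "\<lambda>x. c" "\<lambda>x. 0" n] by (simp add: fsin_def)
    have "freq n * fsin n W = fcos n (\<lambda>x. F x + Q x + c)"
      by (rule fsin_eq_fcos_deriv[OF W' _ W01]) (auto intro!: continuous_intros Fc Qc)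
    also have "\<dots> = fcos n F + fcos n Q"
      using fcos_add[of "\<lambda>x. F x + Q x" "\<lambda>x. c" n] fcos_add[OF Fc Qc, of n] c0 Fc Qc by (simp add: continuous_on_add)
    finally have "freq n * (freq n * fsin n W) = freq n * fcos n F + freq n * fcos n Q" by (simp add: algebra_simps)
    also have "freq n * fcos n Q = - fsin n q" by (rule fcos_eq_fsin_deriv[OF Q' qc])
    also have "fsin n q = fsin n z - fsin n (\<lambda>x. r (Y t x))"
      unfolding q_def by (rule fsin_diff) (intro z cont_compose Y_slice t)+
    finally have "(freq n)\<^sup>2 * fsin n W = (freq n)\<^sup>2 * fsin n (Y t)"
      unfolding eq source_coef_def F_def by (simp add: power2_eq_square)
    then show ?thesis by simp
  qed
  have YW: "Y t x = W x" if "x \<in> {0..1}" for x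
  proof -
    have "Y t x - W x = 0"
      by (rule fsin_complete[OF _ _ that]) (intro continuous_intros Y_slice t Wc, simp only: fsin_diff[OF Y_slice[OF t] Wc] fW diff_self)
    then show ?thesis by simp
  qed
  have Y': "(Y t has_real_derivative F x + Q x + c) (at x within {0..1})" if "x \<in> {0..1}" for x
    by (rule has_field_derivative_transform_within[OF W'[OF that] zero_less_one that]) (simp add: YW)
  show ?thesis
  proof (rule that[OF Y'])
    fix x :: real assume x: "x \<in> {0..1}"
    show "((\<lambda>x. F x + Q x + c) has_real_derivative z x + f' (Y t x) * (F x + Q x + c) - r (Y t x)) (at x within {0..1})"
      unfolding F_def by (rule derivative_eq_intros DERIV_chain2[OF f_deriv] Y'[OF x, unfolded F_def] Q'[OF x] refl)+ (simp add: q_def)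
  qed (use YW W01 in auto)
qed

end

text \<open>Scaling supplies the candidate \<open>Z t x / t\<close> for the time derivative. Its
  coefficients are identified by computing the derivative of \<open>mild_coef u Y n\<close> twice,
  as the limit of scaling quotients and from the Duhamel formula; the resulting identity is the
  hypothesis of \<open>space_regularity\<close>.\<close>

lemma (in mild_solution) mild_classical:
  obtains yt yx where "classical_sol f f' r T (weight_sum * sqrt E0 +
    (pi * (weight_sum * sqrt (energy_const * (1 + K)))) * exp (\<kappa> * T) * (16 * T powr (1/16) * \<kappa> powr (-1/16))) (Y 0) Y yt yx"
proof -
  obtain Z A where Z: "jointly_cont T Z" "A \<ge> 0" "\<And>c t x. c \<in> {1/2..3/2} \<Longrightarrow> c \<noteq> 1 \<Longrightarrow> t \<in> {0..T} \<Longrightarrow> x \<in> {0..1} \<Longrightarrow>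
    \<bar>D c t x - Z t x\<bar> \<le> A * \<bar>c - 1\<bar>" using scaling_derivative_exists by blast
  define yt where "yt t x = Z t x / t" for t x
  define C1 where "C1 = weight_sum * sqrt E0"
  define C2 where "C2 = (pi * (weight_sum * sqrt (energy_const * (1 + K)))) * exp (\<kappa> * T) * (16 * T powr (1/16) * \<kappa> powr (-1/16))"
  have E00: "E0 \<ge> 0" using u_energy[of 0] by simp
  have C: "C1 \<ge> 0" "C2 \<ge> 0" using weight_sum_nonneg E00 energy_const_nonneg K by (auto simp: C1_def C2_def)
  have Yt: "((\<lambda>s. Y s x) has_real_derivative yt t x) (at t)" if "t \<in> {0<..T}" "x \<in> {0..1}" for t x
    unfolding yt_def by (rule scaling_to_derivative[OF _ Z(2)]) (use that Z(3) in \<open>auto simp: D_def\<close>)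
  have fZ: "fsin n (Z t) = t * (source_coef n (Y t) - (freq n)\<^sup>2 * fsin n (Y t))" if t: "t \<in> {0<..T}" for n t
  proof -
    have t2: "t \<in> {0<..<2*T}" "t \<in> {0..T}" "t \<in> {0..2*T}" using t T by auto
    have "(mild_coef u Y n has_real_derivative fsin n (Z t) / t) (at t)"
    proof (rule scaling_to_derivative[where A = "2 * A"])
      fix c :: real assume c: "c \<in> {1/2..3/2}" "c \<noteq> 1"
      have "(mild_coef u Y n (c * t) - mild_coef u Y n t) / (c - 1) = fsin n (D c t)"
      proof -
        have "D c t = (\<lambda>x. (1 / (c - 1)) * (Y (c * t) x - Y t x))" by (auto simp: D_def)
        then show ?thesis
          using fsin_diff[OF Y_slice Y_slice, of "c * t" t n] mild scaled_in[OF c(1) t2(2)] t2 by (simp only: fsin_cmult) simp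
      qed
      then have "(mild_coef u Y n (c * t) - mild_coef u Y n t) / (c - 1) - fsin n (Z t) = fsin n (\<lambda>x. D c t x - Z t x)"
        using fsin_diff[OF D_slice[OF c(1) t2(2)] jointly_cont_slice[OF Z(1) t2(2)], of n] by simp
      also have "\<bar>\<dots>\<bar> \<le> 2 * (A * \<bar>c - 1\<bar>)"
        by (intro abs_fsin_le continuous_intros D_slice c jointly_cont_slice[OF Z(1)] t2 Z(3))
      finally show "\<bar>(mild_coef u Y n (c * t) - mild_coef u Y n t) / (c - 1) - fsin n (Z t)\<bar> \<le> 2 * A * \<bar>c - 1\<bar>" by simp
    qed (use t Z(2) in auto)
    from DERIV_unique[OF this mild_coef_derivative[OF t2(1)]] show ?thesis
      using t mild[OF t2(3)] by (simp add: field_simps)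
  qed
  have ex: "\<exists>yx. (\<forall>x\<in>{0..1}. (Y t has_real_derivative yx x) (at x within {0..1}) \<and>
      (yx has_real_derivative yt t x + f' (Y t x) * yx x - r (Y t x)) (at x within {0..1}))" if t: "t \<in> {0<..T}" for t
  proof -
    have t2: "t \<in> {0..2*T}" "t \<in> {0..T}" using t T by auto
    have cz: "continuous_on {0..1} (yt t)" unfolding yt_def divide_inverse
      by (intro continuous_intros jointly_cont_slice[OF Z(1)] t2)
    have "yt t = (\<lambda>x. (1 / t) * Z t x)" by (auto simp: yt_def)
    then have "fsin n (yt t) = source_coef n (Y t) - (freq n)\<^sup>2 * fsin n (Y t)" for n
      using t by (simp only: fsin_cmult fZ[OF t]) simp
    then show ?thesis
    proof (rule space_regularity[OF t2(1) cz])
      fix g assume g: "\<And>x. x \<in> {0..1} \<Longrightarrow> (Y t has_real_derivative g x) (at x within {0..1})"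
        "\<And>x. x \<in> {0..1} \<Longrightarrow> (g has_real_derivative yt t x + f' (Y t x) * g x - r (Y t x)) (at x within {0..1})"
      show ?thesis by (intro exI[of _ g] ballI conjI g)
    qed
  qed
  have "\<exists>yx. \<forall>t\<in>{0<..T}. \<forall>x\<in>{0..1}. (Y t has_real_derivative yx t x) (at x within {0..1}) \<and>
      (yx t has_real_derivative yt t x + f' (Y t x) * yx t x - r (Y t x)) (at x within {0..1})"
    by (rule bchoice, rule ballI, rule ex)
  then obtain yx where yx: "\<And>t x. t \<in> {0<..T} \<Longrightarrow> x \<in> {0..1} \<Longrightarrow> (Y t has_real_derivative yx t x) (at x within {0..1}) \<and>
      (yx t has_real_derivative yt t x + f' (Y t x) * yx t x - r (Y t x)) (at x within {0..1})" by blast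
  have bnd: "\<bar>yx t x\<bar> \<le> (C1 + C2) * (t powr (-7/8) + 1)" if t: "t \<in> {0<..T}" and x: "x \<in> {0..1}" for t x
  proof -
    have t2: "t \<in> {0..2*T}" using t T by auto
    have "\<bar>yx t x\<bar> \<le> C1 * t powr (-7/8) + C2"
    proof (rule deriv_le_of_lipschitz[OF x])
      show "(Y t has_real_derivative yx t x) (at x within {0..1})" using yx[OF t x] by blast
      fix y :: real assume y: "y \<in> {0..1}"
      show "\<bar>Y t y - Y t x\<bar> \<le> (C1 * t powr (-7/8) + C2) * \<bar>y - x\<bar>"
        by (rule Y_lipschitz[OF t2 _ x y]) (use freq_mild_coef_sum_le[OF t] in \<open>simp add: C1_def C2_def\<close>)
    qed
    also have "\<dots> \<le> (C1 + C2) * (t powr (-7/8) + 1)" using C by (simp add: algebra_simps)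
    finally show ?thesis .
  qed
  have bd: "Y t 0 = 0 \<and> Y t 1 = 0" if "t \<in> {0..2*T}" for t
  proof -
    have E: "(\<Sum>n<m. (freq n * fsin n (Y t))\<^sup>2) \<le> K * exp (\<kappa> * t)" for m using admissible that by (auto simp: admissible_def)
    note e = sine_series_expansion[OF Y_slice[OF that] summable_abs_of_energy(1)[OF E]]
    show ?thesis using e[of 0] e[of 1] by simp
  qed
  obtain M where M: "summable (\<lambda>n. (freq n * M n)\<^sup>2)" "\<And>n t. t \<in> {0..2*T} \<Longrightarrow> \<bar>mild_coef u Y n t\<bar> \<le> M n"
    by (rule mild_coef_majorant[OF admissible u_energy K \<kappa>]) (use T in auto)
  have "classical_sol f f' r T (C1 + C2) (Y 0) Y yt yx"
    unfolding classical_sol_def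
  proof (intro conjI ballI)
    show "continuous_on ({0..T} \<times> {0..1}) (\<lambda>p. Y (fst p) (snd p))" using jointly_cont_T by (simp add: jointly_cont_def)
    have cZ: "continuous_on ({0<..T} \<times> {0..1}) (\<lambda>p. Z (fst p) (snd p))"
      by (rule continuous_on_subset[OF Z(1)[unfolded jointly_cont_def]]) auto
    show "continuous_on ({0<..T} \<times> {0..1}) (\<lambda>p. yt (fst p) (snd p))"
      unfolding yt_def by (intro continuous_intros cZ) auto
    show "\<exists>M. summable (\<lambda>n. (freq n * M n)\<^sup>2) \<and> (\<forall>t\<in>{0..T}. \<forall>n. \<bar>fsin n (Y t)\<bar> \<le> M n)"
      using M mild T by (intro exI[of _ M]) auto
    fix t x :: real assume tx: "t \<in> {0<..T}" "x \<in> {0..1}"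
    show "((\<lambda>s. Y s x) has_real_derivative yt t x) (at t within {0..T})"
      by (rule has_field_derivative_at_within[OF Yt[OF tx]])
    show "(Y t has_real_derivative yx t x) (at x within {0..1})"
      "(yx t has_real_derivative yt t x + f' (Y t x) * yx t x - r (Y t x)) (at x within {0..1})" using yx[OF tx] by auto
    show "\<bar>yx t x\<bar> \<le> (C1 + C2) * (t powr (-7/8) + 1)" by (rule bnd[OF tx])
  qed (use bd T in auto)
  then show ?thesis unfolding C1_def C2_def by (rule that)
qed

context smooth_nonlinearity begin

text \<open>The gradient constant \<open>k\<close> is fixed before \<open>u\<close>, so that one
  comparison constant will serve a whole ball of data.\<close>

theorem classical_solution_exists:
  assumes T: "T > 0" and E0: "E0 \<ge> 0"
  obtains k where "k \<ge> 0" "\<And>u. continuous_on {0..1} u \<Longrightarrow> (\<And>m. (\<Sum>n<m. (freq n * fsin n u)\<^sup>2) \<le> E0) \<Longrightarrow>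
    \<exists>Y yt yx. classical_sol f f' r T k u Y yt yx"
proof -
  have T2: "2 * T \<ge> 0" using T by simp
  obtain \<kappa> where \<kappa>: "\<kappa> > 0" "\<And>u. (\<And>m. (\<Sum>n<m. (freq n * fsin n u)\<^sup>2) \<le> E0) \<Longrightarrow>
     \<exists>Y. admissible (2 * T) (4 * E0 + 1) \<kappa> Y \<and> (\<forall>t\<in>{0..2*T}. \<forall>n. fsin n (Y t) = mild_coef u Y n t)"
    using mild_solution_exists[OF T2 E0] by blast
  define k where "k = weight_sum * sqrt E0 + (pi * (weight_sum * sqrt (energy_const * (1 + (4 * E0 + 1))))) * exp (\<kappa> * T) * (16 * T powr (1/16) * \<kappa> powr (-1/16))"
  show ?thesis
  proof (rule that[of k])
    show "k \<ge> 0" using weight_sum_nonneg E0 energy_const_nonneg by (auto simp: k_def intro!: add_nonneg_nonneg mult_nonneg_nonneg)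
    fix u :: "real \<Rightarrow> real" assume u: "continuous_on {0..1} u" "\<And>m. (\<Sum>n<m. (freq n * fsin n u)\<^sup>2) \<le> E0"
    obtain Y where Y: "admissible (2 * T) (4 * E0 + 1) \<kappa> Y" "\<And>t n. t \<in> {0..2*T} \<Longrightarrow> fsin n (Y t) = mild_coef u Y n t"
      using \<kappa>(2)[OF u(2)] by blast
    interpret mild_solution f f' r r' L u Y T "4 * E0 + 1" \<kappa> E0
      by unfold_locales (use T Y \<kappa>(1) E0 u in auto)
    obtain yt yx where c: "classical_sol f f' r T k (Y 0) Y yt yx" by (rule mild_classical[folded k_def]) (rule that)
    have "Y 0 x = u x" if "x \<in> {0..1}" for x
    proof -
      have Y0: "continuous_on {0..1} (Y 0)" by (rule Y_slice) (use T in auto)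
      have "fsin n (Y 0) = fsin n u" for n using Y(2)[of 0 n] T by (simp add: mild_coef_def)
      then have "fsin n (\<lambda>x. Y 0 x - u x) = 0" for n by (simp only: fsin_diff[OF Y0 u(1)] diff_self)
      then have "Y 0 x - u x = 0"
        by (rule fsin_complete[OF continuous_on_diff[OF Y0 u(1)] _ that])
      then show ?thesis by simp
    qed
    then have "classical_sol f f' r T k u Y yt yx" using c unfolding classical_sol_def by auto
    then show "\<exists>Y yt yx. classical_sol f f' r T k u Y yt yx" by blast
  qed
qed

end

section \<open>Maximum principle and a priori bounds\<close>

text \<open>A value above \<open>m\<close> pushes the maximum over the compact cylinder off the
  parabolic boundary. The maximum may be attained at the final time, so \<open>no_max\<close> may
  compare with earlier times only.\<close>

lemma parabolic_maximum:
  fixes W :: "real \<Rightarrow> real \<Rightarrow> real"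
  assumes cont: "continuous_on ({0..T} \<times> {0..1}) (\<lambda>p. W (fst p) (snd p))"
    and init: "\<And>x. x \<in> {0..1} \<Longrightarrow> W 0 x \<le> m" and bdry: "\<And>t. t \<in> {0..T} \<Longrightarrow> W t 0 \<le> m \<and> W t 1 \<le> m"
    and no_max: "\<And>t x. t \<in> {0<..T} \<Longrightarrow> x \<in> {0<..<1} \<Longrightarrow> W t x > m \<Longrightarrow> (\<And>\<xi>. \<xi> \<in> {0..1} \<Longrightarrow> W t \<xi> \<le> W t x) \<Longrightarrow>
      (\<And>s. s \<in> {0..t} \<Longrightarrow> W s x \<le> W t x) \<Longrightarrow> False"
    and t: "t \<in> {0..T}" and x: "x \<in> {0..1}"
  shows "W t x \<le> m"
proof (rule ccontr)
  assume "\<not> W t x \<le> m"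
  have "\<exists>p\<in>{0..T} \<times> {0..1}. \<forall>q\<in>{0..T} \<times> {0..1}. W (fst q) (snd q) \<le> W (fst p) (snd p)"
    by (rule continuous_attains_sup[OF compact_Times[OF compact_Icc compact_Icc] _ cont]) (use t x in auto)
  then obtain s y where sy: "s \<in> {0..T}" "y \<in> {0..1}" and max: "\<And>a b. a \<in> {0..T} \<Longrightarrow> b \<in> {0..1} \<Longrightarrow> W a b \<le> W s y" by fastforce
  have "W s y > m" using max[OF t x] \<open>\<not> W t x \<le> m\<close> by linarith
  moreover have "s \<noteq> 0" "y \<noteq> 0" "y \<noteq> 1" using init[OF sy(2)] bdry[OF sy(1)] calculation by auto
  ultimately show False using no_max[of s y] max sy by auto
qed

text \<open>The second derivative is given at \<open>x\<close> alone, without continuity. If it were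
  positive, \<open>h'\<close> would be positive just to the right of its zero \<open>x\<close>, and
  \<open>h\<close> would increase there.\<close>

lemma interior_max_derivs:
  fixes h :: "real \<Rightarrow> real"
  assumes x: "x \<in> {0<..<1}" and max: "\<And>\<xi>. \<xi> \<in> {0..1} \<Longrightarrow> h \<xi> \<le> h x"
    and d: "\<forall>\<^sub>F \<xi> in nhds x. (h has_real_derivative h' \<xi>) (at \<xi>)" and d2: "(h' has_real_derivative h2) (at x)"
  shows "h' x = 0" "h2 \<le> 0"
proof -
  define e where "e = min x (1 - x)"
  have e: "e > 0" using x by (auto simp: e_def)
  have dx: "(h has_real_derivative h' x) (at x)" using d by (rule eventually_nhds_x_imp_x)
  show h0: "h' x = 0"
    by (rule DERIV_local_max[OF dx e]) (auto simp: e_def intro!: max)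
  show "h2 \<le> 0"
  proof (rule ccontr)
    assume "\<not> h2 \<le> 0"
    then obtain r where r: "r > 0" "\<And>k. 0 < k \<Longrightarrow> k < r \<Longrightarrow> h' x < h' (x + k)" using DERIV_pos_inc_right[OF d2] by auto
    obtain s where s: "s > 0" "\<And>\<xi>. \<bar>\<xi> - x\<bar> < s \<Longrightarrow> (h has_real_derivative h' \<xi>) (at \<xi>)"
      using d unfolding eventually_nhds_metric dist_real_def by auto
    define k where "k = min e (min r s) / 2"
    have k: "0 < k" "k < e" "k < r" "k < s" using e r s by (auto simp: k_def)
    have "h x < h (x + k)"
    proof (rule DERIV_pos_imp_increasing_open[of x "x + k" h])
      show "\<exists>y. DERIV h z :> y \<and> 0 < y" if z: "x < z" "z < x + k" for z
      proof (intro exI conjI)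
        show "DERIV h z :> h' z" by (rule s(2)) (use z k in auto)
        show "0 < h' z" using r(2)[of "z - x"] z k h0 by auto
      qed
      show "continuous_on {x..x + k} h"
        by (intro continuous_at_imp_continuous_on ballI DERIV_isCont[OF s(2)]) (use k in auto)
    qed (use k in simp)
    moreover have "h (x + k) \<le> h x" by (rule max) (use k x in \<open>auto simp: e_def\<close>)
    ultimately show False by simp
  qed
qed

lemma deriv_nonneg_at_left_max:
  fixes h :: "real \<Rightarrow> real"
  assumes t: "t \<in> {0<..T}" and d: "(h has_real_derivative D) (at t within {0..T})" and max: "\<And>s. s \<in> {0..t} \<Longrightarrow> h s \<le> h t"
  shows "D \<ge> 0"
proof -
  have "(h has_real_derivative D) (at t within {0..t})" by (rule DERIV_subset[OF d]) (use t in auto)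
  then have "((\<lambda>s. (h s - h t) / (s - t)) \<longlongrightarrow> D) (at t within {0..t})" by (simp add: has_field_derivative_iff)
  then show ?thesis
  proof (rule tendsto_lowerbound)
    show "\<forall>\<^sub>F s in at t within {0..t}. 0 \<le> (h s - h t) / (s - t)"
      unfolding eventually_at_filter
      by (rule always_eventually) (use max in \<open>auto intro!: divide_nonpos_nonpos\<close>)
    show "at t within {0..t} \<noteq> bot" using t by (simp add: trivial_limit_within islimpt_Icc)
  qed
qed

text \<open>As in \<open>is_sol\<close>, nothing is assumed about the derivatives beyond their existence.\<close>

definition pointwise_sol :: "(real \<Rightarrow> real) \<Rightarrow> (real \<Rightarrow> real) \<Rightarrow> real \<Rightarrow> (real \<Rightarrow> real) \<Rightarrow> (real \<Rightarrow> real \<Rightarrow> real) \<Rightarrow> bool" where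
  "pointwise_sol f r T u Y \<longleftrightarrow>
     continuous_on ({0..T} \<times> {0..1}) (\<lambda>p. Y (fst p) (snd p)) \<and>
     (\<forall>x\<in>{0..1}. Y 0 x = u x) \<and> (\<forall>t\<in>{0..T}. Y t 0 = 0 \<and> Y t 1 = 0) \<and>
     (\<forall>t\<in>{0<..T}. \<forall>x\<in>{0<..<1}. \<exists>yt yx yxx fx.
        ((\<lambda>s. Y s x) has_real_derivative yt) (at t within {0..T}) \<and>
        (\<forall>\<^sub>F \<xi> in nhds x. (Y t has_real_derivative yx \<xi>) (at \<xi>)) \<and>
        (yx has_real_derivative yxx) (at x) \<and>
        ((\<lambda>\<xi>. f (Y t \<xi>)) has_real_derivative fx) (at x) \<and>
        yt + fx = yxx + r (Y t x))"

section \<open>Comparison of a pointwise solution with a classical one\<close>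

lemma eventually_nhds_unit: "x \<in> {0<..<1} \<Longrightarrow> \<forall>\<^sub>F \<xi> in nhds x. \<xi> \<in> {0<..<1::real}"
  by (rule eventually_nhds_in_open) auto

lemma classical_solD:
  assumes "classical_sol f f' r T k u Y yt yx"
  shows "continuous_on ({0..T} \<times> {0..1}) (\<lambda>p. Y (fst p) (snd p))"
    and "\<And>x. x \<in> {0..1} \<Longrightarrow> Y 0 x = u x" and "\<And>t. t \<in> {0..T} \<Longrightarrow> Y t 0 = 0" and "\<And>t. t \<in> {0..T} \<Longrightarrow> Y t 1 = 0"
    and "continuous_on ({0<..T} \<times> {0..1}) (\<lambda>p. yt (fst p) (snd p))"
    and "\<And>t x. t \<in> {0<..T} \<Longrightarrow> x \<in> {0..1} \<Longrightarrow> ((\<lambda>s. Y s x) has_real_derivative yt t x) (at t within {0..T})"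
    and "\<And>t x. t \<in> {0<..T} \<Longrightarrow> x \<in> {0..1} \<Longrightarrow> (Y t has_real_derivative yx t x) (at x within {0..1})"
    and "\<And>t x. t \<in> {0<..T} \<Longrightarrow> x \<in> {0..1} \<Longrightarrow> (yx t has_real_derivative yt t x + f' (Y t x) * yx t x - r (Y t x)) (at x within {0..1})"
    and "\<And>t x. t \<in> {0<..T} \<Longrightarrow> x \<in> {0..1} \<Longrightarrow> \<bar>yx t x\<bar> \<le> k * (t powr (-7/8) + 1)"
    and "\<exists>M. summable (\<lambda>n. (freq n * M n)\<^sup>2) \<and> (\<forall>t\<in>{0..T}. \<forall>n. \<bar>fsin n (Y t)\<bar> \<le> M n)"
  using assms unfolding classical_sol_def by blast+

lemma pointwise_solD:
  assumes "pointwise_sol f r T u Y"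
  shows "continuous_on ({0..T} \<times> {0..1}) (\<lambda>p. Y (fst p) (snd p))"
    and "\<And>x. x \<in> {0..1} \<Longrightarrow> Y 0 x = u x" and "\<And>t. t \<in> {0..T} \<Longrightarrow> Y t 0 = 0" and "\<And>t. t \<in> {0..T} \<Longrightarrow> Y t 1 = 0"
  using assms unfolding pointwise_sol_def by blast+

lemma classical_interior_deriv:
  assumes c: "classical_sol f f' r T k u Y yt yx" and t: "t \<in> {0<..T}" and x: "x \<in> {0<..<1}"
  shows "(Y t has_real_derivative yx t x) (at x)"
    and "(yx t has_real_derivative yt t x + f' (Y t x) * yx t x - r (Y t x)) (at x)"
  using classical_solD(7)[OF c t, of x] classical_solD(8)[OF c t, of x] x by (simp_all add: at_within_Icc_at)

lemma classical_imp_pointwise: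
  assumes f: "\<And>x. (f has_real_derivative f' x) (at x)" and c: "classical_sol f f' r T k u Y yt yx"
  shows "pointwise_sol f r T u Y"
  unfolding pointwise_sol_def
proof (intro conjI ballI)
  fix t x :: real assume t: "t \<in> {0<..T}" and x: "x \<in> {0<..<1}"
  show "\<exists>yt yx yxx fx. ((\<lambda>s. Y s x) has_real_derivative yt) (at t within {0..T}) \<and>
        (\<forall>\<^sub>F \<xi> in nhds x. (Y t has_real_derivative yx \<xi>) (at \<xi>)) \<and>
        (yx has_real_derivative yxx) (at x) \<and>
        ((\<lambda>\<xi>. f (Y t \<xi>)) has_real_derivative fx) (at x) \<and>
        yt + fx = yxx + r (Y t x)"
  proof (intro exI conjI)
    show "((\<lambda>s. Y s x) has_real_derivative yt t x) (at t within {0..T})" by (rule classical_solD(6)[OF c t]) (use x in auto)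
    show "\<forall>\<^sub>F \<xi> in nhds x. (Y t has_real_derivative yx t \<xi>) (at \<xi>)"
      using eventually_nhds_unit[OF x] by eventually_elim (rule classical_interior_deriv(1)[OF c t])
    show "(yx t has_real_derivative yt t x + f' (Y t x) * yx t x - r (Y t x)) (at x)"
      by (rule classical_interior_deriv(2)[OF c t x])
    show "((\<lambda>\<xi>. f (Y t \<xi>)) has_real_derivative f' (Y t x) * yx t x) (at x)"
      by (rule DERIV_chain2[OF f classical_interior_deriv(1)[OF c t x]])
  qed simp
qed (use classical_solD(1-4)[OF c] in auto)

text \<open>The primitive, zero at \<open>t = 0\<close>, of the gradient profile
  \<open>t powr (-7/8) + 1\<close> of \<open>classical_sol\<close>. It takes the place of
  \<open>t\<close> in the Gronwall exponent.\<close>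

definition gweight :: "real \<Rightarrow> real" where "gweight t = 8 * t powr (1/8) + t"

lemma gweight_deriv: "t > 0 \<Longrightarrow> (gweight has_real_derivative t powr (-7/8) + 1) (at t)"
  unfolding gweight_def by (auto intro!: derivative_eq_intros simp: powr_diff)

lemma gweight_cont: "continuous_on {0..T} gweight"
  unfolding gweight_def by (intro continuous_intros continuous_on_powr') auto

lemma gweight_mono: "0 \<le> s \<Longrightarrow> s \<le> t \<Longrightarrow> gweight s \<le> gweight t"
  unfolding gweight_def by (intro add_mono mult_left_mono powr_mono2) auto

text \<open>At an extremum the space derivatives of both solutions agree, so only the integrable gradient bound of the classical solution
  enters; the pointwise solution need not have one.\<close>

lemma comparison_one_sided:
  assumes f: "\<And>x. (f has_real_derivative f' x) (at x)"
    and Y: "pointwise_sol f r T u Y" and Z: "classical_sol f f' r T k v Z zt zx"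
    and B: "\<And>t x. t \<in> {0..T} \<Longrightarrow> x \<in> {0..1} \<Longrightarrow> \<bar>Y t x\<bar> \<le> B" "\<And>t x. t \<in> {0..T} \<Longrightarrow> x \<in> {0..1} \<Longrightarrow> \<bar>Z t x\<bar> \<le> B"
    and lip: "\<And>a b. \<bar>a\<bar> \<le> B \<Longrightarrow> \<bar>b\<bar> \<le> B \<Longrightarrow> \<bar>f' a - f' b\<bar> \<le> L * \<bar>a - b\<bar>" "\<And>a b. \<bar>a\<bar> \<le> B \<Longrightarrow> \<bar>b\<bar> \<le> B \<Longrightarrow> \<bar>r a - r b\<bar> \<le> L * \<bar>a - b\<bar>"
    and L: "L \<ge> 0" and k: "k \<ge> 0" and \<delta>: "\<delta> \<ge> 0" "\<And>x. x \<in> {0..1} \<Longrightarrow> \<sigma> * (u x - v x) \<le> \<delta>" and \<sigma>: "\<sigma> = 1 \<or> \<sigma> = -1"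
    and t: "t \<in> {0..T}" and x: "x \<in> {0..1}"
  shows "\<sigma> * (Y t x - Z t x) \<le> \<delta> * exp ((L * k + L + 1) * gweight t)"
proof -
  define c where "c = L * k + L + 1"
  define W where "W t x = \<sigma> * (Y t x - Z t x) * exp (- (c * gweight t))" for t x
  have "W t x \<le> \<delta>"
  proof (rule parabolic_maximum[OF _ _ _ _ t x])
    have YZ: "continuous_on ({0..T} \<times> {0..1}) (\<lambda>p. Y (fst p) (snd p))" "continuous_on ({0..T} \<times> {0..1}) (\<lambda>p. Z (fst p) (snd p))"
      by (rule pointwise_solD[OF Y] classical_solD[OF Z])+
    have g: "continuous_on ({0..T} \<times> {0..1::real}) (\<lambda>p. gweight (fst p))"
      by (rule continuous_on_compose2[OF gweight_cont]) (auto intro!: continuous_intros)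
    show "continuous_on ({0..T} \<times> {0..1}) (\<lambda>p. W (fst p) (snd p))"
      unfolding W_def by (intro continuous_intros YZ g)
    show "W 0 x \<le> \<delta>" if "x \<in> {0..1}" for x
      using \<delta>(2)[OF that] by (simp add: W_def gweight_def pointwise_solD(2)[OF Y that] classical_solD(2)[OF Z that])
    show "W t 0 \<le> \<delta> \<and> W t 1 \<le> \<delta>" if "t \<in> {0..T}" for t
      using \<delta>(1) by (simp add: W_def pointwise_solD(3,4)[OF Y that] classical_solD(3,4)[OF Z that])
  next
    fix t x :: real
    assume t: "t \<in> {0<..T}" and x: "x \<in> {0<..<1}" and pos: "W t x > \<delta>"
      and mx: "\<And>\<xi>. \<xi> \<in> {0..1} \<Longrightarrow> W t \<xi> \<le> W t x" and mt: "\<And>s. s \<in> {0..t} \<Longrightarrow> W s x \<le> W t x"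
    have x': "x \<in> {0..1}" and t': "t \<in> {0..T}" "t > 0" using t x by auto
    obtain yt yx yxx fx where y: "((\<lambda>s. Y s x) has_real_derivative yt) (at t within {0..T})"
        "\<forall>\<^sub>F \<xi> in nhds x. (Y t has_real_derivative yx \<xi>) (at \<xi>)" "(yx has_real_derivative yxx) (at x)"
        "((\<lambda>\<xi>. f (Y t \<xi>)) has_real_derivative fx) (at x)" "yt + fx = yxx + r (Y t x)"
      using Y t x unfolding pointwise_sol_def by blast
    note z = classical_interior_deriv[OF Z t]
    have zt: "((\<lambda>s. Z s x) has_real_derivative zt t x) (at t within {0..T})" and zb: "\<bar>zx t x\<bar> \<le> k * (t powr (-7/8) + 1)"
      by (rule classical_solD[OF Z] t x')+
    define w where "w = \<sigma> * (Y t x - Z t x)"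
    define E where "E = exp (- (c * gweight t))"
    have E: "E > 0" by (simp add: E_def)
    have "w * E > 0" using pos \<delta>(1) by (simp add: W_def w_def E_def)
    then have w: "w > 0" using E by (simp add: zero_less_mult_iff)
    have yx: "(Y t has_real_derivative yx x) (at x)" using y(2) by (rule eventually_nhds_x_imp_x)
    have fx: "fx = f' (Y t x) * yx x" by (rule DERIV_unique[OF y(4) DERIV_chain2[OF f yx]])
    have "\<sigma> * (yx x - zx t x) = 0 \<and> \<sigma> * (yxx - (zt t x + f' (Z t x) * zx t x - r (Z t x))) \<le> 0"
    proof (rule conjI; rule interior_max_derivs[OF x, of "\<lambda>\<xi>. \<sigma> * (Y t \<xi> - Z t \<xi>)" "\<lambda>\<xi>. \<sigma> * (yx \<xi> - zx t \<xi>)"])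
      have m: "\<sigma> * (Y t \<xi> - Z t \<xi>) \<le> \<sigma> * (Y t x - Z t x)" if "\<xi> \<in> {0..1}" for \<xi>
        using mx[OF that] unfolding W_def E_def[symmetric] by (rule mult_right_le_imp_le[OF _ E])
      then show "\<sigma> * (Y t \<xi> - Z t \<xi>) \<le> \<sigma> * (Y t x - Z t x)" if "\<xi> \<in> {0..1}" for \<xi> using that .
      show "\<sigma> * (Y t \<xi> - Z t \<xi>) \<le> \<sigma> * (Y t x - Z t x)" if "\<xi> \<in> {0..1}" for \<xi> using m that .
      have ev: "\<forall>\<^sub>F \<xi> in nhds x. ((\<lambda>\<xi>. \<sigma> * (Y t \<xi> - Z t \<xi>)) has_real_derivative \<sigma> * (yx \<xi> - zx t \<xi>)) (at \<xi>)"
        using y(2) eventually_nhds_unit[OF x] by eventually_elim (auto intro!: derivative_eq_intros z)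
      show "\<forall>\<^sub>F \<xi> in nhds x. ((\<lambda>\<xi>. \<sigma> * (Y t \<xi> - Z t \<xi>)) has_real_derivative \<sigma> * (yx \<xi> - zx t \<xi>)) (at \<xi>)" by (rule ev)
      show "\<forall>\<^sub>F \<xi> in nhds x. ((\<lambda>\<xi>. \<sigma> * (Y t \<xi> - Z t \<xi>)) has_real_derivative \<sigma> * (yx \<xi> - zx t \<xi>)) (at \<xi>)" by (rule ev)
      have d2: "((\<lambda>\<xi>. \<sigma> * (yx \<xi> - zx t \<xi>)) has_real_derivative \<sigma> * (yxx - (zt t x + f' (Z t x) * zx t x - r (Z t x)))) (at x)"
        by (rule DERIV_cmult[OF DERIV_diff[OF y(3) z(2)[OF x]]])
      show "((\<lambda>\<xi>. \<sigma> * (yx \<xi> - zx t \<xi>)) has_real_derivative \<sigma> * (yxx - (zt t x + f' (Z t x) * zx t x - r (Z t x)))) (at x)"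
        by (rule d2)
      show "((\<lambda>\<xi>. \<sigma> * (yx \<xi> - zx t \<xi>)) has_real_derivative \<sigma> * (yxx - (zt t x + f' (Z t x) * zx t x - r (Z t x)))) (at x)"
        by (rule d2)
    qed
    then have eqx: "yx x = zx t x" and le: "\<sigma> * (yxx - (zt t x + f' (Z t x) * zx t x - r (Z t x))) \<le> 0" using \<sigma> by auto
    have ge: "\<sigma> * (yt - zt t x) * E + \<sigma> * (Y t x - Z t x) * (- (c * (t powr (-7/8) + 1)) * E) \<ge> 0"
    proof (rule deriv_nonneg_at_left_max[OF t])
      have gd: "(gweight has_real_derivative t powr (-7/8) + 1) (at t within {0..T})"
        by (rule has_field_derivative_at_within[OF gweight_deriv]) (use t in auto)
      show "((\<lambda>s. W s x) has_real_derivative \<sigma> * (yt - zt t x) * E + \<sigma> * (Y t x - Z t x) * (- (c * (t powr (-7/8) + 1)) * E)) (at t within {0..T})"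
        unfolding W_def E_def by (rule derivative_eq_intros y(1) zt gd refl)+ (simp add: algebra_simps)
    qed (rule mt)
    have "E * (\<sigma> * (yt - zt t x) - c * (t powr (-7/8) + 1) * w) \<ge> 0" using ge by (simp add: w_def algebra_simps)
    then have lower: "\<sigma> * (yt - zt t x) \<ge> c * (t powr (-7/8) + 1) * w" using E by (simp add: zero_le_mult_iff)
    have absw: "\<bar>Y t x - Z t x\<bar> = w" using w \<sigma> by (auto simp: w_def)
    have "\<sigma> * (yt - zt t x) = \<sigma> * (yxx - (zt t x + f' (Z t x) * zx t x - r (Z t x))) - \<sigma> * ((f' (Y t x) - f' (Z t x)) * zx t x) + \<sigma> * (r (Y t x) - r (Z t x))"
    proof -
      have yt: "yt = yxx + r (Y t x) - f' (Y t x) * zx t x" using y(5) fx eqx by simp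
      show ?thesis unfolding yt by (simp add: algebra_simps)
    qed
    also have "\<dots> \<le> 0 + \<bar>f' (Y t x) - f' (Z t x)\<bar> * \<bar>zx t x\<bar> + \<bar>r (Y t x) - r (Z t x)\<bar>"
    proof -
      have "- (\<sigma> * ((f' (Y t x) - f' (Z t x)) * zx t x)) \<le> \<bar>f' (Y t x) - f' (Z t x)\<bar> * \<bar>zx t x\<bar>"
        using \<sigma> unfolding abs_mult[symmetric] by auto
      moreover have "\<sigma> * (r (Y t x) - r (Z t x)) \<le> \<bar>r (Y t x) - r (Z t x)\<bar>" using \<sigma> by auto
      ultimately show ?thesis using le by linarith
    qed
    also have "\<dots> \<le> 0 + (L * w) * (k * (t powr (-7/8) + 1)) + L * w"
      using lip[OF B(1)[OF t'(1) x'] B(2)[OF t'(1) x']] zb w L unfolding absw by (intro add_mono mult_mono) auto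
    also have "\<dots> \<le> (L * w) * (k * (t powr (-7/8) + 1)) + (L * w) * (t powr (-7/8) + 1)"
      using L w mult_left_mono[of 1 "t powr (-7/8) + 1" "L * w"] by simp
    also have "\<dots> = (L * k + L) * ((t powr (-7/8) + 1) * w)" by (simp add: algebra_simps)
    \<comment> \<open>The summand 1 in \<open>c\<close> makes this upper bound strictly smaller than
      the one in \<open>lower\<close>, so no maximum above \<open>\<delta>\<close> exists.\<close>
    also have "\<dots> < c * ((t powr (-7/8) + 1) * w)" unfolding c_def
    proof (rule mult_strict_right_mono)
      have "t powr (-7/8) + 1 > 0" by (rule add_nonneg_pos) auto
      then show "0 < (t powr (-7/8) + 1) * w" using w by simp
    qed simp
    finally show False using lower by (simp add: mult.assoc)
  qed
  then have "\<sigma> * (Y t x - Z t x) * exp (- (c * gweight t)) * exp (c * gweight t) \<le> \<delta> * exp (c * gweight t)"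
    unfolding W_def by (rule mult_right_mono) simp
  then show ?thesis by (simp add: c_def mult.assoc flip: exp_add)
qed

lemma comparison:
  assumes f: "\<And>x. (f has_real_derivative f' x) (at x)"
    and Y: "pointwise_sol f r T u Y" and Z: "classical_sol f f' r T k v Z zt zx"
    and B: "\<And>t x. t \<in> {0..T} \<Longrightarrow> x \<in> {0..1} \<Longrightarrow> \<bar>Y t x\<bar> \<le> B" "\<And>t x. t \<in> {0..T} \<Longrightarrow> x \<in> {0..1} \<Longrightarrow> \<bar>Z t x\<bar> \<le> B"
    and lip: "\<And>a b. \<bar>a\<bar> \<le> B \<Longrightarrow> \<bar>b\<bar> \<le> B \<Longrightarrow> \<bar>f' a - f' b\<bar> \<le> L * \<bar>a - b\<bar>" "\<And>a b. \<bar>a\<bar> \<le> B \<Longrightarrow> \<bar>b\<bar> \<le> B \<Longrightarrow> \<bar>r a - r b\<bar> \<le> L * \<bar>a - b\<bar>"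
    and L: "L \<ge> 0" and k: "k \<ge> 0" and \<delta>: "\<And>x. x \<in> {0..1} \<Longrightarrow> \<bar>u x - v x\<bar> \<le> \<delta>"
    and t: "t \<in> {0..T}" and x: "x \<in> {0..1}"
  shows "\<bar>Y t x - Z t x\<bar> \<le> \<delta> * exp ((L * k + L + 1) * gweight t)"
proof -
  have \<delta>0: "\<delta> \<ge> 0" using \<delta>[of 0] by auto
  have "1 * (Y t x - Z t x) \<le> \<delta> * exp ((L * k + L + 1) * gweight t)"
    by (rule comparison_one_sided[OF f Y Z B lip L k \<delta>0 _ _ t x]) (use \<delta> in \<open>auto simp: abs_le_iff\<close>)
  moreover have "- 1 * (Y t x - Z t x) \<le> \<delta> * exp ((L * k + L + 1) * gweight t)"
    by (rule comparison_one_sided[OF f Y Z B lip L k \<delta>0 _ _ t x]) (use \<delta> in \<open>auto simp: abs_le_iff\<close>)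
  ultimately show ?thesis by (simp add: abs_le_iff)
qed

section \<open>Bounds in the maximum norm from the integral conditions\<close>

lemma exists_antiderivative:
  fixes h :: "real \<Rightarrow> real"
  assumes h: "continuous_on UNIV h"
  obtains F where "\<And>x. (F has_real_derivative h x) (at x)"
proof -
  define F where "F x = (if 0 \<le> x then integral {0..x} h else - integral {x..0} h)" for x
  have int: "h integrable_on {a..b}" for a b by (rule integrable_continuous_interval) (rule continuous_on_subset[OF h], simp)
  have "(F has_real_derivative h x) (at x)" for x
  proof -
    define N where "N = \<bar>x\<bar> + 1"
    have N: "N > 0" "x \<in> {-N<..<N}" by (auto simp: N_def)
    have "((\<lambda>x. integral {-N..x} h - integral {-N..0} h) has_real_derivative h x - 0) (at x within {-N..N})"
      by (intro DERIV_diff integral_has_real_derivative continuous_on_subset[OF h]) (use N in auto)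
    then have 1: "((\<lambda>x. integral {-N..x} h - integral {-N..0} h) has_real_derivative h x) (at x)"
      using N by (simp add: at_within_Icc_at)
    have comb: "integral {-N..a} h + integral {a..b} h = integral {-N..b} h" if "-N \<le> a" "a \<le> b" for a b
      by (rule Henstock_Kurzweil_Integration.integral_combine) (use that int in auto)
    show ?thesis
    proof (rule has_field_derivative_transform_within_open[OF 1, of "{-N<..<N}"])
      fix z assume z: "z \<in> {-N<..<N}"
      show "integral {-N..z} h - integral {-N..0} h = F z"
        using comb[of 0 z] comb[of z 0] z N by (auto simp: F_def)
    qed (use N in auto)
  qed
  then show ?thesis by (rule that)
qed

text \<open>The increasing function \<open>\<Psi>\<close> with \<open>\<Psi>' = 1 / (\<bar>r\<bar> + 1)\<close> turns the pointwise growth \<open>y\<^sub>t \<le> r y\<close> at a maximum into linear growth of \<open>\<Psi> y\<close>.\<close>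

lemma a_priori_bound:
  assumes f: "\<And>x. (f has_real_derivative f' x) (at x)" and Y: "pointwise_sol f r T u Y"
    and \<Psi>: "\<And>x. (\<Psi> has_real_derivative 1 / (\<bar>r x\<bar> + 1)) (at x)"
    and u: "\<And>x. x \<in> {0..1} \<Longrightarrow> u x \<le> K" and K: "K \<ge> 0" and t: "t \<in> {0..T}" and x: "x \<in> {0..1}"
  shows "\<Psi> (Y t x) \<le> \<Psi> K + t"
proof -
  have pos: "1 / (\<bar>r z\<bar> + 1) > 0" for z by (simp add: add_nonneg_pos)
  have mono: "\<Psi> a < \<Psi> b" if "a < b" for a b
    by (rule DERIV_pos_imp_increasing[OF that]) (use \<Psi> pos in blast)
  have mono': "\<Psi> a \<le> \<Psi> b \<longleftrightarrow> a \<le> b" for a b using mono[of a b] mono[of b a] by (cases a b rule: linorder_cases) auto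
  have \<Psi>c: "continuous_on UNIV \<Psi>" using \<Psi> by (meson DERIV_continuous_on has_field_derivative_at_within)
  define W where "W t x = \<Psi> (Y t x) - t" for t x
  have "W t x \<le> \<Psi> K"
  proof (rule parabolic_maximum[OF _ _ _ _ t x])
    show "continuous_on ({0..T} \<times> {0..1}) (\<lambda>p. W (fst p) (snd p))"
      unfolding W_def by (intro continuous_intros continuous_on_compose2[OF \<Psi>c pointwise_solD(1)[OF Y]]) auto
    show "W 0 x \<le> \<Psi> K" if "x \<in> {0..1}" for x
      using u[OF that] by (simp add: W_def pointwise_solD(2)[OF Y that] mono')
    show "W t 0 \<le> \<Psi> K \<and> W t 1 \<le> \<Psi> K" if "t \<in> {0..T}" for t
    proof -
      have "\<Psi> 0 \<le> \<Psi> K" using K by (simp add: mono')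
      then show ?thesis using that by (simp add: W_def pointwise_solD(3,4)[OF Y that])
    qed
  next
    fix t x :: real
    assume t: "t \<in> {0<..T}" and x: "x \<in> {0<..<1}"
      and mx: "\<And>\<xi>. \<xi> \<in> {0..1} \<Longrightarrow> W t \<xi> \<le> W t x" and mt: "\<And>s. s \<in> {0..t} \<Longrightarrow> W s x \<le> W t x"
    obtain yt yx yxx fx where y: "((\<lambda>s. Y s x) has_real_derivative yt) (at t within {0..T})"
        "\<forall>\<^sub>F \<xi> in nhds x. (Y t has_real_derivative yx \<xi>) (at \<xi>)" "(yx has_real_derivative yxx) (at x)"
        "((\<lambda>\<xi>. f (Y t \<xi>)) has_real_derivative fx) (at x)" "yt + fx = yxx + r (Y t x)"
      using Y t x unfolding pointwise_sol_def by blast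
    have yx: "(Y t has_real_derivative yx x) (at x)" using y(2) by (rule eventually_nhds_x_imp_x)
    have fx: "fx = f' (Y t x) * yx x" by (rule DERIV_unique[OF y(4) DERIV_chain2[OF f yx]])
    have mx': "Y t \<xi> \<le> Y t x" if "\<xi> \<in> {0..1}" for \<xi> using mx[OF that] by (simp add: W_def mono')
    have "yx x = 0" "yxx \<le> 0" by (rule interior_max_derivs[OF x mx' y(2,3)], assumption)+
    then have le: "yt \<le> r (Y t x)" using y(5) fx by simp
    have "1 / (\<bar>r (Y t x)\<bar> + 1) * yt - 1 \<ge> 0"
    proof (rule deriv_nonneg_at_left_max[OF t, where h = "\<lambda>s. W s x"])
      show "W s x \<le> W t x" if "s \<in> {0..t}" for s by (rule mt[OF that])
      show "((\<lambda>s. W s x) has_real_derivative 1 / (\<bar>r (Y t x)\<bar> + 1) * yt - 1) (at t within {0..T})"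
        unfolding W_def by (intro DERIV_diff DERIV_chain2[OF \<Psi> y(1)] DERIV_ident)
    qed
    \<comment> \<open>The summand 1 in the denominator provides the strict inequality that excludes
      the maximum.\<close>
    moreover have "1 / (\<bar>r (Y t x)\<bar> + 1) * yt < 1" using le by (simp add: divide_less_eq add_nonneg_pos)
    ultimately show False by simp
  qed
  then show ?thesis by (simp add: W_def)
qed

text \<open>The equation keeps its form under reflection of \<open>y\<close> when flux and reaction
  are reflected too. Lower bounds thus become upper bounds for the reflected problem, and there the
  integral condition at minus infinity enters.\<close>

lemma pointwise_sol_minus:
  assumes Y: "pointwise_sol f r T u Y"
  shows "pointwise_sol (\<lambda>y. - f (- y)) (\<lambda>y. - r (- y)) T (\<lambda>x. - u x) (\<lambda>t x. - Y t x)"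
  unfolding pointwise_sol_def
proof (intro conjI ballI)
  show "continuous_on ({0..T} \<times> {0..1}) (\<lambda>p. - Y (fst p) (snd p))" by (intro continuous_intros pointwise_solD(1)[OF Y])
  fix t x :: real assume t: "t \<in> {0<..T}" and x: "x \<in> {0<..<1}"
  obtain yt yx yxx fx where y: "((\<lambda>s. Y s x) has_real_derivative yt) (at t within {0..T})"
        "\<forall>\<^sub>F \<xi> in nhds x. (Y t has_real_derivative yx \<xi>) (at \<xi>)" "(yx has_real_derivative yxx) (at x)"
        "((\<lambda>\<xi>. f (Y t \<xi>)) has_real_derivative fx) (at x)" "yt + fx = yxx + r (Y t x)"
      using Y t x unfolding pointwise_sol_def by blast
  show "\<exists>yt yx yxx fx. ((\<lambda>s. - Y s x) has_real_derivative yt) (at t within {0..T}) \<and>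
        (\<forall>\<^sub>F \<xi> in nhds x. ((\<lambda>x. - Y t x) has_real_derivative yx \<xi>) (at \<xi>)) \<and>
        (yx has_real_derivative yxx) (at x) \<and>
        ((\<lambda>\<xi>. - f (- (- Y t \<xi>))) has_real_derivative fx) (at x) \<and> yt + fx = yxx + - r (- (- Y t x))"
  proof (intro exI conjI)
    show "\<forall>\<^sub>F \<xi> in nhds x. ((\<lambda>x. - Y t x) has_real_derivative - yx \<xi>) (at \<xi>)"
      using y(2) by eventually_elim (rule DERIV_minus)
    show "((\<lambda>\<xi>. - f (- (- Y t \<xi>))) has_real_derivative - fx) (at x)" using DERIV_minus[OF y(4)] by simp
  qed (rule DERIV_minus[OF y(1)], rule DERIV_minus[OF y(3)], use y(5) in simp)
qed (use pointwise_solD(2-4)[OF Y] in auto)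

text \<open>The derivative is cut off, by clamping its argument to \<open>{-B..B}\<close>, and
  integrated again. It is then bounded and Lipschitz on the whole line, while function and
  derivative are unchanged on the interval.\<close>

lemma truncation:
  assumes C2: "C2 g" and B: "B > 0"
  obtains G G' L g1 where "L \<ge> 0" "\<And>x. (g has_real_derivative g1 x) (at x)" "\<And>x. (G has_real_derivative G' x) (at x)"
    "\<And>x. \<bar>G' x\<bar> \<le> L" "\<And>x y. \<bar>G' x - G' y\<bar> \<le> L * \<bar>x - y\<bar>" "\<And>x. \<bar>x\<bar> \<le> B \<Longrightarrow> G x = g x" "\<And>x. \<bar>x\<bar> \<le> B \<Longrightarrow> G' x = g1 x"
proof -
  obtain g1 g2 where g: "\<And>x. (g has_real_derivative g1 x) (at x)" "\<And>x. (g1 has_real_derivative g2 x) (at x)" "continuous_on UNIV g2"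
    using C2 unfolding C2_def by blast
  have g1c: "continuous_on S g1" for S using g(2) by (meson DERIV_continuous_on has_field_derivative_at_within)
  obtain L1 where L1: "L1 \<ge> 0" "\<And>x. x \<in> {-B..B} \<Longrightarrow> norm (g1 x) \<le> L1"
    using continuous_on_compact_bound[OF compact_Icc g1c] by blast
  obtain L2 where L2: "L2 \<ge> 0" "\<And>x. x \<in> {-B..B} \<Longrightarrow> norm (g2 x) \<le> L2"
    using continuous_on_compact_bound[OF compact_Icc continuous_on_subset[OF g(3)]] by blast
  define cl where "cl x = max (-B) (min B x)" for x
  have cl: "cl x \<in> {-B..B}" "\<bar>cl x - cl y\<bar> \<le> \<bar>x - y\<bar>" "\<bar>x\<bar> \<le> B \<Longrightarrow> cl x = x" for x y
    using B by (auto simp: cl_def max_def min_def)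
  define G' where "G' x = g1 (cl x)" for x
  have lip: "\<bar>g1 a - g1 b\<bar> \<le> L2 * \<bar>a - b\<bar>" if "a \<in> {-B..B}" "b \<in> {-B..B}" for a b
  proof -
    have "norm (g1 a - g1 b) \<le> L2 * norm (a - b)"
      by (rule field_differentiable_bound[of "{-B..B}" g1 g2]) (use g(2) L2 that in \<open>auto intro: has_field_derivative_at_within\<close>)
    then show ?thesis by simp
  qed
  have "continuous_on UNIV G'" unfolding G'_def
    by (rule continuous_on_compose2[OF g1c[of UNIV]]) (auto simp: cl_def intro!: continuous_intros)
  then obtain F where F: "\<And>x. (F has_real_derivative G' x) (at x)" using exists_antiderivative by blast
  define G where "G x = F x - F 0 + g 0" for x
  have G: "(G has_real_derivative G' x) (at x)" for x
    unfolding G_def by (auto intro!: derivative_eq_intros F)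
  show ?thesis
  proof (rule that[of "max L1 L2" g1 G G'])
    show "\<bar>G' x\<bar> \<le> max L1 L2" for x using L1(2)[OF cl(1)[of x]] by (simp add: G'_def)
    show "\<bar>G' x - G' y\<bar> \<le> max L1 L2 * \<bar>x - y\<bar>" for x y
    proof -
      have "\<bar>G' x - G' y\<bar> \<le> L2 * \<bar>cl x - cl y\<bar>" unfolding G'_def by (rule lip[OF cl(1) cl(1)])
      also have "\<dots> \<le> max L1 L2 * \<bar>x - y\<bar>" using cl(2)[of x y] L2(1) by (intro mult_mono) auto
      finally show ?thesis .
    qed
    show "G' x = g1 x" if "\<bar>x\<bar> \<le> B" for x unfolding G'_def cl(3)[OF that] ..
    show "G x = g x" if "\<bar>x\<bar> \<le> B" for x
    proof -
      have "norm ((G x - g x) - (G 0 - g 0)) \<le> 0 * norm (x - 0)"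
      proof (rule field_differentiable_bound[of "{-B..B}" "\<lambda>x. G x - g x" "\<lambda>x. G' x - g1 x"])
        show "((\<lambda>x. G x - g x) has_field_derivative G' z - g1 z) (at z within {-B..B})" for z
          by (intro DERIV_diff has_field_derivative_at_within[OF G] has_field_derivative_at_within[OF g(1)])
        show "norm (G' z - g1 z) \<le> 0" if "z \<in> {-B..B}" for z using cl(3)[of z] that by (auto simp: G'_def)
      qed (use that B in auto)
      then show ?thesis by (simp add: G_def)
    qed
  qed (use G g(1) L1(1) in auto)
qed

text \<open>The truncated reaction \<open>R\<close> has its own comparison function
  \<open>\<Phi>\<close>, which differs from \<open>\<Psi>\<close> by a constant on
  \<open>{-B..B}\<close>. Between \<open>K\<close> and \<open>B\<close> it grows by more than
  \<open>T\<close>, whereas \<open>a_priori_bound\<close> allows a growth of \<open>t\<close> only.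
  So a \<open>B\<close> chosen from the original \<open>r\<close> also confines the solution of the
  truncated problem.\<close>

lemma upper_bound:
  assumes F: "\<And>x. (F has_real_derivative F' x) (at x)" and Y: "pointwise_sol F R T u Y"
    and R: "continuous_on UNIV R" "\<And>x. \<bar>x\<bar> \<le> B \<Longrightarrow> R x = r x"
    and \<Psi>: "\<And>x. (\<Psi> has_real_derivative 1 / (\<bar>r x\<bar> + 1)) (at x)" and B: "\<Psi> K + T < \<Psi> B" "K \<le> B"
    and u: "\<And>x. x \<in> {0..1} \<Longrightarrow> u x \<le> K" and K: "K \<ge> 0" and t: "t \<in> {0..T}" and x: "x \<in> {0..1}"
  shows "Y t x \<le> B"
proof (rule ccontr)
  assume "\<not> Y t x \<le> B"
  have nz: "\<bar>R x\<bar> + 1 \<noteq> 0" for x by linarith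
  obtain \<Phi> where \<Phi>: "\<And>x. (\<Phi> has_real_derivative 1 / (\<bar>R x\<bar> + 1)) (at x)"
    by (rule exists_antiderivative[of "\<lambda>x. 1 / (\<bar>R x\<bar> + 1)"]) (intro continuous_intros R ballI nz, rule that)
  have "norm ((\<Phi> B - \<Psi> B) - (\<Phi> K - \<Psi> K)) \<le> 0 * norm (B - K)"
  proof (rule field_differentiable_bound[of "{-B..B}" "\<lambda>x. \<Phi> x - \<Psi> x" "\<lambda>x. 1 / (\<bar>R x\<bar> + 1) - 1 / (\<bar>r x\<bar> + 1)"])
    show "((\<lambda>x. \<Phi> x - \<Psi> x) has_field_derivative 1 / (\<bar>R z\<bar> + 1) - 1 / (\<bar>r z\<bar> + 1)) (at z within {-B..B})" for z
      by (intro DERIV_diff has_field_derivative_at_within[OF \<Phi>] has_field_derivative_at_within[OF \<Psi>])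
    show "norm (1 / (\<bar>R z\<bar> + 1) - 1 / (\<bar>r z\<bar> + 1)) \<le> 0" if "z \<in> {-B..B}" for z using R(2)[of z] that by auto
  qed (use B K in auto)
  then have "\<Phi> K + T < \<Phi> B" using B by simp
  moreover have "\<Phi> B < \<Phi> (Y t x)"
  proof (rule DERIV_pos_imp_increasing[of B "Y t x" \<Phi>])
    show "B < Y t x" using \<open>\<not> Y t x \<le> B\<close> by simp
    show "\<exists>y. DERIV \<Phi> z :> y \<and> y > 0" for z using \<Phi>[of z] by (intro exI[of _ "1 / (\<bar>R z\<bar> + 1)"]) (simp add: add_nonneg_pos)
  qed
  moreover have "\<Phi> (Y t x) \<le> \<Phi> K + t" by (rule a_priori_bound[OF F Y \<Phi> u K t x])
  ultimately show False using t by simp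
qed

text \<open>A bounded monotone \<open>\<Psi>\<close> would have a limit at infinity, and thereby
  give the divergent integral a finite value.\<close>

lemma antiderivative_unbounded:
  assumes r: "continuous_on UNIV r" and inf: "(\<integral>\<^sup>+ y\<in>{0..}. ennreal (1 / (\<bar>r y\<bar> + 1)) \<partial>lborel) = \<infinity>"
    and \<Psi>: "\<And>x. (\<Psi> has_real_derivative 1 / (\<bar>r x\<bar> + 1)) (at x)"
  shows "\<exists>B>K. \<Psi> B > (C :: real)"
proof (rule ccontr)
  assume a: "\<not> ?thesis"
  have mono: "mono \<Psi>"
  proof (rule monoI)
    fix a b :: real assume ab: "a \<le> b"
    show "\<Psi> a \<le> \<Psi> b" by (rule DERIV_nonneg_imp_nondecreasing[OF ab]) (meson \<Psi> abs_ge_zero add_nonneg_nonneg divide_nonneg_nonneg zero_le_one)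
  qed
  have bd: "\<Psi> (real n) \<le> C" for n
  proof -
    obtain B where B: "B > K" "B > real n" using gt_ex[of "max K (real n)"] by auto
    have "\<Psi> (real n) \<le> \<Psi> B" using mono B by (auto simp: mono_def)
    also have "\<Psi> B \<le> C" using a B by (metis not_less)
    finally show ?thesis .
  qed
  have "(\<lambda>n. \<Psi> (real n)) \<longlonglongrightarrow> (SUP n. \<Psi> (real n))"
    by (rule LIMSEQ_incseq_SUP) (use bd mono in \<open>auto intro!: bdd_aboveI[of _ C] simp: incseq_def mono_def\<close>)
  then have lim: "(\<Psi> \<longlongrightarrow> (SUP n. \<Psi> (real n))) at_top"
    by (rule tendsto_at_topI_sequentially_real[OF mono])
  have nz: "\<bar>r x\<bar> + 1 \<noteq> 0" for x by linarith
  have "(\<integral>\<^sup>+ y\<in>{0..}. ennreal (1 / (\<bar>r y\<bar> + 1)) \<partial>lborel) = ennreal ((SUP n. \<Psi> (real n)) - \<Psi> 0)"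
    by (rule nn_integral_FTC_atLeast[OF _ \<Psi> _ lim])
      (auto intro!: borel_measurable_continuous_onI continuous_intros r nz)
  then show False using inf by simp
qed

lemma reflect_nn_integral:
  fixes r :: "real \<Rightarrow> real"
  assumes r: "continuous_on UNIV r"
  shows "(\<integral>\<^sup>+ y\<in>{0..}. ennreal (1 / (\<bar>- r (- y)\<bar> + 1)) \<partial>lborel) = (\<integral>\<^sup>+ y\<in>{..0}. ennreal (1 / (\<bar>r y\<bar> + 1)) \<partial>lborel)"
proof -
  have [measurable]: "r \<in> borel_measurable borel" by (rule borel_measurable_continuous_onI[OF r])
  have "(\<integral>\<^sup>+ y\<in>{..0}. ennreal (1 / (\<bar>r y\<bar> + 1)) \<partial>lborel) =
    ennreal \<bar>-1\<bar> * (\<integral>\<^sup>+ y. ennreal (1 / (\<bar>r (0 + (-1) * y)\<bar> + 1)) * indicator {..0} (0 + (-1) * y) \<partial>lborel)"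
    by (rule nn_integral_real_affine) auto
  also have "\<dots> = (\<integral>\<^sup>+ y\<in>{0..}. ennreal (1 / (\<bar>- r (- y)\<bar> + 1)) \<partial>lborel)"
    by (auto intro!: nn_integral_cong simp: indicator_def)
  finally show ?thesis by simp
qed

text \<open>The order of choices avoids a circle: \<open>B\<close> comes from \<open>K\<close>,
  \<open>T\<close> and the growth of the original \<open>r\<close>, \<open>L\<close> from the
  truncation at \<open>B\<close>, and \<open>k\<close> from the truncated problem with
  \<open>T\<close> and \<open>E0\<close>. The truncated solution stays within \<open>B\<close> and
  hence solves the original equation.\<close>

theorem local_solution:
  assumes fC2: "C2 f" and rC2: "C2 r"
    and r_neg: "(\<integral>\<^sup>+ y\<in>{..0}. ennreal (1 / (\<bar>r y\<bar> + 1)) \<partial>lborel) = \<infinity>"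
    and r_pos: "(\<integral>\<^sup>+ y\<in>{0..}. ennreal (1 / (\<bar>r y\<bar> + 1)) \<partial>lborel) = \<infinity>"
    and T: "T > 0" and K: "K \<ge> 0" and E0: "E0 \<ge> 0"
  obtains B L k where "B > 0" "L \<ge> 0" "k \<ge> 0"
    "\<And>a b. \<bar>a\<bar> \<le> B \<Longrightarrow> \<bar>b\<bar> \<le> B \<Longrightarrow> \<bar>deriv f a - deriv f b\<bar> \<le> L * \<bar>a - b\<bar>"
    "\<And>a b. \<bar>a\<bar> \<le> B \<Longrightarrow> \<bar>b\<bar> \<le> B \<Longrightarrow> \<bar>deriv r a - deriv r b\<bar> \<le> L * \<bar>a - b\<bar>"
    "\<And>a. \<bar>a\<bar> \<le> B \<Longrightarrow> \<bar>deriv f a\<bar> \<le> L" "\<And>a. \<bar>a\<bar> \<le> B \<Longrightarrow> \<bar>deriv r a\<bar> \<le> L"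
    "\<And>u. continuous_on {0..1} u \<Longrightarrow> (\<And>x. x \<in> {0..1} \<Longrightarrow> \<bar>u x\<bar> \<le> K) \<Longrightarrow> (\<And>m. (\<Sum>n<m. (freq n * fsin n u)\<^sup>2) \<le> E0) \<Longrightarrow>
       \<exists>Y yt yx. classical_sol f (deriv f) r T k u Y yt yx \<and> (\<forall>t\<in>{0..T}. \<forall>x\<in>{0..1}. \<bar>Y t x\<bar> \<le> B)"
proof -
  obtain r1 where r1: "\<And>x. (r has_real_derivative r1 x) (at x)" using rC2 unfolding C2_def by blast
  have rc: "continuous_on UNIV r" using r1 by (meson DERIV_continuous_on has_field_derivative_at_within)
  define rm where "rm y = - r (- y)" for y
  have rmc: "continuous_on UNIV rm" unfolding rm_def
    by (intro continuous_intros continuous_on_compose2[OF rc]) auto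
  have nz: "\<bar>r x\<bar> + 1 \<noteq> 0" "\<bar>rm x\<bar> + 1 \<noteq> 0" for x by linarith+
  obtain \<Psi> where \<Psi>: "\<And>x. (\<Psi> has_real_derivative 1 / (\<bar>r x\<bar> + 1)) (at x)"
    by (rule exists_antiderivative[of "\<lambda>x. 1 / (\<bar>r x\<bar> + 1)"]) (intro continuous_intros rc ballI nz, rule that)
  obtain \<Psi>m where \<Psi>m: "\<And>x. (\<Psi>m has_real_derivative 1 / (\<bar>rm x\<bar> + 1)) (at x)"
    by (rule exists_antiderivative[of "\<lambda>x. 1 / (\<bar>rm x\<bar> + 1)"]) (intro continuous_intros rmc ballI nz, rule that)
  have infm: "(\<integral>\<^sup>+ y\<in>{0..}. ennreal (1 / (\<bar>rm y\<bar> + 1)) \<partial>lborel) = \<infinity>"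
    unfolding rm_def reflect_nn_integral[OF rc] by (rule r_neg)
  obtain B1 where B1: "B1 > K" "\<Psi> B1 > \<Psi> K + T" using antiderivative_unbounded[OF rc r_pos \<Psi>] by blast
  obtain B2 where B2: "B2 > K" "\<Psi>m B2 > \<Psi>m K + T" using antiderivative_unbounded[OF rmc infm \<Psi>m] by blast
  define B where "B = max B1 B2"
  have mono: "\<Psi> B1 \<le> \<Psi> B" "\<Psi>m B2 \<le> \<Psi>m B"
    by (rule DERIV_nonneg_imp_nondecreasing; use \<Psi> \<Psi>m in \<open>force simp: B_def\<close>)+
  have B: "B > 0" "K \<le> B" "\<Psi> K + T < \<Psi> B" "\<Psi>m K + T < \<Psi>m B" using B1 B2 K mono by (auto simp: B_def)
  obtain F F' L1 f1 where F: "L1 \<ge> 0" "\<And>x. (f has_real_derivative f1 x) (at x)" "\<And>x. (F has_real_derivative F' x) (at x)"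
    "\<And>x. \<bar>F' x\<bar> \<le> L1" "\<And>x y. \<bar>F' x - F' y\<bar> \<le> L1 * \<bar>x - y\<bar>" "\<And>x. \<bar>x\<bar> \<le> B \<Longrightarrow> F x = f x" "\<And>x. \<bar>x\<bar> \<le> B \<Longrightarrow> F' x = f1 x"
    using truncation[OF fC2 B(1)] by (metis (no_types, lifting))
  obtain R R' L2 r2 where R: "L2 \<ge> 0" "\<And>x. (r has_real_derivative r2 x) (at x)" "\<And>x. (R has_real_derivative R' x) (at x)"
    "\<And>x. \<bar>R' x\<bar> \<le> L2" "\<And>x y. \<bar>R' x - R' y\<bar> \<le> L2 * \<bar>x - y\<bar>" "\<And>x. \<bar>x\<bar> \<le> B \<Longrightarrow> R x = r x" "\<And>x. \<bar>x\<bar> \<le> B \<Longrightarrow> R' x = r2 x"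
    using truncation[OF rC2 B(1)] by (metis (no_types, lifting))
  have f1: "deriv f = f1" and r2: "deriv r = r2" using F(2) R(2) by (auto intro!: DERIV_imp_deriv)
  define L where "L = max L1 L2"
  have Lle: "L1 * \<bar>z\<bar> \<le> L * \<bar>z\<bar>" "L2 * \<bar>z\<bar> \<le> L * \<bar>z\<bar>" for z by (auto simp: L_def intro!: mult_right_mono)
  interpret smooth_nonlinearity F F' R R' L
  proof
    fix x y
    show "\<bar>F' x\<bar> \<le> L" "\<bar>R' x\<bar> \<le> L" using F(4)[of x] R(4)[of x] by (auto simp: L_def)
    show "\<bar>F' x - F' y\<bar> \<le> L * \<bar>x - y\<bar>" by (rule order_trans[OF F(5) Lle(1)])
    show "\<bar>R' x - R' y\<bar> \<le> L * \<bar>x - y\<bar>" by (rule order_trans[OF R(5) Lle(2)])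
  qed (rule F R)+
  obtain k where k: "k \<ge> 0" "\<And>u. continuous_on {0..1} u \<Longrightarrow> (\<And>m. (\<Sum>n<m. (freq n * fsin n u)\<^sup>2) \<le> E0) \<Longrightarrow>
    \<exists>Y yt yx. classical_sol F F' R T k u Y yt yx"
    by (rule classical_solution_exists[OF T E0]) blast
  show ?thesis
  proof (rule that[of B L k])
    show "B > 0" "L \<ge> 0" "k \<ge> 0" using B k L_nonneg by auto
    show "\<bar>deriv f a - deriv f b\<bar> \<le> L * \<bar>a - b\<bar>" if "\<bar>a\<bar> \<le> B" "\<bar>b\<bar> \<le> B" for a b
      using f'_lip[of a b] unfolding F(7)[OF that(1)] F(7)[OF that(2)] f1 .
    show "\<bar>deriv r a - deriv r b\<bar> \<le> L * \<bar>a - b\<bar>" if "\<bar>a\<bar> \<le> B" "\<bar>b\<bar> \<le> B" for a b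
      using r'_lip[of a b] unfolding R(7)[OF that(1)] R(7)[OF that(2)] r2 .
    show "\<bar>deriv f a\<bar> \<le> L" if "\<bar>a\<bar> \<le> B" for a using f'_le[of a] unfolding F(7)[OF that] f1 .
    show "\<bar>deriv r a\<bar> \<le> L" if "\<bar>a\<bar> \<le> B" for a using r'_le[of a] unfolding R(7)[OF that] r2 .
    fix u :: "real \<Rightarrow> real" assume u: "continuous_on {0..1} u" "\<And>x. x \<in> {0..1} \<Longrightarrow> \<bar>u x\<bar> \<le> K" "\<And>m. (\<Sum>n<m. (freq n * fsin n u)\<^sup>2) \<le> E0"
    obtain Y yt yx where c: "classical_sol F F' R T k u Y yt yx" using k(2)[OF u(1,3)] by blast
    have p: "pointwise_sol F R T u Y" by (rule classical_imp_pointwise[OF F(3) c])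
    have Rc: "continuous_on UNIV R" by (rule r_cont)
    have bnd: "\<bar>Y t x\<bar> \<le> B" if t: "t \<in> {0..T}" and x: "x \<in> {0..1}" for t x
    proof -
      have "Y t x \<le> B"
        by (rule upper_bound[OF F(3) p Rc R(6) \<Psi> B(3,2) _ K t x]) (use u(2) in \<open>auto simp: abs_le_iff\<close>)
      moreover have "- Y t x \<le> B"
      proof (rule upper_bound[OF _ pointwise_sol_minus[OF p] _ _ \<Psi>m B(4,2) _ K t x])
        show "((\<lambda>y. - F (- y)) has_real_derivative F' (- z)) (at z)" for z
          using DERIV_minus[OF DERIV_chain2[OF F(3)[of "- z"] DERIV_minus[OF DERIV_ident]], of UNIV] by simp
        show "continuous_on UNIV (\<lambda>y. - R (- y))" by (intro continuous_intros continuous_on_compose2[OF Rc]) auto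
        show "- R (- x) = rm x" if "\<bar>x\<bar> \<le> B" for x using R(6)[of "- x"] that by (simp add: rm_def)
        show "- u x \<le> K" if "x \<in> {0..1}" for x using u(2)[OF that] by (simp add: abs_le_iff)
      qed
      ultimately show ?thesis by (simp add: abs_le_iff)
    qed
    have "classical_sol f (deriv f) r T k u Y yt yx"
      unfolding classical_sol_def f1
    proof (intro conjI ballI)
      fix t x :: real assume t: "t \<in> {0<..T}" and x: "x \<in> {0..1}"
      have b: "\<bar>Y t x\<bar> \<le> B" by (rule bnd) (use t x in auto)
      show "(yx t has_real_derivative yt t x + f1 (Y t x) * yx t x - r (Y t x)) (at x within {0..1})"
        using classical_solD(8)[OF c t x] unfolding F(7)[OF b] R(6)[OF b] .
      show "((\<lambda>s. Y s x) has_real_derivative yt t x) (at t within {0..T})"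
        "(Y t has_real_derivative yx t x) (at x within {0..1})" "\<bar>yx t x\<bar> \<le> k * (t powr (-7/8) + 1)"
        using classical_solD(6,7,9)[OF c t x] by auto
    qed (use classical_solD(1-5,10)[OF c] in auto)
    then show "\<exists>Y yt yx. classical_sol f (deriv f) r T k u Y yt yx \<and> (\<forall>t\<in>{0..T}. \<forall>x\<in>{0..1}. \<bar>Y t x\<bar> \<le> B)"
      using bnd by blast
  qed
qed

section \<open>The space V\<close>

text \<open>Lebesgue's differentiation theorem on an interval: by the Henstock lemma the intervals on which the mean of \<open>g\<close> is far from
  \<open>g x\<close> have small total length, and a Vitali covering turns this into a bound for the exceptional set.\<close>

lemma negligible_not_deriv_integral_aux:
  fixes g :: "real \<Rightarrow> real"
  assumes g: "g integrable_on {a..b}" and \<eta>: "\<eta> > 0"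
  shows "negligible {x \<in> {a<..<b}. \<forall>\<delta>>0. \<exists>y\<in>{a..b}. y \<noteq> x \<and> \<bar>y - x\<bar> < \<delta> \<and>
     \<eta> * \<bar>y - x\<bar> < \<bar>integral {min x y..max x y} g - g x * \<bar>y - x\<bar>\<bar>}" (is "negligible ?E")
  unfolding negligible_outer_le
proof (intro allI impI)
  fix e :: real assume e: "e > 0"
  have g': "g integrable_on cbox a b" using g by simp
  \<comment> \<open>The Henstock bound is divided by \<open>\<eta>\<close> on the bad intervals, and
    the Vitali balls are enlarged five times.\<close>
  have e': "\<eta> * e / 5 > 0" using e \<eta> by simp
  obtain \<gamma> where \<gamma>: "gauge \<gamma>"
    "\<And>p. p tagged_partial_division_of cbox a b \<Longrightarrow> \<gamma> fine p \<Longrightarrow> (\<Sum>(x,k)\<in>p. norm (measure lborel k *\<^sub>R g x - integral k g)) < \<eta> * e / 5"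
    using Henstock_lemma[OF g' e'] by blast
  have "\<exists>y. y \<in> {a..b} \<and> y \<noteq> x \<and> {min x y..max x y} \<subseteq> \<gamma> x \<and> \<eta> * \<bar>y - x\<bar> < \<bar>integral {min x y..max x y} g - g x * \<bar>y - x\<bar>\<bar>" if x: "x \<in> ?E" for x
  proof -
    have "open (\<gamma> x)" "x \<in> \<gamma> x" using \<gamma>(1) by (auto simp: gauge_def)
    then obtain \<delta> where \<delta>: "\<delta> > 0" "ball x \<delta> \<subseteq> \<gamma> x" by (meson openE)
    obtain y where y: "y \<in> {a..b}" "y \<noteq> x" "\<bar>y - x\<bar> < \<delta>" "\<eta> * \<bar>y - x\<bar> < \<bar>integral {min x y..max x y} g - g x * \<bar>y - x\<bar>\<bar>"
      using x \<delta>(1) by blast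
    have "{min x y..max x y} \<subseteq> ball x \<delta>" using y(3) \<delta>(1) by (auto simp: dist_real_def min_def max_def split: if_splits)
    then show ?thesis using y \<delta>(2) by blast
  qed
  then have "\<exists>y. \<forall>x\<in>?E. y x \<in> {a..b} \<and> y x \<noteq> x \<and> {min x (y x)..max x (y x)} \<subseteq> \<gamma> x \<and> \<eta> * \<bar>y x - x\<bar> < \<bar>integral {min x (y x)..max x (y x)} g - g x * \<bar>y x - x\<bar>\<bar>"
    by (intro bchoice ballI)
  then obtain y where y0: "\<forall>x\<in>?E. y x \<in> {a..b} \<and> y x \<noteq> x \<and> {min x (y x)..max x (y x)} \<subseteq> \<gamma> x \<and> \<eta> * \<bar>y x - x\<bar> < \<bar>integral {min x (y x)..max x (y x)} g - g x * \<bar>y x - x\<bar>\<bar>"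
    by (rule exE)
  note y = bspec[OF y0]
  \<comment> \<open>Each bad interval is written as a ball for the Vitali lemma. The tag
    \<open>x\<close> is one of its end points, which a tagged partial division permits.\<close>
  define c where "c x = (x + y x) / 2" for x
  define r where "r x = \<bar>y x - x\<bar> / 2" for x
  have cb: "cball (c x) (r x) = {min x (y x)..max x (y x)}" for x
    by (auto simp: c_def r_def cball_eq_atLeastAtMost min_def max_def field_simps)
  have r: "0 < r x \<and> r x \<le> b - a" if "x \<in> ?E" for x
    using y[OF that] that by (auto simp: r_def)
  have cov: "?E \<subseteq> (\<Union>x\<in>?E. cball (c x) (r x))" using cb by auto
  obtain C where C: "countable C" "C \<subseteq> ?E" "pairwise (\<lambda>i j. disjnt (cball (c i) (r i)) (cball (c j) (r j))) C"
     "?E \<subseteq> (\<Union>i\<in>C. cball (c i) (5 * r i))"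
    using Vitali_covering_lemma_cballs[OF cov r] by blast
  have fin: "measure lebesgue (\<Union>i\<in>J. cball (c i) (5 * r i)) \<le> e" if J: "J \<subseteq> C" "finite J" for J
  proof -
    have JE: "J \<subseteq> ?E" using J C(2) by blast
    define p where "p = (\<lambda>x. (x, cball (c x) (r x))) ` J"
    have tp: "p tagged_partial_division_of cbox a b"
      unfolding tagged_partial_division_of_def
    proof (intro conjI allI impI)
      show "finite p" using J by (simp add: p_def)
      fix x K assume xK: "(x, K) \<in> p"
      then have x: "x \<in> ?E" and K: "K = cball (c x) (r x)" using JE by (auto simp: p_def)
      show "x \<in> K" unfolding K cb by auto
      show "K \<subseteq> cbox a b" unfolding K cb using y[OF x] x by auto
      show "\<exists>a b. K = cbox a b" unfolding K cb by (metis box_real(2))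
    next
      fix x1 K1 x2 K2 assume "(x1, K1) \<in> p \<and> (x2, K2) \<in> p \<and> (x1, K1) \<noteq> (x2, K2)"
      then have "x1 \<in> C" "x2 \<in> C" "x1 \<noteq> x2" and K: "K1 = cball (c x1) (r x1)" "K2 = cball (c x2) (r x2)" using J by (auto simp: p_def)
      then have "disjnt K1 K2" using C(3) by (auto simp: pairwise_def)
      then show "interior K1 \<inter> interior K2 = {}" using interior_subset by (fastforce simp: disjnt_def)
    qed
    have fp: "\<gamma> fine p" unfolding fine_def p_def using y JE cb by auto
    have "measure lebesgue (\<Union>i\<in>J. cball (c i) (5 * r i)) \<le> (\<Sum>i\<in>J. measure lebesgue (cball (c i) (5 * r i)))"
      by (rule measure_UNION_le) (use J in auto)
    also have "\<dots> = (\<Sum>i\<in>J. 5 * \<bar>y i - i\<bar>)"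
      by (intro sum.cong) (simp_all add: r_def cball_eq_atLeastAtMost)
    also have "\<dots> \<le> (\<Sum>i\<in>J. 5 / \<eta> * norm (measure lborel (cball (c i) (r i)) *\<^sub>R g i - integral (cball (c i) (r i)) g))"
    proof (intro sum_mono)
      fix i assume "i \<in> J"
      then have i: "i \<in> ?E" using JE by blast
      have "measure lborel (cball (c i) (r i)) = \<bar>y i - i\<bar>" unfolding cb by (auto simp: min_def max_def)
      then have "\<eta> * \<bar>y i - i\<bar> \<le> norm (measure lborel (cball (c i) (r i)) *\<^sub>R g i - integral (cball (c i) (r i)) g)"
        using y[OF i] unfolding cb by (simp add: abs_minus_commute mult.commute)
      then show "5 * \<bar>y i - i\<bar> \<le> 5 / \<eta> * norm (measure lborel (cball (c i) (r i)) *\<^sub>R g i - integral (cball (c i) (r i)) g)"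
        using \<eta> by (simp add: field_simps)
    qed
    also have "\<dots> = 5 / \<eta> * (\<Sum>(x,k)\<in>p. norm (measure lborel k *\<^sub>R g x - integral k g))"
      unfolding p_def by (subst sum.reindex) (auto simp: inj_on_def sum_distrib_left)
    also have "\<dots> \<le> 5 / \<eta> * (\<eta> * e / 5)" using \<gamma>(2)[OF tp fp] \<eta> by (intro mult_left_mono) auto
    also have "\<dots> = e" using \<eta> by simp
    finally show ?thesis .
  qed
  show "\<exists>T. ?E \<subseteq> T \<and> T \<in> lmeasurable \<and> measure lebesgue T \<le> e"
  proof (intro exI conjI)
    show "(\<Union>i\<in>C. cball (c i) (5 * r i)) \<in> lmeasurable" by (rule fmeasurable_UN_bound[OF C(1) _ fin]) auto
    show "measure lebesgue (\<Union>i\<in>C. cball (c i) (5 * r i)) \<le> e" by (rule measure_UN_bound[OF C(1) _ fin]) auto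
  qed (rule C)
qed

lemma negligible_not_deriv_integral:
  fixes g :: "real \<Rightarrow> real"
  assumes g: "g integrable_on {a..b}"
  shows "negligible {x \<in> {a<..<b}. \<not> ((\<lambda>x. integral {a..x} g) has_real_derivative g x) (at x)}"
proof (rule negligible_subset)
  define E where "E \<eta> = {x \<in> {a<..<b}. \<forall>\<delta>>0. \<exists>y\<in>{a..b}. y \<noteq> x \<and> \<bar>y - x\<bar> < \<delta> \<and>
     \<eta> * \<bar>y - x\<bar> < \<bar>integral {min x y..max x y} g - g x * \<bar>y - x\<bar>\<bar>}" for \<eta> :: real
  show "negligible (\<Union>k. E (1 / real (Suc k)))"
  proof (intro negligible_countable_Union)
    show "negligible A" if A: "A \<in> range (\<lambda>k. E (1 / real (Suc k)))" for A
    proof -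
      obtain k where "A = E (1 / real (Suc k))" using A by blast
      then show ?thesis unfolding E_def by (simp only:, intro negligible_not_deriv_integral_aux[OF g]) simp
    qed
  qed auto
  show "{x \<in> {a<..<b}. \<not> ((\<lambda>x. integral {a..x} g) has_real_derivative g x) (at x)} \<subseteq> (\<Union>k. E (1 / real (Suc k)))"
  proof (rule ccontr)
    assume "\<not> ?thesis"
    then obtain x where x: "x \<in> {a<..<b}" "\<not> ((\<lambda>x. integral {a..x} g) has_real_derivative g x) (at x)" "\<And>k. x \<notin> E (1 / real (Suc k))" by blast
    have "((\<lambda>x. integral {a..x} g) has_real_derivative g x) (at x)"
      unfolding has_field_derivative_iff
    proof (rule tendstoI)
      fix \<epsilon> :: real assume \<epsilon>: "\<epsilon> > 0"
      obtain k where k: "1 / real (Suc k) < \<epsilon>" using nat_approx_posE[OF \<epsilon>] by blast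
      obtain \<delta> where \<delta>: "\<delta> > 0" "\<And>y. y \<in> {a..b} \<Longrightarrow> y \<noteq> x \<Longrightarrow> \<bar>y - x\<bar> < \<delta> \<Longrightarrow>
        \<bar>integral {min x y..max x y} g - g x * \<bar>y - x\<bar>\<bar> \<le> 1 / real (Suc k) * \<bar>y - x\<bar>"
      proof -
        obtain \<delta> where "\<delta> > 0" "\<not> (\<exists>y\<in>{a..b}. y \<noteq> x \<and> \<bar>y - x\<bar> < \<delta> \<and>
          1 / real (Suc k) * \<bar>y - x\<bar> < \<bar>integral {min x y..max x y} g - g x * \<bar>y - x\<bar>\<bar>)"
          using x(1) x(3)[of k] unfolding E_def by blast
        then show ?thesis by (intro that[of \<delta>]) (auto simp: not_less simp del: of_nat_Suc)
      qed
      define d where "d = min \<delta> (min (x - a) (b - x))"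
      have d: "d > 0" using \<delta> x by (auto simp: d_def)
      show "\<forall>\<^sub>F y in at x. dist ((integral {a..y} g - integral {a..x} g) / (y - x)) (g x) < \<epsilon>"
        unfolding eventually_at
      proof (intro exI[of _ d] conjI ballI impI d)
        fix y assume y: "y \<noteq> x \<and> dist y x < d"
        then have yab: "y \<in> {a..b}" "\<bar>y - x\<bar> < \<delta>" using x by (auto simp: d_def dist_real_def)
        have comb: "integral {a..u} g + integral {u..v} g = integral {a..v} g" if "a \<le> u" "u \<le> v" "v \<le> b" for u v
          using Henstock_Kurzweil_Integration.integral_combine[where a = a and c = u and b = v and f = g] integrable_subinterval_real[OF g, of a v] that by auto
        have diff: "integral {a..y} g - integral {a..x} g = sgn (y - x) * integral {min x y..max x y} g"
          using comb[of x y] comb[of y x] yab x y by (cases "x < y") (auto simp: min_def max_def sgn_if)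
        have "(integral {a..y} g - integral {a..x} g) / (y - x) - g x = (integral {min x y..max x y} g - g x * \<bar>y - x\<bar>) / \<bar>y - x\<bar>"
          unfolding diff using y by (auto simp: sgn_if field_simps abs_if)
        then have "dist ((integral {a..y} g - integral {a..x} g) / (y - x)) (g x) = \<bar>integral {min x y..max x y} g - g x * \<bar>y - x\<bar>\<bar> / \<bar>y - x\<bar>"
          by (simp add: dist_real_def)
        also have "\<dots> \<le> 1 / real (Suc k)" using \<delta>(2)[OF yab(1) _ yab(2)] y by (simp add: divide_le_eq)
        finally show "dist ((integral {a..y} g - integral {a..x} g) / (y - x)) (g x) < \<epsilon>" using k by linarith
      qed
    qed
    then show False using x by blast
  qed
qed

section \<open>Measurability of the derivative\<close>

definition quotient :: "(real \<Rightarrow> real) \<Rightarrow> real \<Rightarrow> real \<Rightarrow> real" where "quotient F h x = (F (x + h) - F x) / h"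

text \<open>Differentiability of a continuous function expressed by countably many conditions, which makes \<open>deriv\<close> measurable.\<close>

definition rat_quotients_cauchy :: "(real \<Rightarrow> real) \<Rightarrow> real \<Rightarrow> bool" where
  "rat_quotients_cauchy F x \<longleftrightarrow> (\<forall>i::nat. \<exists>j::nat. \<forall>h::rat. \<forall>k::rat. h \<noteq> 0 \<and> k \<noteq> 0 \<and> \<bar>real_of_rat h\<bar> < 1 / real (Suc j) \<and> \<bar>real_of_rat k\<bar> < 1 / real (Suc j) \<longrightarrow>
     \<bar>quotient F (real_of_rat h) x - quotient F (real_of_rat k) x\<bar> \<le> 1 / real (Suc i))"

lemma deriv_imp_rat_quotients_cauchy:
  assumes "(F has_real_derivative d) (at x)"
  shows "rat_quotients_cauchy F x"
  unfolding rat_quotients_cauchy_def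
proof (intro allI)
  fix i :: nat
  have "((\<lambda>h. quotient F h x) \<longlongrightarrow> d) (at 0)" using assms by (simp add: DERIV_def quotient_def)
  then have "\<forall>\<^sub>F h in at 0. dist (quotient F h x) d < 1 / real (Suc i) / 2" by (rule tendstoD) simp
  then obtain \<delta> where \<delta>: "\<delta> > 0" "\<And>h. h \<noteq> 0 \<Longrightarrow> \<bar>h\<bar> < \<delta> \<Longrightarrow> \<bar>quotient F h x - d\<bar> < 1 / real (Suc i) / 2"
    unfolding eventually_at dist_real_def by auto
  obtain j where j: "1 / real (Suc j) < \<delta>" using nat_approx_posE[OF \<delta>(1)] by blast
  show "\<exists>j::nat. \<forall>h::rat. \<forall>k::rat. h \<noteq> 0 \<and> k \<noteq> 0 \<and> \<bar>real_of_rat h\<bar> < 1 / real (Suc j) \<and> \<bar>real_of_rat k\<bar> < 1 / real (Suc j) \<longrightarrow>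
     \<bar>quotient F (real_of_rat h) x - quotient F (real_of_rat k) x\<bar> \<le> 1 / real (Suc i)"
  proof (intro exI[of _ j] allI impI)
    fix h k :: rat assume hk: "h \<noteq> 0 \<and> k \<noteq> 0 \<and> \<bar>real_of_rat h\<bar> < 1 / real (Suc j) \<and> \<bar>real_of_rat k\<bar> < 1 / real (Suc j)"
    have "\<bar>quotient F (real_of_rat h) x - d\<bar> < 1 / real (Suc i) / 2" "\<bar>quotient F (real_of_rat k) x - d\<bar> < 1 / real (Suc i) / 2"
      using hk j \<delta>(2)[of "real_of_rat h"] \<delta>(2)[of "real_of_rat k"] by simp_all
    then have "\<bar>quotient F (real_of_rat h) x - quotient F (real_of_rat k) x\<bar> < e / 2 + e / 2" if "e = 1 / real (Suc i)" for e
      unfolding that[symmetric] by linarith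
    then show "\<bar>quotient F (real_of_rat h) x - quotient F (real_of_rat k) x\<bar> \<le> 1 / real (Suc i)" by (simp del: of_nat_Suc add: less_imp_le)
  qed
qed

text \<open>Continuity of \<open>F\<close> makes the quotient continuous in every nonzero increment,
  so the estimates pass from rational to real increments; completeness of the reals supplies the
  derivative.\<close>

lemma rat_quotients_cauchy_imp_deriv:
  assumes F: "continuous_on UNIV F" and c: "rat_quotients_cauchy F x"
  shows "\<exists>d. (F has_real_derivative d) (at x)"
proof -
  have qc: "isCont (\<lambda>h. quotient F h x) h" if "h \<noteq> 0" for h
  proof -
    have "isCont F (x + h)" using F by (simp add: continuous_on_eq_continuous_at)
    then have "isCont (\<lambda>h. F (x + h)) h" by (intro continuous_at_compose[of h "\<lambda>h. x + h" F, unfolded o_def] continuous_intros) auto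
    then show ?thesis unfolding quotient_def using that by (intro continuous_intros) auto
  qed
  have rat_seq: "\<exists>q. (\<forall>n. q n \<noteq> 0) \<and> (\<lambda>n. real_of_rat (q n)) \<longlonglongrightarrow> h" if h: "h \<noteq> 0" for h
  proof -
    have "\<exists>q::rat. h - 1 / real (Suc n) < real_of_rat q \<and> real_of_rat q < h \<and> q \<noteq> 0" for n
    proof (cases "h > 0")
      case True
      have "max 0 (h - 1 / real (Suc n)) < h" using True by auto
      from of_rat_dense[OF this] show ?thesis by auto
    next
      case False
      have "h - 1 / real (Suc n) < h" by simp
      from of_rat_dense[OF this] obtain q where "h - 1 / real (Suc n) < real_of_rat q \<and> real_of_rat q < h" by blast
      moreover have "q \<noteq> 0" using calculation False by auto
      ultimately show ?thesis by blast
    qed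
    then obtain q where q: "\<And>n. h - 1 / real (Suc n) < real_of_rat (q n) \<and> real_of_rat (q n) < h \<and> q n \<noteq> 0" by metis
    have "(\<lambda>n. real_of_rat (q n)) \<longlonglongrightarrow> h"
    proof (rule tendsto_sandwich[of "\<lambda>n. h - 1 / real (Suc n)" _ _ "\<lambda>n. h"])
      show "(\<lambda>n. h - 1 / real (Suc n)) \<longlonglongrightarrow> h"
        using tendsto_diff[OF tendsto_const LIMSEQ_Suc[OF lim_1_over_n], of h] by simp
    qed (use q in \<open>auto intro!: always_eventually less_imp_le\<close>)
    then show ?thesis using q by blast
  qed
  have real_c: "\<exists>\<delta>>0. \<forall>h k. h \<noteq> 0 \<and> k \<noteq> 0 \<and> \<bar>h\<bar> < \<delta> \<and> \<bar>k\<bar> < \<delta> \<longrightarrow> \<bar>quotient F h x - quotient F k x\<bar> \<le> \<epsilon>" if \<epsilon>: "\<epsilon> > 0" for \<epsilon>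
  proof -
    obtain i where i: "1 / real (Suc i) < \<epsilon>" using nat_approx_posE[OF \<epsilon>] by blast
    obtain j where j: "\<And>h k :: rat. h \<noteq> 0 \<and> k \<noteq> 0 \<and> \<bar>real_of_rat h\<bar> < 1 / real (Suc j) \<and> \<bar>real_of_rat k\<bar> < 1 / real (Suc j) \<Longrightarrow>
     \<bar>quotient F (real_of_rat h) x - quotient F (real_of_rat k) x\<bar> \<le> 1 / real (Suc i)"
      using c unfolding rat_quotients_cauchy_def by blast
    show ?thesis
    proof (intro exI[of _ "1 / real (Suc j)"] conjI allI impI)
      fix h k assume hk: "h \<noteq> 0 \<and> k \<noteq> 0 \<and> \<bar>h\<bar> < 1 / real (Suc j) \<and> \<bar>k\<bar> < 1 / real (Suc j)"
      obtain p q where p: "\<And>n. p n \<noteq> 0" "(\<lambda>n. real_of_rat (p n)) \<longlonglongrightarrow> h" and q: "\<And>n. q n \<noteq> 0" "(\<lambda>n. real_of_rat (q n)) \<longlonglongrightarrow> k"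
        using rat_seq hk by metis
      have lim: "(\<lambda>n. \<bar>quotient F (real_of_rat (p n)) x - quotient F (real_of_rat (q n)) x\<bar>) \<longlonglongrightarrow> \<bar>quotient F h x - quotient F k x\<bar>"
        by (intro tendsto_intros isCont_tendsto_compose[OF qc] p q) (use hk in auto)
      have "\<forall>\<^sub>F n in sequentially. \<bar>real_of_rat (p n)\<bar> < 1 / real (Suc j)"
        by (rule order_tendstoD(2)[OF tendsto_rabs[OF p(2)]]) (use hk in blast)
      moreover have "\<forall>\<^sub>F n in sequentially. \<bar>real_of_rat (q n)\<bar> < 1 / real (Suc j)"
        by (rule order_tendstoD(2)[OF tendsto_rabs[OF q(2)]]) (use hk in blast)
      ultimately have "\<forall>\<^sub>F n in sequentially. \<bar>quotient F (real_of_rat (p n)) x - quotient F (real_of_rat (q n)) x\<bar> \<le> 1 / real (Suc i)"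
        by eventually_elim (rule j, use p q in auto)
      then have "\<bar>quotient F h x - quotient F k x\<bar> \<le> 1 / real (Suc i)"
        by (rule tendsto_upperbound[OF lim]) simp
      then show "\<bar>quotient F h x - quotient F k x\<bar> \<le> \<epsilon>" using i by linarith
    qed simp
  qed
  define e where "e n = 1 / real (Suc n)" for n
  have e: "e n \<noteq> 0" "e n > 0" for n by (simp_all add: e_def del: of_nat_Suc)
  have e0: "e \<longlonglongrightarrow> 0" unfolding e_def by (rule LIMSEQ_Suc[OF lim_1_over_n])
  have ev: "\<forall>\<^sub>F n in sequentially. \<bar>e n\<bar> < \<delta>" if "\<delta> > 0" for \<delta>
    using tendstoD[OF e0 that] by (simp add: dist_real_def)
  have "Cauchy (\<lambda>n. quotient F (e n) x)"
  proof (rule metric_CauchyI)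
    fix \<epsilon> :: real assume "\<epsilon> > 0"
    then have "\<epsilon> / 2 > 0" by simp
    from real_c[OF this] obtain \<delta> where \<delta>: "\<delta> > 0" "\<And>h k. h \<noteq> 0 \<and> k \<noteq> 0 \<and> \<bar>h\<bar> < \<delta> \<and> \<bar>k\<bar> < \<delta> \<Longrightarrow> \<bar>quotient F h x - quotient F k x\<bar> \<le> \<epsilon> / 2" by blast
    obtain N where N: "\<And>n. n \<ge> N \<Longrightarrow> \<bar>e n\<bar> < \<delta>" using ev[OF \<delta>(1)] unfolding eventually_sequentially by blast
    show "\<exists>M. \<forall>m\<ge>M. \<forall>n\<ge>M. dist (quotient F (e m) x) (quotient F (e n) x) < \<epsilon>"
    proof (intro exI[of _ N] allI impI)
      fix m n assume "N \<le> m" "N \<le> n"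
      then have "\<bar>quotient F (e m) x - quotient F (e n) x\<bar> \<le> \<epsilon> / 2" using e N by (intro \<delta>(2)) auto
      then show "dist (quotient F (e m) x) (quotient F (e n) x) < \<epsilon>" using \<open>\<epsilon> > 0\<close> by (simp add: dist_real_def)
    qed
  qed
  then obtain d where d: "(\<lambda>n. quotient F (e n) x) \<longlonglongrightarrow> d" using Cauchy_convergent convergent_def by blast
  have "((\<lambda>h. quotient F h x) \<longlongrightarrow> d) (at 0)"
  proof (rule tendstoI)
    fix \<epsilon> :: real assume \<epsilon>: "\<epsilon> > 0"
    then have "\<epsilon> / 2 > 0" by simp
    from real_c[OF this] obtain \<delta> where \<delta>: "\<delta> > 0" "\<And>h k. h \<noteq> 0 \<and> k \<noteq> 0 \<and> \<bar>h\<bar> < \<delta> \<and> \<bar>k\<bar> < \<delta> \<Longrightarrow> \<bar>quotient F h x - quotient F k x\<bar> \<le> \<epsilon> / 2" by blast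
    have "\<bar>quotient F h x - d\<bar> \<le> \<epsilon> / 2" if h: "h \<noteq> 0" "\<bar>h\<bar> < \<delta>" for h
    proof (rule tendsto_upperbound)
      show "(\<lambda>n. \<bar>quotient F h x - quotient F (e n) x\<bar>) \<longlonglongrightarrow> \<bar>quotient F h x - d\<bar>" by (intro tendsto_intros d)
      show "\<forall>\<^sub>F n in sequentially. \<bar>quotient F h x - quotient F (e n) x\<bar> \<le> \<epsilon> / 2"
        using ev[OF \<delta>(1)] by eventually_elim (rule \<delta>(2), use h e in auto)
    qed simp
    then show "\<forall>\<^sub>F h in at 0. dist (quotient F h x) d < \<epsilon>"
      unfolding eventually_at using \<delta>(1) \<epsilon> by (intro exI[of _ \<delta>]) (force simp: dist_real_def)
  qed
  then show ?thesis by (auto simp: DERIV_def quotient_def)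
qed

text \<open>\<open>Vnorm\<close> integrates \<open>deriv u\<close> itself, and replacing it by an
  almost everywhere equal function under the integral presupposes that both are measurable.\<close>

lemma borel_measurable_deriv:
  fixes F :: "real \<Rightarrow> real"
  assumes F: "continuous_on UNIV F"
  shows "deriv F \<in> borel_measurable borel"
proof -
  have [measurable]: "F \<in> borel_measurable borel" by (rule borel_measurable_continuous_onI[OF F])
  have [measurable]: "quotient F h \<in> borel_measurable borel" for h unfolding quotient_def by measurable
  have [measurable]: "Measurable.pred borel (rat_quotients_cauchy F)" unfolding rat_quotients_cauchy_def by measurable
  \<comment> \<open>Where \<open>F\<close> is not differentiable, \<open>deriv\<close> is a choice
    from the empty predicate, hence the same number at all such points.\<close>
  have "deriv F = (\<lambda>x. if rat_quotients_cauchy F x then lim (\<lambda>n. quotient F (1 / real (Suc n)) x) else (SOME d. False))"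
  proof
    fix x
    show "deriv F x = (if rat_quotients_cauchy F x then lim (\<lambda>n. quotient F (1 / real (Suc n)) x) else (SOME d. False))"
    proof (cases "rat_quotients_cauchy F x")
      case True
      then obtain d where d: "(F has_real_derivative d) (at x)" using rat_quotients_cauchy_imp_deriv[OF F] by blast
      then have "((\<lambda>h. quotient F h x) \<longlongrightarrow> d) (at 0)" by (simp add: DERIV_def quotient_def)
      moreover have "filterlim (\<lambda>n. 1 / real (Suc n)) (at 0) sequentially"
        unfolding filterlim_at using LIMSEQ_Suc[OF lim_1_over_n] by auto
      ultimately have "(\<lambda>n. quotient F (1 / real (Suc n)) x) \<longlonglongrightarrow> d" by (rule filterlim_compose)
      then show ?thesis using True DERIV_imp_deriv[OF d] by (simp add: limI)
    next
      case False
      then have "\<not> (F has_real_derivative d) (at x)" for d using deriv_imp_rat_quotients_cauchy by blast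
      then show ?thesis using False by (simp add: deriv_def)
    qed
  qed
  also have "\<dots> \<in> borel_measurable borel" by measurable
  finally show ?thesis .
qed

section \<open>Square integrable functions, represented by Borel functions vanishing off the unit
  interval\<close>

definition sqint :: "(real \<Rightarrow> real) \<Rightarrow> bool" where
  "sqint g \<longleftrightarrow> g \<in> borel_measurable borel \<and> (\<forall>x. x \<notin> {0..1} \<longrightarrow> g x = 0) \<and> integrable lborel (\<lambda>x. (g x)\<^sup>2)"

lemma sqint_D [dest]:
  assumes "sqint g"
  shows "g \<in> borel_measurable borel" "\<And>x. x \<notin> {0..1} \<Longrightarrow> g x = 0" "integrable lborel (\<lambda>x. (g x)\<^sup>2)"
  using assms by (auto simp: sqint_def)

lemma sqint_mult_integrable:
  assumes g: "sqint g" and h: "sqint h"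
  shows "integrable lborel (\<lambda>x. g x * h x)"
proof (rule Bochner_Integration.integrable_bound)
  show "integrable lborel (\<lambda>x. (g x)\<^sup>2 + (h x)\<^sup>2)" using g h by (auto simp: sqint_def)
  show "(\<lambda>x. g x * h x) \<in> borel_measurable lborel" using g h by (auto simp: sqint_def)
  show "AE x in lborel. norm (g x * h x) \<le> norm ((g x)\<^sup>2 + (h x)\<^sup>2)"
  proof (rule AE_I2)
    fix x
    have "2 * (\<bar>g x\<bar> * \<bar>h x\<bar>) \<le> (g x)\<^sup>2 + (h x)\<^sup>2" using sum_squares_bound[of "\<bar>g x\<bar>" "\<bar>h x\<bar>"] by (simp add: mult.assoc)
    then show "norm (g x * h x) \<le> norm ((g x)\<^sup>2 + (h x)\<^sup>2)" by (simp add: abs_mult)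
      (smt (verit) mult_nonneg_nonneg abs_ge_zero)
  qed
qed

lemma sqint_lin:
  assumes g: "sqint g" and h: "sqint h"
  shows "sqint (\<lambda>x. a * g x + b * h x)"
  unfolding sqint_def
proof (intro conjI allI impI)
  have "(\<lambda>x. (a * g x + b * h x)\<^sup>2) = (\<lambda>x. a\<^sup>2 * (g x)\<^sup>2 + 2 * a * b * (g x * h x) + b\<^sup>2 * (h x)\<^sup>2)"
    by (auto simp: power2_eq_square algebra_simps)
  then show "integrable lborel (\<lambda>x. (a * g x + b * h x)\<^sup>2)"
    using g h sqint_mult_integrable[OF g h] by (auto simp: sqint_def)
qed (use g h in \<open>auto simp: sqint_def\<close>)

lemma sqint_diff: "sqint g \<Longrightarrow> sqint h \<Longrightarrow> sqint (\<lambda>x. g x - h x)"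
  using sqint_lin[of g h 1 "-1"] by simp

lemma sqint_continuous:
  assumes "continuous_on {0..1} g"
  shows "sqint (\<lambda>x. if x \<in> {0..1} then g x else 0)"
  unfolding sqint_def
proof (intro conjI allI impI)
  show "(\<lambda>x. if x \<in> {0..1} then g x else 0) \<in> borel_measurable borel"
    by (rule borel_measurable_continuous_on_if) (auto intro: assms)
  have "integrable lborel (\<lambda>x. indicator {0..1} x *\<^sub>R (g x)\<^sup>2)"
    by (rule borel_integrable_atLeastAtMost'[unfolded set_integrable_def]) (intro continuous_intros assms)
  also have "(\<lambda>x. indicator {0..1} x *\<^sub>R (g x)\<^sup>2) = (\<lambda>x. (if x \<in> {0..1} then g x else 0)\<^sup>2)" by (auto simp: indicator_def)
  finally show "integrable lborel (\<lambda>x. (if x \<in> {0..1} then g x else 0)\<^sup>2)" .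
qed auto

lemma sqint_one: "sqint (indicator {0..1})"
proof -
  have "(\<lambda>x. (indicator {0..1} x)\<^sup>2) = (indicator {0..1} :: real \<Rightarrow> real)" by (auto simp: indicator_def)
  then show ?thesis unfolding sqint_def by (auto simp: indicator_def[of _ "_ :: real"])
qed

lemma sqint_integrable:
  assumes g: "sqint g" shows "integrable lborel g"
proof -
  have "integrable lborel (\<lambda>x. g x * indicator {0..1} x)" by (rule sqint_mult_integrable[OF g sqint_one])
  also have "(\<lambda>x. g x * indicator {0..1} x) = g"
    using sqint_D(2)[OF g] by (intro ext) (auto simp: indicator_def)
  finally show ?thesis .
qed

text \<open>The variance of the absolute value of \<open>g\<close> on the unit interval, with mean
  \<open>c\<close>, is nonnegative.\<close>

lemma sqint_L1_le:
  assumes g: "sqint g"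
  shows "(\<integral>x. \<bar>g x\<bar> \<partial>lborel) \<le> sqrt (\<integral>x. (g x)\<^sup>2 \<partial>lborel)"
proof -
  define c where "c = (\<integral>x. \<bar>g x\<bar> \<partial>lborel)"
  have one: "integrable lborel (\<lambda>x. c\<^sup>2 * indicator {0..1::real} x)" by (simp add: sqint_integrable[OF sqint_one])
  have "(\<integral>x. (g x)\<^sup>2 - 2 * c * \<bar>g x\<bar> + c\<^sup>2 * indicator {0..1} x \<partial>lborel) = (\<integral>x. (g x)\<^sup>2 \<partial>lborel) - 2 * c * c + c\<^sup>2 * 1"
    using sqint_integrable[OF g] sqint_D(3)[OF g] one by (simp add: c_def)
  moreover have "0 \<le> (\<integral>x. (g x)\<^sup>2 - 2 * c * \<bar>g x\<bar> + c\<^sup>2 * indicator {0..1} x \<partial>lborel)"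
  proof (rule integral_nonneg_AE, rule AE_I2)
    fix x show "0 \<le> (g x)\<^sup>2 - 2 * c * \<bar>g x\<bar> + c\<^sup>2 * indicator {0..1} x"
      using sqint_D(2)[OF g, of x] zero_le_power2[of "\<bar>g x\<bar> - c"] by (auto simp: indicator_def power2_eq_square algebra_simps)
  qed
  ultimately have "c\<^sup>2 \<le> (\<integral>x. (g x)\<^sup>2 \<partial>lborel)" by (simp add: power2_eq_square)
  then show ?thesis unfolding c_def by (rule real_le_rsqrt)
qed

lemma sqint_primitive_le:
  assumes g: "sqint g"
  shows "\<bar>LINT s:{0..x}|lborel. g s\<bar> \<le> sqrt (\<integral>x. (g x)\<^sup>2 \<partial>lborel)"
proof -
  have "\<bar>LINT s:{0..x}|lborel. g s\<bar> \<le> (\<integral>s. \<bar>indicator {0..x} s *\<^sub>R g s\<bar> \<partial>lborel)"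
    unfolding set_lebesgue_integral_def using integral_norm_bound[of lborel "\<lambda>s. indicator {0..x} s *\<^sub>R g s"] by simp
  also have "\<dots> \<le> (\<integral>s. \<bar>g s\<bar> \<partial>lborel)"
    using sqint_integrable[OF g]
    by (intro integral_mono integrable_abs integrable_mult_indicator) (auto simp: indicator_def)
  also have "\<dots> \<le> sqrt (\<integral>x. (g x)\<^sup>2 \<partial>lborel)" by (rule sqint_L1_le[OF g])
  finally show ?thesis .
qed

lemma sqint_set_integrable: "sqint g \<Longrightarrow> A \<in> sets borel \<Longrightarrow> set_integrable lborel A g"
  unfolding set_integrable_def by (intro integrable_mult_indicator sqint_integrable) auto

text \<open>Riesz-Fischer: on the unit interval the sequence is also Cauchy in L1, which yields a
  subsequence converging almost everywhere, and Fatou's lemma turns its limit into an L2 limit of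
  the whole sequence.\<close>

lemma sqint_complete:
  assumes g: "\<And>k. sqint (g k)"
    and cauchy: "\<And>e. e > 0 \<Longrightarrow> \<exists>N. \<forall>i\<ge>N. \<forall>j\<ge>N. (\<integral>x. (g i x - g j x)\<^sup>2 \<partial>lborel) < e"
  obtains h where "sqint h" "(\<lambda>k. \<integral>x. (g k x - h x)\<^sup>2 \<partial>lborel) \<longlonglongrightarrow> 0"
proof -
  have [measurable]: "g k \<in> borel_measurable borel" for k using g by blast
  have "\<exists>N. \<forall>i\<ge>N. \<forall>j\<ge>N. (\<integral>x. norm (g i x - g j x) \<partial>lborel) < e" if e: "e > 0" for e
  proof -
    obtain N where N: "\<And>i j. i \<ge> N \<Longrightarrow> j \<ge> N \<Longrightarrow> (\<integral>x. (g i x - g j x)\<^sup>2 \<partial>lborel) < e\<^sup>2"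
      using cauchy[of "e\<^sup>2"] e by auto
    have "(\<integral>x. norm (g i x - g j x) \<partial>lborel) < e" if "i \<ge> N" "j \<ge> N" for i j
    proof -
      have "(\<integral>x. norm (g i x - g j x) \<partial>lborel) \<le> sqrt (\<integral>x. (g i x - g j x)\<^sup>2 \<partial>lborel)"
        using sqint_L1_le[OF sqint_diff[OF g g]] by simp
      also have "\<dots> < sqrt (e\<^sup>2)" using N[OF that] by (intro real_sqrt_less_mono)
      finally show ?thesis using e by simp
    qed
    then show ?thesis by blast
  qed
  then obtain r where r: "strict_mono r" "AE x in lborel. Cauchy (\<lambda>i. g (r i) x)"
    using cauchy_L1_AE_cauchy_subseq[of lborel g] sqint_integrable[OF g] by blast
  \<comment> \<open>Replacing the sequence by the constant 0 where it is not Cauchy makes the limit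
    exist, and hence measurable, at every point.\<close>
  define h where "h x = lim (\<lambda>i. if Cauchy (\<lambda>i. g (r i) x) then g (r i) x else 0)" for x
  have [measurable]: "h \<in> borel_measurable borel" unfolding h_def by measurable
  have hl: "AE x in lborel. (\<lambda>i. g (r i) x) \<longlonglongrightarrow> h x"
    using r(2) by eventually_elim (simp add: h_def Cauchy_convergent_iff convergent_LIMSEQ_iff)
  have h0: "h x = 0" if "x \<notin> {0..1}" for x
    unfolding h_def sqint_D(2)[OF g that] by (simp add: limI)
  have fatou: "integrable lborel (\<lambda>x. (g j x - h x)\<^sup>2) \<and> (\<integral>x. (g j x - h x)\<^sup>2 \<partial>lborel) \<le> e"
    if e: "e > 0" and N: "\<And>i. i \<ge> N \<Longrightarrow> (\<integral>x. (g i x - g j x)\<^sup>2 \<partial>lborel) < e" for e N j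
  proof -
    have "(\<integral>\<^sup>+x. ennreal ((g j x - h x)\<^sup>2) \<partial>lborel) = (\<integral>\<^sup>+x. liminf (\<lambda>i. ennreal ((g (r i) x - g j x)\<^sup>2)) \<partial>lborel)"
    proof (rule nn_integral_cong_AE, use hl in eventually_elim)
      fix x assume "(\<lambda>i. g (r i) x) \<longlonglongrightarrow> h x"
      then have "(\<lambda>i. ennreal ((g (r i) x - g j x)\<^sup>2)) \<longlonglongrightarrow> ennreal ((h x - g j x)\<^sup>2)"
        by (intro tendsto_intros)
      then show "ennreal ((g j x - h x)\<^sup>2) = liminf (\<lambda>i. ennreal ((g (r i) x - g j x)\<^sup>2))"
        by (subst lim_imp_Liminf[OF sequentially_bot]) (simp_all add: power2_commute[of "g j x"])
    qed
    also have "\<dots> \<le> liminf (\<lambda>i. \<integral>\<^sup>+x. ennreal ((g (r i) x - g j x)\<^sup>2) \<partial>lborel)"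
      by (rule nn_integral_liminf) measurable
    also have "\<dots> \<le> liminf (\<lambda>i::nat. ennreal e)"
    proof (rule Liminf_mono, rule eventually_mono[OF eventually_ge_at_top[of N]])
      fix i assume "N \<le> i"
      then have "r i \<ge> N" using seq_suble[OF r(1), of i] by linarith
      have "(\<integral>\<^sup>+x. ennreal ((g (r i) x - g j x)\<^sup>2) \<partial>lborel) = ennreal (\<integral>x. (g (r i) x - g j x)\<^sup>2 \<partial>lborel)"
        using sqint_D(3)[OF sqint_diff[OF g g]] by (intro nn_integral_eq_integral) auto
      then show "(\<integral>\<^sup>+x. ennreal ((g (r i) x - g j x)\<^sup>2) \<partial>lborel) \<le> ennreal e"
        using N[OF \<open>r i \<ge> N\<close>] by (simp add: ennreal_leI)
    qed
    also have "\<dots> = ennreal e" by (simp add: Liminf_const)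
    finally have le: "(\<integral>\<^sup>+x. ennreal ((g j x - h x)\<^sup>2) \<partial>lborel) \<le> ennreal e" .
    have int: "integrable lborel (\<lambda>x. (g j x - h x)\<^sup>2)"
      by (rule integrableI_bounded) (use le in \<open>auto intro: le_less_trans\<close>)
    then have "ennreal (\<integral>x. (g j x - h x)\<^sup>2 \<partial>lborel) \<le> ennreal e"
      using le nn_integral_eq_integral[OF int] by simp
    then show ?thesis using int e by (simp add: ennreal_le_iff)
  qed
  have fat2: "\<exists>N. \<forall>j\<ge>N. integrable lborel (\<lambda>x. (g j x - h x)\<^sup>2) \<and> (\<integral>x. (g j x - h x)\<^sup>2 \<partial>lborel) \<le> e" if e: "e > 0" for e
    using cauchy[OF e] fatou[OF e] by blast
  obtain j where "integrable lborel (\<lambda>x. (g j x - h x)\<^sup>2)" using fat2[of 1] by auto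
  then have "sqint (\<lambda>x. g j x - h x)" unfolding sqint_def using h0 sqint_D(2)[OF g] by auto
  then have "sqint h" using sqint_diff[OF g[of j]] by fastforce
  moreover have "(\<lambda>k. \<integral>x. (g k x - h x)\<^sup>2 \<partial>lborel) \<longlonglongrightarrow> 0"
  proof (rule LIMSEQ_I)
    fix e :: real assume e: "e > 0"
    then obtain N where N: "\<forall>j\<ge>N. integrable lborel (\<lambda>x. (g j x - h x)\<^sup>2) \<and> (\<integral>x. (g j x - h x)\<^sup>2 \<partial>lborel) \<le> e / 2"
      using fat2[of "e/2"] by auto
    then show "\<exists>no. \<forall>n\<ge>no. norm ((\<integral>x. (g n x - h x)\<^sup>2 \<partial>lborel) - 0) < e"
      using e by (intro exI[of _ N]) (force simp: integral_nonneg_AE)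
  qed
  ultimately show ?thesis by (rule that)
qed

text \<open>Membership in \<open>V\<close> with the derivative as a parameter. The normalisation
  \<open>sqint g\<close> lets linear combinations and limits be taken on \<open>g\<close> instead of
  \<open>deriv u\<close>.\<close>

definition wderiv :: "(real \<Rightarrow> real) \<Rightarrow> (real \<Rightarrow> real) \<Rightarrow> bool" where
  "wderiv u g \<longleftrightarrow> sqint g \<and> (\<forall>x\<in>{0..1}. u x = (LINT s:{0..x}|lborel. g s)) \<and> u 0 = 0 \<and> u 1 = 0 \<and> (\<forall>x. x \<notin> {0..1} \<longrightarrow> u x = 0)"

lemma V_iff: "u \<in> V \<longleftrightarrow> (\<exists>g. wderiv u g)"
proof
  assume "u \<in> V"
  then obtain g where g: "g \<in> L2" "\<forall>x\<in>{0..1}. u x = (LINT s:{0..x}|lborel. g s)" "u 0 = 0" "u 1 = 0" "\<forall>x. x \<notin> {0..1} \<longrightarrow> u x = 0"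
    unfolding V_def by blast
  define h where "h x = indicator {0..1} x * g x" for x
  have "sqint h" unfolding sqint_def
  proof (intro conjI allI impI)
    have "(\<lambda>x. (h x)\<^sup>2) = (\<lambda>x. indicator {0..1} x *\<^sub>R (g x)\<^sup>2)" by (auto simp: h_def indicator_def)
    then show "integrable lborel (\<lambda>x. (h x)\<^sup>2)" using g(1) by (simp add: L2_def set_integrable_def)
    show "h \<in> borel_measurable borel"
      using g(1) unfolding L2_def set_borel_measurable_def h_def by simp
  qed (auto simp: h_def)
  moreover have "(LINT s:{0..x}|lborel. h s) = (LINT s:{0..x}|lborel. g s)" if "x \<in> {0..1}" for x
    using that by (intro set_lebesgue_integral_cong) (auto simp: h_def)
  ultimately show "\<exists>g. wderiv u g" unfolding wderiv_def using g by (intro exI[of _ h]) auto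
next
  assume "\<exists>g. wderiv u g"
  then obtain g where g: "wderiv u g" by blast
  then have q: "sqint g" by (simp add: wderiv_def)
  have "set_integrable lborel {0..1} (\<lambda>x. (g x)\<^sup>2)"
    unfolding set_integrable_def by (rule integrable_mult_indicator) (use q in auto)
  then have "g \<in> L2" using sqint_D(1)[OF q] unfolding L2_def set_borel_measurable_def by simp
  then show "u \<in> V" using g unfolding V_def wderiv_def by blast
qed

lemma wderiv_integral:
  assumes "wderiv u g"
  shows "g integrable_on {0..1}" "\<And>x. x \<in> {0..1} \<Longrightarrow> u x = integral {0..x} g"
proof -
  have g: "sqint g" using assms by (simp add: wderiv_def)
  show "g integrable_on {0..1}"
    by (rule set_borel_integral_eq_integral(1)[OF sqint_set_integrable[OF g]]) simp
  show "u x = integral {0..x} g" if "x \<in> {0..1}" for x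
    using assms that set_borel_integral_eq_integral(2)[OF sqint_set_integrable[OF g, of "{0..x}"]] by (simp add: wderiv_def)
qed

lemma wderiv_continuous:
  assumes u: "wderiv u g"
  shows "continuous_on UNIV u"
proof -
  have c1: "continuous_on {0..1} u"
    by (rule continuous_on_eq[OF indefinite_integral_continuous_1[OF wderiv_integral(1)[OF u]]]) (rule wderiv_integral(2)[OF u, symmetric])
  have u0: "0 = u x" if x: "x \<in> {..0} \<union> {1..}" for x
  proof -
    have "u 0 = 0" "u 1 = 0" "\<And>x. x \<notin> {0..1} \<Longrightarrow> u x = 0" using u by (simp_all add: wderiv_def)
    moreover have "x = 0 \<or> x = 1 \<or> x \<notin> {0..1}" using x by auto
    ultimately show ?thesis by metis
  qed
  have c2: "continuous_on ({..0} \<union> {1..}) u"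
    by (rule continuous_on_eq[OF continuous_on_const u0])
  have "continuous_on (({..0} \<union> {1..}) \<union> {0..1}) u"
    by (rule continuous_on_closed_Un[OF _ _ c2 c1]) auto
  moreover have "({..0} \<union> {1..}) \<union> {0..1} = (UNIV :: real set)" by auto
  ultimately show ?thesis by simp
qed

text \<open>By the differentiation theorem \<open>deriv u\<close> equals \<open>g\<close> off a null
  set. The end points are removed too, because the two-sided derivative there sees the extension of
  \<open>u\<close> by zero.\<close>

lemma Vnorm_wderiv:
  assumes u: "wderiv u g"
  shows "Vnorm u = sqrt (\<integral>x. (g x)\<^sup>2 \<partial>lborel)"
proof -
  have g: "sqint g" using u by (simp add: wderiv_def)
  define N where "N = {x \<in> {0<..<1}. \<not> ((\<lambda>x. integral {0..x} g) has_real_derivative g x) (at x)}"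
  have "negligible N" unfolding N_def by (rule negligible_not_deriv_integral[OF wderiv_integral(1)[OF u]])
  then have "negligible (N \<union> {0, 1})" by (intro negligible_Un) auto
  then have "AE x in lebesgue. x \<notin> N \<union> {0, 1}"
    unfolding negligible_iff_null_sets by (rule AE_not_in)
  then have "AE x in lborel. x \<notin> N \<union> {0, 1}" by (simp only: AE_completion_iff)
  then have ae: "AE x in lborel. indicator {0..1} x *\<^sub>R (deriv u x)\<^sup>2 = (g x)\<^sup>2"
  proof eventually_elim
    case (elim x)
    show ?case
    proof (cases "x \<in> {0..1}")
      case True
      then have x: "x \<in> {0<..<1}" using elim by auto
      then have "((\<lambda>x. integral {0..x} g) has_real_derivative g x) (at x)" using elim by (auto simp: N_def)
      then have "(u has_real_derivative g x) (at x)"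
      proof (rule has_field_derivative_transform_within_open[of _ _ _ "{0<..<1}"])
        show "integral {0..s} g = u s" if "s \<in> {0<..<1}" for s
          by (rule wderiv_integral(2)[OF u, symmetric]) (use that in auto)
      qed (use x in auto)
      then show ?thesis using True by (simp add: DERIV_imp_deriv)
    next
      case False
      then show ?thesis using sqint_D(2)[OF g] by simp
    qed
  qed
  have [measurable]: "deriv u \<in> borel_measurable borel" "g \<in> borel_measurable borel"
    using borel_measurable_deriv[OF wderiv_continuous[OF u]] sqint_D(1)[OF g] by auto
  have "(LINT x:{0..1}|lborel. (deriv u x)\<^sup>2) = (\<integral>x. (g x)\<^sup>2 \<partial>lborel)"
    unfolding set_lebesgue_integral_def by (intro integral_cong_AE ae) measurable
  then show ?thesis by (simp add: Vnorm_def)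
qed

section \<open>Hilbert space structure of V\<close>

lemma sqint_Cauchy_Schwarz:
  assumes g: "sqint g" and h: "sqint h"
  shows "\<bar>\<integral>x. g x * h x \<partial>lborel\<bar> \<le> sqrt (\<integral>x. (g x)\<^sup>2 \<partial>lborel) * sqrt (\<integral>x. (h x)\<^sup>2 \<partial>lborel)"
proof -
  define P Q R where "P = (\<integral>x. (g x)\<^sup>2 \<partial>lborel)" and "Q = (\<integral>x. (h x)\<^sup>2 \<partial>lborel)" and "R = (\<integral>x. g x * h x \<partial>lborel)"
  have q: "0 \<le> P - 2 * c * R + c\<^sup>2 * Q" for c
  proof -
    have "(\<integral>x. (g x)\<^sup>2 - 2 * c * (g x * h x) + c\<^sup>2 * (h x)\<^sup>2 \<partial>lborel) = P - 2 * c * R + c\<^sup>2 * Q"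
      unfolding P_def Q_def R_def using sqint_mult_integrable[OF g h] sqint_D(3)[OF g] sqint_D(3)[OF h] by simp
    moreover have "0 \<le> (\<integral>x. (g x)\<^sup>2 - 2 * c * (g x * h x) + c\<^sup>2 * (h x)\<^sup>2 \<partial>lborel)"
    proof (rule integral_nonneg_AE, rule AE_I2)
      fix x show "0 \<le> (g x)\<^sup>2 - 2 * c * (g x * h x) + c\<^sup>2 * (h x)\<^sup>2"
        using zero_le_power2[of "g x - c * h x"] by (simp add: power2_eq_square algebra_simps)
    qed
    ultimately show ?thesis by simp
  qed
  have Q0: "Q \<ge> 0" and P0: "P \<ge> 0" unfolding P_def Q_def by (auto intro: integral_nonneg_AE)
  have "R\<^sup>2 \<le> P * Q"
  proof (cases "Q = 0")
    case True
    have "R = 0"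
    proof (rule ccontr)
      assume "R \<noteq> 0"
      then show False using q[of "(P + 1) / (2 * R)"] q[of 0] True by simp
    qed
    then show ?thesis using True by simp
  next
    case False
    then have "P - 2 * (R / Q) * R + (R / Q)\<^sup>2 * Q = P - R\<^sup>2 / Q" by (simp add: power2_eq_square)
    then have "R\<^sup>2 / Q \<le> P" using q[of "R / Q"] by simp
    then show ?thesis using False Q0 by (simp add: pos_divide_le_eq)
  qed
  then have "\<bar>R\<bar> \<le> sqrt (P * Q)" by (intro real_le_rsqrt) simp
  then show ?thesis by (simp add: P_def Q_def R_def real_sqrt_mult)
qed

lemma sqint_lin_square:
  assumes g: "sqint g" and h: "sqint h"
  shows "(\<integral>x. (a * g x + b * h x)\<^sup>2 \<partial>lborel) = a\<^sup>2 * (\<integral>x. (g x)\<^sup>2 \<partial>lborel) + 2 * a * b * (\<integral>x. g x * h x \<partial>lborel) + b\<^sup>2 * (\<integral>x. (h x)\<^sup>2 \<partial>lborel)"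
proof -
  have "(\<lambda>x. (a * g x + b * h x)\<^sup>2) = (\<lambda>x. a\<^sup>2 * (g x)\<^sup>2 + 2 * a * b * (g x * h x) + b\<^sup>2 * (h x)\<^sup>2)"
    by (auto simp: power2_eq_square algebra_simps)
  then show ?thesis
    using sqint_mult_integrable[OF g h] sqint_D(3)[OF g] sqint_D(3)[OF h] by simp
qed

lemma sqint_triangle:
  assumes g: "sqint g" and h: "sqint h"
  shows "sqrt (\<integral>x. (g x + h x)\<^sup>2 \<partial>lborel) \<le> sqrt (\<integral>x. (g x)\<^sup>2 \<partial>lborel) + sqrt (\<integral>x. (h x)\<^sup>2 \<partial>lborel)"
proof (rule real_le_lsqrt)
  have P: "(\<integral>x. (g x)\<^sup>2 \<partial>lborel) \<ge> 0" "(\<integral>x. (h x)\<^sup>2 \<partial>lborel) \<ge> 0" by (auto intro: integral_nonneg_AE)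
  then show "0 \<le> sqrt (\<integral>x. (g x)\<^sup>2 \<partial>lborel) + sqrt (\<integral>x. (h x)\<^sup>2 \<partial>lborel)" by simp
  show "(\<integral>x. (g x + h x)\<^sup>2 \<partial>lborel) \<le> (sqrt (\<integral>x. (g x)\<^sup>2 \<partial>lborel) + sqrt (\<integral>x. (h x)\<^sup>2 \<partial>lborel))\<^sup>2"
    using sqint_lin_square[OF g h, of 1 1] sqint_Cauchy_Schwarz[OF g h] P by (simp add: power2_sum)
qed

lemma wderiv_lin:
  assumes u: "wderiv u g" and v: "wderiv v h"
  shows "wderiv (\<lambda>x. a * u x + b * v x) (\<lambda>x. a * g x + b * h x)"
proof -
  have g: "sqint g" "sqint h" using u v by (auto simp: wderiv_def)
  have "(LINT s:{0..x}|lborel. a * g s + b * h s) = a * (LINT s:{0..x}|lborel. g s) + b * (LINT s:{0..x}|lborel. h s)" for x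
    using set_integral_add[of lborel "{0..x}" "\<lambda>s. a * g s" "\<lambda>s. b * h s"] sqint_set_integrable[OF g(1), of "{0..x}"] sqint_set_integrable[OF g(2), of "{0..x}"] by simp
  then show ?thesis using u v sqint_lin[OF g] by (auto simp: wderiv_def)
qed

lemma V_lin: "u \<in> V \<Longrightarrow> v \<in> V \<Longrightarrow> (\<lambda>x. a * u x + b * v x) \<in> V"
  unfolding V_iff using wderiv_lin by blast

lemma V_diff: "u \<in> V \<Longrightarrow> v \<in> V \<Longrightarrow> (\<lambda>x. u x - v x) \<in> V"
  using V_lin[of u v 1 "-1"] by simp

text \<open>\<open>B\<close> is the inner product of the two derivatives. One number valid for all
  \<open>a\<close> and \<open>b\<close> yields the triangle inequality, the symmetry of the distance
  and the parallelogram law without a name for that inner product.\<close>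

lemma Vnorm_lin_square:
  assumes "u \<in> V" "v \<in> V"
  shows "\<exists>B. (\<forall>a b. (Vnorm (\<lambda>x. a * u x + b * v x))\<^sup>2 = a\<^sup>2 * (Vnorm u)\<^sup>2 + 2 * a * b * B + b\<^sup>2 * (Vnorm v)\<^sup>2) \<and> \<bar>B\<bar> \<le> Vnorm u * Vnorm v"
proof -
  obtain g h where gh: "wderiv u g" "wderiv v h" using assms V_iff by blast
  have q: "sqint g" "sqint h" using gh by (auto simp: wderiv_def)
  have *: "(Vnorm w)\<^sup>2 = (\<integral>x. (k x)\<^sup>2 \<partial>lborel)" if "wderiv w k" for w k
    using Vnorm_wderiv[OF that] by (simp add: integral_nonneg_AE)
  show ?thesis
  proof (intro exI[of _ "\<integral>x. g x * h x \<partial>lborel"] conjI allI)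
    show "(Vnorm (\<lambda>x. a * u x + b * v x))\<^sup>2 = a\<^sup>2 * (Vnorm u)\<^sup>2 + 2 * a * b * (\<integral>x. g x * h x \<partial>lborel) + b\<^sup>2 * (Vnorm v)\<^sup>2" for a b
      unfolding *[OF wderiv_lin[OF gh]] *[OF gh(1)] *[OF gh(2)] by (rule sqint_lin_square[OF q])
    show "\<bar>\<integral>x. g x * h x \<partial>lborel\<bar> \<le> Vnorm u * Vnorm v"
      unfolding Vnorm_wderiv[OF gh(1)] Vnorm_wderiv[OF gh(2)] by (rule sqint_Cauchy_Schwarz[OF q])
  qed
qed

lemma Vnorm_nonneg [simp]: "Vnorm u \<ge> 0"
  unfolding Vnorm_def set_lebesgue_integral_def by (auto intro!: integral_nonneg_AE)

lemma Vnorm_triangle: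
  assumes "u \<in> V" "v \<in> V"
  shows "Vnorm (\<lambda>x. u x + v x) \<le> Vnorm u + Vnorm v"
proof -
  obtain B where B0: "\<forall>a b. (Vnorm (\<lambda>x. a * u x + b * v x))\<^sup>2 = a\<^sup>2 * (Vnorm u)\<^sup>2 + 2 * a * b * B + b\<^sup>2 * (Vnorm v)\<^sup>2" "\<bar>B\<bar> \<le> Vnorm u * Vnorm v"
    using Vnorm_lin_square[OF assms] by (elim exE conjE)
  note B = B0[rule_format]
  have "(Vnorm (\<lambda>x. u x + v x))\<^sup>2 \<le> (Vnorm u + Vnorm v)\<^sup>2"
    using B(1)[of 1 1] B(2) by (simp add: power2_sum)
  then show ?thesis by (rule power2_le_imp_le) simp
qed

lemma Vnorm_minus_commute: "u \<in> V \<Longrightarrow> v \<in> V \<Longrightarrow> Vnorm (\<lambda>x. u x - v x) = Vnorm (\<lambda>x. v x - u x)"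
proof -
  assume uv: "u \<in> V" "v \<in> V"
  obtain B where B0: "\<forall>a b. (Vnorm (\<lambda>x. a * u x + b * v x))\<^sup>2 = a\<^sup>2 * (Vnorm u)\<^sup>2 + 2 * a * b * B + b\<^sup>2 * (Vnorm v)\<^sup>2"
    using Vnorm_lin_square[OF uv] by (elim exE conjE)
  note B = B0[rule_format]
  have "(Vnorm (\<lambda>x. u x - v x))\<^sup>2 = (Vnorm (\<lambda>x. v x - u x))\<^sup>2" using B[of 1 "-1"] B[of "-1" 1] by simp
  then show ?thesis by (simp add: power2_eq_iff_nonneg)
qed

text \<open>The parallelogram law. Its last term is the strong convexity of the regularisation,
  which has to outweigh the defect of the solution map.\<close>

lemma Vnorm_midpoint:
  assumes "u \<in> V" "v \<in> V"
  shows "(Vnorm (\<lambda>x. (u x + v x) / 2))\<^sup>2 = (Vnorm u)\<^sup>2 / 2 + (Vnorm v)\<^sup>2 / 2 - (Vnorm (\<lambda>x. u x - v x))\<^sup>2 / 4"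
proof -
  obtain B where B0: "\<forall>a b. (Vnorm (\<lambda>x. a * u x + b * v x))\<^sup>2 = a\<^sup>2 * (Vnorm u)\<^sup>2 + 2 * a * b * B + b\<^sup>2 * (Vnorm v)\<^sup>2"
    using Vnorm_lin_square[OF assms] by (elim exE conjE)
  note B = B0[rule_format]
  have "(\<lambda>x. (u x + v x) / 2) = (\<lambda>x. (1/2) * u x + (1/2) * v x)" by (auto simp: field_simps)
  then show ?thesis using B[of "1/2" "1/2"] B[of 1 "-1"] by (simp add: power2_eq_square algebra_simps)
qed

lemma abs_le_Vnorm:
  assumes "u \<in> V" shows "\<bar>u x\<bar> \<le> Vnorm u"
proof -
  obtain g where g: "wderiv u g" using assms V_iff by blast
  then have q: "sqint g" by (simp add: wderiv_def)
  show ?thesis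
  proof (cases "x \<in> {0..1}")
    case True
    then have "u x = (LINT s:{0..x}|lborel. g s)" using g by (simp add: wderiv_def)
    then show ?thesis using sqint_primitive_le[OF q] Vnorm_wderiv[OF g] by simp
  next
    case False
    then have "u x = 0" using g by (simp add: wderiv_def)
    then show ?thesis by simp
  qed
qed

lemma V_continuous: "u \<in> V \<Longrightarrow> continuous_on S u"
  using V_iff wderiv_continuous continuous_on_subset by (metis subset_UNIV)

text \<open>The derivatives converge in L2 and their primitives pointwise; hence the limit of the
  derivatives has a primitive that again vanishes at 1.\<close>

lemma V_complete:
  assumes V: "\<And>k. u k \<in> V"
    and cauchy: "\<And>e. e > 0 \<Longrightarrow> \<exists>N. \<forall>i\<ge>N. \<forall>j\<ge>N. Vnorm (\<lambda>x. u i x - u j x) < e"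
  obtains v where "v \<in> V" "(\<lambda>k. Vnorm (\<lambda>x. u k x - v x)) \<longlonglongrightarrow> 0"
proof -
  have "\<forall>k. \<exists>g. wderiv (u k) g" using V V_iff by blast
  from choice[OF this] obtain g where g: "\<And>k. wderiv (u k) (g k)" by blast
  then have q: "sqint (g k)" for k by (simp add: wderiv_def)
  have d: "wderiv (\<lambda>x. u i x - u j x) (\<lambda>x. g i x - g j x)" for i j using wderiv_lin[OF g g, of 1 i "-1" j] by simp
  have "\<exists>N. \<forall>i\<ge>N. \<forall>j\<ge>N. (\<integral>x. (g i x - g j x)\<^sup>2 \<partial>lborel) < e" if e: "e > 0" for e
  proof -
    obtain N where N: "\<And>i j. i \<ge> N \<Longrightarrow> j \<ge> N \<Longrightarrow> Vnorm (\<lambda>x. u i x - u j x) < sqrt e" using cauchy[of "sqrt e"] e by auto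
    then show ?thesis unfolding Vnorm_wderiv[OF d] by auto
  qed
  then obtain h where h: "sqint h" "(\<lambda>k. \<integral>x. (g k x - h x)\<^sup>2 \<partial>lborel) \<longlonglongrightarrow> 0"
    by (rule sqint_complete[OF q]) (assumption, rule that)
  have lim: "(\<lambda>k. sqrt (\<integral>x. (g k x - h x)\<^sup>2 \<partial>lborel)) \<longlonglongrightarrow> 0" using tendsto_real_sqrt[OF h(2)] by simp
  have prim: "(\<lambda>k. u k x) \<longlonglongrightarrow> (LINT s:{0..x}|lborel. h s)" if x: "x \<in> {0..1}" for x
  proof -
    have "\<bar>u k x - (LINT s:{0..x}|lborel. h s)\<bar> \<le> sqrt (\<integral>x. (g k x - h x)\<^sup>2 \<partial>lborel)" for k
    proof -
      have "u k x - (LINT s:{0..x}|lborel. h s) = (LINT s:{0..x}|lborel. g k s - h s)"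
        using g[of k] x set_integral_diff(2)[OF sqint_set_integrable[OF q[of k]] sqint_set_integrable[OF h(1)], of "{0..x}"] by (simp add: wderiv_def)
      then show ?thesis using sqint_primitive_le[OF sqint_diff[OF q h(1)]] by simp
    qed
    then have "(\<lambda>k. u k x - (LINT s:{0..x}|lborel. h s)) \<longlonglongrightarrow> 0"
      by (intro Lim_null_comparison[OF _ lim] always_eventually) simp
    then show ?thesis by (simp add: LIM_zero_iff)
  qed
  define v where "v x = (if x \<in> {0..1} then (LINT s:{0..x}|lborel. h s) else 0)" for x
  have v: "wderiv v h" unfolding wderiv_def
  proof (intro conjI ballI allI impI)
    have h01: "(LINT s:{0..x}|lborel. h s) = 0" if "x = 0 \<or> x = 1" for x
    proof -
      have "u k 0 = 0 \<and> u k 1 = 0" for k using g[of k] unfolding wderiv_def by blast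
      then have "(\<lambda>k. u k x) = (\<lambda>k. 0)" using that by (intro ext) metis
      moreover have "x \<in> {0..1}" using that by auto
      ultimately have "(\<lambda>k. 0) \<longlonglongrightarrow> (LINT s:{0..x}|lborel. h s)" using prim[of x] by metis
      then show ?thesis by (simp add: LIMSEQ_const_iff)
    qed
    show "v 0 = 0" "v 1 = 0" using h01[of 0] h01[of 1] by (simp_all add: v_def)
    show "sqint h" by (rule h)
    show "v x = 0" if "x \<notin> {0..1}" for x unfolding v_def by (rule if_not_P[OF that])
    show "v x = (LINT s:{0..x}|lborel. h s)" if "x \<in> {0..1}" for x unfolding v_def by (rule if_P[OF that])
  qed
  have dk: "wderiv (\<lambda>x. u k x - v x) (\<lambda>x. g k x - h x)" for k using wderiv_lin[OF g v, of 1 k "-1"] by simp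
  have "(\<lambda>k. Vnorm (\<lambda>x. u k x - v x)) \<longlonglongrightarrow> 0" unfolding Vnorm_wderiv[OF dk] by (rule lim)
  then show ?thesis using that[of v] v V_iff by blast
qed

section \<open>Sine coefficients and the norm of V\<close>

lemma wderiv_C1:
  assumes d: "\<And>x. x \<in> {0..1} \<Longrightarrow> (u has_real_derivative g x) (at x within {0..1})" and g: "continuous_on {0..1} g"
    and u: "u 0 = 0" "u 1 = 0" "\<And>x. x \<notin> {0..1} \<Longrightarrow> u x = 0"
  shows "wderiv u (\<lambda>x. if x \<in> {0..1} then g x else 0)"
proof -
  define h where "h x = (if x \<in> {0..1} then g x else 0)" for x
  have q: "sqint h" unfolding h_def by (rule sqint_continuous[OF g])
  have "u x = (LINT s:{0..x}|lborel. h s)" if x: "x \<in> {0..1}" for x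
  proof -
    have "(LINT s:{0..x}|lborel. h s) = integral {0..x} h" by (rule set_borel_integral_eq_integral(2)[OF sqint_set_integrable[OF q]]) simp
    also have "\<dots> = integral {0..x} g" using x by (intro Henstock_Kurzweil_Integration.integral_cong) (auto simp: h_def)
    also have "(g has_integral (u x - u 0)) {0..x}"
      using x by (intro fundamental_theorem_of_calculus)
        (auto simp flip: has_real_derivative_iff_has_vector_derivative intro!: DERIV_subset[OF d])
    then have "integral {0..x} g = u x" using u by (simp add: integral_unique)
    finally show ?thesis by simp
  qed
  then show ?thesis using q u unfolding wderiv_def h_def by auto
qed

text \<open>Integration by parts for a derivative that is only square integrable: Fubini for
  \<open>g s * sin (w * x)\<close> on the triangle \<open>0 \<le> s \<le> x \<le> 1\<close>. The
  inner integral leaves a constant \<open>cos w\<close>, which multiplies the integral of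
  \<open>g\<close>, that is \<open>u 1 = 0\<close>.\<close>

lemma wderiv_fsin:
  assumes u: "wderiv u g"
  shows "freq n * fsin n u = fcos n g"
proof -
  define w where "w = freq n"
  have q: "sqint g" using u by (simp add: wderiv_def)
  have [measurable]: "g \<in> borel_measurable borel" using q by blast
  have gi: "integrable lborel g" by (rule sqint_integrable[OF q])
  define K where "K x s = indicator {p. 0 \<le> snd p \<and> snd p \<le> fst p \<and> fst p \<le> 1} (x, s) * (sin (w * x) * g s)" for x s :: real
  have [measurable]: "{p. 0 \<le> snd p \<and> snd p \<le> fst p \<and> fst p \<le> (1::real)} \<in> sets (borel \<Otimes>\<^sub>M borel)"
  proof -
    have "{p \<in> space (borel \<Otimes>\<^sub>M borel). 0 \<le> snd p \<and> snd p \<le> fst p \<and> fst p \<le> (1::real)} \<in> sets (borel \<Otimes>\<^sub>M borel)"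
      by measurable
    then show ?thesis by (simp add: space_pair_measure)
  qed
  have [measurable]: "case_prod K \<in> borel_measurable (lborel \<Otimes>\<^sub>M lborel)"
    unfolding K_def by measurable
  have Ks: "K x s = indicator {0..1} x * sin (w * x) * (indicator {0..x} s * g s)" for x s
    by (auto simp: K_def indicator_def)
  have Ks': "K x s = g s * (indicator {s..1} x * sin (w * x))" for x s
    using sqint_D(2)[OF q, of s] by (auto simp: K_def indicator_def)
  have bound: "norm (K x s) \<le> indicator {0..1} x * \<bar>g s\<bar>" for x s
    using mult_right_mono[OF abs_sin_le_one[of "w * x"], of "\<bar>g s\<bar>"] by (auto simp: K_def indicator_def abs_mult)
  have gx: "integrable lborel (K x)" for x
    unfolding Ks[abs_def] using integrable_mult_indicator[OF _ gi, of "{0..x}"] by (intro integrable_mult_right) simp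
  have "integrable (lborel \<Otimes>\<^sub>M lborel) (case_prod K)"
  proof (rule lborel_pair.Fubini_integrable)
    show "integrable lborel (\<lambda>x. \<integral>s. norm (case_prod K (x, s)) \<partial>lborel)"
    proof (rule Bochner_Integration.integrable_bound)
      show "integrable lborel (\<lambda>x::real. indicator {0..1} x * (\<integral>s. \<bar>g s\<bar> \<partial>lborel))"
        by (intro integrable_mult_left sqint_integrable[OF sqint_one])
      show "AE x in lborel. norm (\<integral>s. norm (case_prod K (x, s)) \<partial>lborel) \<le> norm (indicator {0..1} x * (\<integral>s. \<bar>g s\<bar> \<partial>lborel))"
      proof (rule AE_I2)
        fix x :: real
        have "(\<integral>s. norm (K x s) \<partial>lborel) \<le> (\<integral>s. indicator {0..1} x * \<bar>g s\<bar> \<partial>lborel)"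
          by (intro integral_mono bound integrable_norm gx integrable_mult_right integrable_abs gi)
        then show "norm (\<integral>s. norm (case_prod K (x, s)) \<partial>lborel) \<le> norm (indicator {0..1} x * (\<integral>s. \<bar>g s\<bar> \<partial>lborel))" by simp
      qed
    qed measurable
  qed (use gx in auto)
  then have fub: "(\<integral>s. \<integral>x. K x s \<partial>lborel \<partial>lborel) = (\<integral>x. \<integral>s. K x s \<partial>lborel \<partial>lborel)"
    by (rule lborel_pair.Fubini_integral)
  have w: "w > 0" by (simp add: w_def)
  have inner: "(\<integral>x. indicator {s..1} x * sin (w * x) \<partial>lborel) = (cos (w * s) - cos w) / w" if s: "s \<in> {0..1}" for s
  proof -
    have "(\<integral>x. indicator {s..1} x * sin (w * x) \<partial>lborel) = (LINT x:{s..1}|lborel. sin (w * x))"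
      by (simp add: set_lebesgue_integral_def)
    also have "\<dots> = integral {s..1} (\<lambda>x. sin (w * x))"
      by (rule set_borel_integral_eq_integral(2)) (intro borel_integrable_atLeastAtMost' continuous_intros)
    also have "((\<lambda>x. sin (w * x)) has_integral (- cos (w * 1) / w - - cos (w * s) / w)) {s..1}"
      using s w by (intro fundamental_theorem_of_calculus)
        (auto simp flip: has_real_derivative_iff_has_vector_derivative intro!: derivative_eq_intros)
    then have "integral {s..1} (\<lambda>x. sin (w * x)) = (cos (w * s) - cos w) / w" by (simp add: integral_unique diff_divide_distrib)
    finally show ?thesis .
  qed
  have gc: "integrable lborel (\<lambda>s. g s * cos (w * s))"
  proof (rule Bochner_Integration.integrable_bound[OF gi])
    show "AE x in lborel. norm (g x * cos (w * x)) \<le> norm (g x)"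
      using mult_left_mono[OF abs_cos_le_one, of "\<bar>g _\<bar>"] by (auto simp: abs_mult)
  qed measurable
  have set_eq: "(\<integral>s. h s \<partial>lborel) = integral {0..1} h" "h integrable_on {0..1}" if "integrable lborel h" "\<And>s. s \<notin> {0..1} \<Longrightarrow> h s = 0" for h :: "real \<Rightarrow> real"
  proof -
    have e: "(\<lambda>s. indicator {0..1} s *\<^sub>R h s) = h"
    proof
      fix s show "indicator {0..1} s *\<^sub>R h s = h s" using that(2)[of s] by (cases "s \<in> {0..1}") auto
    qed
    have si: "set_integrable lborel {0..1} h" unfolding set_integrable_def e by (rule that)
    show "(\<integral>s. h s \<partial>lborel) = integral {0..1} h" "h integrable_on {0..1}"
      using set_borel_integral_eq_integral[OF si] unfolding set_lebesgue_integral_def e by auto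
  qed
  have "(\<integral>s. \<integral>x. K x s \<partial>lborel \<partial>lborel) = (\<integral>s. g s * ((cos (w * s) - cos w) / w) \<partial>lborel)"
  proof (rule Bochner_Integration.integral_cong)
    fix s :: real
    show "(\<integral>x. K x s \<partial>lborel) = g s * ((cos (w * s) - cos w) / w)"
      using inner[of s] sqint_D(2)[OF q, of s] unfolding Ks' by (cases "s \<in> {0..1}") auto
  qed simp
  also have "\<dots> = ((\<integral>s. g s * cos (w * s) \<partial>lborel) - cos w * (\<integral>s. g s \<partial>lborel)) / w"
  proof -
    have "(\<lambda>s. g s * ((cos (w * s) - cos w) / w)) = (\<lambda>s. (g s * cos (w * s) - cos w * g s) / w)" by (auto simp: field_simps)
    then show ?thesis using gc gi by simp
  qed
  also have "(\<integral>s. g s \<partial>lborel) = 0"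
  proof -
    have "(\<integral>s. g s \<partial>lborel) = u 1"
      using set_eq(1)[OF gi sqint_D(2)[OF q]] wderiv_integral(2)[OF u, of 1] by simp
    then show ?thesis using u by (simp add: wderiv_def)
  qed
  also have "(\<integral>s. g s * cos (w * s) \<partial>lborel) = integral {0..1} (\<lambda>s. g s * cos (w * s))"
    by (rule set_eq(1)[OF gc]) (use sqint_D(2)[OF q] in auto)
  finally have L: "(\<integral>s. \<integral>x. K x s \<partial>lborel \<partial>lborel) = integral {0..1} (\<lambda>s. g s * cos (w * s)) / w" by simp
  have uc: "continuous_on {0..1} u" using wderiv_continuous[OF u] continuous_on_subset by blast
  have "(\<integral>x. \<integral>s. K x s \<partial>lborel \<partial>lborel) = (\<integral>x. indicator {0..1} x *\<^sub>R (u x * sin (w * x)) \<partial>lborel)"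
  proof (rule Bochner_Integration.integral_cong)
    fix x :: real
    show "(\<integral>s. K x s \<partial>lborel) = indicator {0..1} x *\<^sub>R (u x * sin (w * x))"
      using u unfolding Ks wderiv_def set_lebesgue_integral_def by (cases "x \<in> {0..1}") (auto simp: mult.commute)
  qed simp
  also have "\<dots> = integral {0..1} (\<lambda>x. u x * sin (w * x))"
    unfolding set_lebesgue_integral_def[symmetric]
    by (rule set_borel_integral_eq_integral(2)) (intro borel_integrable_atLeastAtMost' continuous_intros uc)
  finally have R: "(\<integral>x. \<integral>s. K x s \<partial>lborel \<partial>lborel) = integral {0..1} (\<lambda>x. u x * sin (w * x))" .
  have "w * integral {0..1} (\<lambda>x. u x * sin (w * x)) = integral {0..1} (\<lambda>s. g s * cos (w * s))"
    using L R fub w by simp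
  then show ?thesis unfolding fsin_def fcos_def w_def[symmetric] by simp
qed

lemma sqint_has_integral:
  assumes g: "sqint g"
  shows "(\<lambda>x. (g x)\<^sup>2) integrable_on {0..1}" "integral {0..1} (\<lambda>x. (g x)\<^sup>2) = (\<integral>x. (g x)\<^sup>2 \<partial>lborel)"
    "(\<lambda>x. g x * cos (w * x)) integrable_on {0..1}"
proof -
  have [measurable]: "g \<in> borel_measurable borel" using g by blast
  have e: "(\<lambda>x. indicator {0..1} x *\<^sub>R (g x)\<^sup>2) = (\<lambda>x. (g x)\<^sup>2)"
  proof
    fix s show "indicator {0..1} s *\<^sub>R (g s)\<^sup>2 = (g s)\<^sup>2" using sqint_D(2)[OF g, of s] by (cases "s \<in> {0..1}") auto
  qed
  have si: "set_integrable lborel {0..1} (\<lambda>x. (g x)\<^sup>2)" unfolding set_integrable_def e by (rule sqint_D(3)[OF g])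
  show "(\<lambda>x. (g x)\<^sup>2) integrable_on {0..1}" "integral {0..1} (\<lambda>x. (g x)\<^sup>2) = (\<integral>x. (g x)\<^sup>2 \<partial>lborel)"
    using set_borel_integral_eq_integral[OF si] unfolding set_lebesgue_integral_def e by auto
  have gc: "integrable lborel (\<lambda>s. g s * cos (w * s))"
  proof (rule Bochner_Integration.integrable_bound[OF sqint_integrable[OF g]])
    show "AE x in lborel. norm (g x * cos (w * x)) \<le> norm (g x)"
      using mult_left_mono[OF abs_cos_le_one, of "\<bar>g _\<bar>"] by (auto simp: abs_mult)
  qed measurable
  have "set_integrable lborel {0..1} (\<lambda>s. g s * cos (w * s))"
    unfolding set_integrable_def by (rule integrable_mult_indicator[OF _ gc]) simp
  then show "(\<lambda>x. g x * cos (w * x)) integrable_on {0..1}" by (rule set_borel_integral_eq_integral(1))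
qed

lemma V_energy:
  assumes "u \<in> V"
  shows "(\<Sum>n<m. (freq n * fsin n u)\<^sup>2) \<le> 2 * (Vnorm u)\<^sup>2"
proof -
  obtain g where u: "wderiv u g" using assms V_iff by blast
  then have g: "sqint g" by (simp add: wderiv_def)
  have "(\<Sum>n<m. (2 * integral {0..1} (\<lambda>x. g x * cos (freq n * x)))\<^sup>2) \<le> 2 * integral {0..1} (\<lambda>x. (g x)\<^sup>2)"
    by (rule bessel_inequality[OF has_integral_cos_cos sqint_has_integral(1,3)[OF g]])
  then show ?thesis
    unfolding wderiv_fsin[OF u] fcos_def Vnorm_wderiv[OF u] sqint_has_integral(2)[OF g] by (simp add: integral_nonneg_AE)
qed

lemma V_sine_summable: "u \<in> V \<Longrightarrow> summable (\<lambda>n. \<bar>fsin n u\<bar>)"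
  by (rule summable_abs_of_energy(1)[OF V_energy])

text \<open>The derivatives of the sine partial sums converge in \<open>L\<^sup>2\<close> by completeness; their limit has primitive \<open>u\<close>, so it
  represents \<open>u\<^sub>x\<close>, and no density argument is needed.\<close>

lemma Vnorm_parseval_le:
  assumes uV: "u \<in> V" and S: "\<And>m. (\<Sum>n<m. (freq n * fsin n u)\<^sup>2) \<le> S"
  shows "(Vnorm u)\<^sup>2 \<le> S / 2"
proof -
  define p where "p m x = (if x \<in> {0..1} then (\<Sum>n<m. (freq n * fsin n u) * cos (freq n * x)) else 0)" for m x
  have pd: "p i x - p j x = (if x \<in> {0..1} then (\<Sum>n=j..<i. (freq n * fsin n u) * cos (freq n * x)) else 0)" if "j \<le> i" for i j x
    using that by (auto simp: p_def lessThan_atLeast0 sum_diff_nat_ivl)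
  have q: "sqint (p m)" for m unfolding p_def by (rule sqint_continuous) (intro continuous_intros)
  have nd: "(\<integral>x. (p i x - p j x)\<^sup>2 \<partial>lborel) = 1/2 * (\<Sum>n=j..<i. (freq n * fsin n u)\<^sup>2)" if "j \<le> i" for i j
  proof -
    have "(\<integral>x. (p i x - p j x)\<^sup>2 \<partial>lborel) = integral {0..1} (\<lambda>x. (p i x - p j x)\<^sup>2)"
      by (rule sqint_has_integral(2)[OF sqint_diff[OF q q], symmetric])
    also have "\<dots> = integral {0..1} (\<lambda>x. (\<Sum>n=j..<i. (freq n * fsin n u) * cos (freq n * x))\<^sup>2)"
      by (intro Henstock_Kurzweil_Integration.integral_cong) (simp add: pd[OF that])
    also have "\<dots> = 1/2 * (\<Sum>n=j..<i. (freq n * fsin n u)\<^sup>2)"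
      by (intro integral_unique has_integral_orthogonal_sum_square has_integral_cos_cos)
    finally show ?thesis .
  qed
  have sm: "summable (\<lambda>n. (freq n * fsin n u)\<^sup>2)"
    by (rule bounded_imp_summable[of _ S]) (use S[of "Suc n" for n] in \<open>simp_all add: lessThan_Suc_atMost\<close>)
  have "\<exists>N. \<forall>i\<ge>N. \<forall>j\<ge>N. (\<integral>x. (p i x - p j x)\<^sup>2 \<partial>lborel) < e" if e: "e > 0" for e
  proof -
    obtain N where N: "\<And>m n. m \<ge> N \<Longrightarrow> norm (\<Sum>n=m..<n. (freq n * fsin n u)\<^sup>2) < e"
      using summable_Cauchy[THEN iffD1, OF sm, rule_format, OF e] by blast
    have "(\<integral>x. (p i x - p j x)\<^sup>2 \<partial>lborel) < e" if "j \<ge> N" "j \<le> i" for i j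
      unfolding nd[OF that(2)] using N[OF that(1), of i] sum_nonneg[of "{j..<i}" "\<lambda>n. (freq n * fsin n u)\<^sup>2"] by simp
    moreover have "(\<integral>x. (p i x - p j x)\<^sup>2 \<partial>lborel) = (\<integral>x. (p j x - p i x)\<^sup>2 \<partial>lborel)" for i j
      by (simp add: power2_commute)
    ultimately show ?thesis by (metis nle_le)
  qed
  then obtain h where h: "sqint h" "(\<lambda>k. \<integral>x. (p k x - h x)\<^sup>2 \<partial>lborel) \<longlonglongrightarrow> 0"
    by (rule sqint_complete[OF q]) (assumption, rule that)
  have lim: "(\<lambda>k. sqrt (\<integral>x. (p k x - h x)\<^sup>2 \<partial>lborel)) \<longlonglongrightarrow> 0" using tendsto_real_sqrt[OF h(2)] by simp
  have uh: "u x = (LINT s:{0..x}|lborel. h s)" if x: "x \<in> {0..1}" for x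
  proof -
    have Pk: "(LINT s:{0..x}|lborel. p k s) = (\<Sum>n<k. fsin n u * sin (freq n * x))" for k
    proof -
      have "(LINT s:{0..x}|lborel. p k s) = integral {0..x} (p k)"
        by (rule set_borel_integral_eq_integral(2)[OF sqint_set_integrable[OF q]]) simp
      also have "\<dots> = integral {0..x} (\<lambda>s. \<Sum>n<k. (freq n * fsin n u) * cos (freq n * s))"
        using x by (intro Henstock_Kurzweil_Integration.integral_cong) (auto simp: p_def)
      also have "((\<lambda>s. \<Sum>n<k. (freq n * fsin n u) * cos (freq n * s)) has_integral
          ((\<Sum>n<k. fsin n u * sin (freq n * x)) - (\<Sum>n<k. fsin n u * sin (freq n * 0)))) {0..x}"
        using x by (intro fundamental_theorem_of_calculus)
          (auto simp flip: has_real_derivative_iff_has_vector_derivative intro!: derivative_eq_intros sum.cong)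
      then have "integral {0..x} (\<lambda>s. \<Sum>n<k. (freq n * fsin n u) * cos (freq n * s)) = (\<Sum>n<k. fsin n u * sin (freq n * x))"
        by (simp add: integral_unique)
      finally show ?thesis .
    qed
    have "\<bar>(LINT s:{0..x}|lborel. p k s) - (LINT s:{0..x}|lborel. h s)\<bar> \<le> sqrt (\<integral>x. (p k x - h x)\<^sup>2 \<partial>lborel)" for k
    proof -
      have "(LINT s:{0..x}|lborel. p k s) - (LINT s:{0..x}|lborel. h s) = (LINT s:{0..x}|lborel. p k s - h s)"
        by (rule set_integral_diff(2)[symmetric]) (auto intro: sqint_set_integrable q h)
      then show ?thesis using sqint_primitive_le[OF sqint_diff[OF q h(1)]] by simp
    qed
    then have "(\<lambda>k. (LINT s:{0..x}|lborel. p k s) - (LINT s:{0..x}|lborel. h s)) \<longlonglongrightarrow> 0"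
      by (intro Lim_null_comparison[OF _ lim] always_eventually) simp
    then have 1: "(\<lambda>k. \<Sum>n<k. fsin n u * sin (freq n * x)) \<longlonglongrightarrow> (LINT s:{0..x}|lborel. h s)"
      unfolding Pk by (simp add: LIM_zero_iff)
    have 2: "(\<lambda>k. \<Sum>n<k. fsin n u * sin (freq n * x)) \<longlonglongrightarrow> u x"
      using uniform_limit_sine_expansion[OF V_continuous[OF uV] V_sine_summable[OF uV]] x
      by (rule tendsto_uniform_limitI)
    show ?thesis by (rule LIMSEQ_unique[OF 2 1])
  qed
  obtain g where "wderiv u g" using uV V_iff by blast
  then have uw: "wderiv u h" using h(1) uh unfolding wderiv_def by blast
  have "Vnorm u \<le> sqrt (S / 2) + sqrt (\<integral>x. (p k x - h x)\<^sup>2 \<partial>lborel)" for k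
  proof -
    have "Vnorm u = sqrt (\<integral>x. (p k x + (h x - p k x))\<^sup>2 \<partial>lborel)" unfolding Vnorm_wderiv[OF uw] by simp
    also have "\<dots> \<le> sqrt (\<integral>x. (p k x)\<^sup>2 \<partial>lborel) + sqrt (\<integral>x. (h x - p k x)\<^sup>2 \<partial>lborel)"
      by (rule sqint_triangle[OF q sqint_diff[OF h(1) q]])
    also have "(\<integral>x. (p k x)\<^sup>2 \<partial>lborel) = 1/2 * (\<Sum>n=0..<k. (freq n * fsin n u)\<^sup>2)"
    proof -
      have "p 0 x = 0" for x by (simp add: p_def)
      then show ?thesis using nd[of 0 k] by simp
    qed
    also have "\<dots> \<le> S / 2" using S[of k] by (simp add: lessThan_atLeast0)
    finally show ?thesis by (simp add: power2_commute)
  qed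
  then have "Vnorm u \<le> sqrt (S / 2) + 0"
    by (intro LIMSEQ_le_const[OF tendsto_add[OF tendsto_const lim]]) auto
  then have "(Vnorm u)\<^sup>2 \<le> (sqrt (S / 2))\<^sup>2" by (intro power_mono) auto
  then show ?thesis using S[of 0] by simp
qed

section \<open>The solution map\<close>

definition zero_ext :: "(real \<Rightarrow> real) \<Rightarrow> real \<Rightarrow> real" where
  "zero_ext h x = (if x \<in> {0..1} then h x else 0)"

lemma fsin_zero_ext [simp]: "fsin n (zero_ext h) = fsin n h"
  by (rule fsin_cong) (simp add: zero_ext_def)

lemma zero_ext_V: "u \<in> V \<Longrightarrow> (\<And>x. x \<in> {0..1} \<Longrightarrow> h x = u x) \<Longrightarrow> zero_ext h = u"
  unfolding V_def zero_ext_def by fastforce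

lemma classical_slice_V:
  assumes c: "classical_sol f f' r T k u Y yt yx" and u: "u \<in> V" and t: "t \<in> {0..T}"
  shows "zero_ext (Y t) \<in> V"
proof (cases "t = 0")
  case True
  then have "zero_ext (Y t) = u" using zero_ext_V[OF u] classical_solD(2)[OF c] by simp
  then show ?thesis using u by simp
next
  case False
  then have t': "t \<in> {0<..T}" using t by auto
  have "wderiv (zero_ext (Y t)) (\<lambda>x. if x \<in> {0..1} then yx t x else 0)"
  proof (rule wderiv_C1)
    show "continuous_on {0..1} (yx t)" using classical_solD(8)[OF c t'] by (rule DERIV_continuous_on)
    show "(zero_ext (Y t) has_real_derivative yx t x) (at x within {0..1})" if "x \<in> {0..1}" for x
      by (rule has_field_derivative_transform_within[OF classical_solD(7)[OF c t' that] zero_less_one that]) (simp add: zero_ext_def)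
  qed (use classical_solD(3,4)[OF c t] in \<open>auto simp: zero_ext_def\<close>)
  then show ?thesis using V_iff by blast
qed

text \<open>The majorant makes the series of squared coefficient differences converge uniformly in
  \<open>s\<close>, so its sum is continuous and tends to 0; \<open>Vnorm_parseval_le\<close>
  carries this over to the norm. The argument includes \<open>t = 0\<close>, where the gradient
  bound of \<open>classical_sol\<close> degenerates.\<close>

lemma classical_V_continuous:
  assumes c: "classical_sol f f' r T k u Y yt yx" and u: "u \<in> V" and t: "t \<in> {0..T}"
  shows "((\<lambda>s. Vnorm (\<lambda>x. zero_ext (Y s) x - zero_ext (Y t) x)) \<longlongrightarrow> 0) (at t within {0..T})"
proof -
  obtain M where M: "summable (\<lambda>n. (freq n * M n)\<^sup>2)" "\<And>s n. s \<in> {0..T} \<Longrightarrow> \<bar>fsin n (Y s)\<bar> \<le> M n"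
    using classical_solD(10)[OF c] by blast
  define d where "d n s = (freq n * (fsin n (Y s) - fsin n (Y t)))\<^sup>2" for n s
  have dM: "norm (d n s) \<le> 4 * (freq n * M n)\<^sup>2" if s: "s \<in> {0..T}" for n s
  proof -
    have "\<bar>fsin n (Y s) - fsin n (Y t)\<bar> \<le> 2 * M n" using M(2)[OF s, of n] M(2)[OF t, of n] by linarith
    then have "(fsin n (Y s) - fsin n (Y t))\<^sup>2 \<le> (2 * M n)\<^sup>2" by (rule abs_le_square_iff[THEN iffD1, OF order_trans]) simp
    then have "(freq n)\<^sup>2 * (fsin n (Y s) - fsin n (Y t))\<^sup>2 \<le> (freq n)\<^sup>2 * (2 * M n)\<^sup>2" by (intro mult_left_mono) auto
    then show ?thesis by (simp add: d_def power_mult_distrib mult_ac)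
  qed
  have sM: "summable (\<lambda>n. 4 * (freq n * M n)\<^sup>2)" by (intro summable_mult M)
  have dc: "continuous_on {0..T} (d n)" for n
    unfolding d_def by (intro continuous_intros continuous_on_fourier_param classical_solD(1)[OF c])
  have "continuous_on {0..T} (\<lambda>s. \<Sum>n. d n s)"
    by (rule uniform_limit_theorem[OF _ Weierstrass_m_test[OF dM sM]]) (auto intro!: always_eventually continuous_intros dc)
  then have "((\<lambda>s. \<Sum>n. d n s) \<longlongrightarrow> (\<Sum>n. d n t)) (at t within {0..T})" using t by (simp add: continuous_on_def)
  then have lim: "((\<lambda>s. \<Sum>n. d n s) \<longlongrightarrow> 0) (at t within {0..T})" by (simp add: d_def)
  have le: "(Vnorm (\<lambda>x. zero_ext (Y s) x - zero_ext (Y t) x))\<^sup>2 \<le> (\<Sum>n. d n s) / 2" if s: "s \<in> {0..T}" for s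
  proof (rule Vnorm_parseval_le)
    have V: "zero_ext (Y s) \<in> V" "zero_ext (Y t) \<in> V" by (rule classical_slice_V[OF c u] s t)+
    then show "(\<lambda>x. zero_ext (Y s) x - zero_ext (Y t) x) \<in> V" by (rule V_diff)
    fix m
    have "fsin n (\<lambda>x. zero_ext (Y s) x - zero_ext (Y t) x) = fsin n (Y s) - fsin n (Y t)" for n
      by (subst fsin_diff) (use V in \<open>auto intro: V_continuous\<close>)
    then have "(\<Sum>n<m. (freq n * fsin n (\<lambda>x. zero_ext (Y s) x - zero_ext (Y t) x))\<^sup>2) = (\<Sum>n<m. d n s)" by (simp add: d_def)
    also have "\<dots> \<le> (\<Sum>n. d n s)"
      by (intro sum_le_suminf summable_comparison_test[OF _ sM]) (use dM[OF s] in \<open>auto simp: d_def\<close>)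
    finally show "(\<Sum>n<m. (freq n * fsin n (\<lambda>x. zero_ext (Y s) x - zero_ext (Y t) x))\<^sup>2) \<le> (\<Sum>n. d n s)" .
  qed
  have "((\<lambda>s. (Vnorm (\<lambda>x. zero_ext (Y s) x - zero_ext (Y t) x))\<^sup>2) \<longlongrightarrow> 0) (at t within {0..T})"
  proof (rule tendsto_sandwich[OF _ _ tendsto_const])
    show "((\<lambda>s. (\<Sum>n. d n s) / 2) \<longlongrightarrow> 0) (at t within {0..T})" using tendsto_divide[OF lim tendsto_const, of 2] by simp
    show "\<forall>\<^sub>F s in at t within {0..T}. (Vnorm (\<lambda>x. zero_ext (Y s) x - zero_ext (Y t) x))\<^sup>2 \<le> (\<Sum>n. d n s) / 2"
      unfolding eventually_at_filter by (rule always_eventually) (use le in blast)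
  qed auto
  from tendsto_real_sqrt[OF this] show ?thesis by simp
qed

section \<open>Uniqueness and global existence\<close>

lemma pointwise_sol_restrict:
  assumes Y: "pointwise_sol f r T u Y" and S: "S \<le> T"
  shows "pointwise_sol f r S u Y"
  unfolding pointwise_sol_def
proof (intro conjI ballI)
  show "continuous_on ({0..S} \<times> {0..1}) (\<lambda>p. Y (fst p) (snd p))"
    by (rule continuous_on_subset[OF pointwise_solD(1)[OF Y]]) (use S in auto)
  fix t x :: real assume t: "t \<in> {0<..S}" and x: "x \<in> {0<..<1}"
  then have "t \<in> {0<..T}" using S by auto
  then obtain yt yx yxx fx where y: "((\<lambda>s. Y s x) has_real_derivative yt) (at t within {0..T})"
        "\<forall>\<^sub>F \<xi> in nhds x. (Y t has_real_derivative yx \<xi>) (at \<xi>)" "(yx has_real_derivative yxx) (at x)"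
        "((\<lambda>\<xi>. f (Y t \<xi>)) has_real_derivative fx) (at x)" "yt + fx = yxx + r (Y t x)"
    using Y x unfolding pointwise_sol_def by blast
  have "((\<lambda>s. Y s x) has_real_derivative yt) (at t within {0..S})" by (rule DERIV_subset[OF y(1)]) (use S in auto)
  then show "\<exists>yt yx yxx fx. ((\<lambda>s. Y s x) has_real_derivative yt) (at t within {0..S}) \<and>
        (\<forall>\<^sub>F \<xi> in nhds x. (Y t has_real_derivative yx \<xi>) (at \<xi>)) \<and>
        (yx has_real_derivative yxx) (at x) \<and>
        ((\<lambda>\<xi>. f (Y t \<xi>)) has_real_derivative fx) (at x) \<and> yt + fx = yxx + r (Y t x)" using y(2-5) by blast
qed (use pointwise_solD(2-4)[OF Y] S in auto)

text \<open>Both solutions are continuous on a compact cylinder, hence bounded by some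
  \<open>B\<close>. The truncations at \<open>B\<close> provide Lipschitz constants on
  \<open>{-B..B}\<close>, and \<open>comparison\<close> with equal data gives a bound of
  zero.\<close>

lemma pointwise_classical_unique:
  assumes fC2: "C2 f" and rC2: "C2 r" and Y: "pointwise_sol f r T u Y" and Z: "classical_sol f (deriv f) r T k u Z zt zx" and k: "k \<ge> 0"
    and t: "t \<in> {0..T}" and x: "x \<in> {0..1}"
  shows "Y t x = Z t x"
proof -
  note cpt = compact_Times[OF compact_Icc compact_Icc]
  obtain B1 where B1: "\<And>p. p \<in> {0..T} \<times> {0..1} \<Longrightarrow> norm (Y (fst p) (snd p)) \<le> B1"
    using continuous_on_compact_bound[OF cpt pointwise_solD(1)[OF Y]] by blast
  obtain B2 where B2: "\<And>p. p \<in> {0..T} \<times> {0..1} \<Longrightarrow> norm (Z (fst p) (snd p)) \<le> B2"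
    using continuous_on_compact_bound[OF cpt classical_solD(1)[OF Z]] by blast
  define B where "B = max 1 (max B1 B2)"
  have B: "B > 0" by (simp add: B_def)
  have bY: "\<bar>Y t x\<bar> \<le> B" and bZ: "\<bar>Z t x\<bar> \<le> B" if "t \<in> {0..T}" "x \<in> {0..1}" for t x
    using B1[of "(t,x)"] B2[of "(t,x)"] that by (auto simp: B_def)
  obtain F F' L1 f1 where F: "L1 \<ge> 0" "\<And>x. (f has_real_derivative f1 x) (at x)" "\<And>x. (F has_real_derivative F' x) (at x)"
    "\<And>x. \<bar>F' x\<bar> \<le> L1" "\<And>x y. \<bar>F' x - F' y\<bar> \<le> L1 * \<bar>x - y\<bar>" "\<And>x. \<bar>x\<bar> \<le> B \<Longrightarrow> F x = f x" "\<And>x. \<bar>x\<bar> \<le> B \<Longrightarrow> F' x = f1 x"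
    using truncation[OF fC2 B] by (metis (no_types, lifting))
  obtain R R' L2 r2 where R: "L2 \<ge> 0" "\<And>x. (r has_real_derivative r2 x) (at x)" "\<And>x. (R has_real_derivative R' x) (at x)"
    "\<And>x. \<bar>R' x\<bar> \<le> L2" "\<And>x y. \<bar>R' x - R' y\<bar> \<le> L2 * \<bar>x - y\<bar>" "\<And>x. \<bar>x\<bar> \<le> B \<Longrightarrow> R x = r x" "\<And>x. \<bar>x\<bar> \<le> B \<Longrightarrow> R' x = r2 x"
    using truncation[OF rC2 B] by (metis (no_types, lifting))
  have f1: "deriv f = f1" using F(2) by (auto intro!: DERIV_imp_deriv)
  define L where "L = max L1 L2"
  have Lle: "L1 * \<bar>z\<bar> \<le> L * \<bar>z\<bar>" "L2 * \<bar>z\<bar> \<le> L * \<bar>z\<bar>" for z by (auto simp: L_def intro!: mult_right_mono)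
  have "\<bar>Y t x - Z t x\<bar> \<le> 0 * exp ((L * k + L + 1) * gweight t)"
  proof (rule comparison[OF F(2) Y Z[unfolded f1] bY bZ _ _ _ k _ t x])
    show "\<bar>f1 a - f1 b\<bar> \<le> L * \<bar>a - b\<bar>" if "\<bar>a\<bar> \<le> B" "\<bar>b\<bar> \<le> B" for a b
      using order_trans[OF F(5)[of a b] Lle(1)] unfolding F(7)[OF that(1)] F(7)[OF that(2)] .
    show "\<bar>r a - r b\<bar> \<le> L * \<bar>a - b\<bar>" if "\<bar>a\<bar> \<le> B" "\<bar>b\<bar> \<le> B" for a b
      using order_trans[OF abs_diff_le_of_deriv_bound[OF R(3,4), of a b] Lle(2)] unfolding R(6)[OF that(1)] R(6)[OF that(2)] .
  qed (use F(1) in \<open>auto simp: L_def\<close>)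
  then show ?thesis by simp
qed

text \<open>Joint continuity is not among the clauses of \<open>is_sol\<close>. It follows from
  continuity in \<open>V\<close>, whose norm dominates the maximum norm and so gives continuity in
  time uniformly in \<open>x\<close>, together with continuity of each slice.\<close>

lemma is_sol_imp_pointwise:
  assumes y: "is_sol f r u y"
  shows "pointwise_sol f r T u (\<lambda>t x. y x t)"
  unfolding pointwise_sol_def
proof (intro conjI ballI)
  have V: "slice y t \<in> V" if "t \<ge> 0" for t using y that unfolding is_sol_def by blast
  have lim: "((\<lambda>s. Vnorm (\<lambda>x. slice y s x - slice y t x)) \<longlongrightarrow> 0) (at t within {0..})" if "t \<ge> 0" for t
    using y that unfolding is_sol_def by blast
  show "continuous_on ({0..T} \<times> {0..1}) (\<lambda>p. y (snd p) (fst p))"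
    unfolding continuous_on_iff
  proof (intro ballI allI impI)
    fix p and e :: real assume p: "p \<in> {0..T} \<times> {0..1::real}" and e: "e > 0"
    define t x where "t = fst p" and "x = snd p"
    have t: "t \<ge> 0" and x: "x \<in> {0..1}" using p by (auto simp: t_def x_def)
    have "\<forall>\<^sub>F s in at t within {0..}. dist (Vnorm (\<lambda>x. slice y s x - slice y t x)) 0 < e / 2" by (rule tendstoD[OF lim[OF t]]) (use e in simp)
    then obtain d1 where d1: "d1 > 0" "\<And>s. s \<ge> 0 \<Longrightarrow> s \<noteq> t \<Longrightarrow> dist s t < d1 \<Longrightarrow> Vnorm (\<lambda>x. slice y s x - slice y t x) < e / 2"
      unfolding eventually_at by (auto simp: dist_real_def)
    have "isCont (slice y t) x" using V_continuous[OF V[OF t], of UNIV] by (simp add: continuous_on_eq_continuous_at)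
    then obtain d2 where d2: "d2 > 0" "\<And>z. dist z x < d2 \<Longrightarrow> dist (slice y t z) (slice y t x) < e / 2"
      unfolding continuous_at_eps_delta using e by (meson half_gt_zero)
    show "\<exists>d>0. \<forall>q\<in>{0..T} \<times> {0..1}. dist q p < d \<longrightarrow> dist (y (snd q) (fst q)) (y (snd p) (fst p)) < e"
    proof (intro exI[of _ "min d1 d2"] conjI ballI impI)
      fix q assume q: "q \<in> {0..T} \<times> {0..1::real}" "dist q p < min d1 d2"
      define s z where "s = fst q" and "z = snd q"
      have s: "s \<ge> 0" "dist s t < d1" and z: "z \<in> {0..1}" "dist z x < d2"
        using q dist_fst_le[of q p] dist_snd_le[of q p] by (auto simp: s_def z_def t_def x_def)
      have "\<bar>slice y s z - slice y t z\<bar> < e / 2"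
      proof (cases "s = t")
        case False
        have "\<bar>slice y s z - slice y t z\<bar> \<le> Vnorm (\<lambda>x. slice y s x - slice y t x)"
          by (rule abs_le_Vnorm[OF V_diff[OF V[OF s(1)] V[OF t]]])
        then show ?thesis using d1(2)[OF s(1) False s(2)] by simp
      qed (use e in simp)
      moreover have "\<bar>slice y t z - slice y t x\<bar> < e / 2" using d2(2)[OF z(2)] by (simp add: dist_real_def)
      ultimately have "\<bar>slice y s z - slice y t x\<bar> < e" by linarith
      then show "dist (y (snd q) (fst q)) (y (snd p) (fst p)) < e"
        using z x unfolding slice_def s_def z_def t_def x_def by (simp add: dist_real_def)
    qed (use d1 d2 in auto)
  qed
  fix t x :: real assume t: "t \<in> {0<..T}" and x: "x \<in> {0<..<1}"
  then have "t > 0" by simp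
  then obtain yt yx yxx fx where d: "((\<lambda>s. y x s) has_real_derivative yt) (at t)"
        "\<forall>\<^sub>F \<xi> in nhds x. ((\<lambda>\<eta>. y \<eta> t) has_real_derivative yx \<xi>) (at \<xi>)"
        "(yx has_real_derivative yxx) (at x)"
        "((\<lambda>\<xi>. f (y \<xi> t)) has_real_derivative fx) (at x)" "yt + fx = yxx + r (y x t)"
    using y x unfolding is_sol_def by meson
  show "\<exists>yt yx yxx fx. ((\<lambda>s. y x s) has_real_derivative yt) (at t within {0..T}) \<and>
        (\<forall>\<^sub>F \<xi> in nhds x. ((\<lambda>x. y x t) has_real_derivative yx \<xi>) (at \<xi>)) \<and>
        (yx has_real_derivative yxx) (at x) \<and>
        ((\<lambda>\<xi>. f (y \<xi> t)) has_real_derivative fx) (at x) \<and> yt + fx = yxx + r (y x t)"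
    using has_field_derivative_at_within[OF d(1)] d(2-5) by blast
next
  fix x :: real assume "x \<in> {0..1}"
  then show "y x 0 = u x" using y unfolding is_sol_def by blast
next
  fix t :: real assume "t \<in> {0..T}"
  then have "t \<ge> 0" by simp
  then show "y 0 t = 0" "y 1 t = 0" using y unfolding is_sol_def by blast+
qed

locale reaction_convection =
  fixes f r :: "real \<Rightarrow> real"
  assumes f_C2: "C2 f" and r_C2: "C2 r"
    and r_neg: "(\<integral>\<^sup>+ y\<in>{..0}. ennreal (1 / (\<bar>r y\<bar> + 1)) \<partial>lborel) = \<infinity>"
    and r_pos: "(\<integral>\<^sup>+ y\<in>{0..}. ennreal (1 / (\<bar>r y\<bar> + 1)) \<partial>lborel) = \<infinity>"
begin

lemma f_deriv: "(f has_real_derivative deriv f x) (at x)"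
  using f_C2 unfolding C2_def by (metis DERIV_imp_deriv)

lemma r_deriv: "(r has_real_derivative deriv r x) (at x)"
  using r_C2 unfolding C2_def by (metis DERIV_imp_deriv)

lemma classical_exists:
  assumes u: "u \<in> V" and T: "T > 0"
  shows "\<exists>Y yt yx k. k \<ge> 0 \<and> classical_sol f (deriv f) r T k u Y yt yx"
proof -
  have E0: "2 * (Vnorm u)\<^sup>2 \<ge> 0" by simp
  show ?thesis
  proof (rule local_solution[OF f_C2 r_C2 r_neg r_pos T Vnorm_nonneg[of u] E0])
    fix B L k :: real
    assume k: "k \<ge> 0" and ex: "\<And>w. continuous_on {0..1} w \<Longrightarrow> (\<And>x. x \<in> {0..1} \<Longrightarrow> \<bar>w x\<bar> \<le> Vnorm u) \<Longrightarrow> (\<And>m. (\<Sum>n<m. (freq n * fsin n w)\<^sup>2) \<le> 2 * (Vnorm u)\<^sup>2) \<Longrightarrow>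
       \<exists>Y yt yx. classical_sol f (deriv f) r T k w Y yt yx \<and> (\<forall>t\<in>{0..T}. \<forall>x\<in>{0..1}. \<bar>Y t x\<bar> \<le> B)"
    obtain Y yt yx where "classical_sol f (deriv f) r T k u Y yt yx"
      using ex[OF V_continuous[OF u] abs_le_Vnorm[OF u] V_energy[OF u]] by blast
    then show ?thesis using k by blast
  qed
qed

lemma is_sol_exists:
  assumes u: "u \<in> V"
  shows "\<exists>y. is_sol f r u y"
proof -
  have "\<forall>T. \<exists>Y. T > 0 \<longrightarrow> (\<exists>yt yx k. k \<ge> 0 \<and> classical_sol f (deriv f) r T k u Y yt yx)"
    using classical_exists[OF u] by blast
  from choice[OF this] obtain Y where Y: "\<And>T. T > 0 \<Longrightarrow> \<exists>yt yx k. k \<ge> 0 \<and> classical_sol f (deriv f) r T k u (Y T) yt yx" by blast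
  have cons: "Y T t x = Y T' t x" if T: "0 < T" "T \<le> T'" and t: "t \<in> {0..T}" and x: "x \<in> {0..1}" for T T' t x
  proof -
    obtain yt yx k where 1: "k \<ge> 0" "classical_sol f (deriv f) r T k u (Y T) yt yx" using Y[OF T(1)] by blast
    obtain zt zx k' where 2: "k' \<ge> 0" "classical_sol f (deriv f) r T' k' u (Y T') zt zx" using Y[of T'] T by auto
    have "pointwise_sol f r T u (Y T')"
      by (rule pointwise_sol_restrict[OF classical_imp_pointwise[OF f_deriv 2(2)] T(2)])
    from pointwise_classical_unique[OF f_C2 r_C2 this 1(2,1) t x] show ?thesis by simp
  qed
  \<comment> \<open>The solutions on bounded intervals agree where they overlap. The horizon
    \<open>t + 1\<close> lies beyond \<open>t\<close>, so that derivatives within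
    \<open>{0..T}\<close> become two-sided derivatives at \<open>t\<close>.\<close>
  define y where "y x t = (if x \<in> {0..1} \<and> t \<ge> 0 then Y (t + 1) t x else 0)" for x t
  have yY: "y x s = Y T s x" if "x \<in> {0..1}" "s \<in> {0..T}" "T \<ge> t + 1" "t \<ge> 0" for x s t T
  proof -
    have "Y (s + 1) s x = Y (max (s + 1) T) s x" by (rule cons) (use that in auto)
    also have "\<dots> = Y T s x" by (rule cons[symmetric]) (use that in auto)
    finally show ?thesis using that by (simp add: y_def)
  qed
  have "is_sol f r u y" unfolding is_sol_def
  proof (intro conjI allI ballI impI)
    fix t :: real assume t: "t \<ge> 0"
    define T where "T = t + 1"
    have T: "T > 0" "T \<ge> t + 1" "t \<in> {0..T}" using t by (auto simp: T_def)
    obtain yt yx k where c: "k \<ge> 0" "classical_sol f (deriv f) r T k u (Y T) yt yx" using Y[OF T(1)] by blast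
    have sl: "slice y s = zero_ext (Y T s)" if "s \<in> {0..T}" for s
      using yY[OF _ that T(2) t] by (auto simp: slice_def zero_ext_def)
    show "y 0 t = 0" "y 1 t = 0"
      using yY[OF _ T(3) T(2) t, of 0] yY[OF _ T(3) T(2) t, of 1] classical_solD(3,4)[OF c(2) T(3)] by simp_all
    show "slice y t \<in> V" unfolding sl[OF T(3)] by (rule classical_slice_V[OF c(2) u T(3)])
    have nb: "at t within {0..} = at t within {0..T}"
      by (rule at_within_nhd[of _ "{..<t + 1}"]) (use T in auto)
    show "((\<lambda>s. Vnorm (\<lambda>x. slice y s x - slice y t x)) \<longlongrightarrow> 0) (at t within {0..})"
      unfolding nb
    proof (rule Lim_transform_eventually[OF classical_V_continuous[OF c(2) u T(3)]])
      show "\<forall>\<^sub>F s in at t within {0..T}. Vnorm (\<lambda>x. zero_ext (Y T s) x - zero_ext (Y T t) x) = Vnorm (\<lambda>x. slice y s x - slice y t x)"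
        unfolding eventually_at_filter by (rule always_eventually) (simp add: sl sl[OF T(3)])
    qed
  next
    fix x t :: real assume x: "x \<in> {0<..<1}" and t: "t > 0"
    define T where "T = t + 1"
    have T: "T > 0" "T \<ge> t + 1" "t \<in> {0..T}" "t \<ge> 0" "t \<in> {0<..T}" using t by (auto simp: T_def)
    have x': "x \<in> {0..1}" using x by auto
    obtain yt yx k where c: "k \<ge> 0" "classical_sol f (deriv f) r T k u (Y T) yt yx" using Y[OF T(1)] by blast
    obtain a b c d where p: "((\<lambda>s. Y T s x) has_real_derivative a) (at t within {0..T})"
        "\<forall>\<^sub>F \<xi> in nhds x. (Y T t has_real_derivative b \<xi>) (at \<xi>)" "(b has_real_derivative c) (at x)"
        "((\<lambda>\<xi>. f (Y T t \<xi>)) has_real_derivative d) (at x)" "a + d = c + r (Y T t x)"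
      using classical_imp_pointwise[OF f_deriv c(2)] T(5) x unfolding pointwise_sol_def by blast
    have eqx: "Y T t \<xi> = y \<xi> t" if "\<xi> \<in> {0<..<1}" for \<xi> using yY[OF _ T(3,2,4), of \<xi>] that by simp
    have "((\<lambda>s. Y T s x) has_real_derivative a) (at t)" using p(1) t by (simp add: T_def at_within_Icc_at)
    then have 1: "((\<lambda>s. y x s) has_real_derivative a) (at t)"
      by (rule has_field_derivative_transform_within_open[of _ _ _ "{0<..<T}"]) (use yY[OF x' _ T(2,4)] t in \<open>auto simp: T_def\<close>)
    have 2: "\<forall>\<^sub>F \<xi> in nhds x. ((\<lambda>\<eta>. y \<eta> t) has_real_derivative b \<xi>) (at \<xi>)"
      using p(2) eventually_nhds_unit[OF x]
    proof eventually_elim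
      case (elim \<xi>)
      show ?case by (rule has_field_derivative_transform_within_open[OF elim(1) _ elim(2)]) (auto simp: eqx)
    qed
    have 3: "((\<lambda>\<xi>. f (y \<xi> t)) has_real_derivative d) (at x)"
      by (rule has_field_derivative_transform_within_open[OF p(4) _ x]) (auto simp: eqx)
    have 4: "a + d = c + r (y x t)" using p(5) eqx[OF x] by simp
    show "\<exists>yt yx yxx fx. ((\<lambda>s. y x s) has_real_derivative yt) (at t) \<and>
        (\<forall>\<^sub>F \<xi> in nhds x. ((\<lambda>\<eta>. y \<eta> t) has_real_derivative yx \<xi>) (at \<xi>)) \<and>
        (yx has_real_derivative yxx) (at x) \<and>
        ((\<lambda>\<xi>. f (y \<xi> t)) has_real_derivative fx) (at x) \<and> yt + fx = yxx + r (y x t)"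
      using 1 2 p(3) 3 4 by blast
  next
    fix x :: real assume x: "x \<in> {0..1}"
    obtain yt yx k where c: "k \<ge> 0" "classical_sol f (deriv f) r 1 k u (Y 1) yt yx" using Y[of 1] by auto
    show "y x 0 = u x" using x classical_solD(2)[OF c(2) x] by (simp add: y_def)
  qed (auto simp: y_def)
  then show ?thesis by blast
qed

lemma is_sol_unique:
  assumes u: "u \<in> V" and y: "is_sol f r u y" and z: "is_sol f r u z"
  shows "y = z"
proof (intro ext)
  fix x t :: real
  show "y x t = z x t"
  proof (cases "x \<in> {0..1} \<and> t \<ge> 0")
    case True
    have T: "t + 1 > 0" "t \<in> {0..t + 1}" using True by auto
    obtain Y yt yx k where c: "k \<ge> 0" "classical_sol f (deriv f) r (t + 1) k u Y yt yx"
      using classical_exists[OF u T(1)] by blast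
    have "y x t = Y t x" "z x t = Y t x"
      by (rule pointwise_classical_unique[OF f_C2 r_C2 is_sol_imp_pointwise[OF y] c(2,1) T(2)], use True in blast,
          rule pointwise_classical_unique[OF f_C2 r_C2 is_sol_imp_pointwise[OF z] c(2,1) T(2)], use True in blast)
    then show ?thesis by simp
  next
    case False
    then have "x \<notin> {0..1} \<or> t < 0" by auto
    then have "y x t = 0" "z x t = 0" using y z unfolding is_sol_def by meson+
    then show ?thesis by simp
  qed
qed

lemma sol_is_sol: "u \<in> V \<Longrightarrow> is_sol f r u (sol f r u)"
  unfolding sol_def by (rule theI'[of "is_sol f r u"]) (use is_sol_exists is_sol_unique in metis)

lemma slice_sol_eq:
  assumes u: "u \<in> V" and c: "classical_sol f (deriv f) r T k u Y yt yx" and k: "k \<ge> 0" and t: "t \<in> {0..T}"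
  shows "slice (sol f r u) t = zero_ext (Y t)"
proof
  fix x
  show "slice (sol f r u) t x = zero_ext (Y t) x"
    using pointwise_classical_unique[OF f_C2 r_C2 is_sol_imp_pointwise[OF sol_is_sol[OF u]] c k t, of x]
    by (auto simp: slice_def zero_ext_def)
qed

end

section \<open>Midpoint convexity and the minimiser\<close>

text \<open>The defect splits at the midpoint \<open>p\<close> of \<open>a\<close> and
  \<open>b\<close>. The mean value points on the two halves are at most the distance of
  \<open>a\<close> and \<open>b\<close> apart, so the Lipschitz bound on \<open>g'\<close> makes the
  convexity defect at \<open>p\<close> of second order in \<open>W\<close>; the passage from
  \<open>p\<close> to \<open>m\<close> is Lipschitz.\<close>

lemma midpoint_defect:
  fixes g :: "real \<Rightarrow> real"
  assumes g: "\<And>x. (g has_real_derivative g' x) (at x)" and L: "\<And>x y. \<bar>x\<bar> \<le> B \<Longrightarrow> \<bar>y\<bar> \<le> B \<Longrightarrow> \<bar>g' x - g' y\<bar> \<le> L * \<bar>x - y\<bar>"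
    and b: "\<And>x. \<bar>x\<bar> \<le> B \<Longrightarrow> \<bar>g' x\<bar> \<le> L"
    and abm: "\<bar>a\<bar> \<le> B" "\<bar>b\<bar> \<le> B" "\<bar>m\<bar> \<le> B" and L0: "L \<ge> 0" and W: "\<bar>a - b\<bar> \<le> W"
  shows "((g a + g b) / 2 - g m)\<^sup>2 \<le> 2 * L\<^sup>2 * (((a + b) / 2 - m)\<^sup>2 + W ^ 4)"
proof -
  have mvt: "\<exists>z. min x y \<le> z \<and> z \<le> max x y \<and> g x - g y = (x - y) * g' z" for x y
  proof (cases x y rule: linorder_cases)
    case less
    from MVT2[OF less, of g g'] g obtain z where "x < z" "z < y" "g y - g x = (y - x) * g' z" by blast
    then show ?thesis by (intro exI[of _ z]) (auto simp: algebra_simps)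
  next
    case greater
    from MVT2[OF greater, of g g'] g obtain z where "y < z" "z < x" "g x - g y = (x - y) * g' z" by blast
    then show ?thesis by (intro exI[of _ z]) auto
  qed auto
  define p where "p = (a + b) / 2"
  have p: "\<bar>p\<bar> \<le> B" using abm unfolding p_def by auto
  obtain z1 where z1: "min a p \<le> z1" "z1 \<le> max a p" "g a - g p = (a - p) * g' z1" using mvt by blast
  obtain z2 where z2: "min b p \<le> z2" "z2 \<le> max b p" "g b - g p = (b - p) * g' z2" using mvt by blast
  obtain z3 where z3: "min p m \<le> z3" "z3 \<le> max p m" "g p - g m = (p - m) * g' z3" using mvt by blast
  have zB: "\<bar>z1\<bar> \<le> B" "\<bar>z2\<bar> \<le> B" "\<bar>z3\<bar> \<le> B" using z1(1,2) z2(1,2) z3(1,2) abm p by (auto simp: abs_le_iff min_def max_def split: if_splits)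
  have ap: "a - p = (a - b) / 2" "b - p = - ((a - b) / 2)" by (simp_all add: p_def field_simps)
  have "\<bar>z1 - z2\<bar> \<le> \<bar>a - b\<bar>" using z1(1,2) z2(1,2) unfolding p_def by (auto simp: abs_if min_def max_def field_simps split: if_splits)
  then have "\<bar>g' z1 - g' z2\<bar> \<le> L * \<bar>a - b\<bar>" using L[OF zB(1,2)] L0 by (meson mult_left_mono order_trans)
  then have d: "\<bar>g' z1 - g' z2\<bar> \<le> L * W" using W L0 by (meson mult_left_mono order_trans)
  have W0: "W \<ge> 0" using W by linarith
  have "(g a + g b) / 2 - g p = ((a - b) / 4) * (g' z1 - g' z2)"
    using z1(3) z2(3) unfolding ap by (simp add: field_simps)
  then have "\<bar>(g a + g b) / 2 - g p\<bar> = \<bar>a - b\<bar> / 4 * \<bar>g' z1 - g' z2\<bar>" by (simp only: abs_mult abs_divide abs_numeral)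
  also have "\<dots> \<le> W / 4 * (L * W)" using W d L0 W0 by (intro mult_mono) auto
  finally have 1: "\<bar>(g a + g b) / 2 - g p\<bar> \<le> L * W\<^sup>2 / 4" by (simp add: power2_eq_square mult_ac)
  have 2: "\<bar>g p - g m\<bar> \<le> L * \<bar>p - m\<bar>" unfolding z3(3) abs_mult using b[OF zB(3)] by (metis abs_ge_zero mult.commute mult_right_mono)
  have "\<bar>(g a + g b) / 2 - g m\<bar> \<le> L * \<bar>p - m\<bar> + L * W\<^sup>2"
    using abs_triangle_ineq[of "(g a + g b) / 2 - g p" "g p - g m"] 1 2 mult_nonneg_nonneg[OF L0 zero_le_power2[of W]] by linarith
  then have "\<bar>(g a + g b) / 2 - g m\<bar> \<le> L * (\<bar>p - m\<bar> + W\<^sup>2)" by (simp add: algebra_simps)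
  then have "((g a + g b) / 2 - g m)\<^sup>2 \<le> (L * (\<bar>p - m\<bar> + W\<^sup>2))\<^sup>2"
    by (rule abs_le_square_iff[THEN iffD1, OF order_trans]) (rule abs_ge_self)
  also have "\<dots> = L\<^sup>2 * (\<bar>p - m\<bar> + W\<^sup>2)\<^sup>2" by (simp add: power_mult_distrib)
  also have "(\<bar>p - m\<bar> + W\<^sup>2)\<^sup>2 \<le> 2 * (\<bar>p - m\<bar>\<^sup>2 + (W\<^sup>2)\<^sup>2)" using sum_squares_bound[of "\<bar>p - m\<bar>" "W\<^sup>2"] by (simp add: power2_sum)
  then have "L\<^sup>2 * (\<bar>p - m\<bar> + W\<^sup>2)\<^sup>2 \<le> L\<^sup>2 * (2 * (\<bar>p - m\<bar>\<^sup>2 + (W\<^sup>2)\<^sup>2))" by (intro mult_left_mono) auto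
  finally show ?thesis by (simp add: p_def algebra_simps)
qed

text \<open>Testing the equation of the defect with the defect itself leaves the flux term against
  the gradient \<open>qx\<close>; Young's inequality moves the gradient into the dissipation term
  \<open>- 2 * (qx t x)^2\<close>. What remains is at most a constant, depending on \<open>L\<close>
  alone, times \<open>(q t x)^2 + W^4\<close>.\<close>

lemma midpoint_estimate:
  fixes f r :: "real \<Rightarrow> real"
  assumes f: "\<And>x. (f has_real_derivative f' x) (at x)" and r: "\<And>x. (r has_real_derivative r' x) (at x)"
    and L: "\<And>x y. \<bar>x\<bar> \<le> B \<Longrightarrow> \<bar>y\<bar> \<le> B \<Longrightarrow> \<bar>f' x - f' y\<bar> \<le> L * \<bar>x - y\<bar>" "\<And>x y. \<bar>x\<bar> \<le> B \<Longrightarrow> \<bar>y\<bar> \<le> B \<Longrightarrow> \<bar>r' x - r' y\<bar> \<le> L * \<bar>x - y\<bar>"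
    and b: "\<And>x. \<bar>x\<bar> \<le> B \<Longrightarrow> \<bar>f' x\<bar> \<le> L" "\<And>x. \<bar>x\<bar> \<le> B \<Longrightarrow> \<bar>r' x\<bar> \<le> L" and L0: "L \<ge> 0"
    and Y: "classical_sol f f' r T k1 u Y yt yx" and Z: "classical_sol f f' r T k2 v Z zt zx"
    and X: "classical_sol f f' r T k3 (\<lambda>x. (u x + v x) / 2) X xt xx"
    and B: "\<And>t x. t \<in> {0..T} \<Longrightarrow> x \<in> {0..1} \<Longrightarrow> \<bar>Y t x\<bar> \<le> B" "\<And>t x. t \<in> {0..T} \<Longrightarrow> x \<in> {0..1} \<Longrightarrow> \<bar>Z t x\<bar> \<le> B"
      "\<And>t x. t \<in> {0..T} \<Longrightarrow> x \<in> {0..1} \<Longrightarrow> \<bar>X t x\<bar> \<le> B"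
    and W: "\<And>t x. t \<in> {0..T} \<Longrightarrow> x \<in> {0..1} \<Longrightarrow> \<bar>Y t x - Z t x\<bar> \<le> W"
    and t: "t \<in> {0..T}"
  shows "integral {0..1} (\<lambda>x. ((Y t x + Z t x) / 2 - X t x)\<^sup>2) \<le> W ^ 4 * (exp ((6 * L\<^sup>2 + 1) * t) - 1)"
proof -
  define c where "c = 6 * L\<^sup>2 + 1"
  define q where "q t x = (Y t x + Z t x) / 2 - X t x" for t x
  define qt where "qt t x = (yt t x + zt t x) / 2 - xt t x" for t x
  define qx where "qx t x = (yx t x + zx t x) / 2 - xx t x" for t x
  define F where "F t x = (f (Y t x) + f (Z t x)) / 2 - f (X t x)" for t x
  define G where "G t x = (r (Y t x) + r (Z t x)) / 2 - r (X t x)" for t x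
  define \<phi> where "\<phi> t = integral {0..1} (\<lambda>x. (q t x)\<^sup>2)" for t
  have qc: "continuous_on ({0..T} \<times> {0..1}) (\<lambda>p. q (fst p) (snd p))"
    unfolding q_def by (intro continuous_intros classical_solD(1)[OF Y] classical_solD(1)[OF Z] classical_solD(1)[OF X]) simp_all
  have qtc: "continuous_on ({0<..T} \<times> {0..1}) (\<lambda>p. qt (fst p) (snd p))"
    unfolding qt_def by (intro continuous_intros classical_solD(5)[OF Y] classical_solD(5)[OF Z] classical_solD(5)[OF X]) simp_all
  have qsl: "continuous_on {0..1} (q t)" if "t \<in> {0..T}" for t
    by (rule continuous_on_compose2[OF qc, of _ "\<lambda>x. (t, x)", simplified]) (use that in \<open>auto intro!: continuous_intros\<close>)
  have qtsl: "continuous_on {0..1} (qt t)" if "t \<in> {0<..T}" for t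
    by (rule continuous_on_compose2[OF qtc, of _ "\<lambda>x. (t, x)", simplified]) (use that in \<open>auto intro!: continuous_intros\<close>)
  have q0: "q 0 x = 0" if "x \<in> {0..1}" for x
    using classical_solD(2)[OF Y that] classical_solD(2)[OF Z that] classical_solD(2)[OF X that] by (simp add: q_def)
  have \<phi>0: "\<phi> 0 = 0"
    unfolding \<phi>_def by (rule integral_unique, rule has_integral_is_0) (simp add: q0)
  have \<phi>c: "continuous_on {0..T} \<phi>"
    unfolding \<phi>_def
    by (rule integral_continuous_on_param[where a=0 and b="1::real" and f="\<lambda>t x. (q t x)\<^sup>2", simplified])
       (use qc in \<open>simp add: split_beta' continuous_on_power\<close>)
  have ibp: "integral {0..1} (\<lambda>x. 2 * q t x * qt t x) \<le> c * (\<phi> t + W ^ 4)" if t: "t \<in> {0<..T}" for t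
  proof -
    have t0: "t \<in> {0..T}" using t by auto
    \<comment> \<open>The derivative of \<open>q * (qx - F)\<close>, whose integral is 0 by the
      boundary values. Comparing \<open>2 * q * qt\<close> with \<open>2 * P'\<close> pointwise
      performs the integration by parts under the integral sign.\<close>
    define P' where "P' x = qx t x * (qx t x - F t x) + q t x * (qt t x - G t x)" for x
    have dP: "((\<lambda>x. q t x * (qx t x - F t x)) has_real_derivative P' x) (at x within {0..1})" if x: "x \<in> {0..1}" for x
    proof -
      note d1 = classical_solD(7)[OF Y t x] classical_solD(7)[OF Z t x] classical_solD(7)[OF X t x]
      note d2 = classical_solD(8)[OF Y t x] classical_solD(8)[OF Z t x] classical_solD(8)[OF X t x]
      note d3 = d1[THEN DERIV_chain2[OF f]]
      have "(q t has_real_derivative qx t x) (at x within {0..1})"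
        unfolding q_def qx_def by (auto intro!: derivative_eq_intros d1)
      moreover have "((\<lambda>x. qx t x - F t x) has_real_derivative qt t x - G t x) (at x within {0..1})"
      proof -
        have "((\<lambda>x. qx t x - F t x) has_real_derivative
            ((yt t x + f' (Y t x) * yx t x - r (Y t x)) + (zt t x + f' (Z t x) * zx t x - r (Z t x))) / 2 - (xt t x + f' (X t x) * xx t x - r (X t x))
            - ((f' (Y t x) * yx t x + f' (Z t x) * zx t x) / 2 - f' (X t x) * xx t x)) (at x within {0..1})"
          unfolding qx_def F_def by (intro DERIV_diff DERIV_cdivide DERIV_add d2 d3)
        then show ?thesis by (rule DERIV_cong) (simp add: qt_def G_def field_simps)
      qed
      ultimately show ?thesis unfolding P'_def by (rule DERIV_cong[OF DERIV_mult']) simp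
    qed
    have "(P' has_integral q t 1 * (qx t 1 - F t 1) - q t 0 * (qx t 0 - F t 0)) {0..1}"
      by (rule fundamental_theorem_of_calculus) (use dP in \<open>auto simp: has_real_derivative_iff_has_vector_derivative\<close>)
    moreover have "q t 0 = 0" "q t 1 = 0"
      using classical_solD(3,4)[OF Y t0] classical_solD(3,4)[OF Z t0] classical_solD(3,4)[OF X t0] by (simp_all add: q_def)
    ultimately have P0: "(P' has_integral 0) {0..1}" by simp
    have int: "((\<lambda>x. (q t x)\<^sup>2) has_integral \<phi> t) {0..1}"
      unfolding \<phi>_def by (intro integrable_integral integrable_continuous_interval continuous_intros qsl t0)
    have le: "2 * q t x * qt t x \<le> 2 * P' x + c * ((q t x)\<^sup>2 + W ^ 4)" if x: "x \<in> {0..1}" for x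
    proof -
      have F2: "(F t x)\<^sup>2 \<le> 2 * L\<^sup>2 * ((q t x)\<^sup>2 + W ^ 4)"
        unfolding F_def q_def by (rule midpoint_defect[OF f L(1) b(1) B(1,2,3) L0 W]) (use t0 x in auto)
      have G2: "(G t x)\<^sup>2 \<le> 2 * L\<^sup>2 * ((q t x)\<^sup>2 + W ^ 4)"
        unfolding G_def q_def by (rule midpoint_defect[OF r L(2) b(2) B(1,2,3) L0 W]) (use t0 x in auto)
      have "2 * q t x * qt t x = 2 * P' x - 2 * (qx t x)\<^sup>2 + 2 * (qx t x * F t x) + 2 * (q t x * G t x)"
        by (simp add: P'_def power2_eq_square algebra_simps)
      also have "\<dots> \<le> 2 * P' x + (F t x)\<^sup>2 + (q t x)\<^sup>2 + (G t x)\<^sup>2"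
        using sum_squares_bound[of "qx t x" "F t x"] sum_squares_bound[of "q t x" "G t x"] zero_le_power2[of "qx t x"] by linarith
      also have "\<dots> \<le> 2 * P' x + (4 * L\<^sup>2 * ((q t x)\<^sup>2 + W ^ 4) + (q t x)\<^sup>2)" using F2 G2 by linarith
      also have "\<dots> \<le> 2 * P' x + c * ((q t x)\<^sup>2 + W ^ 4)"
      proof -
        have "0 \<le> 2 * L\<^sup>2 * ((q t x)\<^sup>2 + W ^ 4) + W ^ 4" by simp
        then show ?thesis by (simp add: c_def algebra_simps)
      qed
      finally show ?thesis .
    qed
    have "integral {0..1} (\<lambda>x. 2 * q t x * qt t x) \<le> 2 * 0 + c * (\<phi> t + W ^ 4 * (1 - 0))"
    proof (rule has_integral_le)
      show "((\<lambda>x. 2 * q t x * qt t x) has_integral integral {0..1} (\<lambda>x. 2 * q t x * qt t x)) {0..1}"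
        by (intro integrable_integral integrable_continuous_interval continuous_intros qsl[OF t0] qtsl[OF t])
      show "((\<lambda>x. 2 * P' x + c * ((q t x)\<^sup>2 + W ^ 4)) has_integral 2 * 0 + c * (\<phi> t + W ^ 4 * (1 - 0))) {0..1}"
        using has_integral_const_real[of "W ^ 4" 0 1] by (intro has_integral_add has_integral_mult_right P0 int) (simp add: mult.commute)
    qed (use le in auto)
    then show ?thesis by simp
  qed
  have \<phi>d: "(\<phi> has_real_derivative integral {0..1} (\<lambda>x. 2 * q s x * qt s x)) (at s within {0<..T})" if s: "s \<in> {0<..T}" for s
    unfolding \<phi>_def
  proof (rule leibniz_rule_field_derivative[where a=0 and b="1::real" and f="\<lambda>t x. (q t x)\<^sup>2" and fx="\<lambda>s x. 2 * q s x * qt s x", unfolded box_real])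
    fix s x :: real assume s: "s \<in> {0<..T}" and x: "x \<in> {0..1}"
    have "((\<lambda>s. q s x) has_real_derivative qt s x) (at s within {0..T})"
      unfolding q_def qt_def
      by (auto intro!: derivative_eq_intros classical_solD(6)[OF Y s x] classical_solD(6)[OF Z s x] classical_solD(6)[OF X s x])
    then have "((\<lambda>s. q s x) has_real_derivative qt s x) (at s within {0<..T})" by (rule DERIV_subset) auto
    then show "((\<lambda>s. (q s x)\<^sup>2) has_real_derivative 2 * q s x * qt s x) (at s within {0<..T})"
      by (auto intro!: derivative_eq_intros)
  next
    fix s assume "s \<in> {0<..T}"
    then show "(\<lambda>x. (q s x)\<^sup>2) integrable_on {0..1}"
      by (intro integrable_continuous_interval continuous_intros qsl) auto
  next
    have "continuous_on ({0<..T} \<times> {0..1}) (\<lambda>p. q (fst p) (snd p))" by (rule continuous_on_subset[OF qc]) auto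
    then show "continuous_on ({0<..T} \<times> {0..1}) (\<lambda>(s, x). 2 * q s x * qt s x)"
      unfolding split_beta' by (intro continuous_intros qtc)
  qed (use s in auto)
  \<comment> \<open>Gronwall's inequality for \<open>\<phi> t + W ^ 4\<close>. At time 0, where
    \<open>qt\<close> is not controlled, only the continuity of \<open>\<phi>\<close> is
    used.\<close>
  have "(\<phi> t + W ^ 4) * exp (- (c * t)) \<le> (\<phi> 0 + W ^ 4) * exp (- (c * 0))"
  proof (rule DERIV_nonpos_imp_decreasing_open[where f="\<lambda>t. (\<phi> t + W ^ 4) * exp (- (c * t))"])
    show "0 \<le> t" using t by simp
    show "continuous_on {0..t} (\<lambda>t. (\<phi> t + W ^ 4) * exp (- (c * t)))"
      by (intro continuous_intros continuous_on_subset[OF \<phi>c]) (use t in auto)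
    fix s assume s: "0 < s" "s < t"
    then have sT: "s \<in> {0<..T}" "s < T" using t by auto
    have "at s within {0<..T} = at s" by (rule at_within_nhd[of _ "{0<..<T}"]) (use sT in auto)
    then have "(\<phi> has_real_derivative integral {0..1} (\<lambda>x. 2 * q s x * qt s x)) (at s)" using \<phi>d[OF sT(1)] by simp
    then have "((\<lambda>t. (\<phi> t + W ^ 4) * exp (- (c * t))) has_real_derivative
        (integral {0..1} (\<lambda>x. 2 * q s x * qt s x) - c * (\<phi> s + W ^ 4)) * exp (- (c * s))) (at s)"
      by (auto intro!: derivative_eq_intros simp: algebra_simps)
    moreover have "(integral {0..1} (\<lambda>x. 2 * q s x * qt s x) - c * (\<phi> s + W ^ 4)) * exp (- (c * s)) \<le> 0"
      using ibp[OF sT(1)] by (intro mult_nonpos_nonneg) auto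
    ultimately show "\<exists>y. ((\<lambda>t. (\<phi> t + W ^ 4) * exp (- (c * t))) has_real_derivative y) (at s) \<and> y \<le> 0" by blast
  qed
  then have "\<phi> t + W ^ 4 \<le> W ^ 4 * exp (c * t)" by (simp add: \<phi>0 exp_minus field_simps)
  then show ?thesis by (simp add: \<phi>_def q_def c_def algebra_simps)
qed

section \<open>The observation norm and the abstract minimisation argument\<close>

lemma V_imp_L2:
  assumes "v \<in> V" shows "v \<in> L2"
proof -
  note c = V_continuous[OF assms, of "{0..1}"]
  have "set_integrable lborel {0..1} v" "set_integrable lborel {0..1} (\<lambda>x. (v x)\<^sup>2)"
    unfolding set_integrable_def by (intro borel_integrable_compact continuous_intros c compact_Icc)+
  then show ?thesis unfolding L2_def set_borel_measurable_def set_integrable_def by auto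
qed

lemma L2norm_continuous:
  assumes "continuous_on {0..1} v"
  shows "L2norm v = sqrt (integral {0..1} (\<lambda>x. (v x)\<^sup>2))"
proof -
  have "set_integrable lborel {0..1} (\<lambda>x. (v x)\<^sup>2)"
    unfolding set_integrable_def by (intro borel_integrable_compact continuous_intros assms) auto
  from set_borel_integral_eq_integral(2)[OF this] show ?thesis by (simp add: L2norm_def)
qed

lemma L2norm_le:
  assumes v: "v \<in> V" and b: "\<And>x. x \<in> {0..1} \<Longrightarrow> \<bar>v x\<bar> \<le> B"
  shows "L2norm v \<le> B"
proof -
  have "B \<ge> 0" using b[of 0] by auto
  then show ?thesis
    using real_sqrt_le_mono[OF integral_unit_square_le[OF V_continuous[OF v] b]] unfolding L2norm_continuous[OF V_continuous[OF v]] by simp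
qed

lemma unique_minimizer:
  fixes J :: "(real \<Rightarrow> real) \<Rightarrow> real"
  assumes u0: "u0 \<in> V" and J0: "\<And>v. v \<in> V \<Longrightarrow> J v \<ge> 0"
    and coercive: "\<And>v. v \<in> V \<Longrightarrow> J v \<le> J u0 \<Longrightarrow> Vnorm v \<le> K"
    and mid: "\<And>u v. u \<in> V \<Longrightarrow> v \<in> V \<Longrightarrow> Vnorm u \<le> K \<Longrightarrow> Vnorm v \<le> K \<Longrightarrow>
        J (\<lambda>x. (u x + v x) / 2) \<le> (J u + J v) / 2 - \<kappa> * (Vnorm (\<lambda>x. u x - v x))\<^sup>2"
    and \<kappa>: "\<kappa> > 0"
    and lip: "\<And>u v. u \<in> V \<Longrightarrow> v \<in> V \<Longrightarrow> Vnorm u \<le> K \<Longrightarrow> Vnorm v \<le> K \<Longrightarrow> \<bar>J u - J v\<bar> \<le> \<Lambda> * Vnorm (\<lambda>x. u x - v x)"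
  shows "\<exists>!u. u \<in> V \<and> (\<forall>v\<in>V. J u \<le> J v)"
proof -
  define I where "I = Inf (J ` V)"
  have bdd: "bdd_below (J ` V)" using J0 by (intro bdd_belowI[of _ 0]) auto
  have I_le: "I \<le> J v" if "v \<in> V" for v unfolding I_def by (rule cINF_lower[OF bdd that])
  have midV: "(\<lambda>x. (u x + v x) / 2) \<in> V" if "u \<in> V" "v \<in> V" for u v
    using V_lin[OF that, of "1/2" "1/2"] by (simp add: add_divide_distrib)
  have close: "\<kappa> * (Vnorm (\<lambda>x. u x - v x))\<^sup>2 \<le> (J u - I) / 2 + (J v - I) / 2"
    if "u \<in> V" "v \<in> V" "Vnorm u \<le> K" "Vnorm v \<le> K" for u v
    using mid[OF that] I_le[OF midV[OF that(1,2)]] by (simp add: field_simps)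
  \<comment> \<open>Staying below \<open>J u0\<close> keeps the sequence in the ball on which
    \<open>mid\<close> and \<open>lip\<close> hold. Should an almost minimal \<open>w\<close> lie
    above \<open>J u0\<close>, then \<open>u0\<close> is almost minimal itself.\<close>
  have "\<forall>k. \<exists>u. u \<in> V \<and> J u \<le> J u0 \<and> J u < I + 1 / real (Suc k)"
  proof
    fix k
    have "Inf (J ` V) < I + 1 / real (Suc k)" by (simp add: I_def)
    then obtain w where w: "w \<in> V" "J w < I + 1 / real (Suc k)" using cInf_lessD[of "J ` V"] u0 by blast
    show "\<exists>u. u \<in> V \<and> J u \<le> J u0 \<and> J u < I + 1 / real (Suc k)"
    proof (cases "J w \<le> J u0")
      case True
      then show ?thesis using w by blast
    next
      case False
      then show ?thesis using w u0 by (intro exI[of _ u0]) auto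
    qed
  qed
  from choice[OF this] obtain u where u: "\<And>k. u k \<in> V" "\<And>k. J (u k) \<le> J u0" "\<And>k. J (u k) < I + 1 / real (Suc k)" by blast
  have uK: "Vnorm (u k) \<le> K" for k by (rule coercive[OF u(1,2)])
  have half: "x < d" if "x \<le> a / 2 + b / 2" "a < c" "b < c" "c < d" for a b c d x :: real using that by linarith
  have cauchy: "\<exists>N. \<forall>i\<ge>N. \<forall>j\<ge>N. Vnorm (\<lambda>x. u i x - u j x) < e" if e: "e > 0" for e
  proof -
    obtain N where N: "1 / real (Suc N) < \<kappa> * e\<^sup>2" using nat_approx_posE[of "\<kappa> * e\<^sup>2"] \<kappa> e by auto
    show ?thesis
    proof (intro exI[of _ N] allI impI)
      fix i j assume ij: "N \<le> i" "N \<le> j"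
      have le: "J (u i) - I < 1 / real (Suc N)" if "N \<le> i" for i
      proof -
        have "1 / real (Suc i) \<le> 1 / real (Suc N)" using that by (intro divide_left_mono) auto
        then show ?thesis using u(3)[of i] by linarith
      qed
      have "\<kappa> * (Vnorm (\<lambda>x. u i x - u j x))\<^sup>2 < \<kappa> * e\<^sup>2"
        by (rule half[OF close[OF u(1) u(1) uK uK] le[OF ij(1)] le[OF ij(2)] N])
      then have "(Vnorm (\<lambda>x. u i x - u j x))\<^sup>2 < e\<^sup>2" using \<kappa> by simp
      then show "Vnorm (\<lambda>x. u i x - u j x) < e" using e by (simp add: power_less_imp_less_base)
    qed
  qed
  obtain v where v: "v \<in> V" "(\<lambda>k. Vnorm (\<lambda>x. u k x - v x)) \<longlonglongrightarrow> 0"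
    by (rule V_complete[OF u(1) cauchy]) (assumption, rule that)
  have vK: "Vnorm v \<le> K"
  proof (rule tendsto_lowerbound)
    show "(\<lambda>k. K + Vnorm (\<lambda>x. u k x - v x)) \<longlonglongrightarrow> K" using tendsto_add[OF tendsto_const v(2), of K] by simp
    have "Vnorm v \<le> K + Vnorm (\<lambda>x. u k x - v x)" for k
    proof -
      have "Vnorm (\<lambda>x. u k x + (v x - u k x)) \<le> Vnorm (u k) + Vnorm (\<lambda>x. v x - u k x)"
        by (rule Vnorm_triangle[OF u(1) V_diff[OF v(1) u(1)]])
      then show ?thesis using uK[of k] Vnorm_minus_commute[OF v(1) u(1), of k] by simp
    qed
    then show "\<forall>\<^sub>F k in sequentially. Vnorm v \<le> K + Vnorm (\<lambda>x. u k x - v x)" by simp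
  qed simp
  \<comment> \<open>The minimising sequence converges in norm, so the Lipschitz bound on the ball
    passes to the limit in \<open>J\<close>.\<close>
  have "J v \<le> I"
  proof (rule tendsto_lowerbound)
    show "(\<lambda>k. I + inverse (real (Suc k)) + \<Lambda> * Vnorm (\<lambda>x. u k x - v x)) \<longlonglongrightarrow> I"
      using tendsto_add[OF tendsto_add[OF tendsto_const LIMSEQ_inverse_real_of_nat] tendsto_mult[OF tendsto_const v(2)], of I \<Lambda>] by simp
    have "J v \<le> I + inverse (real (Suc k)) + \<Lambda> * Vnorm (\<lambda>x. u k x - v x)" for k
      using lip[OF u(1) v(1) uK vK, of k] u(3)[of k] by (simp add: inverse_eq_divide abs_le_iff)
    then show "\<forall>\<^sub>F k in sequentially. J v \<le> I + inverse (real (Suc k)) + \<Lambda> * Vnorm (\<lambda>x. u k x - v x)" by simp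
  qed simp
  then have min: "\<forall>w\<in>V. J v \<le> J w" using I_le by (meson order_trans)
  show ?thesis
  proof (rule ex1I[of _ v])
    show "v \<in> V \<and> (\<forall>w\<in>V. J v \<le> J w)" using v(1) min by blast
    fix w assume w: "w \<in> V \<and> (\<forall>v\<in>V. J w \<le> J v)"
    have wI: "J w \<le> I" using w v(1) \<open>J v \<le> I\<close> by (meson order_trans)
    have wK: "Vnorm w \<le> K" using w u0 by (intro coercive) auto
    have "\<kappa> * (Vnorm (\<lambda>x. w x - v x))\<^sup>2 \<le> 0" by (rule order_trans[OF close[OF _ v(1) wK vK]]) (use w wI \<open>J v \<le> I\<close> in \<open>auto simp: field_simps\<close>)
    then have "(Vnorm (\<lambda>x. w x - v x))\<^sup>2 \<le> 0" using \<kappa> by (simp add: mult_le_0_iff)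
    then have z: "Vnorm (\<lambda>x. w x - v x) = 0" by simp
    have "(\<lambda>x. w x - v x) \<in> V" using w v(1) by (intro V_diff) auto
    from abs_le_Vnorm[OF this] z show "w = v" by (intro ext) simp
  qed
qed

section \<open>Uniform estimates for the solution map on a ball of V\<close>

context reaction_convection
begin

text \<open>Midpoints stay in the ball, so the three solutions of the defect estimate share the
  constants of \<open>local_solution\<close> for radius \<open>K\<close> on the unit time interval.
  The comparison bound plays the part of \<open>W\<close> in \<open>midpoint_estimate\<close>, and
  the square root of its fourth power gives the quadratic dependence on the distance.\<close>

lemma solution_map_estimates:
  assumes K: "K \<ge> 0"
  obtains B C c where "B \<ge> 0" "C \<ge> 0" "c \<ge> 0"
    "\<And>u t. u \<in> V \<Longrightarrow> Vnorm u \<le> K \<Longrightarrow> t \<in> {0..1} \<Longrightarrow> slice (sol f r u) t \<in> V \<and> L2norm (slice (sol f r u) t) \<le> B"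
    "\<And>u v t. u \<in> V \<Longrightarrow> v \<in> V \<Longrightarrow> Vnorm u \<le> K \<Longrightarrow> Vnorm v \<le> K \<Longrightarrow> t \<in> {0..1} \<Longrightarrow>
       L2norm (\<lambda>x. slice (sol f r u) t x - slice (sol f r v) t x) \<le> C * Vnorm (\<lambda>x. u x - v x)"
    "\<And>u v t. u \<in> V \<Longrightarrow> v \<in> V \<Longrightarrow> Vnorm u \<le> K \<Longrightarrow> Vnorm v \<le> K \<Longrightarrow> t \<in> {0..1} \<Longrightarrow>
       L2norm (\<lambda>x. (slice (sol f r u) t x + slice (sol f r v) t x) / 2 - slice (sol f r (\<lambda>x. (u x + v x) / 2)) t x)
         \<le> (C * Vnorm (\<lambda>x. u x - v x))\<^sup>2 * sqrt (exp (c * t) - 1)"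
proof -
  have E0: "2 * K\<^sup>2 \<ge> 0" by simp
  show ?thesis
  proof (rule local_solution[OF f_C2 r_C2 r_neg r_pos zero_less_one K E0])
    fix B L k :: real
    assume B: "B > 0" and L0: "L \<ge> 0" and k: "k \<ge> 0"
      and L: "\<And>a b. \<bar>a\<bar> \<le> B \<Longrightarrow> \<bar>b\<bar> \<le> B \<Longrightarrow> \<bar>deriv f a - deriv f b\<bar> \<le> L * \<bar>a - b\<bar>"
        "\<And>a b. \<bar>a\<bar> \<le> B \<Longrightarrow> \<bar>b\<bar> \<le> B \<Longrightarrow> \<bar>deriv r a - deriv r b\<bar> \<le> L * \<bar>a - b\<bar>"
      and b: "\<And>a. \<bar>a\<bar> \<le> B \<Longrightarrow> \<bar>deriv f a\<bar> \<le> L" "\<And>a. \<bar>a\<bar> \<le> B \<Longrightarrow> \<bar>deriv r a\<bar> \<le> L"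
      and ex: "\<And>w. continuous_on {0..1} w \<Longrightarrow> (\<And>x. x \<in> {0..1} \<Longrightarrow> \<bar>w x\<bar> \<le> K) \<Longrightarrow> (\<And>m. (\<Sum>n<m. (freq n * fsin n w)\<^sup>2) \<le> 2 * K\<^sup>2) \<Longrightarrow>
         \<exists>Y yt yx. classical_sol f (deriv f) r 1 k w Y yt yx \<and> (\<forall>t\<in>{0..1}. \<forall>x\<in>{0..1}. \<bar>Y t x\<bar> \<le> B)"
    define S where "S u = slice (sol f r u)" for u
    define C where "C = exp ((L * k + L + 1) * gweight 1)"
    define c where "c = 6 * L\<^sup>2 + 1"
    have sol: "\<exists>Y yt yx. classical_sol f (deriv f) r 1 k u Y yt yx \<and> (\<forall>t\<in>{0..1}. \<forall>x\<in>{0..1}. \<bar>Y t x\<bar> \<le> B) \<and> (\<forall>t\<in>{0..1}. S u t = zero_ext (Y t))"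
      if u: "u \<in> V" "Vnorm u \<le> K" for u
    proof -
      have "(Vnorm u)\<^sup>2 \<le> K\<^sup>2" using u by (intro power_mono) auto
      then have en: "(\<Sum>n<m. (freq n * fsin n u)\<^sup>2) \<le> 2 * K\<^sup>2" for m using V_energy[OF u(1), of m] by linarith
      obtain Y yt yx where Y: "classical_sol f (deriv f) r 1 k u Y yt yx" "\<forall>t\<in>{0..1}. \<forall>x\<in>{0..1}. \<bar>Y t x\<bar> \<le> B"
        using ex[OF V_continuous[OF u(1)] order_trans[OF abs_le_Vnorm[OF u(1)] u(2)] en] by blast
      have "\<forall>t\<in>{0..1}. S u t = zero_ext (Y t)" using slice_sol_eq[OF u(1) Y(1) k] by (simp add: S_def)
      with Y show ?thesis by blast
    qed
    have SV: "S u t \<in> V" if u: "u \<in> V" "Vnorm u \<le> K" and t: "t \<in> {0..1}" for u t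
    proof -
      from sol[OF u] obtain Y yt yx where Y: "classical_sol f (deriv f) r 1 k u Y yt yx" "\<forall>t\<in>{0..1}. S u t = zero_ext (Y t)" by blast
      show ?thesis using classical_slice_V[OF Y(1) u(1) t] Y(2) t by simp
    qed
    have rl: "\<bar>r a - r b\<bar> \<le> L * \<bar>a - b\<bar>" if "\<bar>a\<bar> \<le> B" "\<bar>b\<bar> \<le> B" for a b
    proof -
      have "norm (r a - r b) \<le> L * norm (a - b)"
        by (rule field_differentiable_bound[of "{-B..B}" r "deriv r"])
           (use that b(2) in \<open>auto intro: has_field_derivative_at_within[OF r_deriv]\<close>)
      then show ?thesis by simp
    qed
    have dep: "\<bar>Y t x - Z t x\<bar> \<le> C * Vnorm (\<lambda>x. u x - v x)"
      if u: "u \<in> V" and v: "v \<in> V" and Y: "classical_sol f (deriv f) r 1 k u Y yt yx" and Yb: "\<forall>t\<in>{0..1}. \<forall>x\<in>{0..1}. \<bar>Y t x\<bar> \<le> B"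
        and Z: "classical_sol f (deriv f) r 1 k v Z zt zx" and Zb: "\<forall>t\<in>{0..1}. \<forall>x\<in>{0..1}. \<bar>Z t x\<bar> \<le> B"
        and t: "t \<in> {0..1}" and x: "x \<in> {0..1}" for u v Y yt yx Z zt zx t x
    proof -
      have "\<bar>Y t x - Z t x\<bar> \<le> Vnorm (\<lambda>x. u x - v x) * exp ((L * k + L + 1) * gweight t)"
        by (rule comparison[OF f_deriv classical_imp_pointwise[OF f_deriv Y] Z _ _ L(1) rl L0 k _ t x])
           (use Yb Zb abs_le_Vnorm[OF V_diff[OF u v]] in auto)
      also have "\<dots> \<le> Vnorm (\<lambda>x. u x - v x) * C"
        unfolding C_def using t gweight_mono[of t 1] L0 k by (intro mult_left_mono) (auto intro!: mult_left_mono)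
      finally show ?thesis by (simp add: mult.commute)
    qed
    show ?thesis
    proof (rule that[of B C c])
      show "B \<ge> 0" "C \<ge> 0" "c \<ge> 0" using B by (auto simp: C_def c_def)
      fix u t assume u: "u \<in> V" "Vnorm u \<le> K" and t: "t \<in> {0..1::real}"
      from sol[OF u] obtain Y yt yx where Y: "classical_sol f (deriv f) r 1 k u Y yt yx" "\<forall>t\<in>{0..1}. \<forall>x\<in>{0..1}. \<bar>Y t x\<bar> \<le> B"
          "\<forall>t\<in>{0..1}. S u t = zero_ext (Y t)" by blast
      have "L2norm (S u t) \<le> B" by (rule L2norm_le[OF SV[OF u t]]) (use Y(2,3) t in \<open>auto simp: zero_ext_def\<close>)
      then show "slice (sol f r u) t \<in> V \<and> L2norm (slice (sol f r u) t) \<le> B" using SV[OF u t] by (simp add: S_def)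
    next
      fix u v t assume u: "u \<in> V" and v: "v \<in> V" and uK: "Vnorm u \<le> K" and vK: "Vnorm v \<le> K" and t: "t \<in> {0..1::real}"
      from sol[OF u uK] obtain Y yt yx where Y: "classical_sol f (deriv f) r 1 k u Y yt yx" "\<forall>t\<in>{0..1}. \<forall>x\<in>{0..1}. \<bar>Y t x\<bar> \<le> B"
          "\<forall>t\<in>{0..1}. S u t = zero_ext (Y t)" by blast
      from sol[OF v vK] obtain Z zt zx where Z: "classical_sol f (deriv f) r 1 k v Z zt zx" "\<forall>t\<in>{0..1}. \<forall>x\<in>{0..1}. \<bar>Z t x\<bar> \<le> B"
          "\<forall>t\<in>{0..1}. S v t = zero_ext (Z t)" by blast
      have "L2norm (\<lambda>x. S u t x - S v t x) \<le> C * Vnorm (\<lambda>x. u x - v x)"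
        by (rule L2norm_le[OF V_diff[OF SV[OF u uK t] SV[OF v vK t]]])
           (use dep[OF u v Y(1,2) Z(1,2) t] Y(3) Z(3) t in \<open>auto simp: zero_ext_def\<close>)
      then show "L2norm (\<lambda>x. slice (sol f r u) t x - slice (sol f r v) t x) \<le> C * Vnorm (\<lambda>x. u x - v x)" by (simp add: S_def)
      define m where "m x = (u x + v x) / 2" for x
      have m: "m \<in> V" unfolding m_def using V_lin[OF u v, of "1/2" "1/2"] by (simp add: add_divide_distrib)
      have "(Vnorm m)\<^sup>2 \<le> (Vnorm u)\<^sup>2 / 2 + (Vnorm v)\<^sup>2 / 2" unfolding m_def Vnorm_midpoint[OF u v] by simp
      also have "\<dots> \<le> K\<^sup>2" using power_mono[OF uK Vnorm_nonneg, of 2] power_mono[OF vK Vnorm_nonneg, of 2] by linarith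
      finally have mK: "Vnorm m \<le> K" using K by (rule power2_le_imp_le)
      from sol[OF m mK] obtain X xt xx where X: "classical_sol f (deriv f) r 1 k m X xt xx" "\<forall>t\<in>{0..1}. \<forall>x\<in>{0..1}. \<bar>X t x\<bar> \<le> B"
          "\<forall>t\<in>{0..1}. S m t = zero_ext (X t)" by blast
      have "integral {0..1} (\<lambda>x. ((Y t x + Z t x) / 2 - X t x)\<^sup>2) \<le> (C * Vnorm (\<lambda>x. u x - v x)) ^ 4 * (exp ((6 * L\<^sup>2 + 1) * t) - 1)"
        by (rule midpoint_estimate[OF f_deriv r_deriv L b L0 Y(1) Z(1) X(1)[unfolded m_def] _ _ _ dep[OF u v Y(1,2) Z(1,2)] t])
           (use Y(2) Z(2) X(2) in auto)
      also have "integral {0..1} (\<lambda>x. ((Y t x + Z t x) / 2 - X t x)\<^sup>2) = integral {0..1} (\<lambda>x. ((S u t x + S v t x) / 2 - S m t x)\<^sup>2)"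
        by (rule Henstock_Kurzweil_Integration.integral_cong) (use Y(3) Z(3) X(3) t in \<open>simp add: zero_ext_def\<close>)
      finally have "sqrt (integral {0..1} (\<lambda>x. ((S u t x + S v t x) / 2 - S m t x)\<^sup>2)) \<le> sqrt ((C * Vnorm (\<lambda>x. u x - v x)) ^ 4 * (exp (c * t) - 1))"
        unfolding c_def by (rule real_sqrt_le_mono)
      also have "sqrt (integral {0..1} (\<lambda>x. ((S u t x + S v t x) / 2 - S m t x)\<^sup>2)) = L2norm (\<lambda>x. (S u t x + S v t x) / 2 - S m t x)"
        by (rule L2norm_continuous[symmetric]) (intro continuous_intros V_continuous SV u v m uK vK mK t, simp)
      also have "sqrt ((C * Vnorm (\<lambda>x. u x - v x)) ^ 4 * (exp (c * t) - 1)) = (C * Vnorm (\<lambda>x. u x - v x))\<^sup>2 * sqrt (exp (c * t) - 1)"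
      proof -
        have "(C * Vnorm (\<lambda>x. u x - v x)) ^ 4 = ((C * Vnorm (\<lambda>x. u x - v x))\<^sup>2)\<^sup>2" by (simp flip: power_mult)
        then show ?thesis by (simp only: real_sqrt_mult real_sqrt_abs abs_power2)
      qed
      finally show "L2norm (\<lambda>x. (slice (sol f r u) t x + slice (sol f r v) t x) / 2 - slice (sol f r (\<lambda>x. (u x + v x) / 2)) t x)
         \<le> (C * Vnorm (\<lambda>x. u x - v x))\<^sup>2 * sqrt (exp (c * t) - 1)" unfolding S_def m_def .
    qed
  qed
qed

end

text \<open>Convexity of the square at the mean of the two norms, combined with a difference of
  squares for the perturbation, in which the factor formed by the sum is at most
  \<open>2 * Q\<close>.\<close>

lemma norm_midpoint_perturbed:
  fixes a b m :: "'a::real_normed_vector"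
  assumes "norm a \<le> Q" "norm b \<le> Q" "norm m \<le> Q"
  shows "(norm m)\<^sup>2 \<le> ((norm a)\<^sup>2 + (norm b)\<^sup>2) / 2 + 2 * Q * norm ((1/2) *\<^sub>R a + (1/2) *\<^sub>R b - m)"
proof -
  define s where "s = (norm a + norm b) / 2"
  define e where "e = norm ((1/2) *\<^sub>R a + (1/2) *\<^sub>R b - m)"
  have "norm ((1/2) *\<^sub>R a + (1/2) *\<^sub>R b) \<le> s"
    using norm_triangle_ineq[of "(1/2) *\<^sub>R a" "(1/2) *\<^sub>R b"] by (simp add: s_def)
  then have m: "norm m \<le> s + e"
    using norm_triangle_sub[of m "(1/2) *\<^sub>R a + (1/2) *\<^sub>R b"] norm_minus_commute[of m "(1/2) *\<^sub>R a + (1/2) *\<^sub>R b"]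
    unfolding e_def by linarith
  have e0: "e \<ge> 0" and s0: "s \<ge> 0" by (simp_all add: e_def s_def)
  have "(norm m)\<^sup>2 - s\<^sup>2 = (norm m - s) * (norm m + s)" by (simp add: power2_eq_square algebra_simps)
  also have "\<dots> \<le> e * (norm m + s)" using m s0 by (intro mult_right_mono) auto
  also have "\<dots> \<le> e * (2 * Q)" using e0 assms by (intro mult_left_mono) (auto simp: s_def field_simps)
  finally have "(norm m)\<^sup>2 \<le> s\<^sup>2 + 2 * Q * e" by (simp add: mult_ac)
  also have "s\<^sup>2 \<le> ((norm a)\<^sup>2 + (norm b)\<^sup>2) / 2"
    using sum_squares_bound[of "norm a" "norm b"] by (simp add: s_def power2_eq_square field_simps)
  finally show ?thesis by (simp add: e_def)
qed

lemma abs_square_diff_le: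
  fixes x y :: real
  assumes "\<bar>x\<bar> \<le> Q" "\<bar>y\<bar> \<le> Q" "\<bar>x - y\<bar> \<le> d"
  shows "\<bar>x\<^sup>2 - y\<^sup>2\<bar> \<le> 2 * Q * d"
proof -
  have "\<bar>x\<^sup>2 - y\<^sup>2\<bar> = \<bar>x + y\<bar> * \<bar>x - y\<bar>" by (simp add: power2_eq_square algebra_simps flip: abs_mult)
  also have "\<dots> \<le> (2 * Q) * d" using assms by (intro mult_mono) auto
  finally show ?thesis .
qed

theorem theorem2:
  fixes f r :: "real \<Rightarrow> real"
    and H :: "(real \<Rightarrow> real) \<Rightarrow> real^'q"
    and R :: "real^'q^'q"
    and N :: nat and D M \<sigma> :: real
  assumes f_C2: "C2 f" and r_C2: "C2 r"
    and r_neg: "(\<integral>\<^sup>+ y\<in>{..0}. ennreal (1 / (\<bar>r y\<bar> + 1)) \<partial>lborel) = \<infinity>"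
    and r_pos: "(\<integral>\<^sup>+ y\<in>{0..}. ennreal (1 / (\<bar>r y\<bar> + 1)) \<partial>lborel) = \<infinity>"
    and H_lin: "\<forall>v\<in>L2. \<forall>w\<in>L2. \<forall>a b. H (\<lambda>x. a * v x + b * w x) = a *\<^sub>R H v + b *\<^sub>R H w"
    and H_bdd: "\<exists>C. \<forall>v\<in>L2. norm (H v) \<le> C * L2norm v"
    and R_spd: "sym_posdef R"
    and N: "N \<ge> 1" and D: "D \<ge> 0" and M: "M \<ge> 0" and \<sigma>: "\<sigma> > 0"
  shows "\<exists>T0>0. \<forall>u0\<in>V. \<forall>t::nat \<Rightarrow> real. \<forall>z::nat \<Rightarrow> real^'q.
           Vnorm u0 \<le> M \<longrightarrow>
           0 < t 1 \<longrightarrow> (\<forall>i\<in>{1..<N}. t i < t (i+1)) \<longrightarrow> t N < T0 \<longrightarrow>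
           (\<forall>i\<in>{1..N}. norm (z i) \<le> D) \<longrightarrow>
           (\<exists>!u. u \<in> V \<and> (\<forall>v\<in>V. costJ f r H R N t z \<sigma> u0 u \<le> costJ f r H R N t z \<sigma> u0 v))"
proof -
  interpret reaction_convection f r by unfold_locales (rule f_C2 r_C2 r_neg r_pos)+
  define S where "S t u = slice (sol f r u) t" for t u
  obtain a where a: "a \<ge> 0" "\<And>x. norm (inv_sqrt R *v x) \<le> a * norm x"
    using bounded_linear.nonneg_bounded[OF matrix_vector_mul_bounded_linear[of "inv_sqrt R"]] by (auto simp: mult.commute)
  obtain h0 where h0: "\<forall>v\<in>L2. norm (H v) \<le> h0 * L2norm v" using H_bdd by blast
  have L2norm0: "L2norm v \<ge> 0" for v unfolding L2norm_def set_lebesgue_integral_def by (auto intro!: integral_nonneg_AE)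
  \<comment> \<open>Boundedness of \<open>H\<close> hands over a constant of unknown sign, while the
    monotonicity steps need a nonnegative one.\<close>
  define h where "h = max h0 0"
  have h: "h \<ge> 0" and hV: "\<And>v. v \<in> V \<Longrightarrow> norm (H v) \<le> h * L2norm v"
  proof -
    fix v assume "v \<in> V"
    then have "norm (H v) \<le> h0 * L2norm v" using h0 V_imp_L2 by blast
    also have "\<dots> \<le> h * L2norm v" unfolding h_def by (intro mult_right_mono L2norm0) simp
    finally show "norm (H v) \<le> h * L2norm v" .
  qed (simp add: h_def)
  have HV: "H (\<lambda>x. a * v x + b * w x) = a *\<^sub>R H v + b *\<^sub>R H w" if "v \<in> V" "w \<in> V" for v w a b
    using H_lin V_imp_L2 that by blast
  have obs_le: "norm (inv_sqrt R *v (H v - z)) \<le> a * (h * B + D)" if "v \<in> V" "L2norm v \<le> B" "norm z \<le> D" for v z B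
  proof -
    have "norm (H v - z) \<le> norm (H v) + norm z" by (rule norm_triangle_ineq4)
    also have "\<dots> \<le> h * B + D" using order_trans[OF hV[OF that(1)] mult_left_mono[OF that(2) h]] that(3) by linarith
    finally show ?thesis using a by (meson mult_left_mono order_trans)
  qed

  \<comment> \<open>The estimates are used on two balls: radius \<open>M\<close> bounds the
    residuals at \<open>u0\<close>, and these determine the radius \<open>K\<close> on which
    convexity is examined.\<close>
  obtain B0 :: real where B0: "B0 \<ge> 0" "\<And>u t. u \<in> V \<Longrightarrow> Vnorm u \<le> M \<Longrightarrow> t \<in> {0..1} \<Longrightarrow> S t u \<in> V \<and> L2norm (S t u) \<le> B0"
  proof (rule solution_map_estimates[OF M])
    fix B0 :: real assume "B0 \<ge> 0" "\<And>u t. u \<in> V \<Longrightarrow> Vnorm u \<le> M \<Longrightarrow> t \<in> {0..1} \<Longrightarrow> slice (sol f r u) t \<in> V \<and> L2norm (slice (sol f r u) t) \<le> B0"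
    then show thesis unfolding S_def[symmetric] by (rule that)
  qed
  define Q0 where "Q0 = a * (h * B0 + D)"
  have Q0: "Q0 \<ge> 0" using a h B0 D by (simp add: Q0_def)
  \<comment> \<open>If \<open>J v \<le> J u0\<close>, the distance of \<open>v\<close> from
    \<open>u0\<close> is at most \<open>\<sigma> * sqrt N * Q0\<close>; the factor \<open>N\<close>
    in place of its root is a convenience.\<close>
  define K where "K = M + \<sigma> * real N * Q0"
  have K: "K \<ge> 0" and MK: "M \<le> K" using M \<sigma> Q0 by (simp_all add: K_def)
  obtain B C c where B: "B \<ge> 0" and C: "C \<ge> 0" and c: "c \<ge> 0"
    and SB: "\<And>u t. u \<in> V \<Longrightarrow> Vnorm u \<le> K \<Longrightarrow> t \<in> {0..1} \<Longrightarrow> S t u \<in> V \<and> L2norm (S t u) \<le> B"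
    and SC: "\<And>u v t. u \<in> V \<Longrightarrow> v \<in> V \<Longrightarrow> Vnorm u \<le> K \<Longrightarrow> Vnorm v \<le> K \<Longrightarrow> t \<in> {0..1} \<Longrightarrow>
       L2norm (\<lambda>x. S t u x - S t v x) \<le> C * Vnorm (\<lambda>x. u x - v x)"
    and Sm: "\<And>u v t. u \<in> V \<Longrightarrow> v \<in> V \<Longrightarrow> Vnorm u \<le> K \<Longrightarrow> Vnorm v \<le> K \<Longrightarrow> t \<in> {0..1} \<Longrightarrow>
       L2norm (\<lambda>x. (S t u x + S t v x) / 2 - S t (\<lambda>x. (u x + v x) / 2) x) \<le> (C * Vnorm (\<lambda>x. u x - v x))\<^sup>2 * sqrt (exp (c * t) - 1)"
  proof (rule solution_map_estimates[OF K, folded S_def])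
    fix B C c :: real
    assume "B \<ge> 0" "C \<ge> 0" "c \<ge> 0" "\<And>u t. u \<in> V \<Longrightarrow> Vnorm u \<le> K \<Longrightarrow> t \<in> {0..1} \<Longrightarrow> S t u \<in> V \<and> L2norm (S t u) \<le> B"
      "\<And>u v t. u \<in> V \<Longrightarrow> v \<in> V \<Longrightarrow> Vnorm u \<le> K \<Longrightarrow> Vnorm v \<le> K \<Longrightarrow> t \<in> {0..1} \<Longrightarrow>
         L2norm (\<lambda>x. S t u x - S t v x) \<le> C * Vnorm (\<lambda>x. u x - v x)"
      "\<And>u v t. u \<in> V \<Longrightarrow> v \<in> V \<Longrightarrow> Vnorm u \<le> K \<Longrightarrow> Vnorm v \<le> K \<Longrightarrow> t \<in> {0..1} \<Longrightarrow>
         L2norm (\<lambda>x. (S t u x + S t v x) / 2 - S t (\<lambda>x. (u x + v x) / 2) x) \<le> (C * Vnorm (\<lambda>x. u x - v x))\<^sup>2 * sqrt (exp (c * t) - 1)"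
    then show thesis by (rule that)
  qed
  define Q where "Q = a * (h * B + D)"
  have Q: "Q \<ge> 0" using a h B D by (simp add: Q_def)
  define P where "P = real N * Q * a * h * C\<^sup>2"
  \<comment> \<open>With \<open>E\<close> the squared distance of \<open>u\<close> and
    \<open>v\<close>, the parallelogram law gives the regularisation a gain of
    \<open>E / (8 * \<sigma>^2)\<close>, which is \<open>2 * \<kappa> * E\<close>. The observations
    may spend half of it, and \<open>\<kappa> * E\<close> remains.\<close>
  define \<kappa> where "\<kappa> = 1 / (16 * \<sigma>\<^sup>2)"
  have \<kappa>: "\<kappa> > 0" using \<sigma> by (simp add: \<kappa>_def)

  have "((\<lambda>t. P * sqrt (exp (c * t) - 1)) \<longlongrightarrow> P * sqrt (exp (c * 0) - 1)) (at 0)" by (intro tendsto_intros)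
  then have "\<forall>\<^sub>F t in at 0. P * sqrt (exp (c * t) - 1) < \<kappa>" by (rule order_tendstoD) (simp add: \<kappa>)
  then obtain d where d: "d > 0" "\<And>t. t \<noteq> 0 \<Longrightarrow> dist t 0 < d \<Longrightarrow> P * sqrt (exp (c * t) - 1) < \<kappa>"
    unfolding eventually_at by auto
  \<comment> \<open>The cap 1 is the time interval of \<open>solution_map_estimates\<close>. The
    bound \<open>d\<close> makes the defect factor, which vanishes like the square root of
    \<open>t\<close>, small enough for the budget \<kappa>.\<close>
  define T0 where "T0 = min d 1"
  show ?thesis
  proof (intro exI[of _ T0] conjI ballI allI impI)
    show "T0 > 0" using d by (simp add: T0_def)
    fix u0 and t :: "nat \<Rightarrow> real" and z :: "nat \<Rightarrow> real^'q"
    assume u0: "u0 \<in> V" "Vnorm u0 \<le> M" and t: "0 < t 1" "\<forall>i\<in>{1..<N}. t i < t (i + 1)" "t N < T0" and z: "\<forall>i\<in>{1..N}. norm (z i) \<le> D"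
    have tmono: "t i \<le> t j" if "1 \<le> i" "i \<le> j" "j \<le> N" for i j
      using that(2,3)
    proof (induction j rule: dec_induct)
      case (step n)
      then have "t n < t (n + 1)" using t(2) that(1) by auto
      with step show ?case by simp
    qed simp
    have ti: "0 < t i" "t i < d" "t i \<in> {0..1}" if "i \<in> {1..N}" for i
      using tmono[of 1 i] tmono[of i N] that t by (auto simp: T0_def)
    define g where "g i u = inv_sqrt R *v (H (S (t i) u) - z i)" for i u
    define J where "J u = costJ f r H R N t z \<sigma> u0 u" for u
    have J: "J u = (1/2) * (\<Sum>i=1..N. (norm (g i u))\<^sup>2) + 1 / (2 * \<sigma>\<^sup>2) * (Vnorm (\<lambda>x. u x - u0 x))\<^sup>2" for u
      by (simp add: J_def costJ_def g_def S_def)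
    have gQ: "norm (g i u) \<le> Q" if "u \<in> V" "Vnorm u \<le> K" "i \<in> {1..N}" for i u
      unfolding g_def Q_def using SB[OF that(1,2) ti(3)[OF that(3)]] z that(3) by (intro obs_le) auto
    have gC: "norm (g i u - g i v) \<le> a * h * C * Vnorm (\<lambda>x. u x - v x)"
      if "u \<in> V" "v \<in> V" "Vnorm u \<le> K" "Vnorm v \<le> K" "i \<in> {1..N}" for i u v
    proof -
      have SV: "S (t i) u \<in> V" "S (t i) v \<in> V" using SB ti(3) that by auto
      have "g i u - g i v = inv_sqrt R *v (H (\<lambda>x. S (t i) u x - S (t i) v x))"
        using HV[OF SV, of 1 "-1"] by (simp add: g_def flip: matrix_vector_mult_diff_distrib)
      then have "norm (g i u - g i v) \<le> a * norm (H (\<lambda>x. S (t i) u x - S (t i) v x))" using a by simp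
      also have "\<dots> \<le> a * (h * (C * Vnorm (\<lambda>x. u x - v x)))"
        using order_trans[OF hV[OF V_diff[OF SV]] mult_left_mono[OF SC[OF that(1-4) ti(3)[OF that(5)]] h]] a by (intro mult_left_mono)
      finally show ?thesis by (simp add: mult_ac)
    qed
    have midV: "(\<lambda>x. (u x + v x) / 2) \<in> V" if "u \<in> V" "v \<in> V" for u v
      using V_lin[OF that, of "1/2" "1/2"] by (simp add: add_divide_distrib)
    have midK: "Vnorm (\<lambda>x. (u x + v x) / 2) \<le> K" if "u \<in> V" "v \<in> V" "Vnorm u \<le> K" "Vnorm v \<le> K" for u v
    proof (rule power2_le_imp_le[OF _ K])
      show "(Vnorm (\<lambda>x. (u x + v x) / 2))\<^sup>2 \<le> K\<^sup>2"
        unfolding Vnorm_midpoint[OF that(1,2)]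
        using power_mono[OF that(3) Vnorm_nonneg, of 2] power_mono[OF that(4) Vnorm_nonneg, of 2] zero_le_power2[of "Vnorm (\<lambda>x. u x - v x)"] by linarith
    qed
    have gm: "real N * Q * norm ((1/2) *\<^sub>R g i u + (1/2) *\<^sub>R g i v - g i (\<lambda>x. (u x + v x) / 2)) \<le> \<kappa> * (Vnorm (\<lambda>x. u x - v x))\<^sup>2"
      if "u \<in> V" "v \<in> V" "Vnorm u \<le> K" "Vnorm v \<le> K" "i \<in> {1..N}" for i u v
    proof -
      define m where "m x = (u x + v x) / 2" for x
      have m: "m \<in> V" "Vnorm m \<le> K" unfolding m_def by (rule midV[OF that(1,2)], rule midK[OF that(1-4)])
      have SV: "S (t i) u \<in> V" "S (t i) v \<in> V" "S (t i) m \<in> V" using SB ti(3) m that by auto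
      define w where "w x = (S (t i) u x + S (t i) v x) / 2" for x
      have w: "w \<in> V" "H w = (1/2) *\<^sub>R H (S (t i) u) + (1/2) *\<^sub>R H (S (t i) v)"
        unfolding w_def using midV[OF SV(1,2)] HV[OF SV(1,2), of "1/2" "1/2"] by (simp_all add: add_divide_distrib)
      have "H (\<lambda>x. w x - S (t i) m x) = (1/2) *\<^sub>R (H (S (t i) u) - z i) + (1/2) *\<^sub>R (H (S (t i) v) - z i) - (H (S (t i) m) - z i)"
        using HV[OF w(1) SV(3), of 1 "-1"] by (simp add: w(2) algebra_simps flip: scaleR_add_left)
      then have "inv_sqrt R *v H (\<lambda>x. w x - S (t i) m x) = (1/2) *\<^sub>R g i u + (1/2) *\<^sub>R g i v - g i m"
        by (simp only: g_def matrix_vector_mult_diff_distrib matrix_vector_right_distrib matrix_vector_mult_scaleR)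
      then have "norm ((1/2) *\<^sub>R g i u + (1/2) *\<^sub>R g i v - g i m) \<le> a * norm (H (\<lambda>x. w x - S (t i) m x))" using a by metis
      also have "\<dots> \<le> a * (h * ((C * Vnorm (\<lambda>x. u x - v x))\<^sup>2 * sqrt (exp (c * t i) - 1)))"
        using order_trans[OF hV[OF V_diff[OF w(1) SV(3)]] mult_left_mono[OF Sm[OF that(1-4) ti(3)[OF that(5)], folded m_def w_def] h]] a
        by (intro mult_left_mono)
      finally have "real N * Q * norm ((1/2) *\<^sub>R g i u + (1/2) *\<^sub>R g i v - g i m)
          \<le> real N * Q * (a * (h * ((C * Vnorm (\<lambda>x. u x - v x))\<^sup>2 * sqrt (exp (c * t i) - 1))))"
        using Q by (intro mult_left_mono) auto
      also have "\<dots> = (P * sqrt (exp (c * t i) - 1)) * (Vnorm (\<lambda>x. u x - v x))\<^sup>2" by (simp add: P_def power_mult_distrib mult_ac)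
      also have "\<dots> \<le> \<kappa> * (Vnorm (\<lambda>x. u x - v x))\<^sup>2"
        using d(2)[of "t i"] ti(1,2)[OF that(5)] by (intro mult_right_mono) auto
      finally show ?thesis unfolding m_def .
    qed
    have "\<exists>!u. u \<in> V \<and> (\<forall>v\<in>V. J u \<le> J v)"
    proof (rule unique_minimizer[OF u0(1) _ _ _ \<kappa>])
      show "J v \<ge> 0" for v unfolding J by (intro add_nonneg_nonneg mult_nonneg_nonneg sum_nonneg) auto
    next
      fix v assume v: "v \<in> V" "J v \<le> J u0"
      have g0: "norm (g i u0) \<le> Q0" if "i \<in> {1..N}" for i
        unfolding g_def Q0_def using B0(2)[OF u0 ti(3)[OF that]] z that by (intro obs_le) auto
      have "1 / (2 * \<sigma>\<^sup>2) * (Vnorm (\<lambda>x. v x - u0 x))\<^sup>2 \<le> J v" unfolding J by (simp add: sum_nonneg)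
      also have "J v \<le> J u0" by (rule v)
      also have "J u0 = (1/2) * (\<Sum>i=1..N. (norm (g i u0))\<^sup>2)" unfolding J by (simp add: Vnorm_def)
      also have "\<dots> \<le> (1/2) * (\<Sum>i=1..N. Q0\<^sup>2)" by (intro mult_left_mono sum_mono power_mono g0) auto
      also have "\<dots> = 1 / (2 * \<sigma>\<^sup>2) * (\<sigma>\<^sup>2 * (real N * Q0\<^sup>2))" using \<sigma> by simp
      finally have "(Vnorm (\<lambda>x. v x - u0 x))\<^sup>2 \<le> \<sigma>\<^sup>2 * (real N * Q0\<^sup>2)" using \<sigma> by (subst (asm) mult_le_cancel_left_pos) auto
      also have "\<dots> \<le> \<sigma>\<^sup>2 * ((real N)\<^sup>2 * Q0\<^sup>2)"
        using N self_le_power[of "real N" 2] by (intro mult_left_mono mult_right_mono) auto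
      also have "\<dots> = (\<sigma> * real N * Q0)\<^sup>2" by (simp add: power_mult_distrib mult_ac)
      finally have "Vnorm (\<lambda>x. v x - u0 x) \<le> \<sigma> * real N * Q0" by (rule power2_le_imp_le) (use \<sigma> Q0 in simp)
      moreover have "Vnorm v \<le> Vnorm u0 + Vnorm (\<lambda>x. v x - u0 x)"
        using Vnorm_triangle[OF u0(1) V_diff[OF v(1) u0(1)]] by simp
      ultimately show "Vnorm v \<le> K" using u0(2) by (simp add: K_def)
    next
      fix u v assume uv: "u \<in> V" "v \<in> V" "Vnorm u \<le> K" "Vnorm v \<le> K"
      define m where "m x = (u x + v x) / 2" for x
      define E where "E = (Vnorm (\<lambda>x. u x - v x))\<^sup>2"
      have m: "m \<in> V" "Vnorm m \<le> K" unfolding m_def by (rule midV[OF uv(1,2)], rule midK[OF uv])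
      \<comment> \<open>Scaled by \<open>N\<close> so that each observation contributes
        \<open>2 * \<kappa> * E\<close>; dividing the sum by \<open>N\<close> leaves exactly this
        amount in total.\<close>
      have "real N * (norm (g i m))\<^sup>2 \<le> real N * (((norm (g i u))\<^sup>2 + (norm (g i v))\<^sup>2) / 2) + 2 * (\<kappa> * E)" if i: "i \<in> {1..N}" for i
      proof -
        have "real N * (norm (g i m))\<^sup>2 \<le> real N * (((norm (g i u))\<^sup>2 + (norm (g i v))\<^sup>2) / 2 + 2 * Q * norm ((1/2) *\<^sub>R g i u + (1/2) *\<^sub>R g i v - g i m))"
          by (intro mult_left_mono norm_midpoint_perturbed gQ uv m i) simp
        also have "\<dots> = real N * (((norm (g i u))\<^sup>2 + (norm (g i v))\<^sup>2) / 2) + 2 * (real N * Q * norm ((1/2) *\<^sub>R g i u + (1/2) *\<^sub>R g i v - g i m))"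
          by (simp add: algebra_simps)
        also have "\<dots> \<le> real N * (((norm (g i u))\<^sup>2 + (norm (g i v))\<^sup>2) / 2) + 2 * (\<kappa> * E)"
          using gm[OF uv i] unfolding m_def E_def by simp
        finally show ?thesis .
      qed
      then have "(\<Sum>i=1..N. real N * (norm (g i m))\<^sup>2) \<le> (\<Sum>i=1..N. real N * (((norm (g i u))\<^sup>2 + (norm (g i v))\<^sup>2) / 2) + 2 * (\<kappa> * E))"
        by (rule sum_mono)
      also have "\<dots> = real N * (((\<Sum>i=1..N. (norm (g i u))\<^sup>2) + (\<Sum>i=1..N. (norm (g i v))\<^sup>2)) / 2 + 2 * (\<kappa> * E))"
        by (simp add: sum.distrib distrib_left flip: sum_distrib_left sum_divide_distrib)
      finally have "real N * (\<Sum>i=1..N. (norm (g i m))\<^sup>2) \<le> \<dots>" by (simp add: sum_distrib_left)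
      then have 1: "(\<Sum>i=1..N. (norm (g i m))\<^sup>2) \<le> ((\<Sum>i=1..N. (norm (g i u))\<^sup>2) + (\<Sum>i=1..N. (norm (g i v))\<^sup>2)) / 2 + 2 * (\<kappa> * E)"
        using N by (subst (asm) mult_le_cancel_left_pos) auto
      have eq: "(\<lambda>x. m x - u0 x) = (\<lambda>x. ((u x - u0 x) + (v x - u0 x)) / 2)" by (auto simp: m_def field_simps)
      have V2: "(Vnorm (\<lambda>x. m x - u0 x))\<^sup>2 = (Vnorm (\<lambda>x. u x - u0 x))\<^sup>2 / 2 + (Vnorm (\<lambda>x. v x - u0 x))\<^sup>2 / 2 - E / 4"
        unfolding eq by (subst Vnorm_midpoint[OF V_diff[OF uv(1) u0(1)] V_diff[OF uv(2) u0(1)]]) (simp add: E_def)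
      have 2: "1 / (2 * \<sigma>\<^sup>2) * (Vnorm (\<lambda>x. m x - u0 x))\<^sup>2 = (1 / (2 * \<sigma>\<^sup>2) * (Vnorm (\<lambda>x. u x - u0 x))\<^sup>2 + 1 / (2 * \<sigma>\<^sup>2) * (Vnorm (\<lambda>x. v x - u0 x))\<^sup>2) / 2 - 2 * (\<kappa> * E)"
        unfolding V2 \<kappa>_def using \<sigma> by (simp add: field_simps)
      have "J m \<le> (J u + J v) / 2 - \<kappa> * E" unfolding J 2 using 1 by argo
      then show "J (\<lambda>x. (u x + v x) / 2) \<le> (J u + J v) / 2 - \<kappa> * (Vnorm (\<lambda>x. u x - v x))\<^sup>2" by (simp only: m_def[abs_def] E_def)
    next
      fix u v assume uv: "u \<in> V" "v \<in> V" "Vnorm u \<le> K" "Vnorm v \<le> K"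
      define E where "E = Vnorm (\<lambda>x. u x - v x)"
      have "\<bar>(norm (g i u))\<^sup>2 - (norm (g i v))\<^sup>2\<bar> \<le> 2 * Q * (a * h * C * E)" if i: "i \<in> {1..N}" for i
        by (rule abs_square_diff_le) (use gQ[OF uv(1,3) i] gQ[OF uv(2,4) i] order_trans[OF norm_triangle_ineq3 gC[OF uv i]] in \<open>simp_all add: E_def\<close>)
      then have "(\<Sum>i=1..N. \<bar>(norm (g i u))\<^sup>2 - (norm (g i v))\<^sup>2\<bar>) \<le> (\<Sum>i=1..N. 2 * Q * (a * h * C * E))" by (rule sum_mono)
      then have 1: "\<bar>(\<Sum>i=1..N. (norm (g i u))\<^sup>2) - (\<Sum>i=1..N. (norm (g i v))\<^sup>2)\<bar> \<le> real N * (2 * Q * (a * h * C * E))"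
        using sum_abs[of "\<lambda>i. (norm (g i u))\<^sup>2 - (norm (g i v))\<^sup>2" "{1..N}"] by (simp add: sum_subtractf)
      have bd: "\<bar>Vnorm (\<lambda>x. w x - u0 x)\<bar> \<le> 2 * K" if "w \<in> V" "Vnorm w \<le> K" for w
      proof -
        have "Vnorm (\<lambda>x. u0 x - w x + w x) \<le> Vnorm (\<lambda>x. u0 x - w x) + Vnorm w" by (rule Vnorm_triangle[OF V_diff[OF u0(1) that(1)] that(1)])
        \<comment> \<open>The negative of \<open>u0\<close> is written as a linear combination to
          fit \<open>V_lin\<close>; its norm comes from the symmetry of the distance between
          \<open>u0 - u0\<close> and \<open>u0\<close>.\<close>
        have "Vnorm (\<lambda>x. w x + (-1 * u0 x + 0 * u0 x)) \<le> Vnorm w + Vnorm (\<lambda>x. -1 * u0 x + 0 * u0 x)"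
          by (rule Vnorm_triangle[OF that(1) V_lin[OF u0(1) u0(1)]])
        moreover have "Vnorm (\<lambda>x. -1 * u0 x + 0 * u0 x) = Vnorm u0"
          using Vnorm_minus_commute[OF V_diff[OF u0(1) u0(1)] u0(1)] by simp
        ultimately show ?thesis using that(2) u0(2) MK by simp
      qed
      have tri: "Vnorm (\<lambda>x. w x - u0 x) - Vnorm (\<lambda>x. y x - u0 x) \<le> Vnorm (\<lambda>x. w x - y x)" if "w \<in> V" "y \<in> V" for w y
        using Vnorm_triangle[OF V_diff[OF that] V_diff[OF that(2) u0(1)]] by simp
      have "\<bar>Vnorm (\<lambda>x. u x - u0 x) - Vnorm (\<lambda>x. v x - u0 x)\<bar> \<le> E"
        using tri[OF uv(1,2)] tri[OF uv(2,1)] Vnorm_minus_commute[OF uv(1,2)] unfolding E_def by linarith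
      then have 2: "\<bar>(Vnorm (\<lambda>x. u x - u0 x))\<^sup>2 - (Vnorm (\<lambda>x. v x - u0 x))\<^sup>2\<bar> \<le> 2 * (2 * K) * E"
        by (rule abs_square_diff_le[OF bd[OF uv(1,3)] bd[OF uv(2,4)]])
      have "\<bar>J u - J v\<bar> \<le> (1/2) * \<bar>(\<Sum>i=1..N. (norm (g i u))\<^sup>2) - (\<Sum>i=1..N. (norm (g i v))\<^sup>2)\<bar>
          + 1 / (2 * \<sigma>\<^sup>2) * \<bar>(Vnorm (\<lambda>x. u x - u0 x))\<^sup>2 - (Vnorm (\<lambda>x. v x - u0 x))\<^sup>2\<bar>"
      proof -
        have eq: "J u - J v = (1/2) * ((\<Sum>i=1..N. (norm (g i u))\<^sup>2) - (\<Sum>i=1..N. (norm (g i v))\<^sup>2))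
          + 1 / (2 * \<sigma>\<^sup>2) * ((Vnorm (\<lambda>x. u x - u0 x))\<^sup>2 - (Vnorm (\<lambda>x. v x - u0 x))\<^sup>2)"
          unfolding J by (simp only: right_diff_distrib)
        have "\<bar>J u - J v\<bar> \<le> \<bar>(1/2) * ((\<Sum>i=1..N. (norm (g i u))\<^sup>2) - (\<Sum>i=1..N. (norm (g i v))\<^sup>2))\<bar>
          + \<bar>1 / (2 * \<sigma>\<^sup>2) * ((Vnorm (\<lambda>x. u x - u0 x))\<^sup>2 - (Vnorm (\<lambda>x. v x - u0 x))\<^sup>2)\<bar>" unfolding eq by (rule abs_triangle_ineq)
        then show ?thesis by (simp only: abs_mult abs_divide abs_numeral abs_one abs_power2)
      qed
      also have "\<dots> \<le> (1/2) * (real N * (2 * Q * (a * h * C * E))) + 1 / (2 * \<sigma>\<^sup>2) * (2 * (2 * K) * E)"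
        by (intro add_mono mult_left_mono 1 2) auto
      also have "\<dots> = (real N * Q * a * h * C + 2 * K / \<sigma>\<^sup>2) * E" using \<sigma> by (simp add: field_simps)
      finally show "\<bar>J u - J v\<bar> \<le> (real N * Q * a * h * C + 2 * K / \<sigma>\<^sup>2) * Vnorm (\<lambda>x. u x - v x)" by (simp add: E_def)
    qed
    then show "\<exists>!u. u \<in> V \<and> (\<forall>v\<in>V. costJ f r H R N t z \<sigma> u0 u \<le> costJ f r H R N t z \<sigma> u0 v)" by (simp add: J_def)
  qed
qed

end
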